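(* Let $S$ be a left cancellative semigroup with unit, let $E$ be the semigroup of idempotents in $S^*$ and $E_{\mathcal J}=\{e_X: X\in\mathcal J\}$. There exist an injective action $\tilde\beta$ of $S$ on $C^*(E)$ and an action $\tilde\alpha$ of $S^*$ on $E_{\mathcal J}$ (giving an action on $C^*(E_{\mathcal J})$ denoted by the same symbol) such that, with respect to these actions, $$C^*(S^* )\cong C^*(E)\rtimes_{\tilde\beta}S,\qquad C^*(S)\cong C^*(E_{\mathcal J})\rtimes_{\tilde\alpha}S^*.$$
   Context: $S^*$ is the inverse semigroup generated by elements $v_p$ ($p\in S$) subject to $v_pv_q=v_{pq}$ and $v_p^*v_p=1$ (quotient of the free inverse semigroup on $\{v_p:p\in S\}$). For an inverse semigroup $P$, $C^*(P)$ is the completion of $\ell^1(P)$ in the supremum norm over all *-representations of $P$ (sending a zero element, if any, to $0$). For $A\subset S$, $a\in S$ let $aA=\{ax:x\in A\}$, $a^{-1}A=\{x\in S: ax\in A\}$. $\mathcal J$ consists of $\emptyset$ and all sets $a_n^{-1}(a_{n-1}\cdots a_2^{-1}(a_1S))$, $a_i\in S$. $C^*(S)$ is the universal C*-algebra generated by isometries $w_s$ ($s\in S$) and projections $e_X$ ($X\in\mathcal J$) subject to $w_{st}=w_sw_t$, $w_se_Xw_s^*=e_{sX}$, $e_S=1$, $e_\emptyset=0$, $e_{X\cap Y}=e_Xe_Y$. $E_{\mathcal J}$ is the commutative semigroup of the projections $e_X$, with zero $e_\emptyset$. An action of an inverse semigroup $P$ on a set $X$ is a *-homomorphism from $P$ into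 the inverse semigroup of partial bijections of $X$, $\alpha_s\colon D_{s^*}\to D_s$, with $\bigcup_s D_s=X$. An action of $P$ on a C*-algebra $A$ is a *-homomorphism from $P$ into the inverse semigroup of partial automorphisms of $A$ ( *-isomorphisms between closed two-sided *-ideals), $\alpha_s\colon E_{s^*}\to E_s$, with $\bigcup_sE_s=A$. An injective action of $S$ on $A$ is a family of injective *-endomorphisms $\alpha_s$ with $\alpha_{st}=\alpha_s\alpha_t$ (here with each $\alpha_s(A)$ a closed two-sided *-ideal). For an action $\alpha$ of $S$ on a unital $A$, a covariant representation is a pair $(\pi,T)$, $\pi$ a non-degenerate *-representation of $A$ on $H$, $T\colon S\to B(H)$ a unital isometric representation, $\pi(\alpha_s(a))=T_s\pi(a)T_s^*$; $A\rtimes_\alpha S$ is the universal C*-algebra for covariant representations, generated by images $i_A(A)$ and $i_S(S)$ of a universal covariant pair. For an action $\alpha$ of $P$ on $A$, a covariant representation is a pair $(\pi,T)$, $\pi$ non-degenerate, $T$ a unital *-representation of $P$ with $T_s^*T_sH=\pi(E_{s^*})H$, $T_sT_s^*H=\pi(E_s)H$, $\pi(\alpha_s(a))=T_s\pi(a)T_s^*$ for $a\in E_{s^*}$; $A\rtimes_\alpha P$ is the Hausdorff completion of the *-algebra of finite sums $\sum a_s\delta_s$ ($a_s\in E_s$), with $(a\delta_s)(b\delta_t)=\alpha_s(\alpha_{s^*}(a)b)\delta_{st}$, $(a\delta_s)^*=\alpha_{s^*}(a^* )\delta_{s^*}$, in the supremum of the seminorms $\|\sum\pi(a_s)T_s\|$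 over all covariant $(\pi,T)$.
   Formalization: In C*(E) the zero sent to 0 is the zero of S*, if any, not a zero of E alone, and the element of a one-element semigroup is not counted as a zero; otherwise the first isomorphism fails, e.g. for S = Z, where E = {1}. *)

theory Defs
  imports "HOL-Analysis.Infinite_Sum" "HOL-Algebra.FiniteProduct"
begin

section \<open>Hilbert spaces and bounded operators\<close>

text \<open>Up to unitary equivalence, the Hilbert spaces of dimension at most the cardinality of
  \<^typ>\<open>'i\<close> are the closed subspaces of \<open>\<ell>\<^sup>2('i)\<close>. Suprema over ``all representations'' range over
  these. The universe \<^typ>\<open>'i\<close> is a parameter of every construction. No norm depends on it as soon
  as it is infinite and at least as large as some set of topological generators: a vector on which a norm is
  attained up to \<open>\<epsilon>\<close> then lies in a cyclic subrepresentation of dimension at most that of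
  \<open>\<ell>\<^sup>2('i)\<close>.\<close>

type_synonym 'i vec = "'i \<Rightarrow> complex"
type_synonym 'i operator = "'i vec \<Rightarrow> 'i vec"

definition ell2 :: "'i vec set" where
  "ell2 = {x. (\<lambda>i. (cmod (x i))\<^sup>2) summable_on UNIV}"

definition ell2_inner :: "'i vec \<Rightarrow> 'i vec \<Rightarrow> complex" where
  "ell2_inner x y = (\<Sum>\<^sub>\<infinity>i. cnj (x i) * y i)"

definition ell2_norm :: "'i vec \<Rightarrow> real" where
  "ell2_norm x = sqrt (\<Sum>\<^sub>\<infinity>i. (cmod (x i))\<^sup>2)"

definition hilbert_space :: "'i vec set \<Rightarrow> bool" where
  "hilbert_space H \<longleftrightarrow>
     H \<subseteq> ell2 \<and> (\<lambda>_. 0) \<in> H \<and>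
     (\<forall>x\<in>H. \<forall>y\<in>H. (\<lambda>i. x i + y i) \<in> H) \<and>
     (\<forall>c. \<forall>x\<in>H. (\<lambda>i. c * x i) \<in> H) \<and>
     (\<forall>X x. (\<forall>n::nat. X n \<in> H) \<and> x \<in> ell2 \<and>
        (\<lambda>n. ell2_norm (\<lambda>i. X n i - x i)) \<longlonglongrightarrow> 0 \<longrightarrow> x \<in> H)"

definition hilbert_span :: "'i vec set \<Rightarrow> 'i vec set" where
  "hilbert_span X = \<Inter>{K. hilbert_space K \<and> X \<subseteq> K}"

text \<open>Operators on \<open>H\<close> are extensional functions, so that equality of operators is equality.\<close>

definition bounded_ops :: "'i vec set \<Rightarrow> 'i operator set" where
  "bounded_ops H = {T. T \<in> H \<rightarrow>\<^sub>E H \<and>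
     (\<forall>x\<in>H. \<forall>y\<in>H. T (\<lambda>i. x i + y i) = (\<lambda>i. T x i + T y i)) \<and>
     (\<forall>c. \<forall>x\<in>H. T (\<lambda>i. c * x i) = (\<lambda>i. c * T x i)) \<and>
     (\<exists>M. \<forall>x\<in>H. ell2_norm (T x) \<le> M * ell2_norm x)}"

definition op_norm :: "'i vec set \<Rightarrow> 'i operator \<Rightarrow> real" where
  "op_norm H T = Sup {ell2_norm (T x) | x. x \<in> H \<and> ell2_norm x \<le> 1}"

definition adjoint :: "'i vec set \<Rightarrow> 'i operator \<Rightarrow> 'i operator" where
  "adjoint H T = (THE A. A \<in> bounded_ops H \<and>
     (\<forall>x\<in>H. \<forall>y\<in>H. ell2_inner (T x) y = ell2_inner x (A y)))"

definition id_op :: "'i vec set \<Rightarrow> 'i operator" where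
  "id_op H = (\<lambda>x\<in>H. x)"

definition zero_op :: "'i vec set \<Rightarrow> 'i operator" where
  "zero_op H = (\<lambda>x\<in>H. \<lambda>_. 0)"

section \<open>Normed *-algebras\<close>

record 'a star_algebra = "'a partial_object" +
  cadd :: "'a \<Rightarrow> 'a \<Rightarrow> 'a"
  czero :: 'a
  cscale :: "complex \<Rightarrow> 'a \<Rightarrow> 'a"
  cmult :: "'a \<Rightarrow> 'a \<Rightarrow> 'a"
  cstar :: "'a \<Rightarrow> 'a"
  cnorm :: "'a \<Rightarrow> real"

definition Bop :: "'i vec set \<Rightarrow> 'i operator star_algebra" where
  "Bop H = \<lparr> carrier = bounded_ops H,
     cadd = (\<lambda>S T. \<lambda>x\<in>H. \<lambda>i. S x i + T x i),
     czero = zero_op H,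
     cscale = (\<lambda>c T. \<lambda>x\<in>H. \<lambda>i. c * T x i),
     cmult = (\<lambda>S T. compose H S T),
     cstar = adjoint H,
     cnorm = op_norm H \<rparr>"

definition cdiff :: "'a star_algebra \<Rightarrow> 'a \<Rightarrow> 'a \<Rightarrow> 'a" where
  "cdiff A x y = cadd A x (cscale A (-1) y)"

definition star_hom :: "'a star_algebra \<Rightarrow> 'b star_algebra \<Rightarrow> ('a \<Rightarrow> 'b) set" where
  "star_hom A B = {f. f \<in> carrier A \<rightarrow> carrier B \<and>
     (\<forall>x\<in>carrier A. \<forall>y\<in>carrier A. f (cadd A x y) = cadd B (f x) (f y)) \<and>
     (\<forall>c. \<forall>x\<in>carrier A. f (cscale A c x) = cscale B c (f x)) \<and>
     (\<forall>x\<in>carrier A. \<forall>y\<in>carrier A. f (cmult A x y) = cmult B (f x) (f y)) \<and>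
     (\<forall>x\<in>carrier A. f (cstar A x) = cstar B (f x))}"

definition star_iso :: "'a star_algebra \<Rightarrow> 'b star_algebra \<Rightarrow> ('a \<Rightarrow> 'b) set" where
  "star_iso A B = {f \<in> star_hom A B. bij_betw f (carrier A) (carrier B)}"

text \<open>The norm condition is automatic between C*-algebras.\<close>

definition cstar_isomorphic :: "'a star_algebra \<Rightarrow> 'b star_algebra \<Rightarrow> bool" where
  "cstar_isomorphic A B \<longleftrightarrow>
     (\<exists>f \<in> star_iso A B. \<forall>x\<in>carrier A. cnorm B (f x) = cnorm A x)"

definition closed_subspace :: "'a star_algebra \<Rightarrow> 'a set \<Rightarrow> bool" where
  "closed_subspace A K \<longleftrightarrow> K \<subseteq> carrier A \<and> czero A \<in> K \<and>
     (\<forall>x\<in>K. \<forall>y\<in>K. cadd A x y \<in> K) \<and> (\<forall>c. \<forall>x\<in>K. cscale A c x \<in> K) \<and>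
     (\<forall>X x. (\<forall>n::nat. X n \<in> K) \<and> x \<in> carrier A \<and>
        (\<lambda>n. cnorm A (cdiff A (X n) x)) \<longlonglongrightarrow> 0 \<longrightarrow> x \<in> K)"

definition closed_span :: "'a star_algebra \<Rightarrow> 'a set \<Rightarrow> 'a set" where
  "closed_span A X = \<Inter>{K. closed_subspace A K \<and> X \<subseteq> K}"

definition closed_star_ideal :: "'a star_algebra \<Rightarrow> 'a set \<Rightarrow> bool" where
  "closed_star_ideal A K \<longleftrightarrow> closed_subspace A K \<and>
     (\<forall>a\<in>carrier A. \<forall>x\<in>K. cmult A a x \<in> K \<and> cmult A x a \<in> K) \<and>
     (\<forall>x\<in>K. cstar A x \<in> K)"

definition nondegenerate :: "'i vec set \<Rightarrow> 'a star_algebra \<Rightarrow> ('a \<Rightarrow> 'i operator) \<Rightarrow> bool" where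
  "nondegenerate H A \<pi> \<longleftrightarrow> hilbert_span {\<pi> a x | a x. a \<in> carrier A \<and> x \<in> H} = H"

subsection \<open>Hausdorff completion\<close>

text \<open>\<^const>\<open>cnorm\<close> of \<open>D\<close> is a seminorm; the completion consists of the Cauchy sequences modulo
  null sequences.\<close>

definition cauchy_seq :: "'a star_algebra \<Rightarrow> (nat \<Rightarrow> 'a) \<Rightarrow> bool" where
  "cauchy_seq D X \<longleftrightarrow> (\<forall>n. X n \<in> carrier D) \<and>
     (\<forall>e>0. \<exists>N. \<forall>m\<ge>N. \<forall>n\<ge>N. cnorm D (cdiff D (X m) (X n)) < e)"

definition limit_class :: "'a star_algebra \<Rightarrow> (nat \<Rightarrow> 'a) \<Rightarrow> (nat \<Rightarrow> 'a) set" where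
  "limit_class D X =
     {Y. cauchy_seq D Y \<and> (\<lambda>n. cnorm D (cdiff D (X n) (Y n))) \<longlonglongrightarrow> 0}"

definition completion :: "'a star_algebra \<Rightarrow> (nat \<Rightarrow> 'a) set star_algebra" where
  "completion D = \<lparr> carrier = {limit_class D X | X. cauchy_seq D X},
     cadd = (\<lambda>U V. \<Union>X\<in>U. \<Union>Y\<in>V. limit_class D (\<lambda>n. cadd D (X n) (Y n))),
     czero = limit_class D (\<lambda>_. czero D),
     cscale = (\<lambda>c U. \<Union>X\<in>U. limit_class D (\<lambda>n. cscale D c (X n))),
     cmult = (\<lambda>U V. \<Union>X\<in>U. \<Union>Y\<in>V. limit_class D (\<lambda>n. cmult D (X n) (Y n))),
     cstar = (\<lambda>U. \<Union>X\<in>U. limit_class D (\<lambda>n. cstar D (X n))),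
     cnorm = (\<lambda>U. THE r. \<forall>X\<in>U. (\<lambda>n. cnorm D (X n)) \<longlonglongrightarrow> r) \<rparr>"

definition to_completion :: "'a star_algebra \<Rightarrow> 'a \<Rightarrow> (nat \<Rightarrow> 'a) set" where
  "to_completion D x = limit_class D (\<lambda>_. x)"

section \<open>Universal C*-algebras\<close>

text \<open>A letter \<open>(g, False)\<close> stands for \<open>g\<close> and \<open>(g, True)\<close> for its adjoint.\<close>

type_synonym 'g word = "('g \<times> bool) list"

definition word_star :: "'g word \<Rightarrow> 'g word" where
  "word_star w = rev (map (\<lambda>(g, b). (g, \<not> b)) w)"

fun word_op :: "'i vec set \<Rightarrow> ('g \<Rightarrow> 'i operator) \<Rightarrow> 'g word \<Rightarrow> 'i operator" where
  "word_op H \<rho> [] = id_op H"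
| "word_op H \<rho> ((g, b) # w) = compose H (if b then adjoint H (\<rho> g) else \<rho> g) (word_op H \<rho> w)"

text \<open>The free unital *-algebra on the generators \<open>G\<close>, with the supremum of the seminorms given by
  the families \<open>\<rho>\<close> of operators admitted by \<open>Rel\<close> (the relations must bound every generator, and
  one of them must say that some generator is the unit, as is the case below). Its completion is the
  universal C*-algebra generated by \<open>G\<close> subject to \<open>Rel\<close>.\<close>

definition free_star_algebra ::
  "'g set \<Rightarrow> ('i vec set \<Rightarrow> ('g \<Rightarrow> 'i operator) \<Rightarrow> bool) \<Rightarrow> ('g word \<Rightarrow> complex) star_algebra" where
  "free_star_algebra G Rel =
    \<lparr> carrier = {f. finite {w. f w \<noteq> 0} \<and> (\<forall>w. f w \<noteq> 0 \<longrightarrow> fst ` set w \<subseteq> G)},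
      cadd = (\<lambda>f g w. f w + g w),
      czero = (\<lambda>_. 0),
      cscale = (\<lambda>c f w. c * f w),
      cmult = (\<lambda>f g w. \<Sum>n\<le>length w. f (take n w) * g (drop n w)),
      cstar = (\<lambda>f w. cnj (f (word_star w))),
      cnorm = (\<lambda>f. Sup {op_norm H (\<lambda>x\<in>H. \<lambda>i. \<Sum>w | f w \<noteq> 0. f w * word_op H \<rho> w x i) | H \<rho>.
                 hilbert_space H \<and> Rel H \<rho>}) \<rparr>"

definition monomial :: "'x \<Rightarrow> 'x \<Rightarrow> complex" where
  "monomial w = (\<lambda>v. if v = w then 1 else 0)"

section \<open>Inverse semigroups and their C*-algebras\<close>

record 'p star_semigroup = "'p partial_object" +
  smul :: "'p \<Rightarrow> 'p \<Rightarrow> 'p"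
  sstar :: "'p \<Rightarrow> 'p"

definition star_semigroup_hom ::
  "'p star_semigroup \<Rightarrow> 'q star_semigroup \<Rightarrow> ('p \<Rightarrow> 'q) set" where
  "star_semigroup_hom P Q = {f. f \<in> carrier P \<rightarrow> carrier Q \<and>
     (\<forall>s\<in>carrier P. \<forall>t\<in>carrier P. f (smul P s t) = smul Q (f s) (f t)) \<and>
     (\<forall>s\<in>carrier P. f (sstar P s) = sstar Q (f s))}"

definition idempotents :: "'p star_semigroup \<Rightarrow> 'p star_semigroup" where
  "idempotents P = P\<lparr>carrier := {e \<in> carrier P. smul P e e = e}\<rparr>"

text \<open>The element of a one-element semigroup does not count as a zero.\<close>

definition zero_elements :: "'p star_semigroup \<Rightarrow> 'p set" where
  "zero_elements P = {z \<in> carrier P. (\<exists>x\<in>carrier P. x \<noteq> z) \<and>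
     (\<forall>x\<in>carrier P. smul P z x = z \<and> smul P x z = z)}"

definition is_unit_element :: "'p star_semigroup \<Rightarrow> 'p \<Rightarrow> bool" where
  "is_unit_element P u \<longleftrightarrow>
     u \<in> carrier P \<and> (\<forall>x\<in>carrier P. smul P u x = x \<and> smul P x u = x)"

definition op_semigroup :: "'i vec set \<Rightarrow> 'i operator star_semigroup" where
  "op_semigroup H =
     \<lparr> carrier = bounded_ops H, smul = (\<lambda>S T. compose H S T), sstar = adjoint H \<rparr>"

definition sg_reps :: "'p star_semigroup \<Rightarrow> 'i vec set \<Rightarrow> ('p \<Rightarrow> 'i operator) set" where
  "sg_reps P H = star_semigroup_hom P (op_semigroup H)"

text \<open>\<open>\<ell>\<^sup>1(P)\<close> with the supremum of the seminorms given by the *-representations of \<open>P\<close> that vanish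
  on \<open>Z\<close>; here \<open>Z\<close> is empty or consists of the zero of \<open>P\<close>.\<close>

definition l1_algebra ::
  "'i itself \<Rightarrow> 'p star_semigroup \<Rightarrow> 'p set \<Rightarrow> ('p \<Rightarrow> complex) star_algebra" where
  "l1_algebra I P Z =
    \<lparr> carrier = {f. (\<forall>s. s \<notin> carrier P \<longrightarrow> f s = 0) \<and> (\<lambda>s. cmod (f s)) summable_on carrier P},
      cadd = (\<lambda>f g s. f s + g s),
      czero = (\<lambda>_. 0),
      cscale = (\<lambda>c f s. c * f s),
      cmult = (\<lambda>f g r. \<Sum>\<^sub>\<infinity>(s, t)\<in>{(s, t). s \<in> carrier P \<and> t \<in> carrier P \<and> smul P s t = r}. f s * g t),
      cstar = (\<lambda>f s. if s \<in> carrier P then cnj (f (sstar P s)) else 0),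
      cnorm = (\<lambda>f. Sup {op_norm H (\<lambda>x\<in>H. \<lambda>i. \<Sum>\<^sub>\<infinity>s\<in>carrier P. f s * \<pi> s x i) | (H :: 'i vec set) \<pi>.
                 hilbert_space H \<and> \<pi> \<in> sg_reps P H \<and> (\<forall>z\<in>Z. \<pi> z = zero_op H)}) \<rparr>"

definition isg_cstar ::
  "'i itself \<Rightarrow> 'p star_semigroup \<Rightarrow> 'p set \<Rightarrow> (nat \<Rightarrow> 'p \<Rightarrow> complex) set star_algebra" where
  "isg_cstar I P Z = completion (l1_algebra I P Z)"

definition isg_gen ::
  "'i itself \<Rightarrow> 'p star_semigroup \<Rightarrow> 'p set \<Rightarrow> 'p \<Rightarrow> (nat \<Rightarrow> 'p \<Rightarrow> complex) set" where
  "isg_gen I P Z s = to_completion (l1_algebra I P Z) (monomial s)"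

section \<open>Actions\<close>

text \<open>Partial bijections are partial functions; \<open>\<circ>\<^sub>m\<close> composes them on the largest possible
  domain. If \<open>\<alpha>\<close> is an action, \<open>D\<^bsub>s*\<^esub> = dom (\<alpha> s)\<close> and \<open>D\<^bsub>s\<^esub> = ran (\<alpha> s)\<close>.\<close>

definition partial_inverse :: "('a \<rightharpoonup> 'a) \<Rightarrow> ('a \<rightharpoonup> 'a)" where
  "partial_inverse f = (\<lambda>y. if y \<in> ran f then Some (THE x. f x = Some y) else None)"

definition partial_bijections :: "'a set \<Rightarrow> ('a \<rightharpoonup> 'a) star_semigroup" where
  "partial_bijections X =
     \<lparr> carrier = {f. dom f \<subseteq> X \<and> ran f \<subseteq> X \<and> inj_on f (dom f)},
       smul = (\<circ>\<^sub>m), sstar = partial_inverse \<rparr>"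

definition partial_automorphisms :: "'a star_algebra \<Rightarrow> ('a \<rightharpoonup> 'a) star_semigroup" where
  "partial_automorphisms A =
     \<lparr> carrier = {f. closed_star_ideal A (dom f) \<and> closed_star_ideal A (ran f) \<and>
         (\<lambda>x. the (f x)) \<in> star_iso (A\<lparr>carrier := dom f\<rparr>) (A\<lparr>carrier := ran f\<rparr>)},
       smul = (\<circ>\<^sub>m), sstar = partial_inverse \<rparr>"

definition isg_set_action :: "'p star_semigroup \<Rightarrow> 'a set \<Rightarrow> ('p \<Rightarrow> 'a \<rightharpoonup> 'a) \<Rightarrow> bool" where
  "isg_set_action P X \<alpha> \<longleftrightarrow> \<alpha> \<in> star_semigroup_hom P (partial_bijections X) \<and>
     (\<Union>s\<in>carrier P. ran (\<alpha> s)) = X"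

definition isg_algebra_action ::
  "'p star_semigroup \<Rightarrow> 'a star_algebra \<Rightarrow> ('p \<Rightarrow> 'a \<rightharpoonup> 'a) \<Rightarrow> bool" where
  "isg_algebra_action P A \<alpha> \<longleftrightarrow> \<alpha> \<in> star_semigroup_hom P (partial_automorphisms A) \<and>
     (\<Union>s\<in>carrier P. ran (\<alpha> s)) = carrier A"

text \<open>For \<open>\<iota> : X \<rightarrow> A\<close> with image generating \<open>A\<close>, the action \<open>\<gamma>\<close> on \<open>A\<close> is the linear and continuous
  extension of the action \<open>\<alpha>\<close> on \<open>X\<close>; this determines \<open>\<gamma>\<close>.\<close>

definition induces_action ::
  "'p star_semigroup \<Rightarrow> ('p \<Rightarrow> 'x \<rightharpoonup> 'x) \<Rightarrow> ('x \<Rightarrow> 'a) \<Rightarrow> 'a star_algebra \<Rightarrow> ('p \<Rightarrow> 'a \<rightharpoonup> 'a) \<Rightarrow> bool" where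
  "induces_action P \<alpha> \<iota> A \<gamma> \<longleftrightarrow> (\<forall>s\<in>carrier P.
     dom (\<gamma> s) = closed_span A (\<iota> ` dom (\<alpha> s)) \<and>
     (\<forall>x\<in>dom (\<alpha> s). \<gamma> s (\<iota> x) = Some (\<iota> (the (\<alpha> s x)))))"

definition injective_action :: "'a star_algebra \<Rightarrow> ('s::monoid_mult \<Rightarrow> 'a \<Rightarrow> 'a) \<Rightarrow> bool" where
  "injective_action A \<alpha> \<longleftrightarrow>
     (\<forall>s. \<alpha> s \<in> star_hom A A \<and> inj_on (\<alpha> s) (carrier A) \<and> closed_star_ideal A (\<alpha> s ` carrier A)) \<and>
     (\<forall>s t. \<forall>a\<in>carrier A. \<alpha> (s * t) a = \<alpha> s (\<alpha> t a))"

section \<open>Crossed products\<close>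

definition covariant_monoid ::
  "'a star_algebra \<Rightarrow> ('s::monoid_mult \<Rightarrow> 'a \<Rightarrow> 'a) \<Rightarrow> 'i vec set \<Rightarrow>
   ('a \<Rightarrow> 'i operator) \<Rightarrow> ('s \<Rightarrow> 'i operator) \<Rightarrow> bool" where
  "covariant_monoid A \<alpha> H \<pi> T \<longleftrightarrow>
     \<pi> \<in> star_hom A (Bop H) \<and> nondegenerate H A \<pi> \<and>
     (\<forall>s. T s \<in> bounded_ops H \<and> compose H (adjoint H (T s)) (T s) = id_op H) \<and>
     T 1 = id_op H \<and> (\<forall>s t. T (s * t) = compose H (T s) (T t)) \<and>
     (\<forall>s. \<forall>a\<in>carrier A. \<pi> (\<alpha> s a) = compose H (T s) (compose H (\<pi> a) (adjoint H (T s))))"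

definition crossed_product_monoid ::
  "'i itself \<Rightarrow> 'a star_algebra \<Rightarrow> ('s::monoid_mult \<Rightarrow> 'a \<Rightarrow> 'a) \<Rightarrow>
   (nat \<Rightarrow> ('a + 's) word \<Rightarrow> complex) set star_algebra" where
  "crossed_product_monoid I A \<alpha> =
     completion (free_star_algebra (Inl ` carrier A \<union> range Inr)
       (\<lambda>(H :: 'i vec set) \<rho>. covariant_monoid A \<alpha> H (\<lambda>a. \<rho> (Inl a)) (\<lambda>s. \<rho> (Inr s))))"

definition covariant_isg ::
  "'p star_semigroup \<Rightarrow> 'a star_algebra \<Rightarrow> ('p \<Rightarrow> 'a \<rightharpoonup> 'a) \<Rightarrow> 'i vec set \<Rightarrow>
   ('a \<Rightarrow> 'i operator) \<Rightarrow> ('p \<Rightarrow> 'i operator) \<Rightarrow> bool" where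
  "covariant_isg P A \<alpha> H \<pi> T \<longleftrightarrow>
     \<pi> \<in> star_hom A (Bop H) \<and> nondegenerate H A \<pi> \<and>
     T \<in> sg_reps P H \<and> (\<forall>u. is_unit_element P u \<longrightarrow> T u = id_op H) \<and>
     (\<forall>s\<in>carrier P.
        compose H (adjoint H (T s)) (T s) ` H = {\<pi> a x | a x. a \<in> dom (\<alpha> s) \<and> x \<in> H} \<and>
        compose H (T s) (adjoint H (T s)) ` H = {\<pi> a x | a x. a \<in> ran (\<alpha> s) \<and> x \<in> H} \<and>
        (\<forall>a\<in>dom (\<alpha> s).
           \<pi> (the (\<alpha> s a)) = compose H (T s) (compose H (\<pi> a) (adjoint H (T s)))))"

definition csum :: "'a star_algebra \<Rightarrow> ('k \<Rightarrow> 'a) \<Rightarrow> 'k set \<Rightarrow> 'a" where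
  "csum A f K = finprod \<lparr>carrier = carrier A, mult = cadd A, one = czero A\<rparr> f K"

text \<open>The *-algebra of finite sums \<open>\<Sum>s. a\<^sub>s \<delta>\<^sub>s\<close>, represented by their coefficient functions
  \<open>s \<mapsto> a\<^sub>s\<close>.\<close>

definition covariance_algebra ::
  "'i itself \<Rightarrow> 'p star_semigroup \<Rightarrow> 'a star_algebra \<Rightarrow> ('p \<Rightarrow> 'a \<rightharpoonup> 'a) \<Rightarrow>
   ('p \<Rightarrow> 'a) star_algebra" where
  "covariance_algebra I P A \<alpha> =
    \<lparr> carrier = {F. (\<forall>s\<in>carrier P. F s \<in> ran (\<alpha> s)) \<and> (\<forall>s. s \<notin> carrier P \<longrightarrow> F s = czero A) \<and>
                    finite {s. F s \<noteq> czero A}},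
      cadd = (\<lambda>F G s. cadd A (F s) (G s)),
      czero = (\<lambda>_. czero A),
      cscale = (\<lambda>c F s. cscale A c (F s)),
      cmult = (\<lambda>F G r. csum A
        (\<lambda>(s, t). the (\<alpha> s (cmult A (the (\<alpha> (sstar P s) (F s))) (G t))))
        {(s, t). s \<in> carrier P \<and> t \<in> carrier P \<and> F s \<noteq> czero A \<and> G t \<noteq> czero A \<and> smul P s t = r}),
      cstar = (\<lambda>F r. if r \<in> carrier P then the (\<alpha> r (cstar A (F (sstar P r)))) else czero A),
      cnorm = (\<lambda>F. Sup {op_norm H (\<lambda>x\<in>H. \<lambda>i. \<Sum>s | s \<in> carrier P \<and> F s \<noteq> czero A. \<pi> (F s) (T s x) i)
                 | (H :: 'i vec set) \<pi> T. hilbert_space H \<and> covariant_isg P A \<alpha> H \<pi> T}) \<rparr>"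

definition crossed_product_isg ::
  "'i itself \<Rightarrow> 'p star_semigroup \<Rightarrow> 'a star_algebra \<Rightarrow> ('p \<Rightarrow> 'a \<rightharpoonup> 'a) \<Rightarrow>
   (nat \<Rightarrow> 'p \<Rightarrow> 'a) set star_algebra" where
  "crossed_product_isg I P A \<alpha> = completion (covariance_algebra I P A \<alpha>)"

section \<open>The inverse semigroup \<open>S\<^sup>*\<close>\<close>

text \<open>The free inverse monoid on the letters \<open>v\<^sub>p\<close> is the free monoid with involution modulo
  \<open>ww\<^sup>*w = w\<close> and \<open>ww\<^sup>*uu\<^sup>* = uu\<^sup>*ww\<^sup>*\<close>. The empty word, which represents the unit, equals \<open>v\<^sub>1\<^sup>*v\<^sub>1\<close> in
  the quotient, so that nothing is added to the quotient of the free inverse semigroup.\<close>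

inductive isg_cong :: "'s::monoid_mult word \<Rightarrow> 's word \<Rightarrow> bool" where
  isg_refl: "isg_cong u u"
| isg_sym: "isg_cong u v \<Longrightarrow> isg_cong v u"
| isg_trans: "isg_cong u v \<Longrightarrow> isg_cong v w \<Longrightarrow> isg_cong u w"
| isg_append: "isg_cong u u' \<Longrightarrow> isg_cong v v' \<Longrightarrow> isg_cong (u @ v) (u' @ v')"
| isg_star: "isg_cong u v \<Longrightarrow> isg_cong (word_star u) (word_star v)"
| isg_inverse: "isg_cong (w @ word_star w @ w) w"
| isg_commute: "isg_cong (w @ word_star w @ u @ word_star u) (u @ word_star u @ w @ word_star w)"
| isg_product: "isg_cong [(p, False), (q, False)] [(p * q, False)]"
| isg_isometry: "isg_cong [(p, True), (p, False)] []"

definition universal_isg :: "'s::monoid_mult itself \<Rightarrow> 's word set star_semigroup" where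
  "universal_isg S =
     \<lparr> carrier = UNIV // {(u, v). isg_cong u v},
       smul = (\<lambda>X Y. {w. \<exists>u\<in>X. \<exists>v\<in>Y. isg_cong (u @ v) w}),
       sstar = (\<lambda>X. {w. \<exists>u\<in>X. isg_cong (word_star u) w}) \<rparr>"

definition cstar_universal_isg ::
  "'i itself \<Rightarrow> 's::monoid_mult itself \<Rightarrow> (nat \<Rightarrow> 's word set \<Rightarrow> complex) set star_algebra" where
  "cstar_universal_isg I S = isg_cstar I (universal_isg S) (zero_elements (universal_isg S))"

text \<open>For the subsemigroup \<open>E\<close> of \<open>S\<^sup>*\<close>, the zero sent to \<open>0\<close> is the zero of \<open>S\<^sup>*\<close>, if there is
  one. A least idempotent of \<open>S\<^sup>*\<close> that is not a zero of \<open>S\<^sup>*\<close> is not killed: if \<open>S\<close> is a group, then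
  \<open>E = {1}\<close> and \<open>C\<^sup>*(E) = \<complex>\<close>.\<close>

definition cstar_isg_idempotents ::
  "'i itself \<Rightarrow> 's::monoid_mult itself \<Rightarrow> (nat \<Rightarrow> 's word set \<Rightarrow> complex) set star_algebra" where
  "cstar_isg_idempotents I S =
     isg_cstar I (idempotents (universal_isg S)) (zero_elements (universal_isg S))"

section \<open>The semigroup C*-algebra \<open>C\<^sup>*(S)\<close>\<close>

definition translate :: "'s::monoid_mult \<Rightarrow> 's set \<Rightarrow> 's set" where
  "translate a X = {a * x | x. x \<in> X}"

definition pretranslate :: "'s::monoid_mult \<Rightarrow> 's set \<Rightarrow> 's set" where
  "pretranslate a X = {x. a * x \<in> X}"

text \<open>A list \<open>[(a\<^sub>n, a\<^bsub>n-1\<^esub>), \<dots>, (a\<^sub>2, a\<^sub>1)]\<close> gives the set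
  \<open>a\<^sub>n\<^sup>-\<^sup>1(a\<^bsub>n-1\<^esub> \<dots> a\<^sub>2\<^sup>-\<^sup>1(a\<^sub>1S))\<close>; the empty list gives \<open>S = 1\<^sup>-\<^sup>1(1S)\<close>.\<close>

definition constructible :: "'s::monoid_mult set set" where
  "constructible = insert {}
     {foldr (\<lambda>(a, b) X. pretranslate a (translate b X)) ps UNIV | ps. True}"

text \<open>\<open>\<rho> (Inl s)\<close> is \<open>w\<^sub>s\<close> and \<open>\<rho> (Inr X)\<close> is \<open>e\<^sub>X\<close>.\<close>

definition semigroup_relations ::
  "'i vec set \<Rightarrow> ('s::monoid_mult + 's set \<Rightarrow> 'i operator) \<Rightarrow> bool" where
  "semigroup_relations H \<rho> \<longleftrightarrow>
     (\<forall>s. \<rho> (Inl s) \<in> bounded_ops H \<and>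
        compose H (adjoint H (\<rho> (Inl s))) (\<rho> (Inl s)) = id_op H) \<and>
     (\<forall>X\<in>constructible. \<rho> (Inr X) \<in> bounded_ops H \<and>
        adjoint H (\<rho> (Inr X)) = \<rho> (Inr X) \<and> compose H (\<rho> (Inr X)) (\<rho> (Inr X)) = \<rho> (Inr X)) \<and>
     (\<forall>s t. \<rho> (Inl (s * t)) = compose H (\<rho> (Inl s)) (\<rho> (Inl t))) \<and>
     (\<forall>s. \<forall>X\<in>constructible.
        compose H (\<rho> (Inl s)) (compose H (\<rho> (Inr X)) (adjoint H (\<rho> (Inl s))))
          = \<rho> (Inr (translate s X))) \<and>
     \<rho> (Inr UNIV) = id_op H \<and> \<rho> (Inr {}) = zero_op H \<and>
     (\<forall>X\<in>constructible. \<forall>Y\<in>constructible.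
        \<rho> (Inr (X \<inter> Y)) = compose H (\<rho> (Inr X)) (\<rho> (Inr Y)))"

definition semigroup_star_algebra ::
  "'i itself \<Rightarrow> 's::monoid_mult itself \<Rightarrow> (('s + 's set) word \<Rightarrow> complex) star_algebra" where
  "semigroup_star_algebra I S =
     free_star_algebra (range Inl \<union> Inr ` constructible)
       (semigroup_relations :: 'i vec set \<Rightarrow> _ \<Rightarrow> bool)"

definition semigroup_cstar ::
  "'i itself \<Rightarrow> 's::monoid_mult itself \<Rightarrow> (nat \<Rightarrow> ('s + 's set) word \<Rightarrow> complex) set star_algebra" where
  "semigroup_cstar I S = completion (semigroup_star_algebra I S)"

definition semigroup_proj ::
  "'i itself \<Rightarrow> 's::monoid_mult set \<Rightarrow> (nat \<Rightarrow> ('s + 's set) word \<Rightarrow> complex) set" where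
  "semigroup_proj I X =
     to_completion (semigroup_star_algebra I TYPE('s)) (monomial [(Inr X, False)])"

definition proj_semigroup ::
  "'i itself \<Rightarrow> 's::monoid_mult itself \<Rightarrow> (nat \<Rightarrow> ('s + 's set) word \<Rightarrow> complex) set star_semigroup" where
  "proj_semigroup I S =
     \<lparr> carrier = semigroup_proj I ` constructible,
       smul = cmult (semigroup_cstar I S), sstar = cstar (semigroup_cstar I S) \<rparr>"

definition cstar_proj_semigroup ::
  "'i itself \<Rightarrow> 's::monoid_mult itself \<Rightarrow>
   (nat \<Rightarrow> (nat \<Rightarrow> ('s + 's set) word \<Rightarrow> complex) set \<Rightarrow> complex) set star_algebra" where
  "cstar_proj_semigroup I S = isg_cstar I (proj_semigroup I S) {semigroup_proj I ({} :: 's set)}"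

definition proj_gen ::
  "'i itself \<Rightarrow> 's::monoid_mult itself \<Rightarrow> (nat \<Rightarrow> ('s + 's set) word \<Rightarrow> complex) set \<Rightarrow>
   (nat \<Rightarrow> (nat \<Rightarrow> ('s + 's set) word \<Rightarrow> complex) set \<Rightarrow> complex) set" where
  "proj_gen I S = isg_gen I (proj_semigroup I S) {semigroup_proj I ({} :: 's set)}"

end

(* All C*-algebras involved are completions of *-algebras in a supremum of seminorms coming from a set
of representations. If two such algebras are normed by the same index set of representations and the
value of every representation on a generator of one algebra is matched by an element of the other, then
they are isomorphic; so each isomorphism reduces to a bijection, up to norms, of two kinds of representations.

Conjugation e -> p e p* by p in S* maps E to E and the projections e_X to projections. It gives
endomorphisms of C*(E) and of C*(E_J); the first, for p = v_s, is the injective action of S, and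
the second, restricted to the corner cut out by p*p, is the action of S*.

A unital representation of S* restricts to E and to the v_s, which gives a covariant pair for (C*(E), S).
Conversely, in a covariant pair the isometries conjugate a commuting set of projections into itself, so
their words are partial isometries with commuting range projections and satisfy the relations of S*.
The relations of C*(S) are related in the same way to covariant pairs of C*(E_J) and S* : a family (w_s, e_X)
consists of isometries that conjugate the projections e_X among themselves, by left cancellation. *)
theory Submission
  imports Defs "HOL-Library.Function_Algebras" "HOL-Analysis.L2_Norm"
begin

text \<open>Homomorphisms between completions are never defined by formulas on Cauchy sequences: an
  element is known by its values in the indexing representations, and a homomorphism sends
  \<open>x\<close> to the unique element with the same values. Three obstacles shape the proof. The
  norm for \<open>S*\<close> ranges over all its representations, while covariant pairs are unital;
  a representation is therefore cut down to the range of the image of 1, which loses no norm. The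
  coefficient algebra of a covariant pair is represented by a merely algebraic *-homomorphism, whose
  continuity has to be proved; a square root of \<open>1 - h\<close>, found as the fixed point of a
  contraction, replaces spectral theory. Finally, conjugation by \<open>p\<close> is defined
  everywhere but invertible only where conjugation by \<open>p*\<close> undoes it; this set is the
  domain of the partial map. The same construction is used for the projections and for their
  C*-algebra, so that the second action extends the first. Left cancellation keeps the constructible
  sets closed under intersection, because \<open>a x = a y\<close> must give \<open>x = y\<close>
  when an intersection with a preimage is rewritten as a preimage.\<close>

definition vscale :: "complex \<Rightarrow> 'i vec \<Rightarrow> 'i vec" (infixr "*\<^sub>v" 75) where
  "c *\<^sub>v x = (\<lambda>i. c * x i)"

lemma vscale_apply [simp]: "(c *\<^sub>v x) i = c * x i"
  by (simp add: vscale_def)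

lemmas vec_defs = plus_fun_def fun_diff_def zero_fun_def vscale_def

lemma vscale_add_right: "c *\<^sub>v (x + y) = c *\<^sub>v x + c *\<^sub>v y"
  and vscale_add_left: "(a + b) *\<^sub>v x = a *\<^sub>v x + b *\<^sub>v x"
  and vscale_diff_right: "c *\<^sub>v (x - y) = c *\<^sub>v x - c *\<^sub>v y"
  and vscale_diff_left: "(a - b) *\<^sub>v x = a *\<^sub>v x - b *\<^sub>v x"
  and vscale_vscale: "a *\<^sub>v (b *\<^sub>v x) = (a * b) *\<^sub>v x"
  and vscale_one [simp]: "1 *\<^sub>v x = x"
  and vscale_minus_one [simp]: "(-1) *\<^sub>v x = - x"
  and vscale_zero_left [simp]: "0 *\<^sub>v x = 0"
  and vscale_zero_right [simp]: "a *\<^sub>v 0 = 0"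
  by (auto simp: fun_eq_iff algebra_simps)

lemma sum_vec_apply: "(\<Sum>k\<in>K. f k) i = (\<Sum>k\<in>K. (f k :: 'i vec) i)"
  by (induction K rule: infinite_finite_induct) auto

lemma vscale_sum_right: "c *\<^sub>v (\<Sum>k\<in>K. f k) = (\<Sum>k\<in>K. c *\<^sub>v f k)"
  by (auto simp: fun_eq_iff sum_vec_apply sum_distrib_left)

lemmas vec_apply = plus_fun_apply minus_apply uminus_apply zero_fun_apply vscale_apply sum_vec_apply

text \<open>As simplification rules these would rewrite below the \<open>\<eta>\<close>-expansions produced by unification.\<close>

declare plus_fun_apply [simp del] minus_apply [simp del] uminus_apply [simp del] vscale_apply [simp del]

section \<open>The Hilbert space of square summable families: norm, inner product,
  completeness\<close>

section \<open>Square summable families\<close>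

lemma L2_set_le_ell2_norm:
  assumes "x \<in> ell2"
  shows "L2_set (\<lambda>i. cmod (x i)) F \<le> ell2_norm x"
proof (cases "finite F")
  case True
  then have "(\<Sum>i\<in>F. (cmod (x i))\<^sup>2) \<le> (\<Sum>\<^sub>\<infinity>i. (cmod (x i))\<^sup>2)"
    using assms by (intro finite_sum_le_infsum) (auto simp: ell2_def)
  then show ?thesis by (simp add: L2_set_def ell2_norm_def)
qed (auto simp: ell2_norm_def infsum_nonneg)

text \<open>Finite partial norms decide both membership and the size of the norm. Inequalities in
  \<open>ell2\<close> thereby reduce to those for \<open>L2_set\<close> on finite index sets, as for
  Minkowski's inequality in \<open>ell2_add\<close>.\<close>

lemma ell2_normI:
  assumes "\<And>F. finite F \<Longrightarrow> L2_set (\<lambda>i. cmod (x i)) F \<le> M"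
  shows "x \<in> ell2" and "ell2_norm x \<le> M"
proof -
  have M: "0 \<le> M" using assms[of "{}"] by simp
  have *: "(\<Sum>i\<in>F. (cmod (x i))\<^sup>2) \<le> M\<^sup>2" if "finite F" for F
    using assms[OF that] M unfolding L2_set_def
    by (metis real_sqrt_le_iff real_sqrt_unique)
  then show 1: "x \<in> ell2" unfolding ell2_def
    by (auto intro!: nonneg_bdd_above_summable_on bdd_aboveI[where M = "M\<^sup>2"])
  then have "(\<Sum>\<^sub>\<infinity>i. (cmod (x i))\<^sup>2) \<le> M\<^sup>2"
    using * by (intro infsum_le_finite_sums) (auto simp: ell2_def)
  then show "ell2_norm x \<le> M"
    using M unfolding ell2_norm_def by (metis real_le_lsqrt real_sqrt_le_iff real_sqrt_unique)
qed

lemma ell2_norm_nonneg [simp]: "0 \<le> ell2_norm x"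
  by (simp add: ell2_norm_def infsum_nonneg)

lemma zero_in_ell2 [simp]: "0 \<in> ell2"
  by (simp add: ell2_def)

lemma ell2_norm_zero [simp]: "ell2_norm 0 = 0"
  by (simp add: ell2_norm_def)

lemma ell2_add:
  assumes "x \<in> ell2" "y \<in> ell2"
  shows "x + y \<in> ell2" and ell2_norm_triangle: "ell2_norm (x + y) \<le> ell2_norm x + ell2_norm y"
proof -
  have "L2_set (\<lambda>i. cmod ((x + y) i)) F \<le> ell2_norm x + ell2_norm y" if "finite F" for F
  proof -
    have "L2_set (\<lambda>i. cmod ((x + y) i)) F \<le> L2_set (\<lambda>i. cmod (x i) + cmod (y i)) F"
      by (intro L2_set_mono) (auto simp: vec_apply intro: norm_triangle_ineq)
    also have "\<dots> \<le> L2_set (\<lambda>i. cmod (x i)) F + L2_set (\<lambda>i. cmod (y i)) F"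
      by (rule L2_set_triangle_ineq)
    also have "\<dots> \<le> ell2_norm x + ell2_norm y"
      using assms by (intro add_mono L2_set_le_ell2_norm)
    finally show ?thesis .
  qed
  from ell2_normI[where x = "x + y", OF this] show "x + y \<in> ell2" "ell2_norm (x + y) \<le> ell2_norm x + ell2_norm y"
    by auto
qed

lemma ell2_scale [intro]: "x \<in> ell2 \<Longrightarrow> c *\<^sub>v x \<in> ell2"
  by (auto simp: vec_apply ell2_def norm_mult power_mult_distrib intro: summable_on_cmult_right)

lemma ell2_norm_scale: "ell2_norm (c *\<^sub>v x) = cmod c * ell2_norm x"
  by (simp add: vec_apply ell2_norm_def norm_mult power_mult_distrib infsum_cmult_right' real_sqrt_mult)

lemma ell2_minus: "x \<in> ell2 \<Longrightarrow> - x \<in> ell2"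
  and ell2_norm_minus: "ell2_norm (- x) = ell2_norm x"
  by (simp_all add: vec_apply ell2_def ell2_norm_def)

lemma ell2_diff: "x \<in> ell2 \<Longrightarrow> y \<in> ell2 \<Longrightarrow> x - y \<in> ell2"
  using ell2_add(1)[of x "- y"] ell2_minus[of y] by simp

lemma ell2_norm_diff_le:
  "x \<in> ell2 \<Longrightarrow> y \<in> ell2 \<Longrightarrow> ell2_norm (x - y) \<le> ell2_norm x + ell2_norm y"
  using ell2_norm_triangle[of x "- y"] ell2_minus[of y] by (simp add: ell2_norm_minus)

lemma ell2_norm_minus_commute: "ell2_norm (x - y) = ell2_norm (y - x)"
  using ell2_norm_minus[of "x - y"] by simp

lemma ell2_coord_le: "x \<in> ell2 \<Longrightarrow> cmod (x i) \<le> ell2_norm x"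
  using L2_set_le_ell2_norm[of x "{i}"] by (simp add: L2_set_def)

lemma ell2_norm_eq_0: "x \<in> ell2 \<Longrightarrow> ell2_norm x = 0 \<longleftrightarrow> x = 0"
proof
  assume "x \<in> ell2" "ell2_norm x = 0"
  then show "x = 0"
    using ell2_coord_le[of x] by (auto simp: fun_eq_iff)
qed auto

lemma ell2_inner_summable:
  assumes "x \<in> ell2" "y \<in> ell2"
  shows "(\<lambda>i. cnj (x i) * y i) abs_summable_on UNIV"
proof (rule abs_summable_on_comparison_test)
  show "(\<lambda>i. (cmod (x i))\<^sup>2 + (cmod (y i))\<^sup>2) abs_summable_on UNIV"
    using summable_on_add[of "\<lambda>i. (cmod (x i))\<^sup>2" UNIV "\<lambda>i. (cmod (y i))\<^sup>2"] assms by (simp add: ell2_def)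
  show "norm (cnj (x i) * y i) \<le> norm ((cmod (x i))\<^sup>2 + (cmod (y i))\<^sup>2)" for i
  proof -
    have "0 \<le> cmod (x i) * cmod (y i)" by simp
    then have "cmod (x i) * cmod (y i) \<le> (cmod (x i))\<^sup>2 + (cmod (y i))\<^sup>2"
      using sum_squares_bound[of "cmod (x i)" "cmod (y i)"] by linarith
    then show ?thesis by (simp add: norm_mult)
  qed
qed

lemma ell2_inner_abs_le:
  assumes "x \<in> ell2" "y \<in> ell2"
  shows "(\<Sum>\<^sub>\<infinity>i. cmod (x i) * cmod (y i)) \<le> ell2_norm x * ell2_norm y"
proof (rule infsum_le_finite_sums)
  show "(\<lambda>i. cmod (x i) * cmod (y i)) summable_on UNIV"
    using ell2_inner_summable[OF assms] by (simp add: norm_mult)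
next
  fix F :: "'a set" assume "finite F"
  have "(\<Sum>i\<in>F. cmod (x i) * cmod (y i)) \<le> L2_set (\<lambda>i. cmod (x i)) F * L2_set (\<lambda>i. cmod (y i)) F"
    using L2_set_mult_ineq[of "\<lambda>i. cmod (x i)" "\<lambda>i. cmod (y i)" F] by simp
  also have "\<dots> \<le> ell2_norm x * ell2_norm y"
    using assms by (intro mult_mono L2_set_le_ell2_norm) auto
  finally show "(\<Sum>i\<in>F. cmod (x i) * cmod (y i)) \<le> ell2_norm x * ell2_norm y" .
qed

lemma ell2_Cauchy_Schwarz:
  assumes "x \<in> ell2" "y \<in> ell2"
  shows "cmod (ell2_inner x y) \<le> ell2_norm x * ell2_norm y"
proof -
  have "cmod (ell2_inner x y) \<le> (\<Sum>\<^sub>\<infinity>i. cmod (cnj (x i) * y i))"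
    unfolding ell2_inner_def by (rule norm_infsum_bound)
      (use ell2_inner_summable[OF assms] in simp)
  also have "\<dots> \<le> ell2_norm x * ell2_norm y"
    using ell2_inner_abs_le[OF assms] by (simp add: norm_mult)
  finally show ?thesis .
qed

lemma ell2_inner_add_right:
  assumes "x \<in> ell2" "y \<in> ell2" "z \<in> ell2"
  shows "ell2_inner x (y + z) = ell2_inner x y + ell2_inner x z"
  using assms by (simp add: vec_apply ell2_inner_def distrib_left infsum_add abs_summable_summable ell2_inner_summable)

lemma ell2_inner_scale_right: "ell2_inner x (c *\<^sub>v y) = c * ell2_inner x y"
  by (simp add: vec_apply ell2_inner_def mult.left_commute infsum_cmult_right')

lemma ell2_inner_commute: "ell2_inner y x = cnj (ell2_inner x y)"
  unfolding ell2_inner_def infsum_cnj[symmetric] by (simp add: mult.commute)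

lemma ell2_inner_add_left:
  "x \<in> ell2 \<Longrightarrow> y \<in> ell2 \<Longrightarrow> z \<in> ell2 \<Longrightarrow> ell2_inner (x + y) z = ell2_inner x z + ell2_inner y z"
  using ell2_inner_add_right[of z x y] by (metis complex_cnj_add ell2_inner_commute)

lemma ell2_inner_scale_left: "ell2_inner (c *\<^sub>v x) y = cnj c * ell2_inner x y"
  by (metis complex_cnj_mult ell2_inner_commute ell2_inner_scale_right)

lemma ell2_inner_minus_right: "ell2_inner x (- y) = - ell2_inner x y"
  using ell2_inner_scale_right[of x "-1" y] by simp

lemma ell2_inner_minus_left: "ell2_inner (- x) y = - ell2_inner x y"
  using ell2_inner_scale_left[of "-1" x y] by simp

lemma ell2_inner_zero [simp]: "ell2_inner x 0 = 0" "ell2_inner 0 x = 0"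
  by (simp_all add: ell2_inner_def)

lemma ell2_inner_diff_right:
  "x \<in> ell2 \<Longrightarrow> y \<in> ell2 \<Longrightarrow> z \<in> ell2 \<Longrightarrow> ell2_inner x (y - z) = ell2_inner x y - ell2_inner x z"
  using ell2_inner_add_right[of x y "- z"] ell2_minus[of z] by (simp add: ell2_inner_minus_right)

lemma ell2_inner_diff_left:
  "x \<in> ell2 \<Longrightarrow> y \<in> ell2 \<Longrightarrow> z \<in> ell2 \<Longrightarrow> ell2_inner (x - y) z = ell2_inner x z - ell2_inner y z"
  using ell2_inner_add_left[of x "- y" z] ell2_minus[of y] by (simp add: ell2_inner_minus_left)

lemma ell2_inner_self:
  assumes "x \<in> ell2"
  shows "ell2_inner x x = complex_of_real ((ell2_norm x)\<^sup>2)"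
proof -
  have "((\<lambda>i. (cmod (x i))\<^sup>2) has_sum (ell2_norm x)\<^sup>2) UNIV"
    using assms by (simp add: ell2_norm_def infsum_nonneg ell2_def)
  then have "((\<lambda>i. complex_of_real ((cmod (x i))\<^sup>2)) has_sum complex_of_real ((ell2_norm x)\<^sup>2)) UNIV"
    by (simp only: has_sum_of_real_iff)
  moreover have "complex_of_real ((cmod (x i))\<^sup>2) = cnj (x i) * x i" for i
    by (metis complex_norm_square mult.commute of_real_power)
  ultimately show ?thesis unfolding ell2_inner_def by (simp add: infsumI)
qed

lemma ell2_norm_add_sq:
  assumes "x \<in> ell2" "y \<in> ell2"
  shows "(ell2_norm (x + y))\<^sup>2 = (ell2_norm x)\<^sup>2 + 2 * Re (ell2_inner x y) + (ell2_norm y)\<^sup>2"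
proof -
  have "ell2_inner (x + y) (x + y) = ell2_inner x x + ell2_inner x y + cnj (ell2_inner x y) + ell2_inner y y"
    using assms ell2_add(1)[OF assms]
    by (simp add: ell2_inner_add_left ell2_inner_add_right ell2_inner_commute[of y x])
  from arg_cong[where f = Re, OF this] show ?thesis
    using assms ell2_add(1)[OF assms] by (simp add: ell2_inner_self del: of_real_power)
qed

lemma ell2_parallelogram:
  assumes "x \<in> ell2" "y \<in> ell2"
  shows "(ell2_norm (x + y))\<^sup>2 + (ell2_norm (x - y))\<^sup>2 = 2 * (ell2_norm x)\<^sup>2 + 2 * (ell2_norm y)\<^sup>2"
  using ell2_norm_add_sq[OF assms] ell2_norm_add_sq[of x "- y"] ell2_minus[of y] assms
  by (simp add: ell2_norm_minus ell2_inner_minus_right)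

text \<open>Each coordinate is dominated by the norm, so the coordinates converge. Convergence in
  norm follows because, on a fixed finite index set, the Cauchy bound survives the limit in its
  second index, and the bound does not depend on the finite set.\<close>

lemma ell2_complete:
  fixes X :: "nat \<Rightarrow> 'i vec"
  assumes X: "\<And>n. X n \<in> ell2"
    and C: "\<And>e. e > 0 \<Longrightarrow> \<exists>N. \<forall>m\<ge>N. \<forall>n\<ge>N. ell2_norm (X m - X n) < e"
  obtains x where "x \<in> ell2" "(\<lambda>n. ell2_norm (X n - x)) \<longlonglongrightarrow> 0"
proof -
  have "Cauchy (\<lambda>n. X n i)" for i
  proof (rule CauchyI)
    fix e :: real assume "e > 0"
    with C obtain N where N: "\<forall>m\<ge>N. \<forall>n\<ge>N. ell2_norm (X m - X n) < e" by blast
    have "norm (X m i - X n i) < e" if "m \<ge> N" "n \<ge> N" for m n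
      using N that ell2_coord_le[OF ell2_diff[OF X X], of m n i] by (force simp: vec_apply)
    then show "\<exists>M. \<forall>m\<ge>M. \<forall>n\<ge>M. norm (X m i - X n i) < e" by blast
  qed
  then have "\<exists>l. (\<lambda>n. X n i) \<longlonglongrightarrow> l" for i
    by (simp add: Cauchy_convergent_iff convergent_def)
  then obtain x where x: "\<And>i. (\<lambda>n. X n i) \<longlonglongrightarrow> x i" by metis
  have key: "\<exists>N. \<forall>n\<ge>N. X n - x \<in> ell2 \<and> ell2_norm (X n - x) \<le> e" if "e > 0" for e
  proof -
    obtain N where N: "\<forall>m\<ge>N. \<forall>n\<ge>N. ell2_norm (X m - X n) < e" using C[OF \<open>e > 0\<close>] by blast
    have "L2_set (\<lambda>i. cmod ((X n - x) i)) F \<le> e" if "n \<ge> N" "finite F" for n F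
    proof (rule LIMSEQ_le_const2)
      show "(\<lambda>m. L2_set (\<lambda>i. cmod ((X n - X m) i)) F) \<longlonglongrightarrow> L2_set (\<lambda>i. cmod ((X n - x) i)) F"
        unfolding L2_set_def fun_diff_def by (intro tendsto_intros x)
      have "L2_set (\<lambda>i. cmod ((X n - X m) i)) F \<le> e" if "m \<ge> N" for m
        using L2_set_le_ell2_norm[OF ell2_diff[OF X X], of n m F] N that \<open>n \<ge> N\<close>
        by (meson less_eq_real_def order_trans)
      then show "\<exists>N. \<forall>m\<ge>N. L2_set (\<lambda>i. cmod ((X n - X m) i)) F \<le> e" by blast
    qed
    then show ?thesis using ell2_normI[of "X n - x" e for n] by blast
  qed
  show thesis
  proof
    obtain n where "X n - x \<in> ell2" using key[of 1] by auto
    then show "x \<in> ell2" using ell2_diff[OF X[of n]] by (metis diff_diff_eq2 add_diff_cancel_left' )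
    show "(\<lambda>n. ell2_norm (X n - x)) \<longlonglongrightarrow> 0"
    proof (rule LIMSEQ_I)
      fix r :: real assume "r > 0"
      then obtain N where "\<forall>n\<ge>N. ell2_norm (X n - x) \<le> r / 2" using key[of "r / 2"] by auto
      then show "\<exists>no. \<forall>n\<ge>no. norm (ell2_norm (X n - x) - 0) < r"
        using \<open>r > 0\<close> by (intro exI[of _ N]) (auto simp: le_less_trans)
    qed
  qed
qed

section \<open>Closed subspaces, Riesz representation and adjoints\<close>

section \<open>Closed subspaces and bounded operators\<close>

context
  fixes H :: "'i vec set"
  assumes H: "hilbert_space H"
begin

lemma hs_ell2: "x \<in> H \<Longrightarrow> x \<in> ell2"
  and hs_zero: "0 \<in> H"
  and hs_add: "x \<in> H \<Longrightarrow> y \<in> H \<Longrightarrow> x + y \<in> H"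
  and hs_scale: "x \<in> H \<Longrightarrow> c *\<^sub>v x \<in> H"
  and hs_closed: "(\<And>n. X n \<in> H) \<Longrightarrow> x \<in> ell2 \<Longrightarrow> (\<lambda>n. ell2_norm (X n - x)) \<longlonglongrightarrow> 0 \<Longrightarrow> x \<in> H"
  using H unfolding hilbert_space_def vec_defs by blast+

lemma hs_minus: "x \<in> H \<Longrightarrow> - x \<in> H"
  using hs_scale[of x "-1"] by simp

lemma hs_diff: "x \<in> H \<Longrightarrow> y \<in> H \<Longrightarrow> x - y \<in> H"
  using hs_add[of x "- y"] hs_minus[of y] by simp

lemma hs_sum: "(\<And>k. k \<in> K \<Longrightarrow> f k \<in> H) \<Longrightarrow> (\<Sum>k\<in>K. f k) \<in> H"
  by (induction K rule: infinite_finite_induct) (auto intro: hs_zero hs_add)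

lemma hs_inner_eqI:
  assumes "a \<in> H" "b \<in> H" "\<And>x. x \<in> H \<Longrightarrow> ell2_inner x a = ell2_inner x b"
  shows "a = b"
proof -
  have "ell2_inner (a - b) (a - b) = 0"
    using assms hs_diff[of a b] by (simp add: ell2_inner_diff_right hs_ell2)
  then have "a - b = 0"
    using ell2_norm_eq_0[OF hs_ell2[OF hs_diff[OF assms(1,2)]]]
    by (simp add: ell2_inner_self hs_ell2 hs_diff assms)
  then show ?thesis by simp
qed

lemma hs_complete:
  fixes X :: "nat \<Rightarrow> 'i vec"
  assumes "\<And>n. X n \<in> H"
    and "\<And>e. e > 0 \<Longrightarrow> \<exists>N. \<forall>m\<ge>N. \<forall>n\<ge>N. ell2_norm (X m - X n) < e"
  obtains x where "x \<in> H" "(\<lambda>n. ell2_norm (X n - x)) \<longlonglongrightarrow> 0"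
proof -
  obtain x where "x \<in> ell2" "(\<lambda>n. ell2_norm (X n - x)) \<longlonglongrightarrow> 0"
    using ell2_complete[of X] assms hs_ell2 by blast
  then show thesis using that hs_closed assms(1) by blast
qed

lemma hs_inner_tendsto:
  assumes "\<And>n. X n \<in> H" "x \<in> H" "(\<lambda>n. ell2_norm (X n - x)) \<longlonglongrightarrow> 0" "y \<in> H"
  shows "(\<lambda>n. ell2_inner (X n) y) \<longlonglongrightarrow> ell2_inner x y"
proof (rule LIM_zero_cancel, rule tendsto_0_le[OF assms(3)])
  show "\<forall>\<^sub>F n in sequentially. norm (ell2_inner (X n) y - ell2_inner x y)
    \<le> norm (ell2_norm (X n - x)) * ell2_norm y"
    using ell2_Cauchy_Schwarz[OF hs_ell2[OF hs_diff[OF assms(1,2)]] hs_ell2[OF assms(4)]] assms hs_ell2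
    by (simp add: ell2_inner_diff_left)
qed

text \<open>At \<open>t = - r / k\<close> the parabola has the negative value
  \<open>- r^2 / k\<close> unless \<open>r = 0\<close>; if \<open>k = 0\<close> it is a line and
  \<open>t = - r\<close> does the same. This is the first-order condition at the minimum in
  \<open>Riesz_representation\<close>.\<close>

lemma quadratic_nonneg_imp_zero:
  fixes r k :: real
  assumes "\<And>t. 0 \<le> 2 * t * r + t\<^sup>2 * k" "0 \<le> k"
  shows "r = 0"
proof (cases "k = 0")
  case True
  then show ?thesis using assms(1)[of "- r"] by (auto simp: mult_le_0_iff)
next
  case False
  have "0 \<le> 2 * (- r / k) * r + (- r / k)\<^sup>2 * k" by (rule assms)
  also have "\<dots> = - (r\<^sup>2 / k)" using False by (simp add: power2_eq_square field_simps)
  finally have "r\<^sup>2 / k \<le> 0" by simp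
  then show ?thesis using False assms(2) by (simp add: divide_le_0_iff)
qed

text \<open>The representing vector minimizes \<open>\<parallel>x\<parallel>\<^sup>2 - 2 Re (f x)\<close>.\<close>

lemma Riesz_representation:
  assumes add: "\<And>x y. x \<in> H \<Longrightarrow> y \<in> H \<Longrightarrow> f (x + y) = f x + f y"
    and scale: "\<And>c x. x \<in> H \<Longrightarrow> f (c *\<^sub>v x) = c * f x"
    and bound: "\<And>x. x \<in> H \<Longrightarrow> cmod (f x) \<le> M * ell2_norm x"
  shows "\<exists>a\<in>H. \<forall>x\<in>H. f x = ell2_inner a x"
proof -
  define J where "J x = (ell2_norm x)\<^sup>2 - 2 * Re (f x)" for x
  have J_lower: "- M\<^sup>2 \<le> J x" if "x \<in> H" for x
  proof -
    have "2 * Re (f x) \<le> 2 * (M * ell2_norm x)"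
      using bound[OF that] complex_Re_le_cmod[of "f x"] by linarith
    moreover have "0 \<le> (ell2_norm x)\<^sup>2 + M\<^sup>2 - 2 * ell2_norm x * M"
      using zero_le_power2[of "ell2_norm x - M"] unfolding power2_diff .
    ultimately show ?thesis unfolding J_def by (simp add: algebra_simps)
  qed
  define m where "m = Inf (J ` H)"
  have bdd: "bdd_below (J ` H)" using J_lower by (auto intro!: bdd_belowI[where m = "- M\<^sup>2"])
  have m_le: "m \<le> J x" if "x \<in> H" for x
    unfolding m_def using bdd that by (auto intro: cInf_lower)
  have "\<exists>x\<in>H. J x < m + 1 / real (Suc n)" for n
    using cInf_lessD[of "J ` H" "m + 1 / real (Suc n)"] hs_zero unfolding m_def by fastforce
  then obtain X where X: "\<And>n. X n \<in> H" and JX: "\<And>n. J (X n) < m + 1 / real (Suc n)" by metis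
  have J_add: "J (x + y) = J x + 2 * (Re (ell2_inner x y) - Re (f y)) + (ell2_norm y)\<^sup>2"
    if "x \<in> H" "y \<in> H" for x y
    using that by (simp add: J_def ell2_norm_add_sq hs_ell2 add)
  \<comment> \<open>By the parallelogram law and \<open>m \<le> J z\<close> at the midpoint
    \<open>z\<close>, two near-minimizers are close to each other; this makes a minimizing sequence
    Cauchy.\<close>
  have dist: "(ell2_norm (x - y))\<^sup>2 \<le> 2 * J x + 2 * J y - 4 * m" if "x \<in> H" "y \<in> H" for x y
  proof -
    define z where "z = (1/2) *\<^sub>v (x + y)"
    have z: "z \<in> H" using that by (auto simp: z_def intro: hs_scale hs_add)
    have "4 * J z = (ell2_norm (x + y))\<^sup>2 - 4 * Re (f x) - 4 * Re (f y)"
      using that by (simp add: J_def z_def ell2_norm_scale scale hs_add add power2_eq_square) (simp add: field_simps)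
    moreover have "(ell2_norm (x - y))\<^sup>2 = 2 * (ell2_norm x)\<^sup>2 + 2 * (ell2_norm y)\<^sup>2 - (ell2_norm (x + y))\<^sup>2"
      using ell2_parallelogram[of x y] that hs_ell2 by simp
    ultimately show ?thesis using m_le[OF z] by (simp add: J_def)
  qed
  obtain a where a: "a \<in> H" and lim: "(\<lambda>n. ell2_norm (X n - a)) \<longlonglongrightarrow> 0"
  proof (rule hs_complete[of X])
    fix e :: real assume "e > 0"
    then obtain N where N: "4 / e\<^sup>2 < real N" using reals_Archimedean2 by blast
    have "ell2_norm (X k - X n) < e" if "k \<ge> N" "n \<ge> N" for k n
    proof -
      have NN: "0 < real N" using N \<open>e > 0\<close> by (smt (verit) divide_pos_pos zero_less_power)
      have "1 / real (Suc k) \<le> 1 / real N" "1 / real (Suc n) \<le> 1 / real N"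
        using that NN by (auto intro!: divide_left_mono)
      then have "(ell2_norm (X k - X n))\<^sup>2 < 4 * (1 / real N)"
        using dist[OF X[of k] X[of n]] JX[of k] JX[of n] by linarith
      also have "\<dots> < e\<^sup>2" using N NN \<open>e > 0\<close> by (simp add: field_simps)
      finally show ?thesis using \<open>e > 0\<close> by (simp add: power_less_imp_less_base)
    qed
    then show "\<exists>N. \<forall>m\<ge>N. \<forall>n\<ge>N. ell2_norm (X m - X n) < e" by blast
  qed (use X in auto)
  \<comment> \<open>First variation of \<open>J\<close> at the minimizer \<open>a\<close> in the
    direction \<open>h\<close>. It is computed along the sequence \<open>X\<close>, where
    \<open>J\<close> is within \<open>1 / Suc n\<close> of the infimum, and then passed to the
    limit.\<close>
  have Re_eq: "Re (f h) = Re (ell2_inner a h)" if h: "h \<in> H" for h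
  proof -
    have "0 \<le> 2 * t * (Re (ell2_inner a h) - Re (f h)) + t\<^sup>2 * (ell2_norm h)\<^sup>2" for t :: real
    proof (rule LIMSEQ_le_const)
      have "(\<lambda>n. 1 / real (Suc n) + 2 * t * (Re (ell2_inner (X n) h) - Re (f h)) + t\<^sup>2 * (ell2_norm h)\<^sup>2)
        \<longlonglongrightarrow> 0 + 2 * t * (Re (ell2_inner a h) - Re (f h)) + t\<^sup>2 * (ell2_norm h)\<^sup>2"
        using LIMSEQ_Suc[OF lim_1_over_n[where 'a = real]]
        by (intro tendsto_intros hs_inner_tendsto X a lim h) auto
      then show "(\<lambda>n. 1 / real (Suc n) + 2 * t * (Re (ell2_inner (X n) h) - Re (f h)) + t\<^sup>2 * (ell2_norm h)\<^sup>2)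
        \<longlonglongrightarrow> 2 * t * (Re (ell2_inner a h) - Re (f h)) + t\<^sup>2 * (ell2_norm h)\<^sup>2" by simp
      have "0 \<le> 1 / real (Suc n) + 2 * t * (Re (ell2_inner (X n) h) - Re (f h)) + t\<^sup>2 * (ell2_norm h)\<^sup>2" for n
      proof -
        have th: "complex_of_real t *\<^sub>v h \<in> H" using h hs_scale by blast
        have "m \<le> J (X n + complex_of_real t *\<^sub>v h)"
          using m_le[OF hs_add[OF X th]] .
        then show ?thesis using JX[of n] J_add[OF X th, of n] h
          by (simp add: ell2_inner_scale_right scale ell2_norm_scale power_mult_distrib algebra_simps)
      qed
      then show "\<exists>N. \<forall>n\<ge>N. 0 \<le> 1 / real (Suc n) + 2 * t * (Re (ell2_inner (X n) h) - Re (f h)) + t\<^sup>2 * (ell2_norm h)\<^sup>2"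
        by blast
    qed
    from quadratic_nonneg_imp_zero[OF this] show ?thesis by simp
  qed
  \<comment> \<open>The real parts at \<open>h\<close> and at \<open>- \<i> h\<close> give the real
    and the imaginary part of the identity.\<close>
  have "f h = ell2_inner a h" if "h \<in> H" for h
    using Re_eq[OF that] Re_eq[OF hs_scale[OF that, of "- \<i>"]] that
    by (simp add: scale ell2_inner_scale_right complex_eq_iff)
  then show ?thesis using a by blast
qed

subsection \<open>Bounded operators\<close>

lemma bop_apply: "T \<in> bounded_ops H \<Longrightarrow> x \<in> H \<Longrightarrow> T x \<in> H"
  and bop_add: "T \<in> bounded_ops H \<Longrightarrow> x \<in> H \<Longrightarrow> y \<in> H \<Longrightarrow> T (x + y) = T x + T y"
  and bop_scale: "T \<in> bounded_ops H \<Longrightarrow> x \<in> H \<Longrightarrow> T (c *\<^sub>v x) = c *\<^sub>v T x"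
  and bop_undefined: "T \<in> bounded_ops H \<Longrightarrow> x \<notin> H \<Longrightarrow> T x = undefined"
  unfolding bounded_ops_def vec_defs by (auto simp only: PiE_iff extensional_def mem_Collect_eq)

lemma bop_zero: "T \<in> bounded_ops H \<Longrightarrow> T 0 = 0"
  using bop_scale[of T 0 0] hs_zero by simp

lemma bop_minus: "T \<in> bounded_ops H \<Longrightarrow> x \<in> H \<Longrightarrow> T (- x) = - T x"
  using bop_scale[of T x "-1"] by simp

lemma bop_diff: "T \<in> bounded_ops H \<Longrightarrow> x \<in> H \<Longrightarrow> y \<in> H \<Longrightarrow> T (x - y) = T x - T y"
  using bop_add[of T x "- y"] by (simp add: bop_minus[of T y] hs_minus)

lemma bop_sum:
  assumes "T \<in> bounded_ops H"
  shows "(\<And>k. k \<in> K \<Longrightarrow> f k \<in> H) \<Longrightarrow> T (\<Sum>k\<in>K. f k) = (\<Sum>k\<in>K. T (f k))"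
  by (induction K rule: infinite_finite_induct) (auto simp: bop_zero[OF assms] bop_add[OF assms] hs_sum)

lemma bop_bounded:
  assumes "T \<in> bounded_ops H"
  obtains M where "0 \<le> M" "\<And>x. x \<in> H \<Longrightarrow> ell2_norm (T x) \<le> M * ell2_norm x"
proof -
  obtain M where M: "\<And>x. x \<in> H \<Longrightarrow> ell2_norm (T x) \<le> M * ell2_norm x"
    using assms unfolding bounded_ops_def by blast
  have "ell2_norm (T x) \<le> \<bar>M\<bar> * ell2_norm x" if "x \<in> H" for x
    using M[OF that] by (meson abs_ge_self ell2_norm_nonneg mult_right_mono order_trans)
  then show thesis using that[of "\<bar>M\<bar>"] by simp
qed

lemma bopI:
  assumes "\<And>x. x \<in> H \<Longrightarrow> T x \<in> H" "\<And>x. x \<notin> H \<Longrightarrow> T x = undefined"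
    and "\<And>x y. x \<in> H \<Longrightarrow> y \<in> H \<Longrightarrow> T (x + y) = T x + T y"
    and "\<And>c x. x \<in> H \<Longrightarrow> T (c *\<^sub>v x) = c *\<^sub>v T x"
    and "\<And>x. x \<in> H \<Longrightarrow> ell2_norm (T x) \<le> M * ell2_norm x"
  shows "T \<in> bounded_ops H"
  using assms unfolding bounded_ops_def vec_defs
  by (auto simp only: PiE_iff extensional_def mem_Collect_eq intro!: exI[of _ M])

lemma bop_eqI:
  assumes "S \<in> bounded_ops H" "T \<in> bounded_ops H" "\<And>x. x \<in> H \<Longrightarrow> S x = T x"
  shows "S = T"
  using assms bop_undefined by (metis ext)

lemma op_norm_bound:
  assumes T: "T \<in> bounded_ops H" and x: "x \<in> H"
  shows "ell2_norm (T x) \<le> op_norm H T * ell2_norm x"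
proof (cases "x = 0")
  case True
  then show ?thesis using bop_zero[OF T] by simp
next
  case False
  obtain M where M: "0 \<le> M" "\<And>x. x \<in> H \<Longrightarrow> ell2_norm (T x) \<le> M * ell2_norm x"
    using bop_bounded[OF T] by blast
  have n: "ell2_norm x > 0" using False x hs_ell2 ell2_norm_eq_0 ell2_norm_nonneg by (metis less_eq_real_def)
  define y where "y = complex_of_real (1 / ell2_norm x) *\<^sub>v x"
  have y: "y \<in> H" "ell2_norm y = 1" using x n by (auto simp: y_def ell2_norm_scale norm_divide intro: hs_scale)
  have "ell2_norm (T y) \<le> op_norm H T" unfolding op_norm_def
  proof (rule cSup_upper)
    show "bdd_above {ell2_norm (T x) |x. x \<in> H \<and> ell2_norm x \<le> 1}"
    proof (rule bdd_aboveI)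
      fix r assume "r \<in> {ell2_norm (T x) |x. x \<in> H \<and> ell2_norm x \<le> 1}"
      then obtain x where "r = ell2_norm (T x)" "x \<in> H" "ell2_norm x \<le> 1" by blast
      then show "r \<le> M * 1" using M by (metis mult_left_mono order_trans)
    qed
  qed (use y in auto)
  moreover have "ell2_norm (T y) = ell2_norm (T x) / ell2_norm x"
    using n by (simp add: y_def bop_scale[OF T x] ell2_norm_scale norm_divide)
  ultimately show ?thesis using n by (simp add: field_simps)
qed

lemma op_norm_le:
  assumes "0 \<le> c" "\<And>x. x \<in> H \<Longrightarrow> ell2_norm (T x) \<le> c * ell2_norm x"
  shows "op_norm H T \<le> c"
  unfolding op_norm_def
proof (rule cSup_least)
  show "{ell2_norm (T x) |x. x \<in> H \<and> ell2_norm x \<le> 1} \<noteq> {}" using hs_zero by force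
  fix r assume "r \<in> {ell2_norm (T x) |x. x \<in> H \<and> ell2_norm x \<le> 1}"
  then obtain x where x: "r = ell2_norm (T x)" "x \<in> H" "ell2_norm x \<le> 1" by blast
  then have "r \<le> c * ell2_norm x" using assms by simp
  also have "\<dots> \<le> c * 1" using x assms by (intro mult_left_mono) auto
  finally show "r \<le> c" by simp
qed

lemma op_norm_nonneg:
  assumes "T \<in> bounded_ops H" shows "0 \<le> op_norm H T"
proof -
  have "0 \<in> {ell2_norm (T x) |x. x \<in> H \<and> ell2_norm x \<le> 1}"
    using hs_zero bop_zero[OF assms] by force
  moreover obtain M where M: "0 \<le> M" "\<And>x. x \<in> H \<Longrightarrow> ell2_norm (T x) \<le> M * ell2_norm x"
    using bop_bounded[OF assms] by blast
  have "bdd_above {ell2_norm (T x) |x. x \<in> H \<and> ell2_norm x \<le> 1}"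
  proof (rule bdd_aboveI)
    fix r assume "r \<in> {ell2_norm (T x) |x. x \<in> H \<and> ell2_norm x \<le> 1}"
    then obtain x where "r = ell2_norm (T x)" "x \<in> H" "ell2_norm x \<le> 1" by blast
    then show "r \<le> M * 1" using M by (metis mult_left_mono order_trans)
  qed
  ultimately show ?thesis unfolding op_norm_def by (simp add: cSup_upper)
qed

text \<open>Riesz applied to \<open>x \<mapsto> ell2_inner y (T x)\<close> for each
  \<open>y\<close>. The bound on the adjoint comes from the square of \<open>ell2_norm (A y)\<close>
  being \<open>ell2_inner (T (A y)) y\<close>, followed by Cauchy-Schwarz and cancellation of one
  factor.\<close>

lemma adjoint_exists:
  assumes T: "T \<in> bounded_ops H"
  shows "\<exists>A\<in>bounded_ops H. \<forall>x\<in>H. \<forall>y\<in>H. ell2_inner (T x) y = ell2_inner x (A y)"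
proof -
  obtain M where M: "0 \<le> M" "\<And>x. x \<in> H \<Longrightarrow> ell2_norm (T x) \<le> M * ell2_norm x"
    using bop_bounded[OF T] by blast
  have "\<exists>a\<in>H. \<forall>x\<in>H. ell2_inner y (T x) = ell2_inner a x" if y: "y \<in> H" for y
  proof (rule Riesz_representation)
    show "cmod (ell2_inner y (T x)) \<le> ell2_norm y * M * ell2_norm x" if "x \<in> H" for x
      using ell2_Cauchy_Schwarz[of y "T x"] mult_left_mono[OF M(2)[OF that] ell2_norm_nonneg[of y]]
        y that bop_apply[OF T] hs_ell2 by (fastforce simp: mult.assoc)
  qed (use y bop_apply[OF T] hs_ell2 in \<open>auto simp: bop_add[OF T] bop_scale[OF T] ell2_inner_add_right ell2_inner_scale_right\<close>)
  then obtain A where A: "\<And>y. y \<in> H \<Longrightarrow> A y \<in> H"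
    and Ainner: "\<And>x y. y \<in> H \<Longrightarrow> x \<in> H \<Longrightarrow> ell2_inner y (T x) = ell2_inner (A y) x" by metis
  have Ain: "ell2_inner (T x) y = ell2_inner x (A y)" if "x \<in> H" "y \<in> H" for x y
    using Ainner[OF that(2,1)] by (metis ell2_inner_commute)
  have "restrict A H \<in> bounded_ops H"
  proof (rule bopI)
    show "restrict A H (x + y) = restrict A H x + restrict A H y" if "x \<in> H" "y \<in> H" for x y
      using that by (auto intro!: hs_inner_eqI simp: hs_add A)
        (simp add: ell2_inner_add_right hs_ell2 A bop_apply[OF T] hs_add flip: Ain)
    show "restrict A H (c *\<^sub>v x) = c *\<^sub>v restrict A H x" if "x \<in> H" for c x
      using that by (auto intro!: hs_inner_eqI simp: hs_scale A)
        (simp add: ell2_inner_scale_right hs_scale flip: Ain)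
    show "ell2_norm (restrict A H y) \<le> M * ell2_norm y" if y: "y \<in> H" for y
    proof (cases "ell2_norm (A y) = 0")
      case False
      have "(ell2_norm (A y))\<^sup>2 = cmod (ell2_inner (A y) (A y))"
        using y A by (simp add: ell2_inner_self hs_ell2 norm_power)
      also have "\<dots> = cmod (ell2_inner (T (A y)) y)" using Ain y A by simp
      also have "\<dots> \<le> ell2_norm (T (A y)) * ell2_norm y"
        using y A bop_apply[OF T] by (intro ell2_Cauchy_Schwarz hs_ell2) auto
      also have "\<dots> \<le> M * ell2_norm (A y) * ell2_norm y"
        using y A M by (intro mult_right_mono) auto
      finally have "ell2_norm (A y) * ell2_norm (A y) \<le> ell2_norm (A y) * (M * ell2_norm y)"
        by (simp add: power2_eq_square algebra_simps)
      then show ?thesis using y False ell2_norm_nonneg[of "A y"] by (simp add: mult_le_cancel_left)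
    qed (use y M in auto)
  qed (use A in auto)
  then show ?thesis using Ain by (intro bexI[of _ "restrict A H"]) auto
qed

lemma adjoint_unique:
  assumes "A \<in> bounded_ops H" "B \<in> bounded_ops H"
    and "\<And>x y. x \<in> H \<Longrightarrow> y \<in> H \<Longrightarrow> ell2_inner x (A y) = ell2_inner x (B y)"
  shows "A = B"
  using assms by (intro bop_eqI hs_inner_eqI) (auto simp: bop_apply)

lemma adjoint_spec:
  assumes "T \<in> bounded_ops H"
  shows adjoint_bop: "adjoint H T \<in> bounded_ops H"
    and adjoint_inner: "x \<in> H \<Longrightarrow> y \<in> H \<Longrightarrow> ell2_inner (T x) y = ell2_inner x (adjoint H T y)"
proof -
  have "\<exists>!A. A \<in> bounded_ops H \<and> (\<forall>x\<in>H. \<forall>y\<in>H. ell2_inner (T x) y = ell2_inner x (A y))"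
  proof (rule ex_ex1I)
    show "A = B" if "A \<in> bounded_ops H \<and> (\<forall>x\<in>H. \<forall>y\<in>H. ell2_inner (T x) y = ell2_inner x (A y))"
      "B \<in> bounded_ops H \<and> (\<forall>x\<in>H. \<forall>y\<in>H. ell2_inner (T x) y = ell2_inner x (B y))" for A B
      using that by (intro adjoint_unique) auto
  qed (use adjoint_exists[OF assms] in blast)
  from theI'[OF this] show "adjoint H T \<in> bounded_ops H"
    and "x \<in> H \<Longrightarrow> y \<in> H \<Longrightarrow> ell2_inner (T x) y = ell2_inner x (adjoint H T y)"
    unfolding adjoint_def by auto
qed

lemma adjoint_inner':
  assumes "T \<in> bounded_ops H" "x \<in> H" "y \<in> H"
  shows "ell2_inner (adjoint H T x) y = ell2_inner x (T y)"
  using adjoint_inner[OF assms(1,3,2)] by (metis ell2_inner_commute)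

lemma adjoint_eqI:
  assumes "T \<in> bounded_ops H" "A \<in> bounded_ops H"
    and "\<And>x y. x \<in> H \<Longrightarrow> y \<in> H \<Longrightarrow> ell2_inner (T x) y = ell2_inner x (A y)"
  shows "adjoint H T = A"
  using assms by (intro adjoint_unique adjoint_bop) (auto simp flip: adjoint_inner)

lemma adjoint_norm_le:
  assumes T: "T \<in> bounded_ops H" and y: "y \<in> H"
  shows "ell2_norm (adjoint H T y) \<le> op_norm H T * ell2_norm y"
proof (cases "ell2_norm (adjoint H T y) = 0")
  case False
  let ?A = "adjoint H T"
  have A: "?A y \<in> H" using bop_apply[OF adjoint_bop[OF T] y] .
  have "(ell2_norm (?A y))\<^sup>2 = cmod (ell2_inner (?A y) (?A y))"
    using A by (simp add: ell2_inner_self hs_ell2 norm_power)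
  also have "\<dots> = cmod (ell2_inner (T (?A y)) y)" using adjoint_inner[OF T A y] by simp
  also have "\<dots> \<le> ell2_norm (T (?A y)) * ell2_norm y"
    using y A bop_apply[OF T] by (intro ell2_Cauchy_Schwarz hs_ell2) auto
  also have "\<dots> \<le> op_norm H T * ell2_norm (?A y) * ell2_norm y"
    using A op_norm_bound[OF T] by (intro mult_right_mono) auto
  finally have "ell2_norm (?A y) * ell2_norm (?A y) \<le> ell2_norm (?A y) * (op_norm H T * ell2_norm y)"
    by (simp add: power2_eq_square algebra_simps)
  then show ?thesis using False ell2_norm_nonneg[of "?A y"] by (simp add: mult_le_cancel_left)
qed (use op_norm_nonneg[OF T] in auto)

end

section \<open>Operator norm, completeness and the *-algebra of bounded operators\<close>

section \<open>The algebra of bounded operators\<close>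

lemma Bop_sel [simp]:
  "carrier (Bop H) = bounded_ops H" "czero (Bop H) = zero_op H" "cnorm (Bop H) = op_norm H"
  "cstar (Bop H) = adjoint H" "cmult (Bop H) S T = compose H S T"
  by (simp_all add: Bop_def)

lemma Bop_add_apply [simp]: "x \<in> H \<Longrightarrow> cadd (Bop H) S T x = S x + T x"
  and Bop_scale_apply [simp]: "x \<in> H \<Longrightarrow> cscale (Bop H) c T x = c *\<^sub>v T x"
  and Bop_diff_apply [simp]: "x \<in> H \<Longrightarrow> cdiff (Bop H) S T x = S x - T x"
  by (auto simp: Bop_def cdiff_def fun_eq_iff vec_apply)

lemma id_op_apply [simp]: "x \<in> H \<Longrightarrow> id_op H x = x"
  and zero_op_apply [simp]: "x \<in> H \<Longrightarrow> zero_op H x = 0"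
  and compose_apply [simp]: "x \<in> H \<Longrightarrow> compose H S T x = S (T x)"
  by (auto simp: id_op_def zero_op_def compose_def fun_eq_iff)

context
  fixes H :: "'i vec set"
  assumes H: "hilbert_space H"
begin

lemma Bop_add_closed:
  assumes "S \<in> bounded_ops H" "T \<in> bounded_ops H"
  shows "cadd (Bop H) S T \<in> bounded_ops H"
proof (rule bopI[OF H])
  note S = assms(1) and T = assms(2)
  show "ell2_norm (cadd (Bop H) S T x) \<le> (op_norm H S + op_norm H T) * ell2_norm x" if "x \<in> H" for x
    using that op_norm_bound[OF H S that] op_norm_bound[OF H T that]
      ell2_norm_triangle[OF hs_ell2[OF H bop_apply[OF H S that]] hs_ell2[OF H bop_apply[OF H T that]]]
    by (simp add: algebra_simps)
qed (use assms in \<open>auto simp: bop_add[OF H assms(1)] bop_add[OF H assms(2)] bop_scale[OF H assms(1)]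
     bop_scale[OF H assms(2)] hs_add[OF H] hs_scale[OF H] bop_apply[OF H] vscale_add_right,
     simp add: Bop_def\<close>)

lemma Bop_scale_closed:
  assumes T: "T \<in> bounded_ops H"
  shows "cscale (Bop H) c T \<in> bounded_ops H"
proof (rule bopI[OF H])
  show "ell2_norm (cscale (Bop H) c T x) \<le> (cmod c * op_norm H T) * ell2_norm x" if "x \<in> H" for x
    using that op_norm_bound[OF H T that]
    by (simp add: ell2_norm_scale mult.assoc mult_left_mono)
qed (use assms in \<open>auto simp: bop_add[OF H T] bop_scale[OF H T] hs_add[OF H] hs_scale[OF H] bop_apply[OF H]
     vscale_add_right vscale_vscale mult.commute, simp add: Bop_def\<close>)

lemma Bop_diff_closed:
  "S \<in> bounded_ops H \<Longrightarrow> T \<in> bounded_ops H \<Longrightarrow> cdiff (Bop H) S T \<in> bounded_ops H"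
  by (simp add: cdiff_def Bop_add_closed Bop_scale_closed)

lemma compose_closed:
  assumes S: "S \<in> bounded_ops H" and T: "T \<in> bounded_ops H"
  shows "compose H S T \<in> bounded_ops H"
proof (rule bopI[OF H])
  show "ell2_norm (compose H S T x) \<le> (op_norm H S * op_norm H T) * ell2_norm x" if "x \<in> H" for x
  proof -
    have "ell2_norm (S (T x)) \<le> op_norm H S * ell2_norm (T x)"
      using op_norm_bound[OF H S bop_apply[OF H T that]] .
    also have "\<dots> \<le> op_norm H S * (op_norm H T * ell2_norm x)"
      using op_norm_bound[OF H T that] op_norm_nonneg[OF H S] by (rule mult_left_mono)
    finally show ?thesis using that by (simp add: mult.assoc)
  qed
qed (use assms in \<open>auto simp: bop_add[OF H T] bop_scale[OF H T] bop_add[OF H S] bop_scale[OF H S]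
     hs_add[OF H] hs_scale[OF H] bop_apply[OF H], simp add: compose_def\<close>)

lemma id_op_closed: "id_op H \<in> bounded_ops H"
proof (rule bopI[OF H])
  show "ell2_norm (id_op H x) \<le> 1 * ell2_norm x" if "x \<in> H" for x using that by simp
qed (auto simp: hs_add[OF H] hs_scale[OF H], simp add: id_op_def)

lemma zero_op_closed: "zero_op H \<in> bounded_ops H"
proof (rule bopI[OF H])
  show "ell2_norm (zero_op H x) \<le> 0 * ell2_norm x" if "x \<in> H" for x using that by simp
qed (auto simp: hs_add[OF H] hs_scale[OF H] hs_zero[OF H], simp add: zero_op_def)

lemmas Bop_closed = Bop_add_closed Bop_scale_closed Bop_diff_closed compose_closed id_op_closed
  zero_op_closed adjoint_bop[OF H]

lemma adjoint_add:
  assumes S: "S \<in> bounded_ops H" and T: "T \<in> bounded_ops H"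
  shows "adjoint H (cadd (Bop H) S T) = cadd (Bop H) (adjoint H S) (adjoint H T)"
  using assms by (intro adjoint_eqI[OF H])
    (auto simp: Bop_closed ell2_inner_add_left ell2_inner_add_right hs_ell2[OF H] bop_apply[OF H]
      adjoint_inner[OF H])

lemma adjoint_scale:
  assumes T: "T \<in> bounded_ops H"
  shows "adjoint H (cscale (Bop H) c T) = cscale (Bop H) (cnj c) (adjoint H T)"
  using assms by (intro adjoint_eqI[OF H])
    (auto simp: Bop_closed ell2_inner_scale_left ell2_inner_scale_right hs_ell2[OF H] bop_apply[OF H]
      adjoint_inner[OF H])

lemma adjoint_compose:
  assumes S: "S \<in> bounded_ops H" and T: "T \<in> bounded_ops H"
  shows "adjoint H (compose H S T) = compose H (adjoint H T) (adjoint H S)"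
  using assms by (intro adjoint_eqI[OF H])
    (auto simp: Bop_closed bop_apply[OF H] adjoint_inner[OF H])

lemma adjoint_adjoint: "T \<in> bounded_ops H \<Longrightarrow> adjoint H (adjoint H T) = T"
  by (intro adjoint_eqI[OF H]) (auto simp: Bop_closed adjoint_inner'[OF H])

lemma adjoint_id: "adjoint H (id_op H) = id_op H"
  by (intro adjoint_eqI[OF H]) (auto simp: Bop_closed)

lemma adjoint_zero: "adjoint H (zero_op H) = zero_op H"
  by (intro adjoint_eqI[OF H]) (auto simp: Bop_closed)

lemma compose_id_left: "T \<in> bounded_ops H \<Longrightarrow> compose H (id_op H) T = T"
  and compose_id_right: "T \<in> bounded_ops H \<Longrightarrow> compose H T (id_op H) = T"
  by (auto intro!: bop_eqI[OF H] simp: Bop_closed bop_apply[OF H])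

lemma compose_assoc':
  "T \<in> bounded_ops H \<Longrightarrow> compose H (compose H R S) T = compose H R (compose H S T)"
  by (auto simp: compose_def fun_eq_iff bop_apply[OF H])

lemma op_norm_zero: "op_norm H (zero_op H) = 0"
  using op_norm_le[OF H, of 0 "zero_op H"] op_norm_nonneg[OF H zero_op_closed] by auto

lemma op_norm_eq_0:
  assumes "T \<in> bounded_ops H" "op_norm H T = 0" shows "T = zero_op H"
proof (rule bop_eqI[OF H])
  fix x assume x: "x \<in> H"
  have "ell2_norm (T x) = 0" using op_norm_bound[OF H assms(1) x] assms(2)
    by (metis ell2_norm_nonneg mult_zero_left order_antisym)
  then show "T x = zero_op H x" using x ell2_norm_eq_0 hs_ell2[OF H] bop_apply[OF H assms(1)] by auto
qed (use assms zero_op_closed in auto)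

lemma op_norm_adjoint: "T \<in> bounded_ops H \<Longrightarrow> op_norm H (adjoint H T) \<le> op_norm H T"
  by (intro op_norm_le[OF H] op_norm_nonneg[OF H] adjoint_norm_le[OF H])

lemma op_norm_triangle:
  assumes S: "S \<in> bounded_ops H" and T: "T \<in> bounded_ops H"
  shows "op_norm H (cadd (Bop H) S T) \<le> op_norm H S + op_norm H T"
proof (rule op_norm_le[OF H])
  show "ell2_norm (cadd (Bop H) S T x) \<le> (op_norm H S + op_norm H T) * ell2_norm x" if "x \<in> H" for x
    using that op_norm_bound[OF H S that] op_norm_bound[OF H T that]
      ell2_norm_triangle[OF hs_ell2[OF H bop_apply[OF H S that]] hs_ell2[OF H bop_apply[OF H T that]]]
    by (simp add: algebra_simps)
qed (use assms op_norm_nonneg[OF H] in auto)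

lemma op_norm_scale:
  assumes T: "T \<in> bounded_ops H"
  shows "op_norm H (cscale (Bop H) c T) \<le> cmod c * op_norm H T"
  by (rule op_norm_le[OF H])
    (use op_norm_bound[OF H T] op_norm_nonneg[OF H T] in \<open>auto simp: ell2_norm_scale mult.assoc mult_left_mono\<close>)

lemma op_norm_compose:
  assumes S: "S \<in> bounded_ops H" and T: "T \<in> bounded_ops H"
  shows "op_norm H (compose H S T) \<le> op_norm H S * op_norm H T"
proof (rule op_norm_le[OF H])
  show "ell2_norm (compose H S T x) \<le> (op_norm H S * op_norm H T) * ell2_norm x" if "x \<in> H" for x
  proof -
    have "ell2_norm (S (T x)) \<le> op_norm H S * ell2_norm (T x)"
      using op_norm_bound[OF H S bop_apply[OF H T that]] .
    also have "\<dots> \<le> op_norm H S * (op_norm H T * ell2_norm x)"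
      using op_norm_bound[OF H T that] op_norm_nonneg[OF H S] by (rule mult_left_mono)
    finally show ?thesis using that by (simp add: mult.assoc)
  qed
qed (use assms op_norm_nonneg[OF H] in auto)

lemma op_norm_diff_triangle:
  assumes "R \<in> bounded_ops H" "S \<in> bounded_ops H" "T \<in> bounded_ops H"
  shows "op_norm H (cdiff (Bop H) R T) \<le> op_norm H (cdiff (Bop H) R S) + op_norm H (cdiff (Bop H) S T)"
proof -
  have "cdiff (Bop H) R T = cadd (Bop H) (cdiff (Bop H) R S) (cdiff (Bop H) S T)"
    using assms by (intro bop_eqI[OF H]) (auto simp: Bop_closed)
  then show ?thesis using op_norm_triangle assms by (simp add: Bop_closed)
qed

lemma op_norm_diff_commute:
  assumes "S \<in> bounded_ops H" "T \<in> bounded_ops H"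
  shows "op_norm H (cdiff (Bop H) S T) = op_norm H (cdiff (Bop H) T S)"
proof -
  have "op_norm H (cdiff (Bop H) S T) \<le> op_norm H (cdiff (Bop H) T S)"
    if "S \<in> bounded_ops H" "T \<in> bounded_ops H" for S T
    using op_norm_bound[OF H Bop_diff_closed[OF that(2,1)]] that
    by (intro op_norm_le[OF H] op_norm_nonneg[OF H] Bop_closed)
      (auto simp: ell2_norm_minus_commute[of "S _"])
  then show ?thesis using assms by (simp add: order_antisym)
qed

lemma op_norm_le_diff:
  assumes "S \<in> bounded_ops H" "T \<in> bounded_ops H"
  shows "\<bar>op_norm H S - op_norm H T\<bar> \<le> op_norm H (cdiff (Bop H) S T)"
proof -
  have "op_norm H S \<le> op_norm H T + op_norm H (cdiff (Bop H) S T)"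
    if "S \<in> bounded_ops H" "T \<in> bounded_ops H" for S T
  proof -
    have "S = cadd (Bop H) T (cdiff (Bop H) S T)"
      using that by (intro bop_eqI[OF H]) (auto simp: Bop_closed)
    then show ?thesis using op_norm_triangle[OF that(2) Bop_diff_closed[OF that]] by simp
  qed
  from this[OF assms] this[OF assms(2,1)] show ?thesis
    using op_norm_diff_commute[OF assms] by linarith
qed

lemma Bop_complete:
  assumes T: "\<And>n. T n \<in> bounded_ops H"
    and C: "\<And>e. e > 0 \<Longrightarrow> \<exists>N. \<forall>m\<ge>N. \<forall>n\<ge>N. op_norm H (cdiff (Bop H) (T m) (T n)) < e"
  obtains L where "L \<in> bounded_ops H" "(\<lambda>n. op_norm H (cdiff (Bop H) (T n) L)) \<longlonglongrightarrow> 0"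
proof -
  have diff: "ell2_norm (T m x - T n x) \<le> op_norm H (cdiff (Bop H) (T m) (T n)) * ell2_norm x"
    if "x \<in> H" for m n x
    using op_norm_bound[OF H Bop_diff_closed[OF T T] that, of m n] that by simp
  have "\<exists>y\<in>H. (\<lambda>n. ell2_norm (T n x - y)) \<longlonglongrightarrow> 0" if x: "x \<in> H" for x
  proof -
    have "\<exists>N. \<forall>m\<ge>N. \<forall>n\<ge>N. ell2_norm (T m x - T n x) < e" if "e > 0" for e
    proof -
      \<comment> \<open>The added 1 keeps the quotient meaningful when
        \<open>ell2_norm x = 0\<close>.\<close>
      have e: "e / (ell2_norm x + 1) > 0" using that by (simp add: add_nonneg_pos)
      obtain N where N: "\<forall>m\<ge>N. \<forall>n\<ge>N. op_norm H (cdiff (Bop H) (T m) (T n)) < e / (ell2_norm x + 1)"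
        using C[OF e] by blast
      have "ell2_norm (T m x - T n x) < e" if mn: "m \<ge> N" "n \<ge> N" for m n
      proof -
        have "ell2_norm (T m x - T n x) \<le> op_norm H (cdiff (Bop H) (T m) (T n)) * ell2_norm x"
          using diff[OF x] .
        also have "\<dots> \<le> e / (ell2_norm x + 1) * ell2_norm x"
          by (rule mult_right_mono[OF less_imp_le ell2_norm_nonneg]) (use N mn in blast)
        also have "\<dots> < e / (ell2_norm x + 1) * (ell2_norm x + 1)"
          by (rule mult_strict_left_mono[OF _ e]) simp
        also have "\<dots> = e"
        proof -
          have "ell2_norm x + 1 \<noteq> 0" using ell2_norm_nonneg[of x] by linarith
          then show ?thesis by simp
        qed
        finally show ?thesis .
      qed
      then show ?thesis by blast
    qed
    then obtain y where "y \<in> H" "(\<lambda>n. ell2_norm (T n x - y)) \<longlonglongrightarrow> 0"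
      using hs_complete[OF H, of "\<lambda>n. T n x"] bop_apply[OF H T x] by blast
    then show ?thesis by blast
  qed
  then obtain L0 where L0: "\<And>x. x \<in> H \<Longrightarrow> L0 x \<in> H"
    and lim: "\<And>x. x \<in> H \<Longrightarrow> (\<lambda>n. ell2_norm (T n x - L0 x)) \<longlonglongrightarrow> 0" by metis
  define L where "L = restrict L0 H"
  have L_in: "L x \<in> H" if "x \<in> H" for x using that L0 by (simp add: L_def)
  have lim_unique: "a = b" if "a \<in> H" "b \<in> H" "(\<lambda>n. ell2_norm (X n - a)) \<longlonglongrightarrow> 0"
    "(\<lambda>n. ell2_norm (X n - b)) \<longlonglongrightarrow> 0" "\<And>n. X n \<in> H" for X :: "nat \<Rightarrow> 'i vec" and a b
  proof (rule hs_inner_eqI[OF H that(1,2)])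
    fix y assume y: "y \<in> H"
    have "ell2_inner a y = ell2_inner b y"
      using hs_inner_tendsto[OF H that(5,1,3) y] hs_inner_tendsto[OF H that(5,2,4) y] by (rule LIMSEQ_unique)
    then show "ell2_inner y a = ell2_inner y b"
      by (simp add: ell2_inner_commute[of y])
  qed
  have L: "(\<lambda>n. ell2_norm (T n x - L x)) \<longlonglongrightarrow> 0" if "x \<in> H" for x
    using lim[OF that] that by (simp add: L_def)
  \<comment> \<open>Letting \<open>m\<close> go to infinity in the Cauchy estimate gives a bound
    with the factor \<open>ell2_norm x\<close>. It yields both the boundedness of \<open>L\<close>
    and convergence in operator norm.\<close>
  have unif: "\<exists>N. \<forall>n\<ge>N. \<forall>x\<in>H. ell2_norm (T n x - L x) \<le> e * ell2_norm x" if "e > 0" for e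
  proof -
    obtain N where N: "\<forall>m\<ge>N. \<forall>n\<ge>N. op_norm H (cdiff (Bop H) (T m) (T n)) < e" using C \<open>e > 0\<close> by blast
    have "ell2_norm (T n x - L x) \<le> e * ell2_norm x" if "n \<ge> N" "x \<in> H" for n x
    proof (rule LIMSEQ_le_const)
      show "(\<lambda>m. e * ell2_norm x + ell2_norm (T m x - L x)) \<longlonglongrightarrow> e * ell2_norm x"
        using tendsto_add[OF tendsto_const L[OF \<open>x \<in> H\<close>]] by simp
      have "ell2_norm (T n x - L x) \<le> e * ell2_norm x + ell2_norm (T m x - L x)" if m: "m \<ge> N" for m
      proof -
        have "ell2_norm (T n x - L x) \<le> ell2_norm (T n x - T m x) + ell2_norm (T m x - L x)"
          using ell2_norm_triangle[OF ell2_diff[OF hs_ell2[OF H bop_apply[OF H T \<open>x \<in> H\<close>]] hs_ell2[OF H bop_apply[OF H T \<open>x \<in> H\<close>]]]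
              ell2_diff[OF hs_ell2[OF H bop_apply[OF H T \<open>x \<in> H\<close>]] hs_ell2[OF H L_in[OF \<open>x \<in> H\<close>]]], of n m m] by simp
        moreover have "ell2_norm (T n x - T m x) \<le> e * ell2_norm x"
          by (rule order_trans[OF diff[OF \<open>x \<in> H\<close>] mult_right_mono[OF less_imp_le ell2_norm_nonneg]])
            (use N m \<open>n \<ge> N\<close> in blast)
        ultimately show ?thesis by linarith
      qed
      then show "\<exists>N. \<forall>m\<ge>N. ell2_norm (T n x - L x) \<le> e * ell2_norm x + ell2_norm (T m x - L x)" by blast
    qed
    then show ?thesis by blast
  qed
  obtain N where N: "\<forall>n\<ge>N. \<forall>x\<in>H. ell2_norm (T n x - L x) \<le> 1 * ell2_norm x" using unif[of 1] by auto
  have L_bop: "L \<in> bounded_ops H"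
  proof (rule bopI[OF H])
    show "L (x + y) = L x + L y" if "x \<in> H" "y \<in> H" for x y
    proof (rule lim_unique)
      show "(\<lambda>n. ell2_norm (T n (x + y) - (L x + L y))) \<longlonglongrightarrow> 0"
      proof (rule real_tendsto_sandwich[where f = "\<lambda>_. 0"])
        have "ell2_norm (T n (x + y) - (L x + L y)) \<le> ell2_norm (T n x - L x) + ell2_norm (T n y - L y)" for n
          using ell2_norm_triangle[OF ell2_diff[OF hs_ell2[OF H bop_apply[OF H T that(1)]] hs_ell2[OF H L_in[OF that(1)]]]
            ell2_diff[OF hs_ell2[OF H bop_apply[OF H T that(2)]] hs_ell2[OF H L_in[OF that(2)]]], of n n] that
          by (simp add: bop_add[OF H T] algebra_simps)
        then show "\<forall>\<^sub>F n in sequentially. ell2_norm (T n (x + y) - (L x + L y))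
          \<le> ell2_norm (T n x - L x) + ell2_norm (T n y - L y)" by simp
        show "(\<lambda>n. ell2_norm (T n x - L x) + ell2_norm (T n y - L y)) \<longlonglongrightarrow> 0"
          using tendsto_add[OF L L, of x y] that by simp
      qed auto
    qed (use that L_in L hs_add[OF H] bop_apply[OF H T] in auto)
    show "L (c *\<^sub>v x) = c *\<^sub>v L x" if "x \<in> H" for c x
    proof (rule lim_unique)
      have "(\<lambda>n. cmod c * ell2_norm (T n x - L x)) \<longlonglongrightarrow> 0"
        using tendsto_mult_left[OF L[OF that], of "cmod c"] by simp
      then show "(\<lambda>n. ell2_norm (T n (c *\<^sub>v x) - (c *\<^sub>v L x))) \<longlonglongrightarrow> 0"
        using that by (simp add: bop_scale[OF H T] ell2_norm_scale flip: vscale_diff_right)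
    qed (use that L_in L hs_scale[OF H] bop_apply[OF H T] in auto)
    show "ell2_norm (L x) \<le> (op_norm H (T N) + 1) * ell2_norm x" if "x \<in> H" for x
    proof -
      have "ell2_norm (T N x - (T N x - L x)) \<le> ell2_norm (T N x) + ell2_norm (T N x - L x)"
        by (intro ell2_norm_diff_le ell2_diff hs_ell2[OF H] L_in bop_apply[OF H T] that)
      moreover have "ell2_norm (T N x - L x) \<le> 1 * ell2_norm x" using N that by blast
      ultimately show ?thesis using op_norm_bound[OF H T that, of N] by (simp add: algebra_simps)
    qed
  qed (auto simp: L_in, simp add: L_def)
  moreover have "(\<lambda>n. op_norm H (cdiff (Bop H) (T n) L)) \<longlonglongrightarrow> 0"
  proof (rule LIMSEQ_I)
    fix e :: real assume "e > 0"
    then obtain N where N: "\<forall>n\<ge>N. \<forall>x\<in>H. ell2_norm (T n x - L x) \<le> e / 2 * ell2_norm x"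
      using unif[of "e / 2"] by auto
    have "op_norm H (cdiff (Bop H) (T n) L) \<le> e / 2" if "n \<ge> N" for n
      using N that \<open>e > 0\<close> by (intro op_norm_le[OF H]) auto
    then have "norm (op_norm H (cdiff (Bop H) (T n) L) - 0) < e" if "n \<ge> N" for n
      using that \<open>e > 0\<close> op_norm_nonneg[OF H Bop_diff_closed[OF T L_bop], of n] by force
    then show "\<exists>no. \<forall>n\<ge>no. norm (op_norm H (cdiff (Bop H) (T n) L) - 0) < e" by blast
  qed
  ultimately show thesis using that by blast
qed

end

section \<open>Absolutely convergent series of vectors\<close>

section \<open>Absolutely convergent combinations of vectors\<close>

lemma ell2_sum: "(\<And>k. k \<in> K \<Longrightarrow> u k \<in> ell2) \<Longrightarrow> (\<Sum>k\<in>K. u k) \<in> ell2"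
  by (induction K rule: infinite_finite_induct) (auto intro: ell2_add)

lemma ell2_norm_sum:
  "(\<And>k. k \<in> K \<Longrightarrow> u k \<in> ell2) \<Longrightarrow> ell2_norm (\<Sum>k\<in>K. u k) \<le> (\<Sum>k\<in>K. ell2_norm (u k))"
proof (induction K rule: infinite_finite_induct)
  case (insert k K)
  then have "ell2_norm (u k + (\<Sum>k\<in>K. u k)) \<le> ell2_norm (u k) + ell2_norm (\<Sum>k\<in>K. u k)"
    by (intro ell2_norm_triangle ell2_sum) auto
  then show ?case using insert by simp
qed auto

text \<open>The sum is taken coordinatewise because \<open>l1_algebra\<close> defines its seminorm
  that way; \<open>l1_comb_tendsto\<close> shows that it is also a limit in norm.\<close>

definition l1_comb :: "'k set \<Rightarrow> ('k \<Rightarrow> complex) \<Rightarrow> ('k \<Rightarrow> 'i vec) \<Rightarrow> 'i vec" where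
  "l1_comb K f u = (\<lambda>i. \<Sum>\<^sub>\<infinity>k\<in>K. f k * u k i)"

context
  fixes K :: "'k set" and f :: "'k \<Rightarrow> complex"
  assumes f: "f abs_summable_on K"
begin

lemma l1_comb_pointwise_summable:
  assumes "\<And>k. k \<in> K \<Longrightarrow> u k \<in> ell2" "\<And>k. k \<in> K \<Longrightarrow> ell2_norm (u k) \<le> C"
  shows "(\<lambda>k. f k * u k i) abs_summable_on K"
proof (rule abs_summable_on_comparison_test)
  show "(\<lambda>k. complex_of_real C * f k) abs_summable_on K"
    using f by (simp add: norm_mult summable_on_cmult_right)
  fix k assume "k \<in> K"
  then have "cmod (u k i) \<le> \<bar>C\<bar>"
    using ell2_coord_le[OF assms(1), of k i] assms(2)[of k] by linarith
  then show "norm (f k * u k i) \<le> norm (complex_of_real C * f k)"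
    using mult_left_mono[of "cmod (u k i)" "\<bar>C\<bar>" "cmod (f k)"] by (simp add: norm_mult mult.commute)
qed

lemma l1_comb_ell2:
  assumes u: "\<And>k. k \<in> K \<Longrightarrow> u k \<in> ell2" and C: "\<And>k. k \<in> K \<Longrightarrow> ell2_norm (u k) \<le> C" "0 \<le> C"
  shows "l1_comb K f u \<in> ell2" and "ell2_norm (l1_comb K f u) \<le> C * (\<Sum>\<^sub>\<infinity>k\<in>K. cmod (f k))"
proof -
  have coord: "((\<lambda>K0. \<Sum>k\<in>K0. f k * u k i) \<longlongrightarrow> l1_comb K f u i) (finite_subsets_at_top K)" for i
    unfolding l1_comb_def
    using infsum_tendsto[OF abs_summable_summable[OF l1_comb_pointwise_summable[OF u C(1)]]] .
  have "L2_set (\<lambda>i. cmod (l1_comb K f u i)) F \<le> C * (\<Sum>\<^sub>\<infinity>k\<in>K. cmod (f k))" if "finite F" for F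
  proof (rule tendsto_upperbound)
    show "((\<lambda>K0. L2_set (\<lambda>i. cmod (\<Sum>k\<in>K0. f k * u k i)) F) \<longlongrightarrow> L2_set (\<lambda>i. cmod (l1_comb K f u i)) F)
      (finite_subsets_at_top K)"
      unfolding L2_set_def by (intro tendsto_intros coord)
    have "L2_set (\<lambda>i. cmod (\<Sum>k\<in>K0. f k * u k i)) F \<le> C * (\<Sum>\<^sub>\<infinity>k\<in>K. cmod (f k))"
      if K0: "finite K0" "K0 \<subseteq> K" for K0
    proof -
      have in2: "f k *\<^sub>v u k \<in> ell2" if "k \<in> K0" for k using u K0 that by auto
      have "L2_set (\<lambda>i. cmod (\<Sum>k\<in>K0. f k * u k i)) F = L2_set (\<lambda>i. cmod ((\<Sum>k\<in>K0. f k *\<^sub>v u k) i)) F"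
        by (simp add: vec_apply)
      also have "\<dots> \<le> ell2_norm (\<Sum>k\<in>K0. f k *\<^sub>v u k)"
        by (intro L2_set_le_ell2_norm ell2_sum in2)
      also have "\<dots> \<le> (\<Sum>k\<in>K0. ell2_norm (f k *\<^sub>v u k))"
        by (intro ell2_norm_sum in2)
      also have "\<dots> \<le> (\<Sum>k\<in>K0. C * cmod (f k))"
        using C K0 by (intro sum_mono) (auto simp: ell2_norm_scale mult.commute[of C] intro!: mult_left_mono)
      also have "\<dots> = C * (\<Sum>k\<in>K0. cmod (f k))" by (simp add: sum_distrib_left)
      also have "\<dots> \<le> C * (\<Sum>\<^sub>\<infinity>k\<in>K. cmod (f k))"
        using K0 C f by (intro mult_left_mono finite_sum_le_infsum) auto
      finally show ?thesis .
    qed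
    then show "\<forall>\<^sub>F K0 in finite_subsets_at_top K.
      L2_set (\<lambda>i. cmod (\<Sum>k\<in>K0. f k * u k i)) F \<le> C * (\<Sum>\<^sub>\<infinity>k\<in>K. cmod (f k))"
      by (intro eventually_finite_subsets_at_top_weakI) auto
  qed auto
  from ell2_normI[OF this] show "l1_comb K f u \<in> ell2"
    "ell2_norm (l1_comb K f u) \<le> C * (\<Sum>\<^sub>\<infinity>k\<in>K. cmod (f k))" by auto
qed

end

text \<open>The error after a finite set \<open>K0\<close> is the combination over
  \<open>K - K0\<close>, whose norm is at most \<open>C\<close> times the tail of the absolutely
  convergent series.\<close>

lemma l1_comb_tendsto:
  assumes f: "f abs_summable_on K"
    and u: "\<And>k. k \<in> K \<Longrightarrow> u k \<in> ell2" "\<And>k. k \<in> K \<Longrightarrow> ell2_norm (u k) \<le> C" "0 \<le> C"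
  shows "((\<lambda>K0. ell2_norm (l1_comb K f u - (\<Sum>k\<in>K0. f k *\<^sub>v u k))) \<longlongrightarrow> 0) (finite_subsets_at_top K)"
proof (rule tendsto_sandwich[where f = "\<lambda>_. 0"
      and h = "\<lambda>K0. C * ((\<Sum>\<^sub>\<infinity>k\<in>K. cmod (f k)) - (\<Sum>k\<in>K0. cmod (f k)))"])
  show "((\<lambda>K0. C * ((\<Sum>\<^sub>\<infinity>k\<in>K. cmod (f k)) - (\<Sum>k\<in>K0. cmod (f k)))) \<longlongrightarrow> 0) (finite_subsets_at_top K)"
    by (rule tendsto_eq_intros infsum_tendsto[OF f] refl)+ simp
  have "ell2_norm (l1_comb K f u - (\<Sum>k\<in>K0. f k *\<^sub>v u k))
      \<le> C * ((\<Sum>\<^sub>\<infinity>k\<in>K. cmod (f k)) - (\<Sum>k\<in>K0. cmod (f k)))"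
    if K0: "finite K0" "K0 \<subseteq> K" for K0
  proof -
    have fK: "f abs_summable_on (K - K0)"
      using f K0 by (simp add: summable_on_Diff)
    have "l1_comb K f u - (\<Sum>k\<in>K0. f k *\<^sub>v u k) = l1_comb (K - K0) f u"
    proof
      fix i
      have "(\<lambda>k. f k * u k i) summable_on K"
        by (rule abs_summable_summable[OF l1_comb_pointwise_summable[OF f, of u C]]) (use u in auto)
      then show "(l1_comb K f u - (\<Sum>k\<in>K0. f k *\<^sub>v u k)) i = l1_comb (K - K0) f u i"
        using K0 by (simp add: l1_comb_def vec_apply infsum_Diff)
    qed
    moreover have "ell2_norm (l1_comb (K - K0) f u) \<le> C * (\<Sum>\<^sub>\<infinity>k\<in>K-K0. cmod (f k))"
      by (rule l1_comb_ell2[OF fK]) (use u in auto)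
    ultimately show ?thesis using K0 f by (simp add: infsum_Diff)
  qed
  then show "\<forall>\<^sub>F K0 in finite_subsets_at_top K. ell2_norm (l1_comb K f u - (\<Sum>k\<in>K0. f k *\<^sub>v u k))
      \<le> C * ((\<Sum>\<^sub>\<infinity>k\<in>K. cmod (f k)) - (\<Sum>k\<in>K0. cmod (f k)))"
    by (intro eventually_finite_subsets_at_top_weakI)
qed auto

context
  fixes H :: "'i vec set" and K :: "'k set" and f :: "'k \<Rightarrow> complex" and u :: "'k \<Rightarrow> 'i vec" and C
  assumes H: "hilbert_space H" and f: "f abs_summable_on K"
    and u: "\<And>k. k \<in> K \<Longrightarrow> u k \<in> H" "\<And>k. k \<in> K \<Longrightarrow> ell2_norm (u k) \<le> C" "0 \<le> C"
begin

lemma l1_comb_conv: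
  "((\<lambda>K0. ell2_norm (l1_comb K f u - (\<Sum>k\<in>K0. f k *\<^sub>v u k))) \<longlongrightarrow> 0) (finite_subsets_at_top K)"
  by (rule l1_comb_tendsto[OF f, of u C]) (use u hs_ell2[OF H] in auto)

lemma hs_l1_comb: "l1_comb K f u \<in> H"
proof -
  \<comment> \<open>Closedness of \<open>H\<close> is sequential, so a sequence is extracted from
    the net of finite subsets, with tolerance \<open>1 / Suc n\<close> at stage
    \<open>n\<close>.\<close>
  have "\<exists>x\<in>H. ell2_norm (x - l1_comb K f u) < 1 / real (Suc n)" for n
  proof -
    have "\<forall>\<^sub>F K0 in finite_subsets_at_top K.
        ell2_norm (l1_comb K f u - (\<Sum>k\<in>K0. f k *\<^sub>v u k)) < 1 / real (Suc n)"
      by (rule order_tendstoD[OF l1_comb_conv]) simp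
    then obtain K0 where "finite K0" "K0 \<subseteq> K"
      "ell2_norm (l1_comb K f u - (\<Sum>k\<in>K0. f k *\<^sub>v u k)) < 1 / real (Suc n)"
      unfolding eventually_finite_subsets_at_top by blast
    then show ?thesis using u by (intro bexI[of _ "\<Sum>k\<in>K0. f k *\<^sub>v u k"] hs_sum[OF H] hs_scale[OF H])
      (auto simp: ell2_norm_minus_commute[of _ "l1_comb K f u"])
  qed
  then obtain X where X: "\<And>n. X n \<in> H" "\<And>n. ell2_norm (X n - l1_comb K f u) < 1 / real (Suc n)"
    by metis
  have "(\<lambda>n. ell2_norm (X n - l1_comb K f u)) \<longlonglongrightarrow> 0"
    by (rule real_tendsto_sandwich[OF _ _ tendsto_const LIMSEQ_Suc[OF lim_1_over_n]])
      (auto intro!: always_eventually less_imp_le X(2) simp del: of_nat_Suc)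
  moreover have "l1_comb K f u \<in> ell2"
    by (rule l1_comb_ell2[OF f, of u C]) (use u hs_ell2[OF H] in auto)
  ultimately show ?thesis by (intro hs_closed[OF H X(1)])
qed

text \<open>Stated for an arbitrary bounded linear functional, so that it covers inner products and,
  through the functionals \<open>x \<mapsto> T x i\<close>, bounded operators.\<close>

lemma l1_comb_functional:
  assumes add: "\<And>x y. x \<in> H \<Longrightarrow> y \<in> H \<Longrightarrow> \<phi> (x + y) = \<phi> x + \<phi> y"
    and scale: "\<And>c x. x \<in> H \<Longrightarrow> \<phi> (c *\<^sub>v x) = c * \<phi> x"
    and bound: "\<And>x. x \<in> H \<Longrightarrow> cmod (\<phi> x) \<le> M * ell2_norm x"
  shows "\<phi> (l1_comb K f u) = (\<Sum>\<^sub>\<infinity>k\<in>K. f k * \<phi> (u k))"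
proof -
  let ?v = "l1_comb K f u"
  have zero: "\<phi> 0 = 0" using scale[of 0 0] hs_zero[OF H] by simp
  have diff: "\<phi> (x - y) = \<phi> x - \<phi> y" if "x \<in> H" "y \<in> H" for x y
    using add[of x "(-1) *\<^sub>v y"] scale[of y "-1"] that hs_minus[OF H] by simp
  have sum: "\<phi> (\<Sum>k\<in>K0. f k *\<^sub>v u k) = (\<Sum>k\<in>K0. f k * \<phi> (u k))" if "finite K0" "K0 \<subseteq> K" for K0
    using that by (induction K0 rule: finite_induct)
      (auto simp: zero add scale u hs_scale[OF H] hs_sum[OF H] subset_iff)
  have "((\<lambda>K0. (\<Sum>k\<in>K0. f k * \<phi> (u k)) - \<phi> ?v) \<longlongrightarrow> 0) (finite_subsets_at_top K)"
  proof (rule tendsto_0_le[OF l1_comb_conv])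
    have "norm ((\<Sum>k\<in>K0. f k * \<phi> (u k)) - \<phi> ?v)
        \<le> norm (ell2_norm (?v - (\<Sum>k\<in>K0. f k *\<^sub>v u k))) * M" if K0: "finite K0" "K0 \<subseteq> K" for K0
    proof -
      have in_H: "(\<Sum>k\<in>K0. f k *\<^sub>v u k) \<in> H" using u K0 by (intro hs_sum[OF H] hs_scale[OF H]) auto
      then show ?thesis
        using bound[OF hs_diff[OF H hs_l1_comb in_H]]
        by (simp add: diff hs_l1_comb sum[OF K0] norm_minus_commute mult.commute)
    qed
    then show "\<forall>\<^sub>F K0 in finite_subsets_at_top K. norm ((\<Sum>k\<in>K0. f k * \<phi> (u k)) - \<phi> ?v)
        \<le> norm (ell2_norm (?v - (\<Sum>k\<in>K0. f k *\<^sub>v u k))) * M"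
      by (intro eventually_finite_subsets_at_top_weakI)
  qed
  then have "((\<lambda>K0. (\<Sum>k\<in>K0. f k * \<phi> (u k))) \<longlongrightarrow> \<phi> ?v) (finite_subsets_at_top K)"
    by (rule LIM_zero_cancel)
  then show ?thesis by (metis has_sum_def infsumI)
qed

lemma l1_comb_inner:
  assumes y: "y \<in> H"
  shows "ell2_inner y (l1_comb K f u) = (\<Sum>\<^sub>\<infinity>k\<in>K. f k * ell2_inner y (u k))"
  by (rule l1_comb_functional[where M = "ell2_norm y"])
    (use y hs_ell2[OF H] ell2_Cauchy_Schwarz in \<open>auto simp: ell2_inner_add_right ell2_inner_scale_right\<close>)

lemma bop_l1_comb:
  assumes T: "T \<in> bounded_ops H"
  shows "T (l1_comb K f u) = l1_comb K f (\<lambda>k. T (u k))"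
proof
  fix i
  have "cmod (T x i) \<le> op_norm H T * ell2_norm x" if "x \<in> H" for x
    using ell2_coord_le[OF hs_ell2[OF H bop_apply[OF H T that]]] op_norm_bound[OF H T that] order_trans by blast
  then show "T (l1_comb K f u) i = l1_comb K f (\<lambda>k. T (u k)) i"
    unfolding l1_comb_def[of _ _ "\<lambda>k. T (u k)"]
    by (intro l1_comb_functional[where \<phi> = "\<lambda>x. T x i"]) (auto simp: bop_add[OF H T] bop_scale[OF H T] vec_apply)
qed

end

section \<open>Seminorms defined as suprema over representations\<close>

section \<open>Algebras normed by a family of representations\<close>

text \<open>Besides closure, nothing is assumed about the algebraic operations: identities are
  checked in each representation and transferred by \<open>norm_cong\<close>.
  \<open>rep_zero\<close> is listed because, without the law \<open>0 + 0 = 0\<close> in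
  \<open>A\<close>, it does not follow from additivity. The same locale describes the
  \<open>l1\<close> algebra, the free algebra, the covariance algebra, \<open>Bop H\<close> and all
  completions.\<close>

locale normed_by_reps =
  fixes A :: "'a star_algebra" and J :: "'j set" and Hs :: "'j \<Rightarrow> 'i vec set"
    and \<rho> :: "'j \<Rightarrow> 'a \<Rightarrow> 'i operator"
  assumes zero_closed: "czero A \<in> carrier A"
    and add_closed: "x \<in> carrier A \<Longrightarrow> y \<in> carrier A \<Longrightarrow> cadd A x y \<in> carrier A"
    and scale_closed: "x \<in> carrier A \<Longrightarrow> cscale A c x \<in> carrier A"
    and mult_closed: "x \<in> carrier A \<Longrightarrow> y \<in> carrier A \<Longrightarrow> cmult A x y \<in> carrier A"
    and star_closed: "x \<in> carrier A \<Longrightarrow> cstar A x \<in> carrier A"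
    and J_nonempty: "J \<noteq> {}"
    and hs: "j \<in> J \<Longrightarrow> hilbert_space (Hs j)"
    and hom: "j \<in> J \<Longrightarrow> \<rho> j \<in> star_hom A (Bop (Hs j))"
    and rep_zero: "j \<in> J \<Longrightarrow> \<rho> j (czero A) = zero_op (Hs j)"
    and bdd: "x \<in> carrier A \<Longrightarrow> bdd_above ((\<lambda>j. op_norm (Hs j) (\<rho> j x)) ` J)"
    and norm_eq: "x \<in> carrier A \<Longrightarrow> cnorm A x = Sup ((\<lambda>j. op_norm (Hs j) (\<rho> j x)) ` J)"
begin

lemma diff_closed: "x \<in> carrier A \<Longrightarrow> y \<in> carrier A \<Longrightarrow> cdiff A x y \<in> carrier A"
  by (simp add: cdiff_def add_closed scale_closed)

lemmas closed = zero_closed add_closed scale_closed mult_closed star_closed diff_closed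

lemma rep_bop: "j \<in> J \<Longrightarrow> x \<in> carrier A \<Longrightarrow> \<rho> j x \<in> bounded_ops (Hs j)"
  and rep_add: "j \<in> J \<Longrightarrow> x \<in> carrier A \<Longrightarrow> y \<in> carrier A \<Longrightarrow>
    \<rho> j (cadd A x y) = cadd (Bop (Hs j)) (\<rho> j x) (\<rho> j y)"
  and rep_scale: "j \<in> J \<Longrightarrow> x \<in> carrier A \<Longrightarrow> \<rho> j (cscale A c x) = cscale (Bop (Hs j)) c (\<rho> j x)"
  and rep_mult: "j \<in> J \<Longrightarrow> x \<in> carrier A \<Longrightarrow> y \<in> carrier A \<Longrightarrow>
    \<rho> j (cmult A x y) = compose (Hs j) (\<rho> j x) (\<rho> j y)"
  and rep_star: "j \<in> J \<Longrightarrow> x \<in> carrier A \<Longrightarrow> \<rho> j (cstar A x) = adjoint (Hs j) (\<rho> j x)"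
  using hom[of j] unfolding star_hom_def by auto

lemma rep_diff: "j \<in> J \<Longrightarrow> x \<in> carrier A \<Longrightarrow> y \<in> carrier A \<Longrightarrow>
    \<rho> j (cdiff A x y) = cdiff (Bop (Hs j)) (\<rho> j x) (\<rho> j y)"
  by (simp add: cdiff_def rep_add rep_scale scale_closed)

lemmas rep_simps = rep_zero rep_add rep_scale rep_mult rep_star rep_diff

lemma rep_norm_le: "j \<in> J \<Longrightarrow> x \<in> carrier A \<Longrightarrow> op_norm (Hs j) (\<rho> j x) \<le> cnorm A x"
  using bdd[of x] by (auto simp: norm_eq intro!: cSUP_upper)

lemma norm_leI:
  assumes "x \<in> carrier A" "\<And>j. j \<in> J \<Longrightarrow> op_norm (Hs j) (\<rho> j x) \<le> c"
  shows "cnorm A x \<le> c"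
  using assms J_nonempty by (auto simp: norm_eq intro: cSUP_least)

lemma norm_nonneg: "x \<in> carrier A \<Longrightarrow> 0 \<le> cnorm A x"
  using J_nonempty rep_norm_le op_norm_nonneg[OF hs rep_bop] by (meson ex_in_conv order_trans)

lemma norm_cong:
  assumes "x \<in> carrier A" "y \<in> carrier A" "\<And>j. j \<in> J \<Longrightarrow> \<rho> j x = \<rho> j y"
  shows "cnorm A x = cnorm A y"
  using assms rep_norm_le[of _ x] rep_norm_le[of _ y] by (intro order_antisym norm_leI) auto

lemma norm_zero: "cnorm A (czero A) = 0"
  using norm_nonneg[OF zero_closed]
  by (intro order_antisym norm_leI zero_closed) (auto simp: rep_zero op_norm_zero[OF hs])

lemma norm_add: "x \<in> carrier A \<Longrightarrow> y \<in> carrier A \<Longrightarrow> cnorm A (cadd A x y) \<le> cnorm A x + cnorm A y"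
  by (intro norm_leI add_closed)
    (auto simp: rep_add intro!: order_trans[OF op_norm_triangle[OF hs]] rep_bop add_mono rep_norm_le)

lemma norm_scale: "x \<in> carrier A \<Longrightarrow> cnorm A (cscale A c x) \<le> cmod c * cnorm A x"
  by (intro norm_leI scale_closed)
    (auto simp: rep_scale intro!: order_trans[OF op_norm_scale[OF hs]] rep_bop mult_left_mono rep_norm_le)

lemma norm_mult: "x \<in> carrier A \<Longrightarrow> y \<in> carrier A \<Longrightarrow> cnorm A (cmult A x y) \<le> cnorm A x * cnorm A y"
  by (intro norm_leI mult_closed)
    (auto simp: rep_mult intro!: order_trans[OF op_norm_compose[OF hs]] rep_bop mult_mono rep_norm_le
      norm_nonneg op_norm_nonneg[OF hs])

lemma norm_star: "x \<in> carrier A \<Longrightarrow> cnorm A (cstar A x) \<le> cnorm A x"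
  by (intro norm_leI star_closed)
    (auto simp: rep_star intro!: order_trans[OF op_norm_adjoint[OF hs]] rep_bop rep_norm_le)

lemma norm_diff_triangle:
  assumes "x \<in> carrier A" "y \<in> carrier A" "z \<in> carrier A"
  shows "cnorm A (cdiff A x z) \<le> cnorm A (cdiff A x y) + cnorm A (cdiff A y z)"
proof (rule norm_leI)
  fix j assume j: "j \<in> J"
  show "op_norm (Hs j) (\<rho> j (cdiff A x z)) \<le> cnorm A (cdiff A x y) + cnorm A (cdiff A y z)"
    using op_norm_diff_triangle[OF hs[OF j] rep_bop[OF j assms(1)] rep_bop[OF j assms(2)] rep_bop[OF j assms(3)]]
      rep_norm_le[OF j diff_closed[OF assms(1,2)]] rep_norm_le[OF j diff_closed[OF assms(2,3)]] assms
    by (simp add: rep_diff j)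
qed (use assms diff_closed in auto)

lemma norm_diff_commute:
  assumes "x \<in> carrier A" "y \<in> carrier A"
  shows "cnorm A (cdiff A x y) = cnorm A (cdiff A y x)"
proof -
  have "cnorm A (cdiff A x y) \<le> cnorm A (cdiff A y x)" if "x \<in> carrier A" "y \<in> carrier A" for x y
    using that rep_norm_le[OF _ diff_closed[OF that(2,1)]]
    by (intro norm_leI diff_closed) (auto simp: rep_diff op_norm_diff_commute[OF hs rep_bop rep_bop, of _ x y])
  then show ?thesis using assms by (simp add: order_antisym)
qed

lemma norm_diff_self:
  assumes "x \<in> carrier A" shows "cnorm A (cdiff A x x) = 0"
proof -
  have "cnorm A (cdiff A x x) = cnorm A (czero A)"
    using assms by (intro norm_cong closed) (auto simp: rep_simps intro!: bop_eqI[OF hs] Bop_closed[OF hs] rep_bop)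
  then show ?thesis by (simp add: norm_zero)
qed

lemma norm_abs_diff:
  assumes "x \<in> carrier A" "y \<in> carrier A"
  shows "\<bar>cnorm A x - cnorm A y\<bar> \<le> cnorm A (cdiff A x y)"
proof -
  have "cnorm A x \<le> cnorm A y + cnorm A (cdiff A x y)" if "x \<in> carrier A" "y \<in> carrier A" for x y
  proof -
    have "cnorm A x = cnorm A (cadd A y (cdiff A x y))"
      using that by (intro norm_cong closed) (auto simp: rep_simps closed intro!: bop_eqI[OF hs] Bop_closed[OF hs] rep_bop)
    then show ?thesis using norm_add[OF that(2) diff_closed[OF that]] by simp
  qed
  from this[OF assms] this[OF assms(2,1)] show ?thesis
    using norm_diff_commute[OF assms] by linarith
qed

lemma norm_diff_add:
  assumes "x \<in> carrier A" "y \<in> carrier A" "x' \<in> carrier A" "y' \<in> carrier A"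
  shows "cnorm A (cdiff A (cadd A x y) (cadd A x' y')) \<le> cnorm A (cdiff A x x') + cnorm A (cdiff A y y')"
proof -
  have "cnorm A (cdiff A (cadd A x y) (cadd A x' y')) = cnorm A (cadd A (cdiff A x x') (cdiff A y y'))"
    using assms by (intro norm_cong closed)
      (auto simp: rep_simps closed intro!: bop_eqI[OF hs] Bop_closed[OF hs] rep_bop)
  then show ?thesis using norm_add assms closed by simp
qed

lemma norm_diff_scale:
  assumes "x \<in> carrier A" "x' \<in> carrier A"
  shows "cnorm A (cdiff A (cscale A c x) (cscale A c x')) \<le> cmod c * cnorm A (cdiff A x x')"
proof -
  have "cnorm A (cdiff A (cscale A c x) (cscale A c x')) = cnorm A (cscale A c (cdiff A x x'))"
    using assms by (intro norm_cong closed)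
      (auto simp: rep_simps closed vscale_diff_right intro!: bop_eqI[OF hs] Bop_closed[OF hs] rep_bop)
  then show ?thesis using norm_scale assms closed by simp
qed

lemma norm_diff_star:
  assumes "x \<in> carrier A" "x' \<in> carrier A"
  shows "cnorm A (cdiff A (cstar A x) (cstar A x')) \<le> cnorm A (cdiff A x x')"
proof -
  have "adjoint (Hs j) (cdiff (Bop (Hs j)) (\<rho> j x) (\<rho> j x')) =
      cdiff (Bop (Hs j)) (adjoint (Hs j) (\<rho> j x)) (adjoint (Hs j) (\<rho> j x'))" if "j \<in> J" for j
    using assms that by (simp add: cdiff_def adjoint_add[OF hs] adjoint_scale[OF hs] rep_bop Bop_closed[OF hs])
  then have "cnorm A (cdiff A (cstar A x) (cstar A x')) = cnorm A (cstar A (cdiff A x x'))"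
    using assms by (intro norm_cong closed) (auto simp: rep_simps closed)
  then show ?thesis using norm_star assms closed by simp
qed

lemma norm_diff_mult:
  assumes "x \<in> carrier A" "y \<in> carrier A" "x' \<in> carrier A" "y' \<in> carrier A"
  shows "cnorm A (cdiff A (cmult A x y) (cmult A x' y'))
    \<le> cnorm A x * cnorm A (cdiff A y y') + cnorm A (cdiff A x x') * cnorm A y'"
proof -
  have "cnorm A (cdiff A (cmult A x y) (cmult A x' y')) =
      cnorm A (cadd A (cmult A x (cdiff A y y')) (cmult A (cdiff A x x') y'))"
  proof (rule norm_cong)
    fix j assume j: "j \<in> J"
    note b = rep_bop[OF j] hs[OF j]
    show "\<rho> j (cdiff A (cmult A x y) (cmult A x' y')) =
        \<rho> j (cadd A (cmult A x (cdiff A y y')) (cmult A (cdiff A x x') y'))"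
      using assms by (intro bop_eqI[OF hs[OF j]])
        (auto simp: rep_simps closed j b Bop_closed bop_apply[OF hs[OF j]] bop_diff[OF hs[OF j] rep_bop[OF j assms(1)]])
  qed (use assms closed in auto)
  also have "\<dots> \<le> cnorm A (cmult A x (cdiff A y y')) + cnorm A (cmult A (cdiff A x x') y')"
    using norm_add assms closed by simp
  also have "\<dots> \<le> cnorm A x * cnorm A (cdiff A y y') + cnorm A (cdiff A x x') * cnorm A y'"
    using assms by (intro add_mono norm_mult closed)
  finally show ?thesis .
qed

subsection \<open>Cauchy sequences and their classes\<close>

lemma cauchy_carrier: "cauchy_seq A X \<Longrightarrow> X n \<in> carrier A"
  by (simp add: cauchy_seq_def)

lemma cauchy_const: "x \<in> carrier A \<Longrightarrow> cauchy_seq A (\<lambda>_. x)"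
  by (simp add: cauchy_seq_def norm_diff_self)

lemma cauchyD: "cauchy_seq A X \<Longrightarrow> e > 0 \<Longrightarrow> \<exists>N. \<forall>m\<ge>N. \<forall>n\<ge>N. cnorm A (cdiff A (X m) (X n)) < e"
  by (simp add: cauchy_seq_def)

text \<open>One estimate for all four operations; the unary ones use it with the same sequence in
  both places.\<close>

lemma cauchy_dominated:
  assumes "\<And>n. Z n \<in> carrier A" "cauchy_seq A X" "cauchy_seq A Y" "0 < c"
    and "\<And>m n. cnorm A (cdiff A (Z m) (Z n))
      \<le> c * cnorm A (cdiff A (X m) (X n)) + c * cnorm A (cdiff A (Y m) (Y n))"
  shows "cauchy_seq A Z"
  unfolding cauchy_seq_def
proof (intro conjI allI impI assms(1))
  fix e :: real assume "e > 0"
  then have e: "e / (2 * c) > 0" using assms(4) by simp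
  obtain M where M: "\<forall>m\<ge>M. \<forall>n\<ge>M. cnorm A (cdiff A (X m) (X n)) < e / (2 * c)"
    using cauchyD[OF assms(2) e] by blast
  obtain N where N: "\<forall>m\<ge>N. \<forall>n\<ge>N. cnorm A (cdiff A (Y m) (Y n)) < e / (2 * c)"
    using cauchyD[OF assms(3) e] by blast
  have "cnorm A (cdiff A (Z m) (Z n)) < e" if "m \<ge> max M N" "n \<ge> max M N" for m n
  proof -
    have "c * cnorm A (cdiff A (X m) (X n)) < c * (e / (2 * c))"
      using M that assms(4) by (intro mult_strict_left_mono) auto
    moreover have "c * cnorm A (cdiff A (Y m) (Y n)) < c * (e / (2 * c))"
      using N that assms(4) by (intro mult_strict_left_mono) auto
    ultimately show ?thesis using assms(5)[of m n] assms(4) by simp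
  qed
  then show "\<exists>N. \<forall>m\<ge>N. \<forall>n\<ge>N. cnorm A (cdiff A (Z m) (Z n)) < e" by blast
qed

lemma cauchy_bounded:
  assumes "cauchy_seq A X"
  obtains M where "0 < M" "\<And>n. cnorm A (X n) \<le> M"
proof -
  obtain N where N: "\<forall>m\<ge>N. \<forall>n\<ge>N. cnorm A (cdiff A (X m) (X n)) < 1" using cauchyD[OF assms, of 1] by auto
  define M where "M = Max ((\<lambda>n. cnorm A (X n)) ` {..N}) + 1"
  have M: "cnorm A (X n) \<le> M - 1" if "n \<le> N" for n
    unfolding M_def using that by (auto intro!: Max_ge)
  have "cnorm A (X n) \<le> M" for n
  proof (cases "n \<le> N")
    case False
    then have "cnorm A (cdiff A (X n) (X N)) < 1" using N by simp
    then show ?thesis using M[of N] norm_abs_diff[OF cauchy_carrier[OF assms] cauchy_carrier[OF assms], of n N] by simp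
  qed (use M in fastforce)
  moreover have "0 < M" using M[of 0] norm_nonneg[OF cauchy_carrier[OF assms, of 0]] by simp
  ultimately show thesis using that by blast
qed

lemma cauchy_add:
  assumes X: "cauchy_seq A X" and Y: "cauchy_seq A Y"
  shows "cauchy_seq A (\<lambda>n. cadd A (X n) (Y n))"
  by (rule cauchy_dominated[OF _ X Y, of _ 1])
    (simp_all add: closed cauchy_carrier[OF X] cauchy_carrier[OF Y] norm_diff_add)

lemma cauchy_scale: "cauchy_seq A X \<Longrightarrow> cauchy_seq A (\<lambda>n. cscale A c (X n))"
\<comment> \<open>The factor has to be positive, hence \<open>cmod c + 1\<close> to allow
  \<open>c = 0\<close>.\<close>
proof (rule cauchy_dominated[of _ X X "cmod c + 1"])
  assume X: "cauchy_seq A X"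
  fix m n
  have 0: "0 \<le> cnorm A (cdiff A (X m) (X n))" by (simp add: norm_nonneg closed cauchy_carrier[OF X])
  have "cnorm A (cdiff A (cscale A c (X m)) (cscale A c (X n))) \<le> cmod c * cnorm A (cdiff A (X m) (X n))"
    by (intro norm_diff_scale cauchy_carrier[OF X])
  also have "\<dots> \<le> (cmod c + 1) * cnorm A (cdiff A (X m) (X n))" using 0 by (intro mult_right_mono) auto
  also have "\<dots> \<le> (cmod c + 1) * cnorm A (cdiff A (X m) (X n)) + (cmod c + 1) * cnorm A (cdiff A (X m) (X n))"
    using 0 by simp
  finally show "cnorm A (cdiff A (cscale A c (X m)) (cscale A c (X n)))
    \<le> (cmod c + 1) * cnorm A (cdiff A (X m) (X n)) + (cmod c + 1) * cnorm A (cdiff A (X m) (X n))" .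
qed (auto simp: closed cauchy_carrier add_nonneg_pos)

lemma cauchy_star: "cauchy_seq A X \<Longrightarrow> cauchy_seq A (\<lambda>n. cstar A (X n))"
proof (rule cauchy_dominated[of _ X X 1])
  assume X: "cauchy_seq A X"
  fix m n
  show "cnorm A (cdiff A (cstar A (X m)) (cstar A (X n)))
    \<le> 1 * cnorm A (cdiff A (X m) (X n)) + 1 * cnorm A (cdiff A (X m) (X n))"
    using norm_diff_star[OF cauchy_carrier[OF X] cauchy_carrier[OF X], of m n]
      norm_nonneg[OF diff_closed[OF cauchy_carrier[OF X] cauchy_carrier[OF X]], of m n] by simp
qed (auto simp: closed cauchy_carrier)

lemma cauchy_mult:
  assumes X: "cauchy_seq A X" and Y: "cauchy_seq A Y"
  shows "cauchy_seq A (\<lambda>n. cmult A (X n) (Y n))"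
proof -
  obtain M N where M: "0 < M" "\<And>n. cnorm A (X n) \<le> M" and N: "0 < N" "\<And>n. cnorm A (Y n) \<le> N"
    using cauchy_bounded[OF X] cauchy_bounded[OF Y] by metis
  show ?thesis
  proof (rule cauchy_dominated[OF _ X Y, of _ "max M N"])
    fix m n
    have 0: "0 \<le> cnorm A (cdiff A (X m) (X n))" "0 \<le> cnorm A (cdiff A (Y m) (Y n))"
      by (simp_all add: norm_nonneg closed cauchy_carrier[OF X] cauchy_carrier[OF Y])
    have "cnorm A (cdiff A (cmult A (X m) (Y m)) (cmult A (X n) (Y n)))
      \<le> cnorm A (X m) * cnorm A (cdiff A (Y m) (Y n)) + cnorm A (cdiff A (X m) (X n)) * cnorm A (Y n)"
      by (intro norm_diff_mult cauchy_carrier[OF X] cauchy_carrier[OF Y])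
    also have "\<dots> \<le> max M N * cnorm A (cdiff A (Y m) (Y n)) + cnorm A (cdiff A (X m) (X n)) * max M N"
      using M(2)[of m] N(2)[of n] 0 by (intro add_mono mult_right_mono mult_left_mono) auto
    finally show "cnorm A (cdiff A (cmult A (X m) (Y m)) (cmult A (X n) (Y n)))
      \<le> max M N * cnorm A (cdiff A (X m) (X n)) + max M N * cnorm A (cdiff A (Y m) (Y n))"
      by (simp add: mult.commute add.commute)
  qed (use M N in \<open>auto simp: closed cauchy_carrier[OF X] cauchy_carrier[OF Y]\<close>)
qed

definition asymp :: "(nat \<Rightarrow> 'a) \<Rightarrow> (nat \<Rightarrow> 'a) \<Rightarrow> bool" where
  "asymp X Y \<longleftrightarrow> (\<lambda>n. cnorm A (cdiff A (X n) (Y n))) \<longlonglongrightarrow> 0"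

lemma asymp_dominated:
  assumes "asymp X X'" "asymp Y Y'" "\<And>n. Z n \<in> carrier A" "\<And>n. Z' n \<in> carrier A"
    and "\<And>n. cnorm A (cdiff A (Z n) (Z' n))
      \<le> c * cnorm A (cdiff A (X n) (X' n)) + c * cnorm A (cdiff A (Y n) (Y' n))"
  shows "asymp Z Z'"
  unfolding asymp_def
proof (rule real_tendsto_sandwich[where f = "\<lambda>_. 0"])
  show "\<forall>\<^sub>F n in sequentially. cnorm A (cdiff A (Z n) (Z' n))
      \<le> c * cnorm A (cdiff A (X n) (X' n)) + c * cnorm A (cdiff A (Y n) (Y' n))"
    using assms(5) by simp
  show "(\<lambda>n. c * cnorm A (cdiff A (X n) (X' n)) + c * cnorm A (cdiff A (Y n) (Y' n))) \<longlonglongrightarrow> 0"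
    using assms(1,2) unfolding asymp_def by (auto intro!: tendsto_eq_intros)
qed (simp_all add: norm_nonneg closed assms(3,4))

lemma asymp_refl: "cauchy_seq A X \<Longrightarrow> asymp X X"
  by (simp add: asymp_def norm_diff_self cauchy_carrier)

lemma asymp_sym:
  "asymp X Y \<Longrightarrow> cauchy_seq A X \<Longrightarrow> cauchy_seq A Y \<Longrightarrow> asymp Y X"
  by (simp add: asymp_def norm_diff_commute[OF cauchy_carrier cauchy_carrier])

lemma asymp_trans:
  assumes "asymp X Y" "asymp Y Z" and X: "cauchy_seq A X" and Y: "cauchy_seq A Y" and Z: "cauchy_seq A Z"
  shows "asymp X Z"
  by (rule asymp_dominated[OF assms(1,2), of _ _ 1])
    (simp_all add: cauchy_carrier[OF X] cauchy_carrier[OF Y] cauchy_carrier[OF Z] norm_diff_triangle)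

lemma mem_limit_class: "Y \<in> limit_class A X \<longleftrightarrow> cauchy_seq A Y \<and> asymp X Y"
  by (simp add: limit_class_def asymp_def)

lemma limit_class_self: "cauchy_seq A X \<Longrightarrow> X \<in> limit_class A X"
  by (simp add: mem_limit_class asymp_refl)

lemma limit_class_eq_iff:
  "cauchy_seq A X \<Longrightarrow> cauchy_seq A Y \<Longrightarrow> limit_class A X = limit_class A Y \<longleftrightarrow> asymp X Y"
  using asymp_trans[of X Y] asymp_trans[of Y X] asymp_sym[of X Y] asymp_refl[of Y]
  by (auto simp: set_eq_iff mem_limit_class)

lemma asymp_add:
  assumes "asymp X X'" "asymp Y Y'" "cauchy_seq A X" "cauchy_seq A X'" "cauchy_seq A Y" "cauchy_seq A Y'"
  shows "asymp (\<lambda>n. cadd A (X n) (Y n)) (\<lambda>n. cadd A (X' n) (Y' n))"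
  by (rule asymp_dominated[OF assms(1,2), of _ _ 1])
    (simp_all add: closed cauchy_carrier[OF assms(3)] cauchy_carrier[OF assms(4)] cauchy_carrier[OF assms(5)]
      cauchy_carrier[OF assms(6)] norm_diff_add)

lemma asymp_scale:
  assumes "asymp X X'" "cauchy_seq A X" "cauchy_seq A X'"
  shows "asymp (\<lambda>n. cscale A c (X n)) (\<lambda>n. cscale A c (X' n))"
proof (rule asymp_dominated[OF assms(1,1), of _ _ "cmod c"])
  fix n
  show "cnorm A (cdiff A (cscale A c (X n)) (cscale A c (X' n)))
    \<le> cmod c * cnorm A (cdiff A (X n) (X' n)) + cmod c * cnorm A (cdiff A (X n) (X' n))"
    using norm_diff_scale[OF cauchy_carrier[OF assms(2)] cauchy_carrier[OF assms(3)], of c n n]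
      mult_nonneg_nonneg[OF norm_ge_zero[of c] norm_nonneg[OF diff_closed[OF cauchy_carrier[OF assms(2)] cauchy_carrier[OF assms(3)]], of n n]]
    by linarith
qed (simp_all add: closed cauchy_carrier[OF assms(2)] cauchy_carrier[OF assms(3)])

lemma asymp_star:
  assumes "asymp X X'" "cauchy_seq A X" "cauchy_seq A X'"
  shows "asymp (\<lambda>n. cstar A (X n)) (\<lambda>n. cstar A (X' n))"
proof (rule asymp_dominated[OF assms(1,1), of _ _ 1])
  fix n
  show "cnorm A (cdiff A (cstar A (X n)) (cstar A (X' n)))
    \<le> 1 * cnorm A (cdiff A (X n) (X' n)) + 1 * cnorm A (cdiff A (X n) (X' n))"
    using norm_diff_star[OF cauchy_carrier[OF assms(2)] cauchy_carrier[OF assms(3)], of n n]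
      norm_nonneg[OF diff_closed[OF cauchy_carrier[OF assms(2)] cauchy_carrier[OF assms(3)]], of n n]
    by linarith
qed (simp_all add: closed cauchy_carrier[OF assms(2)] cauchy_carrier[OF assms(3)])

lemma asymp_mult:
  assumes "asymp X X'" "asymp Y Y'" and X: "cauchy_seq A X" "cauchy_seq A X'" and Y: "cauchy_seq A Y" "cauchy_seq A Y'"
  shows "asymp (\<lambda>n. cmult A (X n) (Y n)) (\<lambda>n. cmult A (X' n) (Y' n))"
proof -
  obtain M N where M: "0 < M" "\<And>n. cnorm A (X n) \<le> M" and N: "0 < N" "\<And>n. cnorm A (Y' n) \<le> N"
    using cauchy_bounded[OF X(1)] cauchy_bounded[OF Y(2)] by metis
  show ?thesis
  proof (rule asymp_dominated[OF assms(1,2), of _ _ "max M N"])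
    fix n
    have 0: "0 \<le> cnorm A (cdiff A (X n) (X' n))" "0 \<le> cnorm A (cdiff A (Y n) (Y' n))"
      by (simp_all add: norm_nonneg closed cauchy_carrier[OF X(1)] cauchy_carrier[OF Y(1)]
          cauchy_carrier[OF X(2)] cauchy_carrier[OF Y(2)])
    have "cnorm A (cdiff A (cmult A (X n) (Y n)) (cmult A (X' n) (Y' n)))
      \<le> cnorm A (X n) * cnorm A (cdiff A (Y n) (Y' n)) + cnorm A (cdiff A (X n) (X' n)) * cnorm A (Y' n)"
      by (intro norm_diff_mult cauchy_carrier[OF X(1)] cauchy_carrier[OF Y(1)]
          cauchy_carrier[OF X(2)] cauchy_carrier[OF Y(2)])
    also have "\<dots> \<le> max M N * cnorm A (cdiff A (Y n) (Y' n)) + cnorm A (cdiff A (X n) (X' n)) * max M N"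
      using M(2)[of n] N(2)[of n] 0 by (intro add_mono mult_right_mono mult_left_mono) auto
    finally show "cnorm A (cdiff A (cmult A (X n) (Y n)) (cmult A (X' n) (Y' n)))
      \<le> max M N * cnorm A (cdiff A (X n) (X' n)) + max M N * cnorm A (cdiff A (Y n) (Y' n))"
      by (simp add: mult.commute add.commute)
  qed (simp_all add: closed cauchy_carrier[OF X(1)] cauchy_carrier[OF Y(1)]
      cauchy_carrier[OF X(2)] cauchy_carrier[OF Y(2)])
qed

end

context normed_by_reps
begin

subsection \<open>Convergence\<close>

definition conv :: "(nat \<Rightarrow> 'a) \<Rightarrow> 'a \<Rightarrow> bool" where
  "conv X x \<longleftrightarrow> (\<forall>n. X n \<in> carrier A) \<and> x \<in> carrier A \<and> (\<lambda>n. cnorm A (cdiff A (X n) x)) \<longlonglongrightarrow> 0"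

lemma conv_carrier: "conv X x \<Longrightarrow> X n \<in> carrier A" "conv X x \<Longrightarrow> x \<in> carrier A"
  by (auto simp: conv_def)

lemma conv_asymp: "conv X x \<Longrightarrow> asymp X (\<lambda>_. x)"
  by (simp add: conv_def asymp_def)

lemma conv_cauchy:
  assumes "conv X x" shows "cauchy_seq A X"
  unfolding cauchy_seq_def
proof (intro conjI allI impI)
  fix e :: real assume "e > 0"
  then obtain N where N: "\<forall>n\<ge>N. norm (cnorm A (cdiff A (X n) x) - 0) < e / 2"
    using LIMSEQ_D[of "\<lambda>n. cnorm A (cdiff A (X n) x)" 0 "e / 2"] assms by (auto simp: conv_def)
  have "cnorm A (cdiff A (X m) (X n)) < e" if mn: "m \<ge> N" "n \<ge> N" for m n
  proof -
    have "cnorm A (cdiff A (X m) (X n)) \<le> cnorm A (cdiff A (X m) x) + cnorm A (cdiff A x (X n))"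
      by (rule norm_diff_triangle) (simp_all add: conv_carrier[OF assms])
    also have "cnorm A (cdiff A x (X n)) = cnorm A (cdiff A (X n) x)"
      by (rule norm_diff_commute) (simp_all add: conv_carrier[OF assms])
    finally show ?thesis using N[rule_format, OF mn(1)] N[rule_format, OF mn(2)] by auto
  qed
  then show "\<exists>N. \<forall>m\<ge>N. \<forall>n\<ge>N. cnorm A (cdiff A (X m) (X n)) < e" by blast
qed (use assms conv_carrier in auto)

lemma convI:
  "asymp X (\<lambda>_. x) \<Longrightarrow> (\<And>n. X n \<in> carrier A) \<Longrightarrow> x \<in> carrier A \<Longrightarrow> conv X x"
  by (simp add: conv_def asymp_def)

lemma conv_const: "x \<in> carrier A \<Longrightarrow> conv (\<lambda>_. x) x"
  by (simp add: conv_def norm_diff_self)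

lemma conv_add:
  assumes X: "conv X x" and Y: "conv Y y"
  shows "conv (\<lambda>n. cadd A (X n) (Y n)) (cadd A x y)"
  by (rule convI, rule asymp_add)
    (simp_all add: conv_asymp[OF X] conv_asymp[OF Y] conv_cauchy[OF X] conv_cauchy[OF Y] cauchy_const
      conv_carrier[OF X] conv_carrier[OF Y] closed)

lemma conv_mult:
  assumes X: "conv X x" and Y: "conv Y y"
  shows "conv (\<lambda>n. cmult A (X n) (Y n)) (cmult A x y)"
  by (rule convI, rule asymp_mult)
    (simp_all add: conv_asymp[OF X] conv_asymp[OF Y] conv_cauchy[OF X] conv_cauchy[OF Y] cauchy_const
      conv_carrier[OF X] conv_carrier[OF Y] closed)

lemma conv_scale:
  assumes X: "conv X x"
  shows "conv (\<lambda>n. cscale A c (X n)) (cscale A c x)"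
  by (rule convI, rule asymp_scale)
    (simp_all add: conv_asymp[OF X] conv_cauchy[OF X] cauchy_const conv_carrier[OF X] closed)

lemma conv_star:
  assumes X: "conv X x"
  shows "conv (\<lambda>n. cstar A (X n)) (cstar A x)"
  by (rule convI, rule asymp_star)
    (simp_all add: conv_asymp[OF X] conv_cauchy[OF X] cauchy_const conv_carrier[OF X] closed)

lemma conv_norm:
  assumes X: "conv X x"
  shows "(\<lambda>n. cnorm A (X n)) \<longlonglongrightarrow> cnorm A x"
proof (rule LIM_zero_cancel, rule tendsto_0_le[of "\<lambda>n. cnorm A (cdiff A (X n) x)" _ _ 1])
  show "(\<lambda>n. cnorm A (cdiff A (X n) x)) \<longlonglongrightarrow> 0" using X by (simp add: conv_def)
  show "\<forall>\<^sub>F n in sequentially. norm (cnorm A (X n) - cnorm A x) \<le> norm (cnorm A (cdiff A (X n) x)) * 1"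
    using norm_abs_diff[OF conv_carrier(1)[OF X] conv_carrier(2)[OF X]]
    by (simp add: norm_nonneg closed conv_carrier[OF X])
qed

lemma conv_unique:
  assumes X: "conv X x" and Y: "conv X y"
  shows "cnorm A (cdiff A x y) = 0"
proof -
  have "asymp (\<lambda>_. x) (\<lambda>_. y)"
    using asymp_trans[OF asymp_sym[OF conv_asymp[OF X]] conv_asymp[OF Y]]
    by (simp add: conv_cauchy[OF X] cauchy_const conv_carrier[OF X] conv_carrier[OF Y])
  then show ?thesis by (simp add: asymp_def LIMSEQ_const_iff)
qed

end

text \<open>With its identity representation, \<open>Bop H\<close> is itself an instance, so
  continuity of the operations in operator norm needs no separate proof.\<close>

lemma normed_by_reps_Bop:
  assumes H: "hilbert_space H"
  shows "normed_by_reps (Bop H) {()} (\<lambda>_. H) (\<lambda>_ T. T)"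
  by standard (auto simp: H Bop_closed[OF H] star_hom_def)

definition op_conv :: "'i vec set \<Rightarrow> (nat \<Rightarrow> 'i operator) \<Rightarrow> 'i operator \<Rightarrow> bool" where
  "op_conv H = normed_by_reps.conv (Bop H)"

context
  fixes H :: "'i vec set"
  assumes H: "hilbert_space H"
begin

interpretation B: normed_by_reps "Bop H" "{()}" "\<lambda>_. H" "\<lambda>_ T. T"
  by (rule normed_by_reps_Bop[OF H])

lemma op_conv_iff: "op_conv H X x \<longleftrightarrow>
    (\<forall>n. X n \<in> bounded_ops H) \<and> x \<in> bounded_ops H \<and> (\<lambda>n. op_norm H (cdiff (Bop H) (X n) x)) \<longlonglongrightarrow> 0"
  by (simp add: op_conv_def B.conv_def)

lemma op_conv_add: "op_conv H X x \<Longrightarrow> op_conv H Y y \<Longrightarrow> op_conv H (\<lambda>n. cadd (Bop H) (X n) (Y n)) (cadd (Bop H) x y)"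
  and op_conv_scale: "op_conv H X x \<Longrightarrow> op_conv H (\<lambda>n. cscale (Bop H) c (X n)) (cscale (Bop H) c x)"
  and op_conv_mult: "op_conv H X x \<Longrightarrow> op_conv H Y y \<Longrightarrow> op_conv H (\<lambda>n. compose H (X n) (Y n)) (compose H x y)"
  and op_conv_star: "op_conv H X x \<Longrightarrow> op_conv H (\<lambda>n. adjoint H (X n)) (adjoint H x)"
  and op_conv_const: "x \<in> bounded_ops H \<Longrightarrow> op_conv H (\<lambda>_. x) x"
  and op_conv_norm: "op_conv H X x \<Longrightarrow> (\<lambda>n. op_norm H (X n)) \<longlonglongrightarrow> op_norm H x"
  using B.conv_add B.conv_scale B.conv_mult B.conv_star B.conv_const B.conv_norm
  by (simp_all add: op_conv_def)

lemma op_conv_unique: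
  assumes "op_conv H X x" "op_conv H X y" shows "x = y"
proof (rule bop_eqI[OF H])
  fix v assume v: "v \<in> H"
  have xy: "x \<in> bounded_ops H" "y \<in> bounded_ops H" using assms by (auto simp: op_conv_iff)
  have "op_norm H (cdiff (Bop H) x y) = 0"
    using B.conv_unique assms by (simp add: op_conv_def)
  then have "cdiff (Bop H) x y = zero_op H" by (intro op_norm_eq_0[OF H] Bop_closed[OF H] xy)
  then have "cdiff (Bop H) x y v = zero_op H v" by simp
  then show "x v = y v" using v by simp
qed (use assms in \<open>auto simp: op_conv_iff\<close>)

end

context normed_by_reps
begin

lemma conv_rep:
  assumes j: "j \<in> J" and X: "conv X x"
  shows "op_conv (Hs j) (\<lambda>n. \<rho> j (X n)) (\<rho> j x)"
proof -
  note c = conv_carrier[OF X]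
  have "(\<lambda>n. op_norm (Hs j) (cdiff (Bop (Hs j)) (\<rho> j (X n)) (\<rho> j x))) \<longlonglongrightarrow> 0"
  proof (rule real_tendsto_sandwich[where f = "\<lambda>_. 0"])
    show "(\<lambda>n. cnorm A (cdiff A (X n) x)) \<longlonglongrightarrow> 0" using X by (simp add: conv_def)
    show "\<forall>\<^sub>F n in sequentially. op_norm (Hs j) (cdiff (Bop (Hs j)) (\<rho> j (X n)) (\<rho> j x)) \<le> cnorm A (cdiff A (X n) x)"
      using rep_norm_le[OF j diff_closed[OF c(1) c(2)]] by (simp add: rep_diff j c)
  qed (auto simp: op_norm_nonneg[OF hs] Bop_closed[OF hs] rep_bop c j)
  then show ?thesis by (simp add: op_conv_iff[OF hs] rep_bop c j)
qed

section \<open>The Hausdorff completion is again normed by representations\<close>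

section \<open>The completion\<close>

text \<open>Extension of the representation by continuity. The quantifier over all members of the
  class leaves independence of the representative to be proved once, in
  \<open>compl_rep_conv\<close>.\<close>

definition compl_rep :: "'j \<Rightarrow> (nat \<Rightarrow> 'a) set \<Rightarrow> 'i operator" where
  "compl_rep j U = (THE L. \<forall>X\<in>U. op_conv (Hs j) (\<lambda>n. \<rho> j (X n)) L)"

lemma compl_carrier: "carrier (completion A) = {limit_class A X |X. cauchy_seq A X}"
  and compl_zero: "czero (completion A) = limit_class A (\<lambda>_. czero A)"
  by (simp_all add: completion_def)

lemma compl_carrierI: "cauchy_seq A X \<Longrightarrow> limit_class A X \<in> carrier (completion A)"
  by (auto simp: compl_carrier)

lemma compl_carrierE:
  assumes "U \<in> carrier (completion A)"
  obtains X where "cauchy_seq A X" "U = limit_class A X"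
  using assms by (auto simp: compl_carrier)

text \<open>The operations of \<open>completion\<close> are unions over all representatives. A union
  of classes that all coincide is that class, so congruence of the operation is all that has to be
  shown.\<close>

lemma Union_classes1:
  assumes "cauchy_seq A X"
    and "\<And>X. cauchy_seq A X \<Longrightarrow> cauchy_seq A (F X)"
    and "\<And>X'. asymp X X' \<Longrightarrow> cauchy_seq A X' \<Longrightarrow> asymp (F X) (F X')"
  shows "(\<Union>X'\<in>limit_class A X. limit_class A (F X')) = limit_class A (F X)"
proof -
  have "limit_class A (F X') = limit_class A (F X)" if "X' \<in> limit_class A X" for X'
    using assms that by (metis limit_class_eq_iff mem_limit_class)
  moreover have "limit_class A X \<noteq> {}" using limit_class_self[OF assms(1)] by blast
  ultimately show ?thesis by (intro SUP_eq_const)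
qed

lemma Union_classes2:
  assumes "cauchy_seq A X" "cauchy_seq A Y"
    and "\<And>X Y. cauchy_seq A X \<Longrightarrow> cauchy_seq A Y \<Longrightarrow> cauchy_seq A (F X Y)"
    and "\<And>X' Y'. asymp X X' \<Longrightarrow> asymp Y Y' \<Longrightarrow> cauchy_seq A X' \<Longrightarrow> cauchy_seq A Y' \<Longrightarrow> asymp (F X Y) (F X' Y')"
  shows "(\<Union>X'\<in>limit_class A X. \<Union>Y'\<in>limit_class A Y. limit_class A (F X' Y')) = limit_class A (F X Y)"
proof -
  have "limit_class A (F X' Y') = limit_class A (F X Y)" if "X' \<in> limit_class A X" "Y' \<in> limit_class A Y" for X' Y'
    using assms that by (metis limit_class_eq_iff mem_limit_class)
  moreover have "limit_class A X \<noteq> {}" "limit_class A Y \<noteq> {}"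
    using limit_class_self[OF assms(1)] limit_class_self[OF assms(2)] by blast+
  ultimately show ?thesis by (intro SUP_eq_const)
qed

lemma compl_add:
  assumes "cauchy_seq A X" "cauchy_seq A Y"
  shows "cadd (completion A) (limit_class A X) (limit_class A Y) = limit_class A (\<lambda>n. cadd A (X n) (Y n))"
  using Union_classes2[OF assms, of "\<lambda>X Y n. cadd A (X n) (Y n)"] assms
  by (simp add: completion_def cauchy_add asymp_add)

lemma compl_mult:
  assumes "cauchy_seq A X" "cauchy_seq A Y"
  shows "cmult (completion A) (limit_class A X) (limit_class A Y) = limit_class A (\<lambda>n. cmult A (X n) (Y n))"
  using Union_classes2[OF assms, of "\<lambda>X Y n. cmult A (X n) (Y n)"] assms
  by (simp add: completion_def cauchy_mult asymp_mult)

lemma compl_scale: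
  assumes "cauchy_seq A X"
  shows "cscale (completion A) c (limit_class A X) = limit_class A (\<lambda>n. cscale A c (X n))"
  using Union_classes1[OF assms, of "\<lambda>X n. cscale A c (X n)"] assms
  by (simp add: completion_def cauchy_scale asymp_scale)

lemma compl_star:
  assumes "cauchy_seq A X"
  shows "cstar (completion A) (limit_class A X) = limit_class A (\<lambda>n. cstar A (X n))"
  using Union_classes1[OF assms, of "\<lambda>X n. cstar A (X n)"] assms
  by (simp add: completion_def cauchy_star asymp_star)

lemma compl_diff:
  assumes "cauchy_seq A X" "cauchy_seq A Y"
  shows "cdiff (completion A) (limit_class A X) (limit_class A Y) = limit_class A (\<lambda>n. cdiff A (X n) (Y n))"
  using assms by (simp add: cdiff_def compl_scale compl_add cauchy_scale)

lemma cauchy_diff: "cauchy_seq A X \<Longrightarrow> cauchy_seq A Y \<Longrightarrow> cauchy_seq A (\<lambda>n. cdiff A (X n) (Y n))"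
  by (simp add: cdiff_def cauchy_add cauchy_scale)

lemma compl_norm:
  assumes X: "cauchy_seq A X"
  shows "(\<lambda>n. cnorm A (X n)) \<longlonglongrightarrow> cnorm (completion A) (limit_class A X)"
proof -
  have "Cauchy (\<lambda>n. cnorm A (X n))"
  proof (rule CauchyI)
    fix e :: real assume "e > 0"
    then obtain N where N: "\<forall>m\<ge>N. \<forall>n\<ge>N. cnorm A (cdiff A (X m) (X n)) < e" using cauchyD[OF X] by blast
    have "norm (cnorm A (X m) - cnorm A (X n)) < e" if "m \<ge> N" "n \<ge> N" for m n
      using N[rule_format, OF that] norm_abs_diff[OF cauchy_carrier[OF X] cauchy_carrier[OF X], of m n] by simp
    then show "\<exists>M. \<forall>m\<ge>M. \<forall>n\<ge>M. norm (cnorm A (X m) - cnorm A (X n)) < e" by blast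
  qed
  then obtain r where r: "(\<lambda>n. cnorm A (X n)) \<longlonglongrightarrow> r" by (auto simp: Cauchy_convergent_iff convergent_def)
  have "(\<lambda>n. cnorm A (Y n)) \<longlonglongrightarrow> r" if Y: "Y \<in> limit_class A X" for Y
  proof -
    have Yc: "cauchy_seq A Y" and a: "asymp X Y" using Y by (auto simp: mem_limit_class)
    have "(\<lambda>n. cnorm A (Y n) - cnorm A (X n)) \<longlonglongrightarrow> 0"
    proof (rule tendsto_0_le[of "\<lambda>n. cnorm A (cdiff A (X n) (Y n))" _ _ 1])
      show "\<forall>\<^sub>F n in sequentially. norm (cnorm A (Y n) - cnorm A (X n)) \<le> norm (cnorm A (cdiff A (X n) (Y n))) * 1"
        using norm_abs_diff[OF cauchy_carrier[OF X] cauchy_carrier[OF Yc]]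
        by (simp add: norm_nonneg closed cauchy_carrier[OF X] cauchy_carrier[OF Yc] abs_minus_commute)
    qed (use a in \<open>simp add: asymp_def\<close>)
    from tendsto_add[OF this r] show ?thesis by simp
  qed
  then have "\<forall>Y\<in>limit_class A X. (\<lambda>n. cnorm A (Y n)) \<longlonglongrightarrow> r" by blast
  moreover have "r' = r" if "\<forall>Y\<in>limit_class A X. (\<lambda>n. cnorm A (Y n)) \<longlonglongrightarrow> r'" for r'
    using that limit_class_self[OF X] r LIMSEQ_unique by blast
  ultimately have "(THE r. \<forall>Y\<in>limit_class A X. (\<lambda>n. cnorm A (Y n)) \<longlonglongrightarrow> r) = r"
    by (rule the_equality)
  then have "cnorm (completion A) (limit_class A X) = r"
    by (simp add: completion_def)
  then show ?thesis using r by simp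
qed

lemma compl_rep_conv:
  assumes j: "j \<in> J" and X: "cauchy_seq A X"
  shows "op_conv (Hs j) (\<lambda>n. \<rho> j (X n)) (compl_rep j (limit_class A X))"
proof -
  have "\<exists>N. \<forall>m\<ge>N. \<forall>n\<ge>N. op_norm (Hs j) (cdiff (Bop (Hs j)) (\<rho> j (X m)) (\<rho> j (X n))) < e" if "e > 0" for e
  proof -
    obtain N where N: "\<forall>m\<ge>N. \<forall>n\<ge>N. cnorm A (cdiff A (X m) (X n)) < e" using cauchyD[OF X \<open>e > 0\<close>] by blast
    have "op_norm (Hs j) (cdiff (Bop (Hs j)) (\<rho> j (X m)) (\<rho> j (X n))) < e" if "m \<ge> N" "n \<ge> N" for m n
      using N[rule_format, OF that] rep_norm_le[OF j diff_closed[OF cauchy_carrier[OF X] cauchy_carrier[OF X]], of m n]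
      by (simp add: rep_diff j cauchy_carrier[OF X])
    then show ?thesis by blast
  qed
  then obtain L where "L \<in> bounded_ops (Hs j)" "(\<lambda>n. op_norm (Hs j) (cdiff (Bop (Hs j)) (\<rho> j (X n)) L)) \<longlonglongrightarrow> 0"
    using Bop_complete[OF hs[OF j], of "\<lambda>n. \<rho> j (X n)"] rep_bop[OF j cauchy_carrier[OF X]] by blast
  then have L: "op_conv (Hs j) (\<lambda>n. \<rho> j (X n)) L"
    by (simp add: op_conv_iff[OF hs[OF j]] rep_bop[OF j cauchy_carrier[OF X]])
  \<comment> \<open>An equivalent sequence has the same limit: write \<open>Y n\<close> as
    \<open>X n\<close> minus \<open>X n - Y n\<close>, where the second term tends to zero.\<close>
  have all: "op_conv (Hs j) (\<lambda>n. \<rho> j (Y n)) L" if Y: "Y \<in> limit_class A X" for Y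
  proof -
    have Yc: "cauchy_seq A Y" and a: "asymp X Y" using Y by (auto simp: mem_limit_class)
    note c = cauchy_carrier[OF X] cauchy_carrier[OF Yc]
    have "conv (\<lambda>n. cdiff A (X n) (Y n)) (czero A)"
    proof -
      have "cnorm A (cdiff A (cdiff A (X n) (Y n)) (czero A)) = cnorm A (cdiff A (X n) (Y n))" for n
        by (rule norm_cong) (auto simp: closed c rep_simps intro!: bop_eqI[OF hs] Bop_closed[OF hs] rep_bop)
      then show ?thesis using a by (simp add: conv_def asymp_def closed c)
    qed
    from op_conv_add[OF hs[OF j] L op_conv_scale[OF hs[OF j] conv_rep[OF j this], of "-1"]]
    have "op_conv (Hs j) (\<lambda>n. cadd (Bop (Hs j)) (\<rho> j (X n)) (cscale (Bop (Hs j)) (-1) (\<rho> j (cdiff A (X n) (Y n)))))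
      (cadd (Bop (Hs j)) L (cscale (Bop (Hs j)) (-1) (\<rho> j (czero A))))" .
    moreover have "cadd (Bop (Hs j)) (\<rho> j (X n)) (cscale (Bop (Hs j)) (-1) (\<rho> j (cdiff A (X n) (Y n)))) = \<rho> j (Y n)" for n
      using j by (auto simp: closed c rep_simps intro!: bop_eqI[OF hs] Bop_closed[OF hs] rep_bop)
    moreover have "cadd (Bop (Hs j)) L (cscale (Bop (Hs j)) (-1) (\<rho> j (czero A))) = L"
      using j L by (auto simp: rep_zero op_conv_iff[OF hs[OF j]] intro!: bop_eqI[OF hs] Bop_closed[OF hs] rep_bop)
    ultimately show ?thesis by simp
  qed
  have "compl_rep j (limit_class A X) = L"
    unfolding compl_rep_def using all op_conv_unique[OF hs[OF j]] limit_class_self[OF X] by blast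
  then show ?thesis using L by simp
qed

lemma compl_rep_eqI:
  "j \<in> J \<Longrightarrow> cauchy_seq A X \<Longrightarrow> op_conv (Hs j) (\<lambda>n. \<rho> j (X n)) L \<Longrightarrow> compl_rep j (limit_class A X) = L"
  using compl_rep_conv op_conv_unique[OF hs] by blast

lemma compl_rep_to_completion:
  assumes "j \<in> J" "x \<in> carrier A"
  shows "compl_rep j (to_completion A x) = \<rho> j x"
  unfolding to_completion_def
  using assms by (intro compl_rep_eqI cauchy_const op_conv_const[OF hs] rep_bop)

text \<open>The limit over \<open>n\<close> and the supremum over \<open>j\<close> may be exchanged
  because the Cauchy estimate in the seminorm is uniform in \<open>j\<close>.\<close>

lemma compl_norm_eq:
  assumes X: "cauchy_seq A X"
  shows "bdd_above ((\<lambda>j. op_norm (Hs j) (compl_rep j (limit_class A X))) ` J)"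
    and "cnorm (completion A) (limit_class A X) = Sup ((\<lambda>j. op_norm (Hs j) (compl_rep j (limit_class A X))) ` J)"
proof -
  let ?r = "cnorm (completion A) (limit_class A X)"
  note lim = compl_norm[OF X]
  have le: "op_norm (Hs j) (compl_rep j (limit_class A X)) \<le> ?r" if j: "j \<in> J" for j
    by (rule LIMSEQ_le[OF op_conv_norm[OF hs[OF j] compl_rep_conv[OF j X]] lim])
      (auto intro!: rep_norm_le j cauchy_carrier[OF X])
  then show bdd': "bdd_above ((\<lambda>j. op_norm (Hs j) (compl_rep j (limit_class A X))) ` J)"
    by (intro bdd_aboveI[where M = ?r]) auto
  let ?S = "Sup ((\<lambda>j. op_norm (Hs j) (compl_rep j (limit_class A X))) ` J)"
  have "?r \<le> ?S + e" if "e > 0" for e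
  proof -
    obtain N where N: "\<forall>m\<ge>N. \<forall>n\<ge>N. cnorm A (cdiff A (X m) (X n)) < e" using cauchyD[OF X \<open>e > 0\<close>] by blast
    have "cnorm A (X n) \<le> ?S + e" if n: "n \<ge> N" for n
    proof (rule norm_leI[OF cauchy_carrier[OF X]])
      fix j assume j: "j \<in> J"
      have "op_norm (Hs j) (\<rho> j (X n)) \<le> op_norm (Hs j) (compl_rep j (limit_class A X)) + e"
      proof (rule LIMSEQ_le_const)
        show "(\<lambda>m. op_norm (Hs j) (\<rho> j (X m)) + e) \<longlonglongrightarrow> op_norm (Hs j) (compl_rep j (limit_class A X)) + e"
          by (intro tendsto_intros op_conv_norm[OF hs[OF j] compl_rep_conv[OF j X]])
        have "op_norm (Hs j) (\<rho> j (X n)) \<le> op_norm (Hs j) (\<rho> j (X m)) + e" if m: "m \<ge> N" for m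
          using op_norm_le_diff[OF hs[OF j] rep_bop[OF j cauchy_carrier[OF X]] rep_bop[OF j cauchy_carrier[OF X]], of n m]
            rep_norm_le[OF j diff_closed[OF cauchy_carrier[OF X] cauchy_carrier[OF X]], of n m] N[rule_format, OF n m]
          by (simp add: rep_diff j cauchy_carrier[OF X])
        then show "\<exists>M. \<forall>m\<ge>M. op_norm (Hs j) (\<rho> j (X n)) \<le> op_norm (Hs j) (\<rho> j (X m)) + e" by blast
      qed
      also have "op_norm (Hs j) (compl_rep j (limit_class A X)) \<le> ?S" using j bdd' by (auto intro: cSup_upper)
      finally show "op_norm (Hs j) (\<rho> j (X n)) \<le> ?S + e" by simp
    qed
    then show ?thesis by (intro LIMSEQ_le_const2[OF lim]) blast
  qed
  then have "?r \<le> ?S" by (rule field_le_epsilon)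
  moreover have "?S \<le> ?r" using le J_nonempty by (auto intro: cSup_least)
  ultimately show "?r = ?S" by simp
qed

text \<open>The locale is thus stable under completion: the results for seminormed algebras can be
  reused for the C*-algebras, and a C*-algebra can serve as the coefficient algebra of the next
  construction.\<close>

theorem completion_normed_by_reps: "normed_by_reps (completion A) J Hs compl_rep"
proof
  show "czero (completion A) \<in> carrier (completion A)"
    by (simp add: compl_zero compl_carrierI cauchy_const zero_closed)
  fix x c assume "x \<in> carrier (completion A)"
  then obtain X where X: "cauchy_seq A X" "x = limit_class A X" by (rule compl_carrierE)
  show "cscale (completion A) c x \<in> carrier (completion A)" "cstar (completion A) x \<in> carrier (completion A)"
    by (simp_all add: X compl_scale compl_star compl_carrierI cauchy_scale cauchy_star)
  show "bdd_above ((\<lambda>j. op_norm (Hs j) (compl_rep j x)) ` J)"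
    "cnorm (completion A) x = Sup ((\<lambda>j. op_norm (Hs j) (compl_rep j x)) ` J)"
    using compl_norm_eq[OF X(1)] X(2) by simp_all
  fix y assume "y \<in> carrier (completion A)"
  then obtain Y where Y: "cauchy_seq A Y" "y = limit_class A Y" by (rule compl_carrierE)
  show "cadd (completion A) x y \<in> carrier (completion A)" "cmult (completion A) x y \<in> carrier (completion A)"
    by (simp_all add: X Y compl_add compl_mult compl_carrierI cauchy_add cauchy_mult)
next
  fix j assume j: "j \<in> J"
  show "compl_rep j (czero (completion A)) = zero_op (Hs j)"
    using compl_rep_to_completion[OF j zero_closed] by (simp add: compl_zero to_completion_def rep_zero j)
  note H = hs[OF j]
  have b: "compl_rep j (limit_class A X) \<in> bounded_ops (Hs j)" if "cauchy_seq A X" for X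
    using compl_rep_conv[OF j that] by (simp add: op_conv_iff[OF H])
  show "compl_rep j \<in> star_hom (completion A) (Bop (Hs j))"
    unfolding star_hom_def
  proof (intro CollectI conjI ballI allI Pi_I)
    fix x c assume "x \<in> carrier (completion A)"
    then obtain X where X: "cauchy_seq A X" "x = limit_class A X" by (rule compl_carrierE)
    note cX = compl_rep_conv[OF j X(1)]
    show "compl_rep j x \<in> carrier (Bop (Hs j))" using b X by simp
    show "compl_rep j (cscale (completion A) c x) = cscale (Bop (Hs j)) c (compl_rep j x)"
      unfolding X(2) compl_scale[OF X(1)]
      using op_conv_scale[OF H cX, of c]
      by (intro compl_rep_eqI j cauchy_scale X) (simp add: rep_simps j cauchy_carrier[OF X(1)])
    show "compl_rep j (cstar (completion A) x) = cstar (Bop (Hs j)) (compl_rep j x)"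
      unfolding X(2) compl_star[OF X(1)] Bop_sel
      using op_conv_star[OF H cX]
      by (intro compl_rep_eqI j cauchy_star X) (simp add: rep_simps j cauchy_carrier[OF X(1)])
    fix y assume "y \<in> carrier (completion A)"
    then obtain Y where Y: "cauchy_seq A Y" "y = limit_class A Y" by (rule compl_carrierE)
    note cY = compl_rep_conv[OF j Y(1)]
    show "compl_rep j (cadd (completion A) x y) = cadd (Bop (Hs j)) (compl_rep j x) (compl_rep j y)"
      unfolding X(2) Y(2) compl_add[OF X(1) Y(1)]
      using op_conv_add[OF H cX cY]
      by (intro compl_rep_eqI j cauchy_add X Y) (simp add: rep_simps j cauchy_carrier[OF X(1)] cauchy_carrier[OF Y(1)])
    show "compl_rep j (cmult (completion A) x y) = cmult (Bop (Hs j)) (compl_rep j x) (compl_rep j y)"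
      unfolding X(2) Y(2) compl_mult[OF X(1) Y(1)] Bop_sel
      using op_conv_mult[OF H cX cY]
      by (intro compl_rep_eqI j cauchy_mult X Y) (simp add: rep_simps j cauchy_carrier[OF X(1)] cauchy_carrier[OF Y(1)])
  qed
qed (use J_nonempty hs in auto)

lemma to_completion_closed: "x \<in> carrier A \<Longrightarrow> to_completion A x \<in> carrier (completion A)"
  by (simp add: to_completion_def compl_carrierI cauchy_const)

text \<open>Equal values in all representations make the seminorm of the difference of
  representatives tend to zero, which is equality of classes. Most identities in completions are
  later proved this way.\<close>

lemma completion_separated:
  assumes "x \<in> carrier (completion A)" "y \<in> carrier (completion A)"
    and "\<And>j. j \<in> J \<Longrightarrow> compl_rep j x = compl_rep j y"
  shows "x = y"
proof -
  interpret C: normed_by_reps "completion A" J Hs compl_rep by (rule completion_normed_by_reps)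
  obtain X where X: "cauchy_seq A X" "x = limit_class A X" using assms(1) by (rule compl_carrierE)
  obtain Y where Y: "cauchy_seq A Y" "y = limit_class A Y" using assms(2) by (rule compl_carrierE)
  have "cnorm (completion A) (cdiff (completion A) x y) = cnorm (completion A) (cdiff (completion A) x x)"
    using assms by (intro C.norm_cong C.closed) (auto simp: C.rep_diff)
  then have "cnorm (completion A) (cdiff (completion A) x y) = 0"
    using assms by (simp add: C.norm_diff_self)
  then have "(\<lambda>n. cnorm A (cdiff A (X n) (Y n))) \<longlonglongrightarrow> 0"
    using compl_norm[OF cauchy_diff[OF X(1) Y(1)]] by (simp add: X Y compl_diff)
  then show ?thesis using X Y limit_class_eq_iff by (simp add: asymp_def)
qed

lemma completion_lim:
  assumes X: "cauchy_seq A X"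
  shows "(\<lambda>n. cnorm (completion A) (cdiff (completion A) (to_completion A (X n)) (limit_class A X))) \<longlonglongrightarrow> 0"
proof (rule LIMSEQ_I)
  fix e :: real assume "e > 0"
  then obtain N where N: "\<forall>m\<ge>N. \<forall>n\<ge>N. cnorm A (cdiff A (X m) (X n)) < e / 2"
    using cauchyD[OF X, of "e / 2"] by auto
  interpret C: normed_by_reps "completion A" J Hs compl_rep by (rule completion_normed_by_reps)
  have "norm (cnorm (completion A) (cdiff (completion A) (to_completion A (X n)) (limit_class A X)) - 0) < e" if n: "n \<ge> N" for n
  proof -
    have c: "cauchy_seq A (\<lambda>_. X n)" by (rule cauchy_const[OF cauchy_carrier[OF X]])
    have "cnorm (completion A) (cdiff (completion A) (to_completion A (X n)) (limit_class A X)) \<le> e / 2"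
      unfolding to_completion_def compl_diff[OF c X]
      by (rule LIMSEQ_le_const2[OF compl_norm[OF cauchy_diff[OF c X]]])
        (use N n in \<open>auto intro!: exI[of _ N] less_imp_le\<close>)
    moreover have "0 \<le> cnorm (completion A) (cdiff (completion A) (to_completion A (X n)) (limit_class A X))"
      by (intro C.norm_nonneg C.closed to_completion_closed cauchy_carrier[OF X] compl_carrierI X)
    ultimately show ?thesis using \<open>e > 0\<close> by simp
  qed
  then show "\<exists>no. \<forall>n\<ge>no. norm (cnorm (completion A) (cdiff (completion A) (to_completion A (X n)) (limit_class A X)) - 0) < e"
    by blast
qed

lemma to_completion_dense:
  assumes "U \<in> carrier (completion A)" "e > 0"
  shows "\<exists>x\<in>carrier A. cnorm (completion A) (cdiff (completion A) (to_completion A x) U) < e"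
proof -
  obtain X where X: "cauchy_seq A X" "U = limit_class A X" using assms(1) by (rule compl_carrierE)
  obtain n where "norm (cnorm (completion A) (cdiff (completion A) (to_completion A (X n)) U) - 0) < e"
    using LIMSEQ_D[OF completion_lim[OF X(1)] assms(2)] X by blast
  then show ?thesis using cauchy_carrier[OF X(1), of n] by (intro bexI[of _ "X n"]) (auto simp: abs_less_iff)
qed

lemma to_completion_isometric:
  assumes "x \<in> carrier A" "y \<in> carrier A"
  shows "cnorm (completion A) (cdiff (completion A) (to_completion A x) (to_completion A y)) = cnorm A (cdiff A x y)"
  using compl_norm[OF cauchy_const[OF diff_closed[OF assms]]] assms
  by (simp add: to_completion_def compl_diff cauchy_const LIMSEQ_const_iff)

text \<open>Diagonal argument: replace \<open>U n\<close> by an element \<open>d n\<close> of the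
  original algebra at distance less than \<open>1 / Suc n\<close>. The sequence \<open>d\<close> is
  Cauchy there, and its class is the limit.\<close>

lemma completion_complete:
  assumes U: "cauchy_seq (completion A) U"
  shows "\<exists>u\<in>carrier (completion A). (\<lambda>n. cnorm (completion A) (cdiff (completion A) (U n) u)) \<longlonglongrightarrow> 0"
proof -
  let ?C = "completion A"
  interpret C: normed_by_reps ?C J Hs compl_rep by (rule completion_normed_by_reps)
  note Uc = C.cauchy_carrier[OF U]
  have "\<exists>x\<in>carrier A. cnorm ?C (cdiff ?C (to_completion A x) (U n)) < 1 / real (Suc n)" for n
    by (rule to_completion_dense[OF Uc]) simp
  then obtain d where d: "\<And>n. d n \<in> carrier A"
    and dU: "\<And>n. cnorm ?C (cdiff ?C (to_completion A (d n)) (U n)) < 1 / real (Suc n)" by metis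
  note dc = to_completion_closed[OF d]
  have lim0: "(\<lambda>n. 1 / real (Suc n)) \<longlonglongrightarrow> 0" by (rule LIMSEQ_Suc[OF lim_1_over_n])
  have asy: "C.asymp (\<lambda>n. to_completion A (d n)) U"
    unfolding C.asymp_def
    by (rule real_tendsto_sandwich[OF _ _ tendsto_const lim0])
      (auto intro!: always_eventually C.norm_nonneg C.closed dc Uc order.strict_implies_order[OF dU] simp del: of_nat_Suc)
  have "cauchy_seq A d" unfolding cauchy_seq_def
  proof (intro conjI allI impI d)
    fix e :: real assume "e > 0"
    then have e3: "e / 3 > 0" by simp
    obtain N where N: "\<forall>m\<ge>N. \<forall>n\<ge>N. cnorm ?C (cdiff ?C (U m) (U n)) < e / 3" using C.cauchyD[OF U e3] by blast
    obtain M where M: "\<forall>n\<ge>M. norm (1 / real (Suc n) - 0) < e / 3" using LIMSEQ_D[OF lim0 e3] by blast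
    have "cnorm A (cdiff A (d m) (d n)) < e" if mn: "m \<ge> max M N" "n \<ge> max M N" for m n
    proof -
      have "cnorm A (cdiff A (d m) (d n)) = cnorm ?C (cdiff ?C (to_completion A (d m)) (to_completion A (d n)))"
        by (simp add: to_completion_isometric d)
      also have "\<dots> \<le> cnorm ?C (cdiff ?C (to_completion A (d m)) (U m)) + cnorm ?C (cdiff ?C (U m) (to_completion A (d n)))"
        by (rule C.norm_diff_triangle) (auto simp: dc Uc)
      also have "cnorm ?C (cdiff ?C (U m) (to_completion A (d n)))
          \<le> cnorm ?C (cdiff ?C (U m) (U n)) + cnorm ?C (cdiff ?C (U n) (to_completion A (d n)))"
        by (rule C.norm_diff_triangle) (auto simp: dc Uc)
      also have "cnorm ?C (cdiff ?C (U n) (to_completion A (d n))) = cnorm ?C (cdiff ?C (to_completion A (d n)) (U n))"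
        by (rule C.norm_diff_commute) (auto simp: dc Uc)
      finally show ?thesis
        using dU[of m] dU[of n] N[rule_format, of m n] M[rule_format, of m] M[rule_format, of n] mn by simp
    qed
    then show "\<exists>N. \<forall>m\<ge>N. \<forall>n\<ge>N. cnorm A (cdiff A (d m) (d n)) < e" by blast
  qed
  then have "C.conv (\<lambda>n. to_completion A (d n)) (limit_class A d)"
    using completion_lim by (simp add: C.conv_def dc compl_carrierI)
  from C.asymp_trans[OF C.asymp_sym[OF asy] C.conv_asymp[OF this]] C.conv_cauchy[OF this] C.conv_carrier(2)[OF this] U
  show ?thesis by (auto simp: C.asymp_def C.cauchy_const)
qed

end

section \<open>Complete algebras: automatic continuity and matching of generators\<close>

section \<open>Complete algebras normed by representations\<close>

locale rep_cstar = normed_by_reps +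
  assumes separated: "x \<in> carrier A \<Longrightarrow> y \<in> carrier A \<Longrightarrow> (\<And>j. j \<in> J \<Longrightarrow> \<rho> j x = \<rho> j y) \<Longrightarrow> x = y"
    and complete: "cauchy_seq A X \<Longrightarrow> \<exists>x\<in>carrier A. (\<lambda>n. cnorm A (cdiff A (X n) x)) \<longlonglongrightarrow> 0"

lemma (in normed_by_reps) completion_rep_cstar: "rep_cstar (completion A) J Hs compl_rep"
proof -
  interpret C: normed_by_reps "completion A" J Hs compl_rep by (rule completion_normed_by_reps)
  show ?thesis
    by standard (fact completion_separated, fact completion_complete)
qed

definition star_subalgebra :: "'a star_algebra \<Rightarrow> 'a set \<Rightarrow> bool" where
  "star_subalgebra A K \<longleftrightarrow> closed_subspace A K \<and> (\<forall>x\<in>K. \<forall>y\<in>K. cmult A x y \<in> K) \<and> (\<forall>x\<in>K. cstar A x \<in> K)"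

text \<open>Density in the form of an induction principle: a property holds on
  \<open>carrier A\<close> once it holds on \<open>G\<close> and the elements with the property form
  a closed *-subalgebra.\<close>

definition generates :: "'a star_algebra \<Rightarrow> 'a set \<Rightarrow> bool" where
  "generates A G \<longleftrightarrow> G \<subseteq> carrier A \<and> (\<forall>K. star_subalgebra A K \<longrightarrow> G \<subseteq> K \<longrightarrow> carrier A \<subseteq> K)"

definition spans :: "'a star_algebra \<Rightarrow> 'a set \<Rightarrow> bool" where
  "spans A G \<longleftrightarrow> G \<subseteq> carrier A \<and> (\<forall>K. closed_subspace A K \<longrightarrow> G \<subseteq> K \<longrightarrow> carrier A \<subseteq> K)"

lemma spans_generates: "spans A G \<Longrightarrow> generates A G"
  by (auto simp: spans_def generates_def star_subalgebra_def)

lemma closed_subspaceD: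
  assumes "closed_subspace A K"
  shows "K \<subseteq> carrier A" "czero A \<in> K" "x \<in> K \<Longrightarrow> y \<in> K \<Longrightarrow> cadd A x y \<in> K" "x \<in> K \<Longrightarrow> cscale A c x \<in> K"
  using assms unfolding closed_subspace_def by blast+

context rep_cstar
begin

lemma closed_subspaceI:
  assumes "K \<subseteq> carrier A" "czero A \<in> K" "\<And>x y. x \<in> K \<Longrightarrow> y \<in> K \<Longrightarrow> cadd A x y \<in> K"
    "\<And>c x. x \<in> K \<Longrightarrow> cscale A c x \<in> K" "\<And>X x. conv X x \<Longrightarrow> (\<And>n. X n \<in> K) \<Longrightarrow> x \<in> K"
  shows "closed_subspace A K"
  unfolding closed_subspace_def
proof (intro conjI ballI allI impI)
  fix X x assume "(\<forall>n. X n \<in> K) \<and> x \<in> carrier A \<and> (\<lambda>n. cnorm A (cdiff A (X n) x)) \<longlonglongrightarrow> 0"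
  then have "conv X x" "\<And>n. X n \<in> K" using assms(1) unfolding conv_def by blast+
  then show "x \<in> K" by (rule assms(5))
qed (use assms(1-4) in auto)

lemma conv_in_closed_subspace:
  "closed_subspace A K \<Longrightarrow> conv X x \<Longrightarrow> (\<And>n. X n \<in> K) \<Longrightarrow> x \<in> K"
  unfolding closed_subspace_def conv_def by blast

lemma cauchy_conv: "cauchy_seq A X \<Longrightarrow> \<exists>x. conv X x"
  using complete[of X] cauchy_carrier[of X] by (auto simp: conv_def)

lemma add_commute: "x \<in> carrier A \<Longrightarrow> y \<in> carrier A \<Longrightarrow> cadd A x y = cadd A y x"
  and add_assoc: "x \<in> carrier A \<Longrightarrow> y \<in> carrier A \<Longrightarrow> z \<in> carrier A \<Longrightarrow> cadd A (cadd A x y) z = cadd A x (cadd A y z)"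
  and add_zero: "x \<in> carrier A \<Longrightarrow> cadd A x (czero A) = x"
  by (auto intro!: separated closed bop_eqI[OF hs] Bop_closed[OF hs] rep_bop simp: rep_simps closed algebra_simps)

lemma norm_eq_0:
  assumes x: "x \<in> carrier A" and "cnorm A x = 0" shows "x = czero A"
proof (rule separated)
  fix j assume j: "j \<in> J"
  have "op_norm (Hs j) (\<rho> j x) = 0"
    using rep_norm_le[OF j x] op_norm_nonneg[OF hs[OF j] rep_bop[OF j x]] assms(2) by simp
  then show "\<rho> j x = \<rho> j (czero A)"
    using op_norm_eq_0[OF hs[OF j] rep_bop[OF j x]] by (simp add: rep_zero j)
qed (use x closed in auto)

text \<open>\<open>csum\<close> is a \<open>finprod\<close>; its rules become available because
  separation turns the laws of addition, which hold in each representation, into equations in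
  \<open>A\<close>.\<close>

lemma additive_comm_monoid: "comm_monoid \<lparr>carrier = carrier A, mult = cadd A, one = czero A\<rparr>"
  by (rule comm_monoidI) (auto simp: closed add_assoc add_zero add_commute[of "czero A"] intro: add_commute)

lemma csum_closed:
  assumes "\<And>k. k \<in> K \<Longrightarrow> f k \<in> carrier A"
  shows "csum A f K \<in> carrier A"
  using comm_monoid.finprod_closed[OF additive_comm_monoid, of f K] assms by (auto simp: csum_def)

lemma csum_empty: "csum A f {} = czero A"
  using comm_monoid.finprod_empty[OF additive_comm_monoid] by (simp add: csum_def)

lemma csum_insert:
  assumes "finite K" "k \<notin> K" "\<And>i. i \<in> insert k K \<Longrightarrow> f i \<in> carrier A"
  shows "csum A f (insert k K) = cadd A (f k) (csum A f K)"
  using comm_monoid.finprod_insert[OF additive_comm_monoid, of K k f] assms by (auto simp: csum_def)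

lemma csum_in_subspace:
  assumes "closed_subspace A L" "finite K"
  shows "(\<And>k. k \<in> K \<Longrightarrow> f k \<in> L) \<Longrightarrow> csum A f K \<in> L"
  using assms(2)
proof (induction K rule: finite_induct)
  case (insert k K)
  then show ?case using csum_insert[of K k f] closed_subspaceD[OF assms(1)] by (metis insertCI subsetD)
qed (simp add: csum_empty closed_subspaceD[OF assms(1)])

lemma linear_csum_apply:
  assumes H: "hilbert_space H" and \<pi>: "\<pi> \<in> star_hom A (Bop H)" and v: "v \<in> H" and "finite K"
  shows "(\<And>k. k \<in> K \<Longrightarrow> f k \<in> carrier A) \<Longrightarrow> \<pi> (csum A f K) v = (\<Sum>k\<in>K. \<pi> (f k) v)"
  using assms(4)
proof (induction K rule: finite_induct)
  case empty
  have "\<pi> (cadd A (czero A) (czero A)) v = \<pi> (czero A) v + \<pi> (czero A) v"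
    using \<pi> v zero_closed by (simp add: star_hom_def)
  then have "\<pi> (czero A) v = 0" by (simp add: add_zero zero_closed)
  then show ?case by (simp add: csum_empty)
next
  case (insert k K)
  have "\<pi> (csum A f (insert k K)) v = \<pi> (cadd A (f k) (csum A f K)) v"
    using csum_insert[of K k f] insert by simp
  also have "\<dots> = \<pi> (f k) v + \<pi> (csum A f K) v"
    using \<pi> v insert by (simp add: star_hom_def csum_closed)
  finally show ?case using insert by simp
qed

end

subsection \<open>Automatic continuity\<close>

lemma star_hom_BopD:
  assumes "\<pi> \<in> star_hom A (Bop H)"
  shows "x \<in> carrier A \<Longrightarrow> \<pi> x \<in> bounded_ops H"
    "x \<in> carrier A \<Longrightarrow> y \<in> carrier A \<Longrightarrow> \<pi> (cadd A x y) = cadd (Bop H) (\<pi> x) (\<pi> y)"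
    "x \<in> carrier A \<Longrightarrow> \<pi> (cscale A c x) = cscale (Bop H) c (\<pi> x)"
    "x \<in> carrier A \<Longrightarrow> y \<in> carrier A \<Longrightarrow> \<pi> (cmult A x y) = compose H (\<pi> x) (\<pi> y)"
    "x \<in> carrier A \<Longrightarrow> \<pi> (cstar A x) = adjoint H (\<pi> x)"
  using assms by (auto simp: star_hom_def)

context rep_cstar
begin

text \<open>The fixed point \<open>y\<close> of \<open>y \<mapsto> (h + y\<^sup>2) / 2\<close> satisfies \<open>(1 - y)\<^sup>2 = 1 - h\<close>.\<close>

lemma square_root_fixpoint:
  assumes h: "h \<in> carrier A" "cstar A h = h" and r: "cnorm A h < 1"
  shows "\<exists>y\<in>carrier A. cstar A y = y \<and> cadd A y y = cadd A h (cmult A y y)"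
proof -
  define r where "r = cnorm A h"
  have r0: "0 \<le> r" "r < 1" using r norm_nonneg[OF h(1)] by (auto simp: r_def)
  define step where "step y = cscale A (1/2) (cadd A h (cmult A y y))" for y
  define Y where "Y n = (step ^^ n) (czero A)" for n
  have Y0: "Y 0 = czero A" and YS: "Y (Suc n) = step (Y n)" for n by (simp_all add: Y_def)
  have step_closed: "step y \<in> carrier A" if "y \<in> carrier A" for y using that h by (simp add: step_def closed)
  have Yc: "Y n \<in> carrier A" for n by (induction n) (auto simp: Y0 YS closed step_closed)
  have Y_norm: "cnorm A (Y n) \<le> r" for n
  proof (induction n)
    case 0 then show ?case by (simp add: Y0 norm_zero r0)
  next
    case (Suc n)
    have "cnorm A (Y (Suc n)) \<le> 1/2 * cnorm A (cadd A h (cmult A (Y n) (Y n)))"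
      unfolding YS step_def using norm_scale[of "cadd A h (cmult A (Y n) (Y n))" "1/2"] h Yc by (simp add: closed)
    also have "\<dots> \<le> 1/2 * (r + r * r)"
    proof (rule mult_left_mono)
      have "cnorm A (cmult A (Y n) (Y n)) \<le> cnorm A (Y n) * cnorm A (Y n)" by (rule norm_mult[OF Yc Yc])
      also have "\<dots> \<le> r * r" using Suc by (intro mult_mono norm_nonneg Yc) (auto simp: r0)
      finally show "cnorm A (cadd A h (cmult A (Y n) (Y n))) \<le> r + r * r"
        using norm_add[OF h(1) mult_closed[OF Yc Yc], of n n] by (simp add: r_def)
    qed simp
    also have "\<dots> \<le> r" using mult_left_mono[of r 1 r] r0 by simp
    finally show ?case .
  qed
  \<comment> \<open>On the ball of radius \<open>r\<close>, the difference of the squares of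
    \<open>Y m\<close> and \<open>Y n\<close> telescopes into two products with a factor of norm at
    most \<open>r\<close>; after halving, the step is a contraction with factor
    \<open>r\<close>.\<close>
  have contr: "cnorm A (cdiff A (step (Y m)) (step (Y n))) \<le> r * cnorm A (cdiff A (Y m) (Y n))" for m n
  proof -
    have 0: "0 \<le> cnorm A (cdiff A (Y m) (Y n))" by (intro norm_nonneg closed Yc)
    have "cnorm A (cdiff A (step (Y m)) (step (Y n))) \<le>
        1/2 * cnorm A (cdiff A (cadd A h (cmult A (Y m) (Y m))) (cadd A h (cmult A (Y n) (Y n))))"
      unfolding step_def
      using norm_diff_scale[of "cadd A h (cmult A (Y m) (Y m))" "cadd A h (cmult A (Y n) (Y n))" "1/2"] h Yc by (simp add: closed)
    also have "\<dots> \<le> 1/2 * cnorm A (cdiff A (cmult A (Y m) (Y m)) (cmult A (Y n) (Y n)))"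
      using norm_diff_add[of h "cmult A (Y m) (Y m)" h "cmult A (Y n) (Y n)"] h Yc by (simp add: closed norm_diff_self)
    also have "\<dots> \<le> 1/2 * (cnorm A (Y m) * cnorm A (cdiff A (Y m) (Y n)) + cnorm A (cdiff A (Y m) (Y n)) * cnorm A (Y n))"
      using norm_diff_mult[OF Yc Yc Yc Yc, of m m n n] by simp
    also have "\<dots> \<le> 1/2 * (r * cnorm A (cdiff A (Y m) (Y n)) + cnorm A (cdiff A (Y m) (Y n)) * r)"
      by (intro mult_left_mono add_mono mult_right_mono Y_norm 0) auto
    finally show ?thesis by (simp add: mult.commute)
  qed
  \<comment> \<open>The contraction factor is applied \<open>n\<close> times to the distance between
    the iterate \<open>k\<close> and the starting point zero, which is at most \<open>r\<close> and
    hence at most 2.\<close>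
  have geo: "cnorm A (cdiff A (Y (n + k)) (Y n)) \<le> 2 * r ^ n" for n k
  proof (induction n)
    case 0
    have "cnorm A (cdiff A (Y k) (Y 0)) \<le> cnorm A (Y k)"
      using norm_abs_diff[OF Yc[of k] Yc[of 0]]
      by (intro order_eq_refl norm_cong closed Yc)
        (auto simp: rep_simps Y0 closed Yc intro!: bop_eqI[OF hs] Bop_closed[OF hs] rep_bop)
    then show ?case using Y_norm[of k] r0 by simp
  next
    case (Suc n)
    have "cnorm A (cdiff A (Y (Suc n + k)) (Y (Suc n))) \<le> r * cnorm A (cdiff A (Y (n + k)) (Y n))"
      using contr[of "n + k" n] by (simp add: YS)
    also have "\<dots> \<le> r * (2 * r ^ n)" by (rule mult_left_mono[OF Suc r0(1)])
    finally show ?case by simp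
  qed
  have "cauchy_seq A Y" unfolding cauchy_seq_def
  proof (intro conjI allI impI Yc)
    fix e :: real assume "e > 0"
    have "(\<lambda>n. 2 * r ^ n) \<longlonglongrightarrow> 2 * 0" using r0 by (intro tendsto_intros LIMSEQ_power_zero) auto
    then obtain N where N: "\<forall>n\<ge>N. norm (2 * r ^ n - 0) < e" using LIMSEQ_D[of "\<lambda>n. 2 * r ^ n" 0 e] \<open>e > 0\<close> by auto
    have *: "cnorm A (cdiff A (Y m) (Y n)) < e" if "n \<ge> N" "m \<ge> n" for m n
      using geo[of n "m - n"] N[rule_format, OF that(1)] that r0 by simp
    have "cnorm A (cdiff A (Y m) (Y n)) < e" if "n \<ge> N" "m \<ge> N" for m n
      using *[of n m] *[of m n] that norm_diff_commute[OF Yc Yc, of m n] by (cases "m \<ge> n") auto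
    then show "\<exists>N. \<forall>m\<ge>N. \<forall>n\<ge>N. cnorm A (cdiff A (Y m) (Y n)) < e" by blast
  qed
  then obtain y where y: "conv Y y" using cauchy_conv by blast
  note yc = conv_carrier(2)[OF y]
  have Ystar: "cstar A (Y n) = Y n" for n
  proof (induction n)
    case 0
    show ?case by (auto simp: Y0 rep_simps closed adjoint_zero[OF hs] intro!: separated closed)
  next
    case (Suc n)
    have "adjoint (Hs j) (\<rho> j (Y n)) = \<rho> j (Y n)" "adjoint (Hs j) (\<rho> j h) = \<rho> j h" if "j \<in> J" for j
      using Suc h that by (simp_all add: Yc flip: rep_star)
    then show ?case unfolding YS step_def
      by (auto simp: rep_simps closed h Yc adjoint_add[OF hs] adjoint_scale[OF hs] adjoint_compose[OF hs] rep_bop Bop_closed[OF hs]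
          intro!: separated closed)
  qed
  have "conv Y (cstar A y)" using conv_star[OF y] by (simp add: Ystar)
  from conv_unique[OF this y] have ystar: "cstar A y = y"
    using norm_eq_0[of "cdiff A (cstar A y) y"] yc
    by (metis (no_types, lifting) closed conv_rep op_conv_unique[OF hs] separated \<open>conv Y (cstar A y)\<close> y)
  have "conv (\<lambda>n. Y (Suc n)) y"
    using y LIMSEQ_Suc by (fastforce simp: conv_def)
  moreover have "conv (\<lambda>n. Y (Suc n)) (step y)"
    unfolding YS step_def by (intro conv_scale conv_add conv_mult conv_const y h)
  ultimately have "y = step y"
    by (intro separated yc step_closed) (metis conv_rep op_conv_unique[OF hs])
  then have "cadd A y y = cadd A (step y) (step y)" by simp
  also have "\<dots> = cadd A h (cmult A y y)"
    unfolding step_def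
  proof (rule separated)
    fix j assume j: "j \<in> J"
    show "\<rho> j (cadd A (cscale A (1/2) (cadd A h (cmult A y y))) (cscale A (1/2) (cadd A h (cmult A y y))))
        = \<rho> j (cadd A h (cmult A y y))"
      by (rule bop_eqI[OF hs[OF j]])
        (use h yc j in \<open>simp_all add: closed rep_bop\<close>, simp add: rep_simps closed flip: vscale_add_left)
  qed (use h yc closed in auto)
  finally show ?thesis using yc ystar by blast
qed

text \<open>For \<open>cnorm A z < 1\<close> take \<open>y\<close> with
  \<open>(1 - y)^2 = 1 - z* z\<close>. Applied to a vector, the square of \<open>ell2_norm v\<close>
  minus the square of \<open>ell2_norm (\<pi> z v)\<close> is the square of
  \<open>ell2_norm (v - \<pi> y v)\<close>, hence nonnegative. The unit is only ever applied to
  vectors, so \<open>A\<close> may be nonunital. Scaling gives the general case.\<close>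

theorem star_hom_contractive:
  assumes H: "hilbert_space H" and \<pi>: "\<pi> \<in> star_hom A (Bop H)" and x: "x \<in> carrier A"
  shows "op_norm H (\<pi> x) \<le> cnorm A x"
proof -
  note \<pi>D = star_hom_BopD[OF \<pi>]
  have unit: "ell2_norm (\<pi> z v) \<le> ell2_norm v" if z: "z \<in> carrier A" "cnorm A z < 1" and v: "v \<in> H" for z v
  proof -
    define h where "h = cmult A (cstar A z) z"
    have hc: "h \<in> carrier A" using z by (simp add: h_def closed)
    have hs': "cstar A h = h" unfolding h_def using z
      by (intro separated closed) (auto simp: rep_simps closed adjoint_compose[OF hs] adjoint_adjoint[OF hs] rep_bop Bop_closed[OF hs])
    have "cnorm A h \<le> cnorm A (cstar A z) * cnorm A z" unfolding h_def using z by (intro norm_mult closed)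
    also have "\<dots> \<le> 1 * cnorm A z" using z norm_star[OF z(1)] by (intro mult_right_mono norm_nonneg) auto
    finally have "cnorm A h < 1" using z by simp
    then obtain y where y: "y \<in> carrier A" "cstar A y = y" "cadd A y y = cadd A h (cmult A y y)"
      using square_root_fixpoint[OF hc hs'] by blast
    let ?Y = "\<pi> y" and ?Z = "\<pi> z"
    have Yb: "?Y \<in> bounded_ops H" and Zb: "?Z \<in> bounded_ops H" using \<pi>D y z by auto
    have Yv: "?Y v \<in> H" "?Y (?Y v) \<in> H" "?Z v \<in> H" "adjoint H ?Z (?Z v) \<in> H"
      using v Yb Zb by (auto simp: bop_apply[OF H] adjoint_bop[OF H])
    have adjY: "adjoint H ?Y = ?Y" using \<pi>D(5)[OF y(1)] y(2) by simp
    have "?Y v + ?Y v = \<pi> (cadd A y y) v" using y(1) v by (simp only: \<pi>D Bop_add_apply)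
    also have "\<dots> = \<pi> (cadd A h (cmult A y y)) v" by (simp only: y(3))
    also have "\<dots> = adjoint H ?Z (?Z v) + ?Y (?Y v)"
      using y(1) z hc v by (simp add: \<pi>D closed h_def)
    finally have eq: "?Y v + ?Y v = adjoint H ?Z (?Z v) + ?Y (?Y v)" .
    have "2 * ell2_inner v (?Y v) = ell2_inner v (?Y v + ?Y v)"
      using v Yv hs_ell2[OF H] by (subst ell2_inner_add_right) auto
    also have "\<dots> = ell2_inner (?Z v) (?Z v) + ell2_inner (?Y v) (?Y v)"
      unfolding eq using v Yv hs_ell2[OF H] adjoint_inner[OF H Zb, of v "?Z v"] adjoint_inner[OF H Yb, of v "?Y v"]
      by (simp add: ell2_inner_add_right adjY)
    finally have "2 * Re (ell2_inner v (?Y v)) = (ell2_norm (?Z v))\<^sup>2 + (ell2_norm (?Y v))\<^sup>2"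
      using Yv hs_ell2[OF H] by (simp add: ell2_inner_self complex_eq_iff)
    moreover have "(ell2_norm (v - ?Y v))\<^sup>2 = (ell2_norm v)\<^sup>2 - 2 * Re (ell2_inner v (?Y v)) + (ell2_norm (?Y v))\<^sup>2"
      using ell2_norm_add_sq[of v "- ?Y v"] v Yv hs_ell2[OF H] hs_minus[OF H]
      by (simp add: ell2_norm_minus ell2_inner_minus_right)
    ultimately have "(ell2_norm (?Z v))\<^sup>2 \<le> (ell2_norm v)\<^sup>2"
      using zero_le_power2[of "ell2_norm (v - ?Y v)"] by linarith
    then show ?thesis by (rule power2_le_imp_le) simp
  qed
  show ?thesis
  proof (rule field_le_epsilon)
    fix e :: real assume e: "e > 0"
    \<comment> \<open>The extra \<open>e\<close> puts the rescaled element strictly inside the unit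
      ball and keeps \<open>c\<close> positive when \<open>cnorm A x = 0\<close>.\<close>
    define c where "c = cnorm A x + e"
    have c: "c > 0" using e norm_nonneg[OF x] by (simp add: c_def)
    define z where "z = cscale A (complex_of_real (1 / c)) x"
    have z: "z \<in> carrier A" using x by (simp add: z_def closed)
    have "cnorm A z \<le> 1 / c * cnorm A x" unfolding z_def using norm_scale[OF x, of "complex_of_real (1/c)"] c by (simp add: norm_divide)
    also have "\<dots> < 1" using c e by (simp add: c_def)
    finally have z1: "cnorm A z < 1" .
    have "ell2_norm (\<pi> x v) \<le> c * ell2_norm v" if v: "v \<in> H" for v
    proof -
      have "\<pi> z v = complex_of_real (1 / c) *\<^sub>v \<pi> x v" using v x by (simp add: z_def \<pi>D)
      then have "ell2_norm (\<pi> x v) / c = ell2_norm (\<pi> z v)" using c by (simp add: ell2_norm_scale norm_divide)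
      also have "\<dots> \<le> ell2_norm v" by (rule unit[OF z z1 v])
      finally show ?thesis using c by (simp add: pos_divide_le_eq mult.commute)
    qed
    then show "op_norm H (\<pi> x) \<le> cnorm A x + e" using op_norm_le[OF H, of c] c by (simp add: c_def)
  qed
qed

lemma star_hom_op_conv:
  assumes H: "hilbert_space H" and \<pi>: "\<pi> \<in> star_hom A (Bop H)" and X: "conv X x"
  shows "op_conv H (\<lambda>n. \<pi> (X n)) (\<pi> x)"
proof -
  note \<pi>D = star_hom_BopD[OF \<pi>] and c = conv_carrier[OF X]
  have "(\<lambda>n. op_norm H (cdiff (Bop H) (\<pi> (X n)) (\<pi> x))) \<longlonglongrightarrow> 0"
  proof (rule real_tendsto_sandwich[where f = "\<lambda>_. 0"])
    show "(\<lambda>n. cnorm A (cdiff A (X n) x)) \<longlonglongrightarrow> 0" using X by (simp add: conv_def)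
    have "cdiff (Bop H) (\<pi> (X n)) (\<pi> x) = \<pi> (cdiff A (X n) x)" for n
      by (simp add: cdiff_def \<pi>D c closed)
    then show "\<forall>\<^sub>F n in sequentially. op_norm H (cdiff (Bop H) (\<pi> (X n)) (\<pi> x)) \<le> cnorm A (cdiff A (X n) x)"
      using star_hom_contractive[OF H \<pi> diff_closed[OF c(1) c(2)]] by simp
  qed (auto simp: op_norm_nonneg[OF H] Bop_closed[OF H] \<pi>D c)
  then show ?thesis by (simp add: op_conv_iff[OF H] \<pi>D c)
qed

lemma star_hom_zero:
  assumes H: "hilbert_space H" and \<pi>: "\<pi> \<in> star_hom A (Bop H)"
  shows "\<pi> (czero A) = zero_op H"
proof (rule bop_eqI[OF H])
  fix v assume v: "v \<in> H"
  have "\<pi> (cadd A (czero A) (czero A)) v = \<pi> (czero A) v + \<pi> (czero A) v"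
    using v zero_closed by (simp add: star_hom_BopD[OF \<pi>])
  then show "\<pi> (czero A) v = zero_op H v" using v by (simp add: add_zero zero_closed)
qed (auto simp: star_hom_BopD[OF \<pi>] zero_closed zero_op_closed[OF H])

text \<open>The equalizer is closed because of automatic continuity: the homomorphisms compared
  here, such as those of covariant pairs, are only assumed to be algebraic.\<close>

lemma star_hom_unique:
  assumes H: "hilbert_space H" and \<pi>: "\<pi> \<in> star_hom A (Bop H)" and \<pi>': "\<pi>' \<in> star_hom A (Bop H)"
    and G: "generates A G" and eq: "\<And>g. g \<in> G \<Longrightarrow> \<pi> g = \<pi>' g" and x: "x \<in> carrier A"
  shows "\<pi> x = \<pi>' x"
proof -
  let ?K = "{x \<in> carrier A. \<pi> x = \<pi>' x}"
  have "closed_subspace A ?K"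
  proof (rule closed_subspaceI)
    fix X x assume X: "conv X x" "\<And>n. X n \<in> ?K"
    have "op_conv H (\<lambda>n. \<pi> (X n)) (\<pi> x)" "op_conv H (\<lambda>n. \<pi> (X n)) (\<pi>' x)"
      using star_hom_op_conv[OF H \<pi> X(1)] star_hom_op_conv[OF H \<pi>' X(1)] X(2) by simp_all
    then show "x \<in> ?K" using op_conv_unique[OF H] conv_carrier(2)[OF X(1)] by blast
  qed (auto simp: closed star_hom_BopD[OF \<pi>] star_hom_BopD[OF \<pi>'] star_hom_zero[OF H \<pi>] star_hom_zero[OF H \<pi>'])
  then have "star_subalgebra A ?K"
    by (auto simp: star_subalgebra_def closed star_hom_BopD[OF \<pi>] star_hom_BopD[OF \<pi>'])
  then show ?thesis using G eq x by (auto simp: generates_def)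
qed

end

subsection \<open>Homomorphisms from matching generators\<close>

context
  fixes A :: "'a star_algebra" and J :: "'j set" and Hs \<rho> and B :: "'b star_algebra" and K :: "'k set"
    and Ls :: "'k \<Rightarrow> 'i vec set" and \<sigma> and m
  assumes A: "rep_cstar A J Hs \<rho>" and B: "rep_cstar B K Ls \<sigma>"
    and m: "\<And>k. k \<in> K \<Longrightarrow> m k \<in> J" "\<And>k. k \<in> K \<Longrightarrow> Hs (m k) = Ls k"
begin

interpretation A: rep_cstar A J Hs \<rho> by (rule A)
interpretation B: rep_cstar B K Ls \<sigma> by (rule B)

text \<open>Closedness is the point. Every representation of \<open>B\<close> in the family
  corresponds to one of \<open>A\<close>, so if \<open>y\<close> and \<open>y'\<close> match
  \<open>x\<close> and \<open>x'\<close>, the norm of \<open>y - y'\<close> is at most that of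
  \<open>x - x'\<close>. Matches of a convergent sequence are therefore Cauchy, and completeness of
  \<open>B\<close> provides the match of the limit.\<close>

lemma matched_subalgebra:
  "star_subalgebra A {x \<in> carrier A. \<exists>y\<in>carrier B. \<forall>k\<in>K. \<sigma> k y = \<rho> (m k) x}" (is "star_subalgebra A ?M")
proof -
  have "closed_subspace A ?M"
  proof (rule A.closed_subspaceI)
    fix x y assume "x \<in> ?M" "y \<in> ?M"
    then obtain x' y' where "x' \<in> carrier B" "\<forall>k\<in>K. \<sigma> k x' = \<rho> (m k) x" "y' \<in> carrier B" "\<forall>k\<in>K. \<sigma> k y' = \<rho> (m k) y"
      "x \<in> carrier A" "y \<in> carrier A" by blast
    then show "cadd A x y \<in> ?M" by (auto intro!: bexI[of _ "cadd B x' y'"] simp: A.closed B.closed A.rep_simps B.rep_simps m)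
  next
    fix c x assume "x \<in> ?M"
    then obtain x' where "x' \<in> carrier B" "\<forall>k\<in>K. \<sigma> k x' = \<rho> (m k) x" "x \<in> carrier A" by blast
    then show "cscale A c x \<in> ?M" by (auto intro!: bexI[of _ "cscale B c x'"] simp: A.closed B.closed A.rep_simps B.rep_simps m)
  next
    fix X x assume X: "A.conv X x" "\<And>n. X n \<in> ?M"
    then obtain Y where Y: "\<And>n. Y n \<in> carrier B" "\<And>n k. k \<in> K \<Longrightarrow> \<sigma> k (Y n) = \<rho> (m k) (X n)"
      by (simp; metis)
    note Xc = A.conv_carrier[OF X(1)]
    have le: "cnorm B (cdiff B (Y p) (Y q)) \<le> cnorm A (cdiff A (X p) (X q))" for p q
    proof (rule B.norm_leI)
      fix k assume k: "k \<in> K"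
      have "\<sigma> k (cdiff B (Y p) (Y q)) = \<rho> (m k) (cdiff A (X p) (X q))"
        using k Y Xc by (simp add: B.rep_diff A.rep_diff m)
      then show "op_norm (Ls k) (\<sigma> k (cdiff B (Y p) (Y q))) \<le> cnorm A (cdiff A (X p) (X q))"
        using A.rep_norm_le[of "m k" "cdiff A (X p) (X q)"] k by (simp add: m A.closed Xc)
    qed (simp add: B.closed Y)
    have "cauchy_seq B Y" unfolding cauchy_seq_def
    proof (intro conjI allI impI Y)
      fix e :: real assume "e > 0"
      then obtain N where "\<forall>p\<ge>N. \<forall>q\<ge>N. cnorm A (cdiff A (X p) (X q)) < e"
        using A.cauchyD[OF A.conv_cauchy[OF X(1)]] by blast
      then show "\<exists>N. \<forall>p\<ge>N. \<forall>q\<ge>N. cnorm B (cdiff B (Y p) (Y q)) < e"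
        using le by (meson le_less_trans)
    qed
    then obtain y where y: "B.conv Y y" using B.cauchy_conv by blast
    have "\<sigma> k y = \<rho> (m k) x" if k: "k \<in> K" for k
    proof (rule op_conv_unique[OF B.hs[OF k]])
      show "op_conv (Ls k) (\<lambda>n. \<sigma> k (Y n)) (\<sigma> k y)" by (rule B.conv_rep[OF k y])
      show "op_conv (Ls k) (\<lambda>n. \<sigma> k (Y n)) (\<rho> (m k) x)"
        using A.conv_rep[OF m(1)[OF k] X(1)] k by (simp add: Y m)
    qed
    then show "x \<in> ?M" using B.conv_carrier(2)[OF y] Xc by blast
  qed (auto intro!: bexI[of _ "czero B"] simp: A.closed B.closed A.rep_simps B.rep_simps m)
  moreover have "cmult A x y \<in> ?M" if "x \<in> ?M" "y \<in> ?M" for x y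
  proof -
    note xy = that
    obtain x' where "x' \<in> carrier B" "\<forall>k\<in>K. \<sigma> k x' = \<rho> (m k) x" "x \<in> carrier A" using xy(1) by blast
    moreover obtain y' where "y' \<in> carrier B" "\<forall>k\<in>K. \<sigma> k y' = \<rho> (m k) y" "y \<in> carrier A" using xy(2) by blast
    ultimately show ?thesis by (auto intro!: bexI[of _ "cmult B x' y'"] simp: A.closed B.closed A.rep_simps B.rep_simps m)
  qed
  moreover have "cstar A x \<in> ?M" if "x \<in> ?M" for x
  proof -
    note xM = that
    obtain x' where "x' \<in> carrier B" "\<forall>k\<in>K. \<sigma> k x' = \<rho> (m k) x" "x \<in> carrier A" using xM by blast
    then show ?thesis by (auto intro!: bexI[of _ "cstar B x'"] simp: A.closed B.closed A.rep_simps B.rep_simps m)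
  qed
  ultimately show ?thesis by (simp add: star_subalgebra_def)
qed

text \<open>The match of \<open>x\<close> is unique because the representations separate
  \<open>B\<close>, and uniqueness makes the choice of matches a *-homomorphism.\<close>

theorem matched_hom:
  assumes G: "generates A G" and match: "\<And>g. g \<in> G \<Longrightarrow> \<exists>y\<in>carrier B. \<forall>k\<in>K. \<sigma> k y = \<rho> (m k) g"
  shows "\<exists>f\<in>star_hom A B. \<forall>x\<in>carrier A. \<forall>k\<in>K. \<sigma> k (f x) = \<rho> (m k) x"
proof -
  have "carrier A \<subseteq> {x \<in> carrier A. \<exists>y\<in>carrier B. \<forall>k\<in>K. \<sigma> k y = \<rho> (m k) x}"
    using G matched_subalgebra match unfolding generates_def by blast
  then have "\<forall>x\<in>carrier A. \<exists>y\<in>carrier B. \<forall>k\<in>K. \<sigma> k y = \<rho> (m k) x" by blast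
  then obtain f where f: "\<And>x. x \<in> carrier A \<Longrightarrow> f x \<in> carrier B"
    "\<And>x k. x \<in> carrier A \<Longrightarrow> k \<in> K \<Longrightarrow> \<sigma> k (f x) = \<rho> (m k) x" by metis
  have "f \<in> star_hom A B"
    unfolding star_hom_def
    by (auto intro!: B.separated simp: f A.closed B.closed A.rep_simps B.rep_simps m)
  then show ?thesis using f by blast
qed

end

text \<open>Matching in both directions gives mutually inverse homomorphisms, and both norms are
  suprema over the same families of operators.\<close>

theorem matched_iso:
  assumes A: "rep_cstar A J Hs \<rho>" and B: "rep_cstar B J Hs \<sigma>"
    and G: "generates A G" "\<And>g. g \<in> G \<Longrightarrow> \<exists>y\<in>carrier B. \<forall>j\<in>J. \<sigma> j y = \<rho> j g"
    and G': "generates B G'" "\<And>g. g \<in> G' \<Longrightarrow> \<exists>x\<in>carrier A. \<forall>j\<in>J. \<rho> j x = \<sigma> j g"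
  shows "cstar_isomorphic A B"
proof -
  interpret A: rep_cstar A J Hs \<rho> by (rule A)
  interpret B: rep_cstar B J Hs \<sigma> by (rule B)
  obtain f where f: "f \<in> star_hom A B" "\<And>x j. x \<in> carrier A \<Longrightarrow> j \<in> J \<Longrightarrow> \<sigma> j (f x) = \<rho> j x"
    using matched_hom[OF A B, of "\<lambda>j. j", OF _ _ G] by auto
  obtain g where g: "g \<in> star_hom B A" "\<And>x j. x \<in> carrier B \<Longrightarrow> j \<in> J \<Longrightarrow> \<rho> j (g x) = \<sigma> j x"
    using matched_hom[OF B A, of "\<lambda>j. j", OF _ _ G'] by auto
  have fc: "f x \<in> carrier B" if "x \<in> carrier A" for x using f that by (auto simp: star_hom_def)
  have gc: "g x \<in> carrier A" if "x \<in> carrier B" for x using g that by (auto simp: star_hom_def)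
  have "bij_betw f (carrier A) (carrier B)"
    by (rule bij_betw_byWitness[where f' = g]) (auto simp: fc gc f g intro!: A.separated B.separated)
  moreover have "cnorm B (f x) = cnorm A x" if "x \<in> carrier A" for x
    using that by (simp add: A.norm_eq B.norm_eq fc f)
  ultimately show ?thesis using f unfolding cstar_isomorphic_def star_iso_def by blast
qed

text \<open>Changes the family of representations without changing the norm, so that two algebras
  acquire the common index set that \<open>matched_iso\<close> requires. It covers the passage to
  unital representations of \<open>S*\<close> and the passage from the relations of C*(S) to
  covariant pairs.\<close>

lemma rep_cstar_reindex:
  assumes A: "rep_cstar A J Hs \<rho>" and K: "K \<noteq> {}"
    and m: "\<And>k. k \<in> K \<Longrightarrow> m k \<in> J" "\<And>k. k \<in> K \<Longrightarrow> Ls k = Hs (m k)"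
      "\<And>k x. k \<in> K \<Longrightarrow> x \<in> carrier A \<Longrightarrow> \<sigma> k x = \<rho> (m k) x"
    and large: "\<And>j. j \<in> J \<Longrightarrow> \<exists>k\<in>K. \<forall>x\<in>carrier A. op_norm (Hs j) (\<rho> j x) \<le> op_norm (Ls k) (\<sigma> k x)"
  shows "rep_cstar A K Ls \<sigma>"
proof -
  interpret A: rep_cstar A J Hs \<rho> by (rule A)
  have bdd: "bdd_above ((\<lambda>k. op_norm (Ls k) (\<sigma> k x)) ` K)" if x: "x \<in> carrier A" for x
    using A.rep_norm_le[OF m(1) x] x by (intro bdd_aboveI[where M = "cnorm A x"]) (auto simp: m)
  have norm: "cnorm A x = Sup ((\<lambda>k. op_norm (Ls k) (\<sigma> k x)) ` K)" if x: "x \<in> carrier A" for x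
  proof (rule order_antisym)
    show "cnorm A x \<le> Sup ((\<lambda>k. op_norm (Ls k) (\<sigma> k x)) ` K)"
    proof (rule A.norm_leI[OF x])
      fix j assume "j \<in> J"
      then obtain k where k: "k \<in> K" "op_norm (Hs j) (\<rho> j x) \<le> op_norm (Ls k) (\<sigma> k x)" using large x by blast
      then show "op_norm (Hs j) (\<rho> j x) \<le> Sup ((\<lambda>k. op_norm (Ls k) (\<sigma> k x)) ` K)"
        using cSUP_upper[OF k(1) bdd[OF x]] by simp
    qed
    show "Sup ((\<lambda>k. op_norm (Ls k) (\<sigma> k x)) ` K) \<le> cnorm A x"
      using A.rep_norm_le[OF m(1) x] x K by (intro cSup_least) (auto simp: m)
  qed
  have hom: "\<sigma> k \<in> star_hom A (Bop (Ls k))" if k: "k \<in> K" for k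
    using A.hom[OF m(1)[OF k]] by (auto simp: star_hom_def Pi_iff m(2,3)[OF k] A.closed)
  have "normed_by_reps A K Ls \<sigma>"
    by (standard; (rule hom bdd norm; assumption | (auto simp: A.closed K A.hs A.rep_zero m)[1]))
  then interpret B: normed_by_reps A K Ls \<sigma> .
  show ?thesis
  proof
    fix x y assume xy: "x \<in> carrier A" "y \<in> carrier A" and eq: "\<And>k. k \<in> K \<Longrightarrow> \<sigma> k x = \<sigma> k y"
    have "cnorm A (cdiff A x y) = cnorm A (cdiff A x x)"
      using xy eq by (intro B.norm_cong B.closed) (auto simp: B.rep_diff)
    then have "cdiff A x y = czero A" using xy by (intro A.norm_eq_0 A.closed) (auto simp: A.norm_diff_self)
    then have "\<rho> j (cdiff A x y) v = 0" if "j \<in> J" "v \<in> Hs j" for j v using that by (simp add: A.rep_zero)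
    then have "\<rho> j x v = \<rho> j y v" if "j \<in> J" "v \<in> Hs j" for j v using that xy by (simp add: A.rep_diff)
    then show "x = y" by (intro A.separated xy bop_eqI[OF A.hs]) (auto intro: A.rep_bop xy)
  qed (rule A.complete)
qed

section \<open>The C*-algebra of a *-semigroup and its representations\<close>

section \<open>C*-algebras of inverse semigroups\<close>

text \<open>Summation along the fibres of \<open>h\<close>, through the bijection from their
  disjoint union onto \<open>X\<close>. With \<open>h\<close> the multiplication of the semigroup it
  turns sums of convolutions into double sums.\<close>

lemma abs_summable_fibres:
  fixes G :: "'x \<Rightarrow> complex"
  assumes G: "G abs_summable_on X" and h: "h ` X \<subseteq> P"
  shows "(\<lambda>r. \<Sum>\<^sub>\<infinity>x\<in>{x \<in> X. h x = r}. G x) abs_summable_on P"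
    and "(\<Sum>\<^sub>\<infinity>r\<in>P. \<Sum>\<^sub>\<infinity>x\<in>{x \<in> X. h x = r}. G x) = (\<Sum>\<^sub>\<infinity>x\<in>X. G x)"
    and "r \<in> P \<Longrightarrow> G abs_summable_on {x \<in> X. h x = r}"
proof -
  let ?S = "Sigma P (\<lambda>r. {x \<in> X. h x = r})"
  have bij: "bij_betw snd ?S X"
    using h by (auto simp: bij_betw_def inj_on_def image_iff)
  have abs: "(\<lambda>p. G (snd p)) abs_summable_on ?S"
    using G summable_on_reindex_bij_betw[OF bij, of "\<lambda>x. norm (G x)"] by simp
  then have *: "\<forall>r\<in>P. G abs_summable_on {x \<in> X. h x = r}"
    and sum: "(\<lambda>r. \<Sum>\<^sub>\<infinity>x\<in>{x \<in> X. h x = r}. norm (G x)) abs_summable_on P"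
    by (auto simp: abs_summable_on_Sigma_iff)
  then show "r \<in> P \<Longrightarrow> G abs_summable_on {x \<in> X. h x = r}" by blast
  show "(\<lambda>r. \<Sum>\<^sub>\<infinity>x\<in>{x \<in> X. h x = r}. G x) abs_summable_on P"
  proof (rule abs_summable_on_comparison_test[OF sum])
    fix r assume "r \<in> P"
    then show "norm (\<Sum>\<^sub>\<infinity>x\<in>{x \<in> X. h x = r}. G x) \<le> norm (\<Sum>\<^sub>\<infinity>x\<in>{x \<in> X. h x = r}. norm (G x))"
      using * by (auto intro!: order_trans[OF norm_infsum_bound])
  qed
  have "(\<Sum>\<^sub>\<infinity>r\<in>P. \<Sum>\<^sub>\<infinity>x\<in>{x \<in> X. h x = r}. G x) = (\<Sum>\<^sub>\<infinity>p\<in>?S. G (snd p))"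
    using infsum_Sigma_banach[OF abs_summable_summable[OF abs]] by simp
  also have "\<dots> = (\<Sum>\<^sub>\<infinity>x\<in>X. G x)" by (rule infsum_reindex_bij_betw[OF bij])
  finally show "(\<Sum>\<^sub>\<infinity>r\<in>P. \<Sum>\<^sub>\<infinity>x\<in>{x \<in> X. h x = r}. G x) = (\<Sum>\<^sub>\<infinity>x\<in>X. G x)" .
qed

lemma abs_summable_times:
  fixes f :: "'x \<Rightarrow> complex" and g :: "'y \<Rightarrow> complex"
  assumes "f abs_summable_on A" "g abs_summable_on B"
  shows "(\<lambda>(s, t). f s * g t) abs_summable_on A \<times> B"
proof -
  have "(\<lambda>x. infsum (\<lambda>y. norm (f x * g y)) B) abs_summable_on A"
    using summable_on_cmult_left[OF assms(1), of "\<Sum>\<^sub>\<infinity>y\<in>B. norm (g y)"]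
    by (simp add: norm_mult infsum_cmult_right' infsum_nonneg)
  then show ?thesis
    using assms by (auto simp: abs_summable_on_Sigma_iff norm_mult intro!: summable_on_cmult_right)
qed

lemma Collect_pair_image: "{F H \<pi> |H \<pi>. C H \<pi>} = (\<lambda>j. F (fst j) (snd j)) ` {(H, \<pi>). C H \<pi>}"
proof (intro Set.set_eqI iffI)
  fix r assume "r \<in> {F H \<pi> |H \<pi>. C H \<pi>}"
  then obtain H \<pi> where "r = F H \<pi>" "C H \<pi>" by blast
  then show "r \<in> (\<lambda>j. F (fst j) (snd j)) ` {(H, \<pi>). C H \<pi>}"
    by (intro image_eqI[of _ _ "(H, \<pi>)"]) auto
qed (auto, blast)

subsection \<open>Representations of a *-semigroup\<close>

text \<open>\<open>regular\<close> makes every represented element a partial isometry, hence a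
  contraction, which bounds the seminorm by the \<open>l1\<close> norm. Instances are
  \<open>S*\<close>, its idempotents and the projections of constructible sets.\<close>

locale regular_star_semigroup =
  fixes P :: "'p star_semigroup"
  assumes smul_closed: "s \<in> carrier P \<Longrightarrow> t \<in> carrier P \<Longrightarrow> smul P s t \<in> carrier P"
    and sstar_closed: "s \<in> carrier P \<Longrightarrow> sstar P s \<in> carrier P"
    and sstar_sstar: "s \<in> carrier P \<Longrightarrow> sstar P (sstar P s) = s"
    and regular: "s \<in> carrier P \<Longrightarrow> smul P s (smul P (sstar P s) s) = s"

lemma sg_repsD:
  assumes "\<pi> \<in> sg_reps P H"
  shows "s \<in> carrier P \<Longrightarrow> \<pi> s \<in> bounded_ops H"
    "s \<in> carrier P \<Longrightarrow> t \<in> carrier P \<Longrightarrow> \<pi> (smul P s t) = compose H (\<pi> s) (\<pi> t)"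
    "s \<in> carrier P \<Longrightarrow> \<pi> (sstar P s) = adjoint H (\<pi> s)"
  using assms by (auto simp: sg_reps_def star_semigroup_hom_def op_semigroup_def)

lemma sg_repsI:
  assumes "\<And>s. s \<in> carrier P \<Longrightarrow> \<pi> s \<in> bounded_ops H"
    "\<And>s t. s \<in> carrier P \<Longrightarrow> t \<in> carrier P \<Longrightarrow> \<pi> (smul P s t) = compose H (\<pi> s) (\<pi> t)"
    "\<And>s. s \<in> carrier P \<Longrightarrow> \<pi> (sstar P s) = adjoint H (\<pi> s)"
  shows "\<pi> \<in> sg_reps P H"
  using assms by (auto simp: sg_reps_def star_semigroup_hom_def op_semigroup_def)

text \<open>With \<open>A\<close> the adjoint, \<open>T A T x = T x\<close> makes
  \<open>A (T x)\<close> as long as \<open>T x\<close>. Cauchy-Schwarz for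
  \<open>ell2_inner x (A (T x))\<close>, which is the square of the norm of \<open>T x\<close>, then
  gives the bound.\<close>

lemma partial_isometry_contractive:
  assumes H: "hilbert_space H" and T: "T \<in> bounded_ops H"
    and reg: "compose H T (compose H (adjoint H T) T) = T" and x: "x \<in> H"
  shows "ell2_norm (T x) \<le> ell2_norm x"
proof (cases "ell2_norm (T x) = 0")
  case False
  let ?A = "adjoint H T"
  have in_H: "T x \<in> H" "?A (T x) \<in> H" using x T by (auto simp: bop_apply[OF H] adjoint_bop[OF H])
  have TAT: "T (?A (T x)) = T x" using fun_cong[OF reg, of x] x by simp
  have "ell2_inner (?A (T x)) (?A (T x)) = ell2_inner (T x) (T x)"
    using adjoint_inner[OF H T in_H(2) in_H(1)] TAT by simp
  then have "(ell2_norm (?A (T x)))\<^sup>2 = (ell2_norm (T x))\<^sup>2"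
    using in_H hs_ell2[OF H] by (simp add: ell2_inner_self complex_eq_iff)
  then have eq: "ell2_norm (?A (T x)) = ell2_norm (T x)" by (simp add: power2_eq_iff_nonneg)
  have "(ell2_norm (T x))\<^sup>2 = cmod (ell2_inner (T x) (T x))"
    using in_H hs_ell2[OF H] by (simp add: ell2_inner_self norm_power)
  also have "\<dots> = cmod (ell2_inner x (?A (T x)))" using adjoint_inner[OF H T x in_H(1)] by simp
  also have "\<dots> \<le> ell2_norm x * ell2_norm (T x)"
    using ell2_Cauchy_Schwarz[of x "?A (T x)"] x in_H hs_ell2[OF H] eq by simp
  finally show ?thesis using False ell2_norm_nonneg[of "T x"]
    by (simp add: power2_eq_square mult_le_cancel_right)
qed simp

definition sg_index :: "'p star_semigroup \<Rightarrow> 'p set \<Rightarrow> ('i vec set \<times> ('p \<Rightarrow> 'i operator)) set" where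
  "sg_index P Z = {(H, \<pi>). hilbert_space H \<and> \<pi> \<in> sg_reps P H \<and> (\<forall>z\<in>Z. \<pi> z = zero_op H)}"

definition l1_rep :: "'p star_semigroup \<Rightarrow> ('i vec set \<times> ('p \<Rightarrow> 'i operator)) \<Rightarrow> ('p \<Rightarrow> complex) \<Rightarrow> 'i operator" where
  "l1_rep P j f = (\<lambda>x\<in>fst j. l1_comb (carrier P) f (\<lambda>s. snd j s x))"

text \<open>On the zero space \<open>zero_op\<close> is also the identity and is the only operator,
  so all the relations considered here hold there. This provides the nonempty index sets over which
  the suprema are taken.\<close>

lemma hilbert_space_zero: "hilbert_space {0}"
  unfolding hilbert_space_def
proof (intro conjI allI ballI impI)
  fix X and x :: "'i vec"
  assume a: "(\<forall>n::nat. X n \<in> {0}) \<and> x \<in> ell2 \<and> (\<lambda>n. ell2_norm (\<lambda>i. X n i - x i)) \<longlonglongrightarrow> 0"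
  then have "X = (\<lambda>_. 0)" by auto
  with a have "(\<lambda>n::nat. ell2_norm (\<lambda>i. - x i)) \<longlonglongrightarrow> 0" by simp
  then have "ell2_norm (\<lambda>i. - x i) = 0" by (simp only: LIMSEQ_const_iff)
  then have "ell2_norm x = 0" by (simp add: ell2_norm_def)
  then show "x \<in> {0}" using a by (simp add: ell2_norm_eq_0)
qed (auto simp: fun_eq_iff)

lemma bop_zero_space: "bounded_ops {0} = {zero_op {0}}"
proof -
  have "T = zero_op {0}" if "T \<in> bounded_ops {0}" for T
    using bop_eqI[OF hilbert_space_zero that zero_op_closed[OF hilbert_space_zero]]
      bop_zero[OF hilbert_space_zero that] by simp
  then show ?thesis using zero_op_closed[OF hilbert_space_zero] by auto
qed

lemma zero_space_index: "({0} :: 'i vec set, \<lambda>_. zero_op {0}) \<in> sg_index P Z"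
proof -
  have "compose {0} (zero_op {0}) (zero_op {0}) = (zero_op {0} :: 'i operator)"
    using compose_closed[OF hilbert_space_zero zero_op_closed[OF hilbert_space_zero]
        zero_op_closed[OF hilbert_space_zero]] bop_zero_space by blast
  then show ?thesis
    by (auto simp: sg_index_def hilbert_space_zero bop_zero_space adjoint_zero[OF hilbert_space_zero] intro!: sg_repsI)
qed

context regular_star_semigroup
begin

lemma sg_rep_contractive:
  assumes H: "hilbert_space H" and \<pi>: "\<pi> \<in> sg_reps P H" and s: "s \<in> carrier P" and x: "x \<in> H"
  shows "ell2_norm (\<pi> s x) \<le> ell2_norm x"
proof (rule partial_isometry_contractive[OF H _ _ x])
  show "\<pi> s \<in> bounded_ops H" using sg_repsD[OF \<pi>] s by blast
  have "\<pi> (smul P s (smul P (sstar P s) s)) = compose H (\<pi> s) (compose H (adjoint H (\<pi> s)) (\<pi> s))"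
    using s by (simp add: sg_repsD[OF \<pi>] sstar_closed smul_closed)
  then show "compose H (\<pi> s) (compose H (adjoint H (\<pi> s)) (\<pi> s)) = \<pi> s" using regular[OF s] by simp
qed

lemma l1_carrier: "f \<in> carrier (l1_algebra I P Z) \<longleftrightarrow>
    (\<forall>s. s \<notin> carrier P \<longrightarrow> f s = 0) \<and> f abs_summable_on carrier P"
  by (simp add: l1_algebra_def)

lemma l1_sel:
  "cadd (l1_algebra I P Z) f g = (\<lambda>s. f s + g s)" "czero (l1_algebra I P Z) = (\<lambda>_. 0)"
  "cscale (l1_algebra I P Z) c f = (\<lambda>s. c * f s)"
  "cstar (l1_algebra I P Z) f = (\<lambda>s. if s \<in> carrier P then cnj (f (sstar P s)) else 0)"
  by (simp_all add: l1_algebra_def)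

lemma l1_mult: "cmult (l1_algebra I P Z) f g =
    (\<lambda>r. \<Sum>\<^sub>\<infinity>x\<in>{x \<in> carrier P \<times> carrier P. (\<lambda>(s, t). smul P s t) x = r}. (\<lambda>(s, t). f s * g t) x)"
proof -
  have "{(s, t). s \<in> carrier P \<and> t \<in> carrier P \<and> smul P s t = r} =
      {x \<in> carrier P \<times> carrier P. (\<lambda>(s, t). smul P s t) x = r}" for r by auto
  then show ?thesis by (simp add: l1_algebra_def fun_eq_iff)
qed

lemma bij_sstar: "bij_betw (sstar P) (carrier P) (carrier P)"
  by (rule bij_betw_byWitness[where f' = "sstar P"]) (auto simp: sstar_closed sstar_sstar)

context
  fixes H :: "'i vec set" and \<pi> :: "'p \<Rightarrow> 'i operator"
  assumes H: "hilbert_space H" and \<pi>: "\<pi> \<in> sg_reps P H"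
begin

lemma l1_rep_apply: "x \<in> H \<Longrightarrow> l1_rep P (H, \<pi>) f x = l1_comb (carrier P) f (\<lambda>s. \<pi> s x)"
  by (simp add: l1_rep_def)

lemma orbit:
  assumes "x \<in> H" "s \<in> carrier P"
  shows "\<pi> s x \<in> H" "\<pi> s x \<in> ell2" "ell2_norm (\<pi> s x) \<le> ell2_norm x"
proof -
  show in_H: "\<pi> s x \<in> H" using bop_apply[OF H sg_repsD(1)[OF \<pi>]] assms by blast
  then show "\<pi> s x \<in> ell2" by (rule hs_ell2[OF H])
  show "ell2_norm (\<pi> s x) \<le> ell2_norm x" using sg_rep_contractive[OF H \<pi>] assms by blast
qed

lemma l1_rep_in:
  assumes f: "f abs_summable_on carrier P" and x: "x \<in> H"
  shows "l1_comb (carrier P) f (\<lambda>s. \<pi> s x) \<in> H"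
    "ell2_norm (l1_comb (carrier P) f (\<lambda>s. \<pi> s x)) \<le> ell2_norm x * (\<Sum>\<^sub>\<infinity>s\<in>carrier P. cmod (f s))"
  using x by (auto intro!: hs_l1_comb[OF H f, of _ "ell2_norm x"] l1_comb_ell2(2)[OF f] orbit)

lemma l1_pointwise:
  assumes f: "f abs_summable_on carrier P" and x: "x \<in> H"
  shows "(\<lambda>s. f s * \<pi> s x i) abs_summable_on carrier P"
  using x by (intro l1_comb_pointwise_summable[OF f, of _ "ell2_norm x"]) (auto intro: orbit)

lemma l1_rep_bop:
  assumes f: "f abs_summable_on carrier P"
  shows "l1_rep P (H, \<pi>) f \<in> bounded_ops H"
proof (rule bopI[OF H])
  show "ell2_norm (l1_rep P (H, \<pi>) f x) \<le> (\<Sum>\<^sub>\<infinity>s\<in>carrier P. cmod (f s)) * ell2_norm x" if "x \<in> H" for x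
    using l1_rep_in(2)[OF f that] that by (simp add: l1_rep_apply mult.commute)
  show "l1_rep P (H, \<pi>) f (x + y) = l1_rep P (H, \<pi>) f x + l1_rep P (H, \<pi>) f y" if "x \<in> H" "y \<in> H" for x y
  proof
    fix i
    have "(\<Sum>\<^sub>\<infinity>s\<in>carrier P. f s * \<pi> s (x + y) i) = (\<Sum>\<^sub>\<infinity>s\<in>carrier P. f s * \<pi> s x i + f s * \<pi> s y i)"
      using that by (intro infsum_cong) (simp add: bop_add[OF H sg_repsD(1)[OF \<pi>]] vec_apply distrib_left)
    also have "\<dots> = (\<Sum>\<^sub>\<infinity>s\<in>carrier P. f s * \<pi> s x i) + (\<Sum>\<^sub>\<infinity>s\<in>carrier P. f s * \<pi> s y i)"
      by (intro infsum_add abs_summable_summable[OF l1_pointwise[OF f]] that)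
    finally show "l1_rep P (H, \<pi>) f (x + y) i = (l1_rep P (H, \<pi>) f x + l1_rep P (H, \<pi>) f y) i"
      using that by (simp add: l1_rep_apply hs_add[OF H] l1_comb_def vec_apply)
  qed
  show "l1_rep P (H, \<pi>) f (c *\<^sub>v x) = c *\<^sub>v l1_rep P (H, \<pi>) f x" if "x \<in> H" for x c
  proof
    fix i
    have "(\<Sum>\<^sub>\<infinity>s\<in>carrier P. f s * \<pi> s (c *\<^sub>v x) i) = (\<Sum>\<^sub>\<infinity>s\<in>carrier P. c * (f s * \<pi> s x i))"
      using that by (intro infsum_cong) (simp add: bop_scale[OF H sg_repsD(1)[OF \<pi>]] vec_apply)
    then show "l1_rep P (H, \<pi>) f (c *\<^sub>v x) i = (c *\<^sub>v l1_rep P (H, \<pi>) f x) i"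
      using that by (simp add: l1_rep_apply hs_scale[OF H] l1_comb_def vec_apply infsum_cmult_right')
  qed
qed (auto simp: l1_rep_in[OF f] l1_rep_def)

lemma l1_rep_norm:
  assumes f: "f abs_summable_on carrier P"
  shows "op_norm H (l1_rep P (H, \<pi>) f) \<le> (\<Sum>\<^sub>\<infinity>s\<in>carrier P. cmod (f s))"
  by (rule op_norm_le[OF H]) (use l1_rep_in(2)[OF f] in \<open>auto simp: l1_rep_apply mult.commute infsum_nonneg\<close>)

text \<open>Fubini: the double series over \<open>(s, t)\<close> converges absolutely because the
  operators are contractions. Summing it along the fibres of the product gives the convolution, and
  summing over \<open>t\<close> first gives the composition.\<close>

lemma l1_rep_mult:
  assumes f: "f abs_summable_on carrier P" and g: "g abs_summable_on carrier P"
  shows "l1_rep P (H, \<pi>) (cmult (l1_algebra I P Z) f g) = compose H (l1_rep P (H, \<pi>) f) (l1_rep P (H, \<pi>) g)"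
proof
  fix x
  show "l1_rep P (H, \<pi>) (cmult (l1_algebra I P Z) f g) x = compose H (l1_rep P (H, \<pi>) f) (l1_rep P (H, \<pi>) g) x"
  proof (cases "x \<in> H")
    case x: True
    let ?X = "carrier P \<times> carrier P" and ?h = "\<lambda>(s, t). smul P s t" and ?F = "\<lambda>(s, t). f s * g t"
    have h: "?h ` ?X \<subseteq> carrier P" using smul_closed by auto
    have F: "?F abs_summable_on ?X" by (rule abs_summable_times[OF f g])
    show ?thesis
    proof
      fix i
      let ?G = "\<lambda>p. ?F p * \<pi> (?h p) x i"
      have G: "?G abs_summable_on ?X"
      proof (rule abs_summable_on_comparison_test)
        show "(\<lambda>p. ?F p * complex_of_real (ell2_norm x)) abs_summable_on ?X"
          using summable_on_cmult_left[OF F, of "ell2_norm x"] by (simp add: norm_mult)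
        fix p assume "p \<in> ?X"
        then have hp: "?h p \<in> carrier P" using h by blast
        have "cmod (\<pi> (?h p) x i) \<le> ell2_norm x"
          by (rule order_trans[OF ell2_coord_le[OF orbit(2)[OF x hp]] orbit(3)[OF x hp]])
        then show "norm (?G p) \<le> norm (?F p * complex_of_real (ell2_norm x))"
          by (simp add: norm_mult mult_left_mono)
      qed
      have inner: "(\<lambda>t. g t * \<pi> s (\<pi> t x) i) abs_summable_on carrier P" if "s \<in> carrier P" for s
      proof (rule l1_comb_pointwise_summable[OF g, of "\<lambda>t. \<pi> s (\<pi> t x)" "ell2_norm x"])
        fix t assume t: "t \<in> carrier P"
        show "\<pi> s (\<pi> t x) \<in> ell2" by (rule orbit(2)[OF orbit(1)[OF x t] that])
        show "ell2_norm (\<pi> s (\<pi> t x)) \<le> ell2_norm x"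
          by (rule order_trans[OF orbit(3)[OF orbit(1)[OF x t] that] orbit(3)[OF x t]])
      qed
      have "l1_rep P (H, \<pi>) (cmult (l1_algebra I P Z) f g) x i =
          (\<Sum>\<^sub>\<infinity>r\<in>carrier P. (\<Sum>\<^sub>\<infinity>p\<in>{p \<in> ?X. ?h p = r}. ?F p) * \<pi> r x i)"
        using x by (simp add: l1_rep_apply l1_comb_def l1_mult)
      also have "\<dots> = (\<Sum>\<^sub>\<infinity>r\<in>carrier P. \<Sum>\<^sub>\<infinity>p\<in>{p \<in> ?X. ?h p = r}. ?G p)"
        by (intro infsum_cong) (auto simp flip: infsum_cmult_left' intro!: infsum_cong)
      also have "\<dots> = (\<Sum>\<^sub>\<infinity>p\<in>?X. ?G p)" by (rule abs_summable_fibres(2)[OF G h])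
      also have "\<dots> = (\<Sum>\<^sub>\<infinity>s\<in>carrier P. \<Sum>\<^sub>\<infinity>t\<in>carrier P. ?G (s, t))"
        using infsum_Sigma_banach[OF abs_summable_summable[OF G]] by simp
      also have "\<dots> = (\<Sum>\<^sub>\<infinity>s\<in>carrier P. f s * (\<Sum>\<^sub>\<infinity>t\<in>carrier P. g t * \<pi> s (\<pi> t x) i))"
        by (intro infsum_cong) (auto simp: sg_repsD[OF \<pi>] x mult.assoc simp flip: infsum_cmult_right' intro!: infsum_cong)
      also have "\<dots> = (\<Sum>\<^sub>\<infinity>s\<in>carrier P. f s * \<pi> s (l1_comb (carrier P) g (\<lambda>t. \<pi> t x)) i)"
      proof (rule infsum_cong)
        fix s assume s: "s \<in> carrier P"
        have "\<pi> s (l1_comb (carrier P) g (\<lambda>t. \<pi> t x)) = l1_comb (carrier P) g (\<lambda>t. \<pi> s (\<pi> t x))"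
          by (rule bop_l1_comb[OF H g, of _ "ell2_norm x"]) (auto simp: orbit x sg_repsD[OF \<pi>] s)
        then show "f s * (\<Sum>\<^sub>\<infinity>t\<in>carrier P. g t * \<pi> s (\<pi> t x) i) =
            f s * \<pi> s (l1_comb (carrier P) g (\<lambda>t. \<pi> t x)) i" by (simp add: l1_comb_def)
      qed
      also have "\<dots> = compose H (l1_rep P (H, \<pi>) f) (l1_rep P (H, \<pi>) g) x i"
        using x l1_rep_in(1)[OF g x] by (simp add: l1_rep_apply) (simp add: l1_comb_def)
      finally show "l1_rep P (H, \<pi>) (cmult (l1_algebra I P Z) f g) x i =
          compose H (l1_rep P (H, \<pi>) f) (l1_rep P (H, \<pi>) g) x i" .
    qed
  qed (simp add: l1_rep_def compose_def)
qed

lemma l1_star_summable: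
  assumes f: "f abs_summable_on carrier P"
  shows "(\<lambda>s. if s \<in> carrier P then cnj (f (sstar P s)) else 0) abs_summable_on carrier P"
proof -
  have "(\<lambda>s. cmod (f (sstar P s))) summable_on carrier P"
    using summable_on_reindex_bij_betw[OF bij_sstar, of "\<lambda>s. cmod (f s)"] f by simp
  then show ?thesis by (rule summable_on_cong[THEN iffD1, rotated]) simp
qed

lemma l1_rep_star:
  assumes f: "f abs_summable_on carrier P"
  shows "l1_rep P (H, \<pi>) (cstar (l1_algebra I P Z) f) = adjoint H (l1_rep P (H, \<pi>) f)"
proof (rule adjoint_eqI[OF H l1_rep_bop[OF f] l1_rep_bop, symmetric])
  show fs: "cstar (l1_algebra I P Z) f abs_summable_on carrier P"
    using l1_star_summable[OF f] by (simp only: l1_sel)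
  fix x y assume x: "x \<in> H" and y: "y \<in> H"
  have "ell2_inner (l1_rep P (H, \<pi>) f x) y = cnj (ell2_inner y (l1_rep P (H, \<pi>) f x))"
    by (rule ell2_inner_commute)
  also have "\<dots> = cnj (\<Sum>\<^sub>\<infinity>s\<in>carrier P. f s * ell2_inner y (\<pi> s x))"
    unfolding l1_rep_apply[OF x] by (subst l1_comb_inner[OF H f, of _ "ell2_norm x"]) (auto simp: orbit x y)
  also have "\<dots> = (\<Sum>\<^sub>\<infinity>s\<in>carrier P. cnj (f s) * ell2_inner (\<pi> s x) y)"
    unfolding infsum_cnj[symmetric] by (intro infsum_cong) (simp add: ell2_inner_commute[of _ y])
  also have "\<dots> = (\<Sum>\<^sub>\<infinity>s\<in>carrier P. cnj (f (sstar P s)) * ell2_inner (\<pi> (sstar P s) x) y)"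
    by (rule infsum_reindex_bij_betw[OF bij_sstar, symmetric])
  also have "\<dots> = (\<Sum>\<^sub>\<infinity>s\<in>carrier P. cstar (l1_algebra I P Z) f s * ell2_inner x (\<pi> s y))"
    by (intro infsum_cong)
      (simp add: l1_sel sg_repsD[OF \<pi>] adjoint_inner'[OF H sg_repsD(1)[OF \<pi>]] x y)
  also have "\<dots> = ell2_inner x (l1_rep P (H, \<pi>) (cstar (l1_algebra I P Z) f) y)"
    unfolding l1_rep_apply[OF y] by (subst l1_comb_inner[OF H fs, of _ "ell2_norm y"]) (auto simp: orbit x y)
  finally show "ell2_inner (l1_rep P (H, \<pi>) f x) y =
      ell2_inner x (l1_rep P (H, \<pi>) (cstar (l1_algebra I P Z) f) y)" .
qed

lemma l1_rep_star_hom: "l1_rep P (H, \<pi>) \<in> star_hom (l1_algebra I P Z) (Bop H)"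
proof -
  have "l1_rep P (H, \<pi>) (\<lambda>s. f s + g s) = cadd (Bop H) (l1_rep P (H, \<pi>) f) (l1_rep P (H, \<pi>) g)"
    if f: "f abs_summable_on carrier P" and g: "g abs_summable_on carrier P" for f g
  proof
    fix x
    show "l1_rep P (H, \<pi>) (\<lambda>s. f s + g s) x = cadd (Bop H) (l1_rep P (H, \<pi>) f) (l1_rep P (H, \<pi>) g) x"
    proof (cases "x \<in> H")
      case x: True
      show ?thesis
      proof
        fix i
        have "(\<Sum>\<^sub>\<infinity>s\<in>carrier P. f s * \<pi> s x i + g s * \<pi> s x i) =
            (\<Sum>\<^sub>\<infinity>s\<in>carrier P. f s * \<pi> s x i) + (\<Sum>\<^sub>\<infinity>s\<in>carrier P. g s * \<pi> s x i)"
          by (intro infsum_add abs_summable_summable[OF l1_pointwise] f g x)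
        then show "l1_rep P (H, \<pi>) (\<lambda>s. f s + g s) x i = cadd (Bop H) (l1_rep P (H, \<pi>) f) (l1_rep P (H, \<pi>) g) x i"
          using x by (simp add: l1_rep_apply l1_comb_def vec_apply distrib_right)
      qed
    qed (simp add: l1_rep_def Bop_def)
  qed
  moreover have "l1_rep P (H, \<pi>) (\<lambda>s. c * f s) = cscale (Bop H) c (l1_rep P (H, \<pi>) f)" for c f
  proof
    fix x
    show "l1_rep P (H, \<pi>) (\<lambda>s. c * f s) x = cscale (Bop H) c (l1_rep P (H, \<pi>) f) x"
    proof (cases "x \<in> H")
      case x: True
      then show ?thesis
        by (auto simp: fun_eq_iff l1_rep_apply l1_comb_def vec_apply mult.assoc infsum_cmult_right')
    qed (simp add: l1_rep_def Bop_def)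
  qed
  ultimately show ?thesis
    using l1_rep_mult l1_rep_star l1_rep_bop
    by (auto simp: star_hom_def l1_carrier l1_sel(1,2,3))
qed

end

lemma l1_normed_by_reps:
  fixes I :: "'i itself"
  shows "normed_by_reps (l1_algebra I P Z) (sg_index P Z :: ('i vec set \<times> _) set) fst (l1_rep P)"
proof
  fix f g c assume f: "f \<in> carrier (l1_algebra I P Z)" and g: "g \<in> carrier (l1_algebra I P Z)"
  then have fa: "f abs_summable_on carrier P" "g abs_summable_on carrier P"
    and f0: "\<And>s. s \<notin> carrier P \<Longrightarrow> f s = 0" "\<And>s. s \<notin> carrier P \<Longrightarrow> g s = 0" by (auto simp: l1_carrier)
  have "(\<lambda>s. f s + g s) abs_summable_on carrier P"
  proof (rule abs_summable_on_comparison_test)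
    show "(\<lambda>s. cmod (f s) + cmod (g s)) abs_summable_on carrier P"
      using summable_on_add[OF fa] by simp
  qed (simp add: norm_triangle_ineq)
  then show "cadd (l1_algebra I P Z) f g \<in> carrier (l1_algebra I P Z)"
    using f0 by (simp add: l1_carrier l1_sel)
  have empty: "{x \<in> carrier P \<times> carrier P. (\<lambda>(s, t). smul P s t) x = r} = {}" if "r \<notin> carrier P" for r
    using that smul_closed by auto
  have "(\<Sum>\<^sub>\<infinity>x\<in>{x \<in> carrier P \<times> carrier P. (\<lambda>(s, t). smul P s t) x = r}. (\<lambda>(s, t). f s * g t) x) = 0"
    if "r \<notin> carrier P" for r by (simp only: empty[OF that] infsum_empty)
  moreover have "(\<lambda>r. \<Sum>\<^sub>\<infinity>x\<in>{x \<in> carrier P \<times> carrier P. (\<lambda>(s, t). smul P s t) x = r}. (\<lambda>(s, t). f s * g t) x)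
      abs_summable_on carrier P"
    by (rule abs_summable_fibres(1)[OF abs_summable_times[OF fa]]) (use smul_closed in auto)
  ultimately show "cmult (l1_algebra I P Z) f g \<in> carrier (l1_algebra I P Z)"
    by (simp add: l1_carrier l1_mult)
  show "cscale (l1_algebra I P Z) c f \<in> carrier (l1_algebra I P Z)"
    using f0 fa by (simp add: l1_carrier l1_sel norm_mult summable_on_cmult_right)
  show "cstar (l1_algebra I P Z) f \<in> carrier (l1_algebra I P Z)"
    unfolding l1_carrier l1_sel using l1_star_summable[OF hilbert_space_zero _ fa(1)] zero_space_index[of P Z]
    by (auto simp: sg_index_def)
  show "bdd_above ((\<lambda>j. op_norm (fst j) (l1_rep P j f)) ` (sg_index P Z :: ('i vec set \<times> _) set))"
    by (rule bdd_aboveI[where M = "\<Sum>\<^sub>\<infinity>s\<in>carrier P. cmod (f s)"]) (auto simp: sg_index_def intro!: l1_rep_norm fa)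
  have "{op_norm H (\<lambda>x\<in>H. \<lambda>i. \<Sum>\<^sub>\<infinity>s\<in>carrier P. f s * \<pi> s x i) | (H :: 'i vec set) \<pi>.
      hilbert_space H \<and> \<pi> \<in> sg_reps P H \<and> (\<forall>z\<in>Z. \<pi> z = zero_op H)}
    = (\<lambda>j. op_norm (fst j) (l1_rep P j f)) ` (sg_index P Z :: ('i vec set \<times> _) set)"
    unfolding sg_index_def l1_rep_def l1_comb_def by (rule Collect_pair_image[of "\<lambda>H \<pi>. op_norm H (\<lambda>x\<in>H. \<lambda>i. \<Sum>\<^sub>\<infinity>s\<in>carrier P. f s * \<pi> s x i)"
        "\<lambda>H \<pi>. hilbert_space H \<and> \<pi> \<in> sg_reps P H \<and> (\<forall>z\<in>Z. \<pi> z = zero_op H)"])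
  then show "cnorm (l1_algebra I P Z) f = Sup ((\<lambda>j. op_norm (fst j) (l1_rep P j f)) ` (sg_index P Z :: ('i vec set \<times> _) set))"
    by (simp add: l1_algebra_def)
next
  fix j :: "'i vec set \<times> ('p \<Rightarrow> 'i operator)" assume "j \<in> sg_index P Z"
  then obtain H \<pi> where j: "j = (H, \<pi>)" "hilbert_space H" "\<pi> \<in> sg_reps P H" by (auto simp: sg_index_def)
  show "hilbert_space (fst j)" "l1_rep P j \<in> star_hom (l1_algebra I P Z) (Bop (fst j))"
    using j l1_rep_star_hom by auto
  show "l1_rep P j (czero (l1_algebra I P Z)) = zero_op (fst j)"
    by (simp add: j l1_sel l1_rep_def l1_comb_def zero_op_def)
qed (use zero_space_index in \<open>auto simp: l1_carrier l1_sel\<close>)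

end

lemma (in normed_by_reps) to_completion_add:
  "x \<in> carrier A \<Longrightarrow> y \<in> carrier A \<Longrightarrow>
    to_completion A (cadd A x y) = cadd (completion A) (to_completion A x) (to_completion A y)"
  by (simp add: to_completion_def compl_add cauchy_const)

lemma (in normed_by_reps) to_completion_scale:
  "x \<in> carrier A \<Longrightarrow> to_completion A (cscale A c x) = cscale (completion A) c (to_completion A x)"
  by (simp add: to_completion_def compl_scale cauchy_const)

text \<open>Two approximations are combined: elements of the completion by elements of
  \<open>A\<close>, and these, in the seminorm, by elements whose images lie in
  \<open>K\<close>.\<close>

lemma (in normed_by_reps) completion_subspace_dense:
  assumes K: "closed_subspace (completion A) K"
    and dense: "\<And>x e. x \<in> carrier A \<Longrightarrow> e > 0 \<Longrightarrow> \<exists>d\<in>carrier A. to_completion A d \<in> K \<and> cnorm A (cdiff A d x) < e"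
  shows "carrier (completion A) \<subseteq> K"
proof
  interpret C: rep_cstar "completion A" J Hs compl_rep by (rule completion_rep_cstar)
  fix U assume U: "U \<in> carrier (completion A)"
  have "\<exists>d\<in>carrier A. to_completion A d \<in> K \<and>
    cnorm (completion A) (cdiff (completion A) (to_completion A d) U) < 1 / real (Suc n)" for n
  proof -
    define e where "e = 1 / real (Suc n)"
    have e: "e / 2 > 0" by (simp add: e_def)
    obtain x where x: "x \<in> carrier A"
      "cnorm (completion A) (cdiff (completion A) (to_completion A x) U) < e / 2"
      using to_completion_dense[OF U e] by blast
    obtain d where d: "d \<in> carrier A" "to_completion A d \<in> K" "cnorm A (cdiff A d x) < e / 2"
      using dense[OF x(1) e] by blast
    have "cnorm (completion A) (cdiff (completion A) (to_completion A d) U) \<le>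
      cnorm (completion A) (cdiff (completion A) (to_completion A d) (to_completion A x)) +
      cnorm (completion A) (cdiff (completion A) (to_completion A x) U)"
      by (rule C.norm_diff_triangle) (simp_all add: to_completion_closed x d U)
    then show ?thesis using d x unfolding e_def[symmetric] by (intro bexI[of _ d]) (auto simp: to_completion_isometric)
  qed
  then obtain d where d: "\<And>n. d n \<in> carrier A" "\<And>n. to_completion A (d n) \<in> K"
    "\<And>n. cnorm (completion A) (cdiff (completion A) (to_completion A (d n)) U) < 1 / real (Suc n)" by metis
  have "C.conv (\<lambda>n. to_completion A (d n)) U"
    unfolding C.conv_def
    by (intro conjI allI to_completion_closed d U
        real_tendsto_sandwich[OF _ _ tendsto_const LIMSEQ_Suc[OF lim_1_over_n]] always_eventually
        C.norm_nonneg C.closed order.strict_implies_order[OF d(3)])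
  then show "U \<in> K" using C.conv_in_closed_subspace[OF K] d(2) by blast
qed

lemma star_hom_comp:
  "f \<in> star_hom A B \<Longrightarrow> g \<in> star_hom B C \<Longrightarrow> (\<lambda>x. g (f x)) \<in> star_hom A C"
  unfolding star_hom_def by (auto simp: Pi_iff)

lemma hom_unique:
  assumes A: "rep_cstar A J Hs \<rho>" and B: "rep_cstar B K Ls \<sigma>"
    and f: "f \<in> star_hom A B" and g: "g \<in> star_hom A B"
    and G: "generates A G" and eq: "\<And>x. x \<in> G \<Longrightarrow> f x = g x" and x: "x \<in> carrier A"
  shows "f x = g x"
proof -
  interpret A: rep_cstar A J Hs \<rho> by (rule A)
  interpret B: rep_cstar B K Ls \<sigma> by (rule B)
  show ?thesis
  proof (rule B.separated)
    fix k assume k: "k \<in> K"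
    show "\<sigma> k (f x) = \<sigma> k (g x)"
      by (rule A.star_hom_unique[OF B.hs[OF k] star_hom_comp[OF f B.hom[OF k]] star_hom_comp[OF g B.hom[OF k]] G _ x])
        (simp add: eq)
  qed (use f g x in \<open>auto simp: star_hom_def\<close>)
qed

definition isg_rep :: "'p star_semigroup \<Rightarrow> ('i vec set \<times> ('p \<Rightarrow> 'i operator)) \<Rightarrow>
    (nat \<Rightarrow> 'p \<Rightarrow> complex) set \<Rightarrow> 'i operator" where
  "isg_rep P = normed_by_reps.compl_rep fst (l1_rep P)"

context regular_star_semigroup
begin

theorem isg_rep_cstar:
  fixes I :: "'i itself"
  shows "rep_cstar (isg_cstar I P Z) (sg_index P Z :: ('i vec set \<times> _) set) fst (isg_rep P)"
  unfolding isg_cstar_def isg_rep_def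
  by (rule normed_by_reps.completion_rep_cstar[OF l1_normed_by_reps])

lemma monomial_l1: "s \<in> carrier P \<Longrightarrow> monomial s \<in> carrier (l1_algebra I P Z)"
proof -
  assume s: "s \<in> carrier P"
  have "(\<lambda>t. cmod (monomial s t)) summable_on carrier P \<longleftrightarrow> (\<lambda>t. cmod (monomial s t)) summable_on {s}"
    by (rule summable_on_cong_neutral) (use s in \<open>auto simp: monomial_def\<close>)
  then show ?thesis using s by (auto simp: l1_carrier monomial_def)
qed

lemma isg_gen_closed:
  fixes I :: "'i itself"
  assumes "s \<in> carrier P" shows "isg_gen I P Z s \<in> carrier (isg_cstar I P Z)"
  unfolding isg_gen_def isg_cstar_def
  by (rule normed_by_reps.to_completion_closed[OF l1_normed_by_reps monomial_l1[OF assms]])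

lemma isg_rep_gen:
  fixes I :: "'i itself" and j :: "'i vec set \<times> _"
  assumes j: "j \<in> sg_index P Z" and s: "s \<in> carrier P"
  shows "isg_rep P j (isg_gen I P Z s) = snd j s"
proof -
  obtain H \<pi> where j': "j = (H, \<pi>)" "hilbert_space H" "\<pi> \<in> sg_reps P H" using j by (auto simp: sg_index_def)
  have "isg_rep P j (isg_gen I P Z s) = l1_rep P j (monomial s)"
    unfolding isg_gen_def isg_rep_def
    by (rule normed_by_reps.compl_rep_to_completion[OF l1_normed_by_reps j monomial_l1[OF s]])
  also have "\<dots> = \<pi> s"
  proof (rule bop_eqI[OF j'(2)])
    show "l1_rep P j (monomial s) \<in> bounded_ops H"
      using monomial_l1[OF s, of I Z] unfolding j'(1) by (intro l1_rep_bop[OF j'(2,3)]) (simp add: l1_carrier)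
    fix x assume x: "x \<in> H"
    have "(\<Sum>\<^sub>\<infinity>t\<in>carrier P. monomial s t * \<pi> t x i) = (\<Sum>\<^sub>\<infinity>t\<in>{s}. \<pi> s x i)" for i
      by (rule infsum_cong_neutral) (use s in \<open>auto simp: monomial_def\<close>)
    then show "l1_rep P j (monomial s) x = \<pi> s x"
      using x by (simp add: j' l1_rep_def l1_comb_def)
  qed (use sg_repsD(1)[OF j'(3)] s in auto)
  finally show ?thesis by (simp add: j')
qed

text \<open>The linear span suffices since the generators are closed under products; finitely
  supported functions are dense because the \<open>l1\<close> norm dominates the seminorm. The form
  with \<open>spans\<close> serves where the set to be filled out is only known to be a closed
  subspace, as in \<open>PC_unit\<close> and \<open>alg_action_induced\<close>.\<close>

lemma isg_gen_spans:
  fixes I :: "'i itself"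
  shows "spans (isg_cstar I P Z) (isg_gen I P Z ` carrier P)"
  unfolding spans_def
proof (intro conjI allI impI)
  let ?D = "l1_algebra I P Z"
  interpret D: normed_by_reps ?D "sg_index P Z :: ('i vec set \<times> _) set" fst "l1_rep P" by (rule l1_normed_by_reps)
  show "isg_gen I P Z ` carrier P \<subseteq> carrier (isg_cstar I P Z)" by (auto intro: isg_gen_closed)
  fix K assume K: "closed_subspace (isg_cstar I P Z) K" and gen: "isg_gen I P Z ` carrier P \<subseteq> K"
  note KD = closed_subspaceD[OF K]
  have fin: "f \<in> carrier ?D \<and> to_completion ?D f \<in> K" if "finite F" "F \<subseteq> carrier P" "\<And>s. s \<notin> F \<Longrightarrow> f s = 0" for F f
    using that
  proof (induction F arbitrary: f rule: finite_induct)
    case empty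
    then have "f = czero ?D" by (auto simp: l1_sel)
    then show ?case using KD(2) D.zero_closed by (simp add: isg_cstar_def D.compl_zero to_completion_def)
  next
    case (insert s F)
    let ?g = "f(s := 0)"
    have g: "?g \<in> carrier ?D" "to_completion ?D ?g \<in> K" using insert by auto
    have m: "monomial s \<in> carrier ?D" "to_completion ?D (monomial s) \<in> K"
      using insert gen by (auto simp: monomial_l1 isg_gen_def)
    have f: "f = cadd ?D ?g (cscale ?D (f s) (monomial s))"
      by (auto simp: l1_sel monomial_def fun_eq_iff)
    have "to_completion ?D f = cadd (isg_cstar I P Z) (to_completion ?D ?g)
        (cscale (isg_cstar I P Z) (f s) (to_completion ?D (monomial s)))"
      using g(1) m(1) unfolding isg_cstar_def by (subst f) (simp only: D.to_completion_add D.to_completion_scale D.scale_closed)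
    moreover have "f \<in> carrier ?D" by (subst f) (intro D.closed g m)
    ultimately show ?case using KD(3,4) g(2) m(2) by simp
  qed
  show "carrier (isg_cstar I P Z) \<subseteq> K"
    unfolding isg_cstar_def
  proof (rule D.completion_subspace_dense)
    show "closed_subspace (completion ?D) K" using K by (simp add: isg_cstar_def)
    fix f :: "'p \<Rightarrow> complex" and e :: real assume f: "f \<in> carrier ?D" and e: "e > 0"
    then have fa: "f abs_summable_on carrier P" by (simp add: l1_carrier)
    obtain F where F: "finite F" "F \<subseteq> carrier P"
      "dist (\<Sum>s\<in>F. cmod (f s)) (\<Sum>\<^sub>\<infinity>s\<in>carrier P. cmod (f s)) \<le> e / 2"
      using infsum_finite_approximation[OF fa, of "e / 2"] e by auto
    define d where "d = (\<lambda>s. if s \<in> F then f s else 0)"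
    have d: "d \<in> carrier ?D" "to_completion ?D d \<in> K" using fin[OF F(1,2), of d] by (auto simp: d_def)
    have dd: "cdiff ?D d f = (\<lambda>s. if s \<in> F then 0 else - f s)"
      by (auto simp: cdiff_def l1_sel d_def fun_eq_iff)
    have "cnorm ?D (cdiff ?D d f) \<le> (\<Sum>\<^sub>\<infinity>s\<in>carrier P. cmod (cdiff ?D d f s))"
      using D.diff_closed[OF d(1) f]
      by (intro D.norm_leI) (auto simp: sg_index_def l1_carrier intro!: l1_rep_norm)
    also have "\<dots> = (\<Sum>\<^sub>\<infinity>s\<in>carrier P - F. cmod (f s))"
      by (rule infsum_cong_neutral) (auto simp: dd)
    also have "\<dots> = (\<Sum>\<^sub>\<infinity>s\<in>carrier P. cmod (f s)) - (\<Sum>s\<in>F. cmod (f s))"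
      using F fa by (simp add: infsum_Diff)
    also have "\<dots> < e" using F(3) e unfolding dist_real_def by linarith
    finally show "\<exists>d\<in>carrier ?D. to_completion ?D d \<in> K \<and> cnorm ?D (cdiff ?D d f) < e" using d by blast
  qed
qed

lemmas isg_gen_generates = spans_generates[OF isg_gen_spans]

lemma isg_gen_mult:
  fixes I :: "'i itself"
  assumes "s \<in> carrier P" "t \<in> carrier P"
  shows "cmult (isg_cstar I P Z) (isg_gen I P Z s) (isg_gen I P Z t) = isg_gen I P Z (smul P s t)"
proof -
  interpret C: rep_cstar "isg_cstar I P Z" "sg_index P Z :: ('i vec set \<times> _) set" fst "isg_rep P" by (rule isg_rep_cstar)
  show ?thesis
    using assms by (intro C.separated C.closed isg_gen_closed smul_closed)
      (auto simp: C.rep_mult isg_gen_closed isg_rep_gen smul_closed sg_index_def sg_repsD)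
qed

lemma isg_gen_star:
  fixes I :: "'i itself"
  assumes "s \<in> carrier P"
  shows "cstar (isg_cstar I P Z) (isg_gen I P Z s) = isg_gen I P Z (sstar P s)"
proof -
  interpret C: rep_cstar "isg_cstar I P Z" "sg_index P Z :: ('i vec set \<times> _) set" fst "isg_rep P" by (rule isg_rep_cstar)
  show ?thesis
    using assms by (intro C.separated C.closed isg_gen_closed sstar_closed)
      (auto simp: C.rep_star isg_gen_closed isg_rep_gen sstar_closed sg_index_def sg_repsD)
qed

lemma isg_gen_zero:
  fixes I :: "'i itself"
  assumes "z \<in> Z" "z \<in> carrier P"
  shows "isg_gen I P Z z = czero (isg_cstar I P Z)"
proof -
  interpret C: rep_cstar "isg_cstar I P Z" "sg_index P Z :: ('i vec set \<times> _) set" fst "isg_rep P" by (rule isg_rep_cstar)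
  show ?thesis
    using assms by (intro C.separated C.closed isg_gen_closed)
      (auto simp: C.rep_zero isg_rep_gen, auto simp: sg_index_def)
qed

lemma star_hom_restrict:
  fixes I :: "'i itself" and H :: "'k vec set"
  assumes H: "hilbert_space H" and \<pi>: "\<pi> \<in> star_hom (isg_cstar I P Z) (Bop H)" and Z: "Z \<subseteq> carrier P"
  shows "(H, \<lambda>s. \<pi> (isg_gen I P Z s)) \<in> sg_index P Z"
proof -
  interpret C: rep_cstar "isg_cstar I P Z" "sg_index P Z :: ('i vec set \<times> _) set" fst "isg_rep P" by (rule isg_rep_cstar)
  note \<pi>D = star_hom_BopD[OF \<pi>]
  have "(\<lambda>s. \<pi> (isg_gen I P Z s)) \<in> sg_reps P H"
    by (intro sg_repsI) (auto simp: \<pi>D isg_gen_closed simp flip: isg_gen_mult isg_gen_star)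
  moreover have "\<pi> (isg_gen I P Z z) = zero_op H" if "z \<in> Z" for z
    using that Z C.star_hom_zero[OF H \<pi>] by (simp add: isg_gen_zero subset_iff)
  ultimately show ?thesis using H by (simp add: sg_index_def)
qed

text \<open>Recognizes a given representation as one of the indexing ones by its values on the
  generators, so that it can be compared with the values used in \<open>matched_hom\<close>.\<close>

lemma star_hom_eq_isg_rep:
  fixes I :: "'i itself" and H :: "'i vec set"
  assumes H: "hilbert_space H" and \<pi>: "\<pi> \<in> star_hom (isg_cstar I P Z) (Bop H)" and Z: "Z \<subseteq> carrier P"
    and x: "x \<in> carrier (isg_cstar I P Z)" and p: "\<And>s. s \<in> carrier P \<Longrightarrow> \<pi> (isg_gen I P Z s) = p s"
    and pH: "(H, p) \<in> sg_index P Z"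
  shows "\<pi> x = isg_rep P (H, p) x"
proof -
  interpret C: rep_cstar "isg_cstar I P Z" "sg_index P Z :: ('i vec set \<times> _) set" fst "isg_rep P" by (rule isg_rep_cstar)
  have "isg_rep P (H, p) \<in> star_hom (isg_cstar I P Z) (Bop H)" using C.hom[OF pH] by simp
  then show ?thesis
    by (rule C.star_hom_unique[OF H \<pi> _ isg_gen_generates _ x]) (auto simp: isg_rep_gen[OF pH] p)
qed

text \<open>Functoriality: pulling representations of \<open>Q\<close> back along \<open>h\<close>
  maps the index set of \<open>Q\<close> into that of \<open>P\<close>, so
  \<open>matched_hom\<close> applies. The condition on \<open>Z\<close> ensures that the pulled back
  representation kills what it has to.\<close>

lemma isg_map:
  fixes I :: "'i itself" and Q :: "'q star_semigroup"
  assumes Q: "regular_star_semigroup Q" and h: "h \<in> star_semigroup_hom P Q" and Z: "h ` Z \<subseteq> Z'"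
  shows "\<exists>f\<in>star_hom (isg_cstar I P Z) (isg_cstar I Q Z'). \<forall>s\<in>carrier P. f (isg_gen I P Z s) = isg_gen I Q Z' (h s)"
proof -
  interpret Q: regular_star_semigroup Q by (rule Q)
  interpret C: rep_cstar "isg_cstar I P Z" "sg_index P Z :: ('i vec set \<times> _) set" fst "isg_rep P" by (rule isg_rep_cstar)
  interpret D: rep_cstar "isg_cstar I Q Z'" "sg_index Q Z' :: ('i vec set \<times> _) set" fst "isg_rep Q" by (rule Q.isg_rep_cstar)
  define m :: "'i vec set \<times> ('q \<Rightarrow> 'i operator) \<Rightarrow> 'i vec set \<times> ('p \<Rightarrow> 'i operator)"
    where "m k = (fst k, \<lambda>s. snd k (h s))" for k
  have hc: "s \<in> carrier P \<Longrightarrow> h s \<in> carrier Q" for s using h by (auto simp: star_semigroup_hom_def)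
  have m: "m k \<in> sg_index P Z" if "k \<in> sg_index Q Z'" for k
    using that Z h unfolding sg_index_def m_def
    by (auto intro!: sg_repsI simp: star_semigroup_hom_def Pi_iff sg_repsD)
  have fm: "fst (m k) = fst k" for k by (simp add: m_def)
  have match: "\<exists>y\<in>carrier (isg_cstar I Q Z'). \<forall>k\<in>sg_index Q Z'. isg_rep Q k y = isg_rep P (m k) g"
    if g: "g \<in> isg_gen I P Z ` carrier P" for g
  proof -
    obtain s where s: "s \<in> carrier P" "g = isg_gen I P Z s" using g by blast
    then show ?thesis
      by (intro bexI[of _ "isg_gen I Q Z' (h s)"])
        (auto simp: Q.isg_rep_gen isg_rep_gen hc m Q.isg_gen_closed, simp add: m_def)
  qed
  obtain f where f: "f \<in> star_hom (isg_cstar I P Z) (isg_cstar I Q Z')"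
    "\<forall>x\<in>carrier (isg_cstar I P Z). \<forall>k\<in>sg_index Q Z'. isg_rep Q k (f x) = isg_rep P (m k) x"
    using matched_hom[OF isg_rep_cstar Q.isg_rep_cstar m fm isg_gen_generates match] by blast
  have "f (isg_gen I P Z s) = isg_gen I Q Z' (h s)" if s: "s \<in> carrier P" for s
  proof (rule D.separated)
    show "f (isg_gen I P Z s) \<in> carrier (isg_cstar I Q Z')" using f(1) isg_gen_closed[OF s] by (auto simp: star_hom_def)
    show "isg_rep Q k (f (isg_gen I P Z s)) = isg_rep Q k (isg_gen I Q Z' (h s))"
      if "k \<in> sg_index Q Z'" for k :: "'i vec set \<times> _"
      using that s by (simp add: f isg_gen_closed isg_rep_gen[OF m] Q.isg_rep_gen hc) (simp add: m_def)
  qed (simp add: Q.isg_gen_closed hc s)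
  then show ?thesis using f(1) by blast
qed

end

section \<open>Algebra in \<open>S*\<close>: idempotents and conjugation\<close>

section \<open>The inverse semigroup of a left cancellative monoid\<close>

lemma word_star_append [simp]: "word_star (u @ v) = word_star v @ word_star u"
  and word_star_word_star [simp]: "word_star (word_star u) = u"
  and word_star_Nil [simp]: "word_star [] = []"
  and word_star_Cons: "word_star ((g, b) # u) = word_star u @ [(g, \<not> b)]"
  by (auto simp: word_star_def rev_map comp_def case_prod_unfold)

definition cls :: "'s::monoid_mult word \<Rightarrow> 's word set" where
  "cls u = {w. isg_cong u w}"

lemma cls_eq_iff: "cls u = cls v \<longleftrightarrow> isg_cong u v"
  unfolding cls_def using isg_refl isg_sym isg_trans by blast

lemma cls_eqI: "isg_cong u v \<Longrightarrow> cls u = cls v"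
  by (simp add: cls_eq_iff)

lemma self_in_cls: "u \<in> cls u"
  by (simp add: cls_def isg_refl)

lemma cls_someI: "cls (SOME w. w \<in> cls u) = cls u"
proof -
  have "(SOME w. w \<in> cls u) \<in> cls u" by (rule someI[of "\<lambda>w. w \<in> cls u", OF self_in_cls])
  then show ?thesis by (metis cls_def cls_eqI mem_Collect_eq)
qed

context
  fixes S :: "'s::monoid_mult itself"
begin

abbreviation "P \<equiv> universal_isg S"

lemma P_carrier: "carrier P = range cls"
  by (auto simp: universal_isg_def quotient_def cls_def)

lemma P_mult: "smul P (cls u) (cls v) = cls (u @ v)"
  unfolding universal_isg_def cls_def using isg_append isg_refl isg_trans isg_sym by (simp; blast)

lemma P_star: "sstar P (cls u) = cls (word_star u)"
  unfolding universal_isg_def cls_def using isg_star isg_refl isg_trans isg_sym by (simp; blast)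

lemma P_E:
  assumes "p \<in> carrier P" obtains w where "p = cls w"
  using assms by (auto simp: P_carrier)

lemma cls_closed [simp]: "cls w \<in> carrier P"
  by (simp add: P_carrier)

lemma P_mult_closed: "p \<in> carrier P \<Longrightarrow> q \<in> carrier P \<Longrightarrow> smul P p q \<in> carrier P"
  by (auto elim!: P_E simp: P_mult)

lemma P_star_closed: "p \<in> carrier P \<Longrightarrow> sstar P p \<in> carrier P"
  by (auto elim!: P_E simp: P_star)

lemma P_assoc: "p \<in> carrier P \<Longrightarrow> q \<in> carrier P \<Longrightarrow> r \<in> carrier P \<Longrightarrow> smul P (smul P p q) r = smul P p (smul P q r)"
  by (auto elim!: P_E simp: P_mult)

lemma P_star_star: "p \<in> carrier P \<Longrightarrow> sstar P (sstar P p) = p"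
  by (auto elim!: P_E simp: P_star)

lemma P_star_mult: "p \<in> carrier P \<Longrightarrow> q \<in> carrier P \<Longrightarrow> sstar P (smul P p q) = smul P (sstar P q) (sstar P p)"
  by (auto elim!: P_E simp: P_mult P_star)

lemma P_regular: "p \<in> carrier P \<Longrightarrow> smul P p (smul P (sstar P p) p) = p"
  by (elim P_E) (simp add: P_mult P_star cls_eq_iff isg_inverse)

lemma P_commute:
  "p \<in> carrier P \<Longrightarrow> q \<in> carrier P \<Longrightarrow>
    smul P (smul P p (sstar P p)) (smul P q (sstar P q)) = smul P (smul P q (sstar P q)) (smul P p (sstar P p))"
  by (elim P_E) (simp add: P_mult P_star cls_eq_iff isg_commute)

lemma P_unit: "p \<in> carrier P \<Longrightarrow> smul P (cls []) p = p" "p \<in> carrier P \<Longrightarrow> smul P p (cls []) = p"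
  by (auto elim!: P_E simp: P_mult)

lemma P_unit_element: "is_unit_element P u \<longleftrightarrow> u = cls []"
  using P_unit unfolding is_unit_element_def by (metis cls_closed)

lemma P_regular_star_semigroup: "regular_star_semigroup P"
  by standard (simp_all add: P_mult_closed P_star_closed P_star_star P_regular)

lemma isometry_relation: "smul P (cls [(s, True)]) (cls [(s, False)]) = cls []"
  by (simp add: P_mult cls_eqI isg_isometry)

lemma product_relation: "smul P (cls [(s, False)]) (cls [(t, False)]) = cls [(s * t, False)]"
  by (simp add: P_mult cls_eqI isg_product)

text \<open>Write \<open>f\<close> for the adjoint of \<open>e\<close>; it is idempotent too. Then
  \<open>f = f e f = (f e) (e f)\<close>, and commuting these two range projections gives
  \<open>(e f) (f e) = e f e = e\<close>.\<close>

lemma idempotent_selfadjoint: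
  assumes e: "e \<in> carrier P" "smul P e e = e"
  shows "sstar P e = e"
proof -
  let ?f = "sstar P e"
  have f: "?f \<in> carrier P" using e P_star_closed by blast
  have ff: "smul P ?f ?f = ?f" using P_star_mult[OF e(1,1)] e(2) by simp
  have "?f = smul P ?f (smul P e ?f)" using P_regular[OF f] P_star_star[OF e(1)] by simp
  also have "\<dots> = smul P ?f (smul P (smul P e e) ?f)" using e by simp
  also have "\<dots> = smul P (smul P ?f e) (smul P e ?f)" using e(1) f by (simp add: P_assoc P_mult_closed)
  also have "\<dots> = smul P (smul P e ?f) (smul P ?f e)" using P_commute[OF f e(1)] P_star_star[OF e(1)] by simp
  also have "\<dots> = smul P e (smul P (smul P ?f ?f) e)" using e f by (simp add: P_assoc P_mult_closed)
  also have "\<dots> = e" using P_regular[OF e(1)] by (simp add: ff)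
  finally show ?thesis .
qed

abbreviation "E \<equiv> idempotents P"

lemma E_sel: "smul E = smul P" "sstar E = sstar P"
  by (simp_all add: idempotents_def)

lemma E_carrier: "e \<in> carrier E \<longleftrightarrow> e \<in> carrier P \<and> smul P e e = e"
  by (simp add: idempotents_def)

lemma E_star: "e \<in> carrier E \<Longrightarrow> sstar P e = e"
  by (simp add: E_carrier idempotent_selfadjoint)

text \<open>A selfadjoint idempotent \<open>e\<close> equals \<open>e e*\<close>, so the commutation
  of range projections applies.\<close>

lemma E_commute:
  assumes "e \<in> carrier E" "f \<in> carrier E" shows "smul P e f = smul P f e"
  using assms P_commute[of e f] E_star[OF assms(1)] E_star[OF assms(2)] by (simp add: E_carrier)

lemma E_mult_closed:
  assumes "e \<in> carrier E" "f \<in> carrier E" shows "smul P e f \<in> carrier E"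
proof -
  have c: "e \<in> carrier P" "f \<in> carrier P" "smul P e e = e" "smul P f f = f" using assms by (auto simp: E_carrier)
  have "smul P (smul P e f) (smul P e f) = smul P e (smul P (smul P f e) f)" using c by (simp add: P_assoc P_mult_closed)
  also have "\<dots> = smul P (smul P e e) (smul P f f)"
    using c(1,2) E_commute[OF assms(2,1)] by (simp add: P_assoc P_mult_closed)
  finally show ?thesis using c by (simp add: E_carrier P_mult_closed)
qed

lemma E_regular_star_semigroup: "regular_star_semigroup E"
  by standard (simp_all add: E_sel E_star E_mult_closed, simp_all add: E_carrier)

lemma unit_in_E: "cls [] \<in> carrier E"
  by (simp add: E_carrier P_mult)

lemma mult_star_in_E: "p \<in> carrier P \<Longrightarrow> smul P p (sstar P p) \<in> carrier E"
  by (simp add: E_carrier P_assoc P_mult_closed P_star_closed)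
    (metis P_assoc P_mult_closed P_regular P_star_closed)

lemma zero_in_E: "zero_elements P \<subseteq> carrier E"
  by (auto simp: zero_elements_def E_carrier)

text \<open>\<open>p e p*\<close> is the range projection of \<open>p e\<close>.\<close>

lemma conj_in_E:
  assumes p: "p \<in> carrier P" and e: "e \<in> carrier E"
  shows "smul P p (smul P e (sstar P p)) \<in> carrier E"
proof -
  have c: "e \<in> carrier P" "smul P e e = e" "sstar P e = e" using e E_star by (auto simp: E_carrier)
  have "smul P (smul P p e) (sstar P (smul P p e)) = smul P p (smul P (smul P e e) (sstar P p))"
    using c(1,3) p by (simp add: P_star_mult P_assoc P_mult_closed P_star_closed)
  then show ?thesis using mult_star_in_E[of "smul P p e"] c p by (simp add: P_mult_closed)
qed

text \<open>The middle factor \<open>p* p\<close> is idempotent, commutes past \<open>e\<close> and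
  is absorbed by \<open>p\<close>.\<close>

lemma conj_mult:
  assumes p: "p \<in> carrier P" and e: "e \<in> carrier E" and f: "f \<in> carrier E"
  shows "smul P (smul P p (smul P e (sstar P p))) (smul P p (smul P f (sstar P p)))
    = smul P p (smul P (smul P e f) (sstar P p))"
proof -
  let ?q = "smul P (sstar P p) p"
  have c: "e \<in> carrier P" "f \<in> carrier P" "sstar P p \<in> carrier P" "?q \<in> carrier P"
    using e f p by (auto simp: E_carrier P_star_closed P_mult_closed)
  have q: "?q \<in> carrier E" using mult_star_in_E[OF c(3)] p by (simp add: P_star_star)
  have "smul P (smul P p (smul P e (sstar P p))) (smul P p (smul P f (sstar P p)))
      = smul P p (smul P (smul P e ?q) (smul P f (sstar P p)))"
    using c p by (simp add: P_assoc P_mult_closed)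
  also have "smul P e ?q = smul P ?q e" by (rule E_commute[OF e q])
  also have "smul P p (smul P (smul P ?q e) (smul P f (sstar P p)))
      = smul P (smul P p ?q) (smul P (smul P e f) (sstar P p))"
    using c p by (simp add: P_assoc P_mult_closed)
  also have "smul P p ?q = p" by (rule P_regular[OF p])
  finally show ?thesis .
qed

lemma conj_hom:
  assumes p: "p \<in> carrier P"
  shows "(\<lambda>e. smul P p (smul P e (sstar P p))) \<in> star_semigroup_hom E E"
proof -
  have "smul P p (smul P (sstar P e) (sstar P p)) = sstar P (smul P p (smul P e (sstar P p)))" if "e \<in> carrier E" for e
    using E_star[OF that] E_star[OF conj_in_E[OF p that]] by simp
  then show ?thesis
    by (auto simp: star_semigroup_hom_def E_sel conj_in_E[OF p] conj_mult[OF p])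
qed

end

section \<open>From isometries and commuting projections to representations of
  \<open>S*\<close>\<close>

section \<open>Representations from isometries\<close>

context
  fixes H :: "'i vec set" and G :: "'g set" and T :: "'g \<Rightarrow> 'i operator"
  assumes H: "hilbert_space H" and T: "\<And>g. g \<in> G \<Longrightarrow> T g \<in> bounded_ops H"
begin

lemma letter_bop_on: "g \<in> G \<Longrightarrow> (if b then adjoint H (T g) else T g) \<in> bounded_ops H"
  by (simp add: T Bop_closed[OF H])

lemma word_op_bop_on: "fst ` set w \<subseteq> G \<Longrightarrow> word_op H T w \<in> bounded_ops H"
proof (induction w)
  case (Cons a w)
  then show ?case by (cases a) (auto simp: Bop_closed[OF H] T)
qed (simp add: Bop_closed[OF H])

lemma word_op_append_on:
  "fst ` set v \<subseteq> G \<Longrightarrow> word_op H T (u @ v) = compose H (word_op H T u) (word_op H T v)"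
proof (induction u)
  case (Cons a u)
  then show ?case by (cases a) (simp only: append_Cons word_op.simps compose_assoc'[OF H word_op_bop_on])
qed (simp add: compose_id_left[OF H word_op_bop_on])

lemma word_op_star_on: "fst ` set w \<subseteq> G \<Longrightarrow> word_op H T (word_star w) = adjoint H (word_op H T w)"
proof (induction w)
  case (Cons a w)
  obtain g b where a: "a = (g, b)" by fastforce
  have g: "g \<in> G" and w: "fst ` set w \<subseteq> G" using Cons.prems by (auto simp: a)
  have adj: "adjoint H (if b then adjoint H (T g) else T g) = (if \<not> b then adjoint H (T g) else T g)"
    by (simp add: adjoint_adjoint[OF H T[OF g]])
  have "word_op H T (word_star (a # w))
      = compose H (adjoint H (word_op H T w)) (if \<not> b then adjoint H (T g) else T g)"
    using g by (simp only: a word_star_Cons word_op_append_on[of "[(g, \<not> b)]"] Cons.IH[OF w] word_op.simps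
        compose_id_right[OF H letter_bop_on] list.set image_insert image_empty fst_conv insert_subset empty_subsetI)
  also have "\<dots> = adjoint H (word_op H T (a # w))"
    by (simp only: a word_op.simps adjoint_compose[OF H letter_bop_on[OF g] word_op_bop_on[OF w]] adj)
  finally show ?case .
qed (simp add: adjoint_id[OF H])

end

text \<open>\<open>F\<close> collects the images of the idempotents: the values of a covariant pair
  on the generators of C*(E) in one application, the projections \<open>e_X\<close> in the other.
  Stability under conjugation in both directions puts the range projection of every word into
  \<open>F\<close>, where it commutes with all the others.\<close>

locale isometries_and_projections =
  fixes H :: "'i vec set" and T :: "'s::monoid_mult \<Rightarrow> 'i operator" and F :: "'i operator set"
  assumes H: "hilbert_space H"
    and T_bop: "\<And>s. T s \<in> bounded_ops H"
    and T_isometry: "\<And>s. compose H (adjoint H (T s)) (T s) = id_op H"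
    and T_mult: "\<And>s t. T (s * t) = compose H (T s) (T t)"
    and F_bop: "\<And>X. X \<in> F \<Longrightarrow> X \<in> bounded_ops H"
    and F_idem: "\<And>X. X \<in> F \<Longrightarrow> compose H X X = X"
    and F_commute: "\<And>X Y. X \<in> F \<Longrightarrow> Y \<in> F \<Longrightarrow> compose H X Y = compose H Y X"
    and F_id: "id_op H \<in> F"
    and F_conj: "\<And>s X. X \<in> F \<Longrightarrow> compose H (T s) (compose H X (adjoint H (T s))) \<in> F"
    and F_conj': "\<And>s X. X \<in> F \<Longrightarrow> compose H (adjoint H (T s)) (compose H X (T s)) \<in> F"
begin

lemma letter_bop: "(if b then adjoint H (T g) else T g) \<in> bounded_ops H"
  by (simp add: T_bop Bop_closed[OF H])

lemma word_op_bop: "word_op H T w \<in> bounded_ops H"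
  by (rule word_op_bop_on[OF H, of UNIV]) (simp_all add: T_bop)

lemma word_op_append: "word_op H T (u @ v) = compose H (word_op H T u) (word_op H T v)"
  by (rule word_op_append_on[OF H, of UNIV]) (simp_all add: T_bop)

lemma word_op_star: "word_op H T (word_star w) = adjoint H (word_op H T w)"
  by (rule word_op_star_on[OF H, of UNIV]) (simp_all add: T_bop)

lemma word_op_conj:
  assumes "X \<in> F"
  shows "compose H (word_op H T w) (compose H X (adjoint H (word_op H T w))) \<in> F"
proof (induction w)
  case Nil
  then show ?case
    using assms by (simp add: adjoint_id[OF H] compose_id_right[OF H F_bop] compose_id_left[OF H F_bop])
next
  case (Cons a w)
  obtain g b where a: "a = (g, b)" by fastforce
  let ?W = "word_op H T w"
  let ?Y = "compose H ?W (compose H X (adjoint H ?W))"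
  note b = letter_bop word_op_bop F_bop[OF assms] adjoint_bop[OF H word_op_bop] adjoint_bop[OF H letter_bop]
  have "compose H (word_op H T (a # w)) (compose H X (adjoint H (word_op H T (a # w))))
      = compose H ((if b then adjoint H (T g) else T g)) (compose H ?Y (adjoint H ((if b then adjoint H (T g) else T g))))"
    by (simp only: a word_op.simps adjoint_compose[OF H letter_bop word_op_bop] compose_assoc'[OF H] b
        compose_closed[OF H])
  moreover have "compose H ((if b then adjoint H (T g) else T g)) (compose H ?Y (adjoint H ((if b then adjoint H (T g) else T g)))) \<in> F"
    using F_conj[OF Cons.IH, of g] F_conj'[OF Cons.IH, of g] by (simp add: adjoint_adjoint[OF H T_bop])
  ultimately show ?case by simp
qed

lemma word_op_range_proj: "compose H (word_op H T w) (adjoint H (word_op H T w)) \<in> F"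
  using word_op_conj[OF F_id, of w] by (simp add: compose_id_left[OF H] adjoint_bop[OF H word_op_bop])

lemma word_op_source_proj: "compose H (adjoint H (word_op H T w)) (word_op H T w) \<in> F"
  using word_op_range_proj[of "word_star w"] by (simp add: word_op_star adjoint_adjoint[OF H word_op_bop])

text \<open>\<open>F\<close> gives only that \<open>q = W* W\<close> is idempotent. Then
  \<open>y = x - q x\<close> has \<open>q y = 0\<close>, so the square of the norm of
  \<open>W y\<close>, which is \<open>ell2_inner y (q y)\<close>, vanishes.\<close>

lemma word_op_partial_isometry:
  "compose H (word_op H T w) (compose H (adjoint H (word_op H T w)) (word_op H T w)) = word_op H T w"
proof (rule bop_eqI[OF H])
  let ?W = "word_op H T w"
  let ?q = "compose H (adjoint H ?W) ?W"
  note W = word_op_bop[of w]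
  have q: "?q \<in> bounded_ops H" using W by (simp add: Bop_closed[OF H])
  fix x assume x: "x \<in> H"
  let ?y = "x - ?q x"
  have y: "?y \<in> H" by (rule hs_diff[OF H x bop_apply[OF H q x]])
  have "?q ?y = ?q x - ?q (?q x)" by (rule bop_diff[OF H q x bop_apply[OF H q x]])
  moreover have "?q (?q x) = ?q x"
    using fun_cong[OF F_idem[OF word_op_source_proj[of w]], of x] compose_apply[OF x, of ?q ?q] by simp
  ultimately have "?q ?y = 0" by simp
  then have "ell2_inner (?W ?y) (?W ?y) = 0"
    using y by (simp add: adjoint_inner[OF H W] bop_apply[OF H W])
  then have "?W ?y = 0"
    using y by (simp add: ell2_inner_self ell2_norm_eq_0 hs_ell2[OF H] bop_apply[OF H W])
  moreover have "?W ?y = ?W x - ?W (?q x)" by (rule bop_diff[OF H W x bop_apply[OF H q x]])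
  ultimately show "compose H ?W ?q x = ?W x" using x by simp
qed (use word_op_bop in \<open>auto simp: Bop_closed[OF H]\<close>)

lemma word_op_cong: "isg_cong u v \<Longrightarrow> word_op H T u = word_op H T v"
proof (induction rule: isg_cong.induct)
  case (isg_inverse w)
  show ?case using word_op_partial_isometry[of w] by (simp add: word_op_append word_op_star)
next
  case (isg_commute w u)
  show ?case
    using F_commute[OF word_op_range_proj[of w] word_op_range_proj[of u]]
    by (simp add: word_op_append word_op_star compose_assoc'[OF H] word_op_bop Bop_closed[OF H])
next
  case (isg_product p q)
  show ?case by (simp add: T_mult compose_id_right[OF H] T_bop Bop_closed[OF H])
next
  case (isg_isometry p)
  show ?case by (simp add: T_isometry compose_id_right[OF H] T_bop)
qed (simp_all add: word_op_append word_op_star)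

text \<open>A word is chosen in the class; \<open>word_op_cong\<close> makes the operator
  independent of the choice.\<close>

definition word_rep :: "'s word set \<Rightarrow> 'i operator" where
  "word_rep p = word_op H T (SOME w. w \<in> p)"

lemma word_rep_cls: "word_rep (cls w) = word_op H T w"
  unfolding word_rep_def by (rule word_op_cong) (simp add: cls_someI flip: cls_eq_iff)

lemma word_rep_sg_reps: "word_rep \<in> sg_reps (universal_isg TYPE('s)) H"
  by (rule sg_repsI; elim P_E)
    (simp_all add: word_rep_cls word_op_bop P_mult P_star word_op_append word_op_star)

end

text \<open>Round trip: after passing to a covariant pair and rebuilding a representation from the
  isometries, the original one returns. Unitality covers the empty word.\<close>

lemma sg_rep_word:
  assumes H: "hilbert_space H" and \<pi>: "\<pi> \<in> sg_reps (universal_isg TYPE('s::monoid_mult)) H"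
    and unit: "\<pi> (cls []) = id_op H"
  shows "\<pi> (cls w) = word_op H (\<lambda>s. \<pi> (cls [(s :: 's, False)])) w"
proof (induction w)
  case (Cons a w)
  obtain g b where a: "a = (g, b)" by fastforce
  have "\<pi> (cls (a # w)) = compose H (\<pi> (cls [a])) (\<pi> (cls w))"
    using sg_repsD(2)[OF \<pi>, of "cls [a]" "cls w"] by (simp add: P_mult)
  moreover have "\<pi> (cls [(g, True)]) = adjoint H (\<pi> (cls [(g, False)]))"
    using sg_repsD(3)[OF \<pi>, of "cls [(g, False)]"] by (simp add: P_star word_star_Cons)
  ultimately show ?case by (cases b) (simp_all add: a Cons)
qed (simp add: unit)

section \<open>Free *-algebras with relations and their completions\<close>

section \<open>Universal C*-algebras\<close>

lemma ell2_inner_sum_right: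
  assumes "x \<in> ell2" "\<And>k. k \<in> K \<Longrightarrow> f k \<in> ell2"
  shows "ell2_inner x (\<Sum>k\<in>K. f k) = (\<Sum>k\<in>K. ell2_inner x (f k))"
  using assms by (induction K rule: infinite_finite_induct) (auto simp: ell2_inner_add_right ell2_sum)

lemma ell2_inner_sum_left:
  assumes "x \<in> ell2" "\<And>k. k \<in> K \<Longrightarrow> f k \<in> ell2"
  shows "ell2_inner (\<Sum>k\<in>K. f k) x = (\<Sum>k\<in>K. ell2_inner (f k) x)"
  using assms by (induction K rule: infinite_finite_induct) (auto simp: ell2_inner_add_left ell2_sum)

lemma op_norm_sum:
  assumes H: "hilbert_space H" and "finite K" and b: "\<And>k. k \<in> K \<Longrightarrow> U k \<in> bounded_ops H"
    and c: "\<And>k. k \<in> K \<Longrightarrow> op_norm H (U k) \<le> c k"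
  shows "(\<lambda>x\<in>H. \<Sum>k\<in>K. U k x) \<in> bounded_ops H" "op_norm H (\<lambda>x\<in>H. \<Sum>k\<in>K. U k x) \<le> (\<Sum>k\<in>K. c k)"
proof -
  have c0: "0 \<le> c k" if "k \<in> K" for k using op_norm_nonneg[OF H b[OF that]] c[OF that] by simp
  have bound: "ell2_norm (\<Sum>k\<in>K. U k x) \<le> (\<Sum>k\<in>K. c k) * ell2_norm x" if x: "x \<in> H" for x
  proof -
    have "ell2_norm (\<Sum>k\<in>K. U k x) \<le> (\<Sum>k\<in>K. ell2_norm (U k x))"
      using b x by (intro ell2_norm_sum hs_ell2[OF H]) (auto simp: bop_apply[OF H])
    also have "\<dots> \<le> (\<Sum>k\<in>K. c k * ell2_norm x)"
    proof (rule sum_mono)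
      fix k assume k: "k \<in> K"
      show "ell2_norm (U k x) \<le> c k * ell2_norm x"
        by (rule order_trans[OF op_norm_bound[OF H b[OF k] x] mult_right_mono[OF c[OF k] ell2_norm_nonneg]])
    qed
    finally show ?thesis by (simp add: sum_distrib_right)
  qed
  show "(\<lambda>x\<in>H. \<Sum>k\<in>K. U k x) \<in> bounded_ops H"
  proof (rule bopI[OF H])
    show "(\<lambda>x\<in>H. \<Sum>k\<in>K. U k x) (x + y) = (\<lambda>x\<in>H. \<Sum>k\<in>K. U k x) x + (\<lambda>x\<in>H. \<Sum>k\<in>K. U k x) y"
      if "x \<in> H" "y \<in> H" for x y
    proof -
      have "(\<Sum>k\<in>K. U k (x + y)) = (\<Sum>k\<in>K. U k x + U k y)"
        by (intro sum.cong refl bop_add[OF H b that])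
      then show ?thesis using that by (simp add: hs_add[OF H] sum.distrib)
    qed
    show "(\<lambda>x\<in>H. \<Sum>k\<in>K. U k x) (c *\<^sub>v x) = c *\<^sub>v (\<lambda>x\<in>H. \<Sum>k\<in>K. U k x) x" if "x \<in> H" for c x
    proof -
      have "(\<Sum>k\<in>K. U k (c *\<^sub>v x)) = (\<Sum>k\<in>K. c *\<^sub>v U k x)"
        by (intro sum.cong refl bop_scale[OF H b that])
      then show ?thesis using that by (simp add: hs_scale[OF H] vscale_sum_right)
    qed
    show "ell2_norm ((\<lambda>x\<in>H. \<Sum>k\<in>K. U k x) x) \<le> (\<Sum>k\<in>K. c k) * ell2_norm x" if "x \<in> H" for x
      using bound[OF that] that by simp
  qed (use b in \<open>auto intro!: hs_sum[OF H] simp: bop_apply[OF H]\<close>)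
  show "op_norm H (\<lambda>x\<in>H. \<Sum>k\<in>K. U k x) \<le> (\<Sum>k\<in>K. c k)"
    using bound c0 by (intro op_norm_le[OF H] sum_nonneg) auto
qed

definition rel_index :: "('i vec set \<Rightarrow> ('g \<Rightarrow> 'i operator) \<Rightarrow> bool) \<Rightarrow> ('i vec set \<times> ('g \<Rightarrow> 'i operator)) set" where
  "rel_index Rel = {(H, \<rho>). hilbert_space H \<and> Rel H \<rho>}"

definition free_rep :: "('i vec set \<times> ('g \<Rightarrow> 'i operator)) \<Rightarrow> ('g word \<Rightarrow> complex) \<Rightarrow> 'i operator" where
  "free_rep j f = (\<lambda>x\<in>fst j. \<Sum>w | f w \<noteq> 0. f w *\<^sub>v word_op (fst j) (snd j) w x)"

text \<open>The bound \<open>M\<close> does not depend on the representation. It therefore bounds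
  each word uniformly and makes the supremum of seminorms finite.\<close>

locale bounded_relations =
  fixes G :: "'g set" and Rel :: "'i vec set \<Rightarrow> ('g \<Rightarrow> 'i operator) \<Rightarrow> bool" and M :: "'g \<Rightarrow> real"
  assumes gen_bop: "hilbert_space H \<Longrightarrow> Rel H \<rho> \<Longrightarrow> g \<in> G \<Longrightarrow> \<rho> g \<in> bounded_ops H"
    and gen_bound: "hilbert_space H \<Longrightarrow> Rel H \<rho> \<Longrightarrow> g \<in> G \<Longrightarrow> op_norm H (\<rho> g) \<le> M g"
    and rel_nonempty: "\<exists>H \<rho>. hilbert_space H \<and> Rel H \<rho>"
begin

abbreviation "D \<equiv> free_star_algebra G Rel"

lemma free_carrier: "f \<in> carrier D \<longleftrightarrow> finite {w. f w \<noteq> 0} \<and> (\<forall>w. f w \<noteq> 0 \<longrightarrow> fst ` set w \<subseteq> G)"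
  by (simp add: free_star_algebra_def)

lemma free_sel:
  "cadd D f g = (\<lambda>w. f w + g w)" "czero D = (\<lambda>_. 0)" "cscale D c f = (\<lambda>w. c * f w)"
  "cmult D f g = (\<lambda>w. \<Sum>n\<le>length w. f (take n w) * g (drop n w))"
  "cstar D f = (\<lambda>w. cnj (f (word_star w)))"
  by (simp_all add: free_star_algebra_def)

lemma fst_set_word_star [simp]: "fst ` set (word_star w) = fst ` set w"
  by (force simp: word_star_def)

lemma star_support: "{w. cnj (f (word_star w)) \<noteq> 0} = word_star ` {w. f w \<noteq> 0}"
  by (auto simp: image_iff) (metis word_star_word_star)

lemma mult_support:
  fixes f g :: "'x list \<Rightarrow> complex"
  assumes "(\<Sum>n\<le>length w. f (take n w) * g (drop n w)) \<noteq> 0"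
  shows "\<exists>u v. w = u @ v \<and> f u \<noteq> 0 \<and> g v \<noteq> 0"
proof -
  obtain n where "f (take n w) * g (drop n w) \<noteq> 0" using assms by (meson sum.neutral)
  then have "w = take n w @ drop n w \<and> f (take n w) \<noteq> 0 \<and> g (drop n w) \<noteq> 0" by simp
  then show ?thesis by blast
qed

lemma mult_support_subset:
  fixes f g :: "'x list \<Rightarrow> complex"
  shows
  "{w. (\<Sum>n\<le>length w. f (take n w) * g (drop n w)) \<noteq> 0} \<subseteq> (\<lambda>(u, v). u @ v) ` ({w. f w \<noteq> 0} \<times> {w. g w \<noteq> 0})"
proof
  fix w assume "w \<in> {w. (\<Sum>n\<le>length w. f (take n w) * g (drop n w)) \<noteq> 0}"
  then obtain u v where "w = u @ v" "f u \<noteq> 0" "g v \<noteq> 0" using mult_support[where w = w and f = f and g = g] by blast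
  then show "w \<in> (\<lambda>(u, v). u @ v) ` ({w. f w \<noteq> 0} \<times> {w. g w \<noteq> 0})"
    by (intro image_eqI[of _ _ "(u, v)"]) auto
qed

lemma word_bound: "fst ` set w \<subseteq> G \<Longrightarrow> \<exists>B. \<forall>H \<rho>. hilbert_space H \<longrightarrow> Rel H \<rho> \<longrightarrow> op_norm H (word_op H \<rho> w) \<le> B"
proof (induction w)
  case Nil
  have "op_norm H (id_op H) \<le> 1" if "hilbert_space H" for H :: "'i vec set"
    by (rule op_norm_le[OF that]) auto
  then show ?case by auto
next
  case (Cons a w)
  obtain g b where a: "a = (g, b)" by fastforce
  have g: "g \<in> G" and w: "fst ` set w \<subseteq> G" using Cons.prems by (auto simp: a)
  obtain B where B: "\<And>H \<rho>. hilbert_space H \<Longrightarrow> Rel H \<rho> \<Longrightarrow> op_norm H (word_op H \<rho> w) \<le> B"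
    using Cons.IH[OF w] by blast
  have "op_norm H (word_op H \<rho> (a # w)) \<le> M g * B" if H: "hilbert_space H" and R: "Rel H \<rho>" for H \<rho>
  proof -
    let ?l = "if b then adjoint H (\<rho> g) else \<rho> g"
    have wb: "word_op H \<rho> w \<in> bounded_ops H" by (rule word_op_bop_on[OF H _ w]) (rule gen_bop[OF H R])
    have lb: "?l \<in> bounded_ops H" by (rule letter_bop_on[OF H _ g]) (rule gen_bop[OF H R])
    have "op_norm H ?l \<le> M g"
      using gen_bound[OF H R g] op_norm_adjoint[OF H gen_bop[OF H R g]] by auto
    then have "op_norm H ?l * op_norm H (word_op H \<rho> w) \<le> M g * B"
      by (intro mult_mono B[OF H R] op_norm_nonneg[OF H] wb order_trans[OF op_norm_nonneg[OF H lb]])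
    then show ?thesis using op_norm_compose[OF H lb wb] unfolding a word_op.simps by (rule order_trans[rotated])
  qed
  then show ?case by blast
qed

context
  fixes H :: "'i vec set" and \<rho> :: "'g \<Rightarrow> 'i operator"
  assumes H: "hilbert_space H" and R: "Rel H \<rho>"
begin

lemma w_bop: "fst ` set w \<subseteq> G \<Longrightarrow> word_op H \<rho> w \<in> bounded_ops H"
  by (rule word_op_bop_on[OF H, of G]) (auto intro: gen_bop[OF H R])

lemma w_append: "fst ` set v \<subseteq> G \<Longrightarrow> word_op H \<rho> (u @ v) = compose H (word_op H \<rho> u) (word_op H \<rho> v)"
  by (rule word_op_append_on[OF H, of G]) (auto intro: gen_bop[OF H R])

lemma w_star: "fst ` set w \<subseteq> G \<Longrightarrow> word_op H \<rho> (word_star w) = adjoint H (word_op H \<rho> w)"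
  by (rule word_op_star_on[OF H, of G]) (auto intro: gen_bop[OF H R])

lemma free_rep_superset:
  assumes "finite W" "{w. f w \<noteq> 0} \<subseteq> W" "x \<in> H"
  shows "free_rep (H, \<rho>) f x = (\<Sum>w\<in>W. f w *\<^sub>v word_op H \<rho> w x)"
  using assms by (auto simp: free_rep_def intro!: sum.mono_neutral_left)

lemma free_rep_bop:
  assumes "f \<in> carrier D" shows "free_rep (H, \<rho>) f \<in> bounded_ops H"
proof -
  have "(\<lambda>x\<in>H. \<Sum>w | f w \<noteq> 0. cscale (Bop H) (f w) (word_op H \<rho> w) x) \<in> bounded_ops H"
    using assms by (intro op_norm_sum(1)[OF H _ _ order_refl]) (auto simp: free_carrier intro!: Bop_closed[OF H] w_bop)
  moreover have "free_rep (H, \<rho>) f = (\<lambda>x\<in>H. \<Sum>w | f w \<noteq> 0. cscale (Bop H) (f w) (word_op H \<rho> w) x)"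
    by (auto simp: free_rep_def fun_eq_iff)
  ultimately show ?thesis by simp
qed

lemma free_rep_vec:
  assumes "f \<in> carrier D" "x \<in> H" "f w \<noteq> 0"
  shows "word_op H \<rho> w x \<in> H"
  using assms bop_apply[OF H w_bop] by (auto simp: free_carrier)

lemma free_rep_mult:
  assumes f: "f \<in> carrier D" and g: "g \<in> carrier D" and x: "x \<in> H"
  shows "free_rep (H, \<rho>) (cmult D f g) x = free_rep (H, \<rho>) f (free_rep (H, \<rho>) g x)"
proof -
  let ?U = "{w. f w \<noteq> 0}" and ?V = "{w. g w \<noteq> 0}" and ?W = "(\<lambda>(u, v). u @ v) ` ({w. f w \<noteq> 0} \<times> {w. g w \<noteq> 0})"
  let ?F = "\<lambda>u v. (f u * g v) *\<^sub>v word_op H \<rho> (u @ v) x"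
  have fin: "finite ?U" "finite ?V" using f g by (auto simp: free_carrier)
  have "free_rep (H, \<rho>) (cmult D f g) x = (\<Sum>w\<in>?W. (\<Sum>n\<le>length w. f (take n w) * g (drop n w)) *\<^sub>v word_op H \<rho> w x)"
    unfolding free_sel
  proof (rule free_rep_superset)
    show "finite ?W" using fin by simp
    show "{w. (\<Sum>n\<le>length w. f (take n w) * g (drop n w)) \<noteq> 0} \<subseteq> ?W"
      by (rule mult_support_subset)
  qed (rule x)
  also have "\<dots> = (\<Sum>w\<in>?W. \<Sum>n\<le>length w. ?F (take n w) (drop n w))"
    by (intro sum.cong refl) (auto simp: fun_eq_iff vec_apply sum_distrib_right)
  also have "\<dots> = (\<Sum>(w, n)\<in>Sigma ?W (\<lambda>w. {..length w}). ?F (take n w) (drop n w))"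
    using fin by (intro sum.Sigma) auto
  \<comment> \<open>A splitting of \<open>w\<close> is recorded as \<open>(w, n)\<close> with
    \<open>n\<close> the place of the cut. The map \<open>(u, v) \<mapsto> (u @ v, length u)\<close>
    is injective, and splittings outside its image of the supports contribute zero.\<close>
  also have "\<dots> = (\<Sum>(w, n)\<in>(\<lambda>(u, v). (u @ v, length u)) ` (?U \<times> ?V). ?F (take n w) (drop n w))"
  proof (rule sum.mono_neutral_right)
    show "finite (Sigma ?W (\<lambda>w. {..length w}))" using fin by auto
    show "(\<lambda>(u, v). (u @ v, length u)) ` (?U \<times> ?V) \<subseteq> Sigma ?W (\<lambda>w. {..length w})" by auto
    have "f (take n w) * g (drop n w) = 0"
      if "n \<le> length w" "(w, n) \<notin> (\<lambda>(u, v). (u @ v, length u)) ` (?U \<times> ?V)" for w n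
    proof (rule ccontr)
      assume "f (take n w) * g (drop n w) \<noteq> 0"
      then have "(w, n) = (\<lambda>(u, v). (u @ v, length u)) (take n w, drop n w)" "(take n w, drop n w) \<in> ?U \<times> ?V"
        using that(1) by auto
      then show False using that(2) by blast
    qed
    note zero = this
    show "\<forall>i\<in>Sigma ?W (\<lambda>w. {..length w}) - (\<lambda>(u, v). (u @ v, length u)) ` (?U \<times> ?V).
        (case i of (w, n) \<Rightarrow> ?F (take n w) (drop n w)) = 0"
    proof
      fix i assume i: "i \<in> Sigma ?W (\<lambda>w. {..length w}) - (\<lambda>(u, v). (u @ v, length u)) ` (?U \<times> ?V)"
      obtain w n where wn: "i = (w, n)" by (cases i)
      have "f (take n w) * g (drop n w) = 0" using i unfolding wn by (intro zero) blast+
      then show "(case i of (w, n) \<Rightarrow> ?F (take n w) (drop n w)) = 0" by (simp only: wn prod.case vscale_zero_left)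
    qed
  qed
  also have "\<dots> = (\<Sum>(u, v)\<in>?U \<times> ?V. ?F u v)"
    by (subst sum.reindex) (auto simp: inj_on_def case_prod_unfold)
  also have "\<dots> = (\<Sum>u\<in>?U. \<Sum>v\<in>?V. ?F u v)"
    by (rule sum.cartesian_product[symmetric])
  also have "\<dots> = (\<Sum>u\<in>?U. f u *\<^sub>v word_op H \<rho> u (free_rep (H, \<rho>) g x))"
  proof (intro sum.cong refl)
    fix u assume u: "u \<in> ?U"
    then have uG: "fst ` set u \<subseteq> G" using f by (auto simp: free_carrier)
    have vH: "g v *\<^sub>v word_op H \<rho> v x \<in> H" if "v \<in> ?V" for v
      using free_rep_vec[OF g x] that by (auto intro: hs_scale[OF H])
    have "word_op H \<rho> u (free_rep (H, \<rho>) g x) = (\<Sum>v\<in>?V. word_op H \<rho> u (g v *\<^sub>v word_op H \<rho> v x))"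
      using x by (simp add: free_rep_def) (rule bop_sum[OF H w_bop[OF uG] vH])
    also have "\<dots> = (\<Sum>v\<in>?V. g v *\<^sub>v word_op H \<rho> (u @ v) x)"
    proof (intro sum.cong refl)
      fix v assume v: "v \<in> ?V"
      then have vG: "fst ` set v \<subseteq> G" using g by (auto simp: free_carrier)
      show "word_op H \<rho> u (g v *\<^sub>v word_op H \<rho> v x) = g v *\<^sub>v word_op H \<rho> (u @ v) x"
        using x bop_scale[OF H w_bop[OF uG] bop_apply[OF H w_bop[OF vG] x]] by (simp add: w_append[OF vG])
    qed
    finally show "(\<Sum>v\<in>?V. ?F u v) = f u *\<^sub>v word_op H \<rho> u (free_rep (H, \<rho>) g x)"
      by (simp add: vscale_sum_right vscale_vscale)
  qed
  also have "\<dots> = free_rep (H, \<rho>) f (free_rep (H, \<rho>) g x)"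
    using bop_apply[OF H free_rep_bop[OF g] x] by (simp add: free_rep_def[of _ f])
  finally show ?thesis .
qed

lemma star_carrier: "f \<in> carrier D \<Longrightarrow> cstar D f \<in> carrier D"
  unfolding free_carrier free_sel star_support by (auto; metis fst_set_word_star image_subset_iff image_eqI fst_conv)

lemma free_rep_star:
  assumes f: "f \<in> carrier D"
  shows "free_rep (H, \<rho>) (cstar D f) = adjoint H (free_rep (H, \<rho>) f)"
proof (rule adjoint_eqI[OF H free_rep_bop[OF f] free_rep_bop[OF star_carrier[OF f]], symmetric])
  fix x y assume x: "x \<in> H" and y: "y \<in> H"
  let ?U = "{w. f w \<noteq> 0}"
  have inj: "inj_on word_star ?U" by (metis inj_onI word_star_word_star)
  have wH: "word_op H \<rho> w x \<in> H" "word_op H \<rho> (word_star w) y \<in> H" if "w \<in> ?U" for w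
  proof -
    have wG: "fst ` set w \<subseteq> G" "fst ` set (word_star w) \<subseteq> G" using f that by (simp_all add: free_carrier)
    show "word_op H \<rho> w x \<in> H" "word_op H \<rho> (word_star w) y \<in> H"
      by (rule bop_apply[OF H w_bop[OF wG(1)] x], rule bop_apply[OF H w_bop[OF wG(2)] y])
  qed
  have "ell2_inner (free_rep (H, \<rho>) f x) y = (\<Sum>w\<in>?U. ell2_inner (f w *\<^sub>v word_op H \<rho> w x) y)"
    using x by (simp add: free_rep_def) (intro ell2_inner_sum_left hs_ell2[OF H] y hs_scale[OF H] wH)
  also have "\<dots> = (\<Sum>w\<in>?U. ell2_inner x (cnj (f w) *\<^sub>v word_op H \<rho> (word_star w) y))"
  proof (intro sum.cong refl)
    fix w assume "w \<in> ?U"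
    then have "fst ` set w \<subseteq> G" using f by (auto simp: free_carrier)
    then show "ell2_inner (f w *\<^sub>v word_op H \<rho> w x) y = ell2_inner x (cnj (f w) *\<^sub>v word_op H \<rho> (word_star w) y)"
      by (simp add: ell2_inner_scale_left ell2_inner_scale_right w_star adjoint_inner[OF H w_bop] x y)
  qed
  also have "\<dots> = ell2_inner x (\<Sum>w\<in>?U. cnj (f w) *\<^sub>v word_op H \<rho> (word_star w) y)"
    by (rule ell2_inner_sum_right[symmetric]) (auto intro!: hs_ell2[OF H] x hs_scale[OF H] wH)
  also have "(\<Sum>w\<in>?U. cnj (f w) *\<^sub>v word_op H \<rho> (word_star w) y) = free_rep (H, \<rho>) (cstar D f) y"
    using y by (simp add: free_rep_def free_sel star_support sum.reindex[OF inj] del: complex_cnj_zero_iff)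
  finally show "ell2_inner (free_rep (H, \<rho>) f x) y = ell2_inner x (free_rep (H, \<rho>) (cstar D f) y)" .
qed

lemma free_rep_star_hom: "free_rep (H, \<rho>) \<in> star_hom D (Bop H)"
proof -
  have "free_rep (H, \<rho>) (cadd D f g) = cadd (Bop H) (free_rep (H, \<rho>) f) (free_rep (H, \<rho>) g)"
    if f: "f \<in> carrier D" and g: "g \<in> carrier D" for f g
  proof
    fix x
    show "free_rep (H, \<rho>) (cadd D f g) x = cadd (Bop H) (free_rep (H, \<rho>) f) (free_rep (H, \<rho>) g) x"
    proof (cases "x \<in> H")
      case x: True
      let ?W = "{w. f w \<noteq> 0} \<union> {w. g w \<noteq> 0}"
      have W: "finite ?W" using f g by (simp add: free_carrier)
      have "free_rep (H, \<rho>) (cadd D f g) x = (\<Sum>w\<in>?W. (f w + g w) *\<^sub>v word_op H \<rho> w x)"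
        unfolding free_sel by (rule free_rep_superset[OF W _ x]) auto
      also have "\<dots> = (\<Sum>w\<in>?W. f w *\<^sub>v word_op H \<rho> w x) + (\<Sum>w\<in>?W. g w *\<^sub>v word_op H \<rho> w x)"
        by (simp add: vscale_add_left sum.distrib)
      also have "\<dots> = free_rep (H, \<rho>) f x + free_rep (H, \<rho>) g x"
        by (subst (1 2) free_rep_superset[OF W _ x]) auto
      finally show ?thesis using x by simp
    qed (simp add: free_rep_def Bop_def)
  qed
  moreover have "free_rep (H, \<rho>) (cscale D c f) = cscale (Bop H) c (free_rep (H, \<rho>) f)" if f: "f \<in> carrier D" for c f
  proof
    fix x
    show "free_rep (H, \<rho>) (cscale D c f) x = cscale (Bop H) c (free_rep (H, \<rho>) f) x"
    proof (cases "x \<in> H")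
      case x: True
      have W: "finite {w. f w \<noteq> 0}" using f by (simp add: free_carrier)
      have "free_rep (H, \<rho>) (cscale D c f) x = (\<Sum>w | f w \<noteq> 0. (c * f w) *\<^sub>v word_op H \<rho> w x)"
        unfolding free_sel by (rule free_rep_superset[OF W _ x]) auto
      also have "\<dots> = c *\<^sub>v free_rep (H, \<rho>) f x"
        using x by (simp add: free_rep_def vscale_sum_right vscale_vscale)
      finally show ?thesis using x by simp
    qed (simp add: free_rep_def Bop_def)
  qed
  moreover have "free_rep (H, \<rho>) (cmult D f g) = compose H (free_rep (H, \<rho>) f) (free_rep (H, \<rho>) g)"
    if "f \<in> carrier D" "g \<in> carrier D" for f g
    using free_rep_mult[OF that] by (auto simp: fun_eq_iff compose_def free_rep_def)
  ultimately show ?thesis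
    unfolding star_hom_def using free_rep_bop free_rep_star by auto
qed

lemma free_rep_monomial:
  assumes "fst ` set w \<subseteq> G"
  shows "free_rep (H, \<rho>) (monomial w) = word_op H \<rho> w"
proof (rule bop_eqI[OF H free_rep_bop w_bop[OF assms]])
  have supp: "{v. monomial w v \<noteq> 0} = {w}" by (auto simp: monomial_def)
  then show "monomial w \<in> carrier D" using assms by (auto simp: free_carrier monomial_def)
  show "free_rep (H, \<rho>) (monomial w) x = word_op H \<rho> w x" if "x \<in> H" for x
    using that by (simp add: free_rep_def supp) (simp add: monomial_def)
qed

end

lemma free_normed_by_reps: "normed_by_reps D (rel_index Rel) fst free_rep"
proof
  fix f g c assume f: "f \<in> carrier D" and g: "g \<in> carrier D"
  show "cadd D f g \<in> carrier D"
    unfolding free_carrier free_sel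
  proof (intro conjI allI impI)
    show "finite {w. f w + g w \<noteq> 0}"
      by (rule finite_subset[of _ "{w. f w \<noteq> 0} \<union> {w. g w \<noteq> 0}"]) (use f g in \<open>auto simp: free_carrier\<close>)
    show "fst ` set w \<subseteq> G" if "f w + g w \<noteq> 0" for w
      using f g that unfolding free_carrier by (cases "f w = 0") auto
  qed
  show "cscale D c f \<in> carrier D" using f
    by (auto simp: free_carrier free_sel elim: rev_finite_subset)
  show "cmult D f g \<in> carrier D"
    unfolding free_carrier free_sel
  proof (intro conjI allI impI)
    show "finite {w. (\<Sum>n\<le>length w. f (take n w) * g (drop n w)) \<noteq> 0}"
    proof (rule finite_subset)
      show "{w. (\<Sum>n\<le>length w. f (take n w) * g (drop n w)) \<noteq> 0} \<subseteq> (\<lambda>(u, v). u @ v) ` ({w. f w \<noteq> 0} \<times> {w. g w \<noteq> 0})"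
        by (rule mult_support_subset)
    qed (use f g in \<open>simp add: free_carrier\<close>)
    show "fst ` set w \<subseteq> G" if "(\<Sum>n\<le>length w. f (take n w) * g (drop n w)) \<noteq> 0" for w
    proof -
      obtain u v where "w = u @ v" "f u \<noteq> 0" "g v \<noteq> 0" using mult_support[OF \<open>_ \<noteq> 0\<close>] by blast
      then show ?thesis using f g by (simp add: free_carrier image_Un)
    qed
  qed
  show "cstar D f \<in> carrier D" using rel_nonempty star_carrier[OF _ _ f] by blast
  have "\<forall>w\<in>{w. f w \<noteq> 0}. \<exists>B. \<forall>H \<rho>. hilbert_space H \<longrightarrow> Rel H \<rho> \<longrightarrow> op_norm H (word_op H \<rho> w) \<le> B"
    using f word_bound by (simp add: free_carrier)
  then obtain B where B: "\<And>w H \<rho>. f w \<noteq> 0 \<Longrightarrow> hilbert_space H \<Longrightarrow> Rel H \<rho> \<Longrightarrow> op_norm H (word_op H \<rho> w) \<le> B w"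
    by (metis (mono_tags, lifting) mem_Collect_eq)
  show "bdd_above ((\<lambda>j. op_norm (fst j) (free_rep j f)) ` rel_index Rel)"
  proof (rule bdd_aboveI)
    fix r assume "r \<in> (\<lambda>j. op_norm (fst j) (free_rep j f)) ` rel_index Rel"
    then obtain H \<rho> where r: "r = op_norm H (free_rep (H, \<rho>) f)" and H: "hilbert_space H" and R: "Rel H \<rho>"
      by (auto simp: rel_index_def)
    have "op_norm H (\<lambda>x\<in>H. \<Sum>w | f w \<noteq> 0. cscale (Bop H) (f w) (word_op H \<rho> w) x) \<le> (\<Sum>w | f w \<noteq> 0. cmod (f w) * B w)"
    proof (rule op_norm_sum(2)[OF H])
      fix w assume w: "w \<in> {w. f w \<noteq> 0}"
      then have wG: "fst ` set w \<subseteq> G" using f by (auto simp: free_carrier)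
      show "cscale (Bop H) (f w) (word_op H \<rho> w) \<in> bounded_ops H" by (intro Bop_closed[OF H] w_bop[OF H R wG])
      show "op_norm H (cscale (Bop H) (f w) (word_op H \<rho> w)) \<le> cmod (f w) * B w"
        by (rule order_trans[OF op_norm_scale[OF H w_bop[OF H R wG]] mult_left_mono[OF B[OF _ H R]]]) (use w in auto)
    qed (use f in \<open>simp add: free_carrier\<close>)
    moreover have "free_rep (H, \<rho>) f = (\<lambda>x\<in>H. \<Sum>w | f w \<noteq> 0. cscale (Bop H) (f w) (word_op H \<rho> w) x)"
      by (auto simp: free_rep_def fun_eq_iff)
    ultimately show "r \<le> (\<Sum>w | f w \<noteq> 0. cmod (f w) * B w)" using r by simp
  qed
  have rep_eq: "(\<lambda>x\<in>H. \<lambda>i. \<Sum>w | f w \<noteq> 0. f w * word_op H \<rho> w x i) = free_rep (H, \<rho>) f" for H \<rho>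
    by (auto simp: free_rep_def fun_eq_iff vec_apply)
  have "cnorm D f = Sup {op_norm H (free_rep (H, \<rho>) f) |H \<rho>. hilbert_space H \<and> Rel H \<rho>}"
    by (simp add: free_star_algebra_def rep_eq)
  also have "\<dots> = Sup ((\<lambda>j. op_norm (fst j) (free_rep j f)) ` rel_index Rel)"
    unfolding Collect_pair_image[of "\<lambda>H \<rho>. op_norm H (free_rep (H, \<rho>) f)"] by (simp add: rel_index_def)
  finally show "cnorm D f = Sup ((\<lambda>j. op_norm (fst j) (free_rep j f)) ` rel_index Rel)" .
next
  fix j :: "'i vec set \<times> ('g \<Rightarrow> 'i operator)" assume "j \<in> rel_index Rel"
  then obtain H \<rho> where j: "j = (H, \<rho>)" "hilbert_space H" "Rel H \<rho>" by (auto simp: rel_index_def)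
  show "hilbert_space (fst j)" "free_rep j \<in> star_hom D (Bop (fst j))"
    using j free_rep_star_hom by auto
  show "free_rep j (czero D) = zero_op (fst j)"
    by (auto simp: j free_sel free_rep_def zero_op_def fun_eq_iff)
qed (use rel_nonempty in \<open>auto simp: free_carrier free_sel rel_index_def\<close>)

definition univ_rep :: "('i vec set \<times> ('g \<Rightarrow> 'i operator)) \<Rightarrow> (nat \<Rightarrow> 'g word \<Rightarrow> complex) set \<Rightarrow> 'i operator" where
  "univ_rep = normed_by_reps.compl_rep fst free_rep"

theorem univ_rep_cstar: "rep_cstar (completion D) (rel_index Rel) fst univ_rep"
  unfolding univ_rep_def by (rule normed_by_reps.completion_rep_cstar[OF free_normed_by_reps])

definition univ_word :: "'g word \<Rightarrow> (nat \<Rightarrow> 'g word \<Rightarrow> complex) set" where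
  "univ_word w = to_completion D (monomial w)"

lemma monomial_carrier: "fst ` set w \<subseteq> G \<Longrightarrow> monomial w \<in> carrier D"
proof -
  assume "fst ` set w \<subseteq> G"
  moreover have "{v. monomial w v \<noteq> 0} = {w}" by (auto simp: monomial_def)
  ultimately show ?thesis by (auto simp: free_carrier monomial_def)
qed

lemma univ_word_closed: "fst ` set w \<subseteq> G \<Longrightarrow> univ_word w \<in> carrier (completion D)"
  unfolding univ_word_def by (intro normed_by_reps.to_completion_closed[OF free_normed_by_reps] monomial_carrier)

lemma univ_rep_word:
  assumes "fst ` set w \<subseteq> G" "j \<in> rel_index Rel"
  shows "univ_rep j (univ_word w) = word_op (fst j) (snd j) w"
proof -
  have "univ_rep j (univ_word w) = free_rep j (monomial w)"
    unfolding univ_rep_def univ_word_def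
    by (rule normed_by_reps.compl_rep_to_completion[OF free_normed_by_reps assms(2) monomial_carrier[OF assms(1)]])
  also have "\<dots> = word_op (fst j) (snd j) w"
    using assms free_rep_monomial[of "fst j" "snd j" w] by (auto simp: rel_index_def)
  finally show ?thesis .
qed

text \<open>The empty word is listed among the generators because a \<open>star_subalgebra\<close>
  need not contain a unit.\<close>

lemma univ_generates: "generates (completion D) (insert (univ_word []) ((\<lambda>g. univ_word [(g, False)]) ` G))"
  unfolding generates_def
proof (intro conjI allI impI)
  interpret D: normed_by_reps D "rel_index Rel" fst free_rep by (rule free_normed_by_reps)
  interpret C: rep_cstar "completion D" "rel_index Rel" fst univ_rep by (rule univ_rep_cstar)
  show "insert (univ_word []) ((\<lambda>g. univ_word [(g, False)]) ` G) \<subseteq> carrier (completion D)"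
    by (auto intro!: univ_word_closed)
  fix K assume K: "star_subalgebra (completion D) K"
    and gen: "insert (univ_word []) ((\<lambda>g. univ_word [(g, False)]) ` G) \<subseteq> K"
  have KD: "closed_subspace (completion D) K" and Km: "\<And>x y. x \<in> K \<Longrightarrow> y \<in> K \<Longrightarrow> cmult (completion D) x y \<in> K"
    and Ks: "\<And>x. x \<in> K \<Longrightarrow> cstar (completion D) x \<in> K"
    using K by (auto simp: star_subalgebra_def)
  have word: "univ_word w \<in> K" if "fst ` set w \<subseteq> G" for w
    using that
  proof (induction w)
    case (Cons a w)
    obtain g b where a: "a = (g, b)" by fastforce
    have g: "g \<in> G" and w: "fst ` set w \<subseteq> G" using Cons.prems by (auto simp: a)
    let ?l = "if b then cstar (completion D) (univ_word [(g, False)]) else univ_word [(g, False)]"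
    have gc: "univ_word [(g, False)] \<in> carrier (completion D)" using g by (intro univ_word_closed) auto
    have lK: "?l \<in> K" using g gen Ks by auto
    have "univ_word (a # w) = cmult (completion D) ?l (univ_word w)"
    proof (rule C.separated)
      fix j assume j: "j \<in> rel_index Rel"
      then have H: "hilbert_space (fst j)" and R: "Rel (fst j) (snd j)" by (auto simp: rel_index_def)
      have "univ_rep j (univ_word [(g, False)]) = snd j g"
        using univ_rep_word[of "[(g, False)]", OF _ j] g by (simp add: compose_id_right[OF H gen_bop[OF H R g]])
      then have "univ_rep j ?l = (if b then adjoint (fst j) (snd j g) else snd j g)"
        by (simp add: C.rep_star j gc)
      then have "univ_rep j (cmult (completion D) ?l (univ_word w)) = compose (fst j) (if b then adjoint (fst j) (snd j g) else snd j g) (word_op (fst j) (snd j) w)"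
        using gc univ_word_closed[OF w] by (subst C.rep_mult[OF j]) (simp_all add: C.closed univ_rep_word[OF w j])
      then show "univ_rep j (univ_word (a # w)) = univ_rep j (cmult (completion D) ?l (univ_word w))"
        using univ_rep_word[OF Cons.prems j] by (simp only: a word_op.simps)
    qed (use gc univ_word_closed[OF w] univ_word_closed[OF Cons.prems] in \<open>auto intro: C.closed\<close>)
    then show ?case using Km[OF lK Cons.IH[OF w]] by simp
  qed (use gen in auto)
  have fin: "f \<in> carrier D \<and> to_completion D f \<in> K" if "finite W" "\<And>w. w \<in> W \<Longrightarrow> fst ` set w \<subseteq> G" "\<And>w. w \<notin> W \<Longrightarrow> f w = 0" for W f
    using that
  proof (induction W arbitrary: f rule: finite_induct)
    case empty
    then have "f = czero D" by (auto simp: free_sel)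
    then show ?case using closed_subspaceD(2)[OF KD] D.zero_closed by (simp add: D.compl_zero to_completion_def)
  next
    case (insert w W)
    let ?g = "f(w := 0)"
    have g: "?g \<in> carrier D" "to_completion D ?g \<in> K" using insert.IH[of ?g] insert.prems unfolding fun_upd_apply by auto
    have m: "monomial w \<in> carrier D" "to_completion D (monomial w) \<in> K"
      using insert.prems(1)[of w] word[of w] monomial_carrier by (auto simp: univ_word_def)
    have f: "f = cadd D ?g (cscale D (f w) (monomial w))"
      by (auto simp: free_sel monomial_def fun_eq_iff)
    have "to_completion D f = cadd (completion D) (to_completion D ?g) (cscale (completion D) (f w) (to_completion D (monomial w)))"
      using g(1) m(1) by (subst f) (simp only: D.to_completion_add D.to_completion_scale D.scale_closed)
    moreover have "f \<in> carrier D" by (subst f) (intro D.closed g m)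
    ultimately show ?case using closed_subspaceD(3,4)[OF KD] g(2) m(2) by simp
  qed
  show "carrier (completion D) \<subseteq> K"
  proof (rule D.completion_subspace_dense[OF KD])
    fix f :: "'g word \<Rightarrow> complex" and e :: real assume f: "f \<in> carrier D" and e: "e > 0"
    have "f \<in> carrier D \<and> to_completion D f \<in> K"
      by (rule fin[of "{w. f w \<noteq> 0}"]) (use f in \<open>simp_all add: free_carrier\<close>)
    then show "\<exists>d\<in>carrier D. to_completion D d \<in> K \<and> cnorm D (cdiff D d f) < e"
      using e by (intro bexI[of _ f]) (simp_all add: D.norm_diff_self)
  qed
qed

end

section \<open>Commutants, corners, nondegeneracy and compression\<close>

section \<open>Commutative algebras, units and corners\<close>

context rep_cstar
begin

lemma mult_assoc:
  "x \<in> carrier A \<Longrightarrow> y \<in> carrier A \<Longrightarrow> z \<in> carrier A \<Longrightarrow> cmult A (cmult A x y) z = cmult A x (cmult A y z)"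
  by (rule separated) (simp_all add: closed rep_mult compose_assoc'[OF hs rep_bop])

lemma star_mult:
  "x \<in> carrier A \<Longrightarrow> y \<in> carrier A \<Longrightarrow> cstar A (cmult A x y) = cmult A (cstar A y) (cstar A x)"
  by (rule separated) (simp_all add: closed rep_mult rep_star adjoint_compose[OF hs rep_bop rep_bop])

lemma star_star: "x \<in> carrier A \<Longrightarrow> cstar A (cstar A x) = x"
  by (rule separated) (simp_all add: closed rep_star adjoint_adjoint[OF hs rep_bop])

lemma mult_add_right:
  assumes "x \<in> carrier A" "y \<in> carrier A" "z \<in> carrier A"
  shows "cmult A x (cadd A y z) = cadd A (cmult A x y) (cmult A x z)"
proof (rule separated)
  fix j assume j: "j \<in> J"
  show "\<rho> j (cmult A x (cadd A y z)) = \<rho> j (cadd A (cmult A x y) (cmult A x z))"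
    using assms j by (intro bop_eqI[OF hs[OF j]] rep_bop closed)
      (auto simp: rep_simps closed bop_add[OF hs[OF j] rep_bop[OF j assms(1)]] bop_apply[OF hs[OF j] rep_bop])
qed (use assms closed in auto)

lemma mult_add_left:
  assumes "x \<in> carrier A" "y \<in> carrier A" "z \<in> carrier A"
  shows "cmult A (cadd A x y) z = cadd A (cmult A x z) (cmult A y z)"
proof (rule separated)
  fix j assume j: "j \<in> J"
  show "\<rho> j (cmult A (cadd A x y) z) = \<rho> j (cadd A (cmult A x z) (cmult A y z))"
    using assms j by (intro bop_eqI[OF hs[OF j]] rep_bop closed)
      (auto simp: rep_simps closed bop_apply[OF hs[OF j] rep_bop])
qed (use assms closed in auto)

lemma mult_scale:
  assumes "x \<in> carrier A" "y \<in> carrier A"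
  shows "cmult A x (cscale A c y) = cscale A c (cmult A x y)" "cmult A (cscale A c x) y = cscale A c (cmult A x y)"
proof -
  have "\<rho> j (cmult A x (cscale A c y)) = \<rho> j (cscale A c (cmult A x y))"
    "\<rho> j (cmult A (cscale A c x) y) = \<rho> j (cscale A c (cmult A x y))" if j: "j \<in> J" for j
    using assms j by (auto intro!: bop_eqI[OF hs[OF j]] rep_bop closed)
      (auto simp: rep_simps closed bop_scale[OF hs[OF j] rep_bop[OF j assms(1)]] bop_apply[OF hs[OF j] rep_bop])
  then show "cmult A x (cscale A c y) = cscale A c (cmult A x y)" "cmult A (cscale A c x) y = cscale A c (cmult A x y)"
    using assms by (auto intro!: separated closed)
qed

lemma mult_zero:
  assumes "x \<in> carrier A" shows "cmult A x (czero A) = czero A" "cmult A (czero A) x = czero A"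
proof -
  have "\<rho> j (cmult A x (czero A)) = \<rho> j (czero A)" "\<rho> j (cmult A (czero A) x) = \<rho> j (czero A)" if j: "j \<in> J" for j
    using assms j by (auto intro!: bop_eqI[OF hs[OF j]] rep_bop closed)
      (auto simp: rep_simps closed bop_zero[OF hs[OF j] rep_bop[OF j assms(1)]] bop_apply[OF hs[OF j] rep_bop])
  then show "cmult A x (czero A) = czero A" "cmult A (czero A) x = czero A"
    using assms by (auto intro!: separated closed)
qed

lemma conv_eq:
  assumes "conv X x" "conv X y" shows "x = y"
  using assms conv_rep op_conv_unique[OF hs]
  by (intro separated conv_carrier(2)[OF assms(1)] conv_carrier(2)[OF assms(2)]) blast

lemma centralizer_subalgebra:
  assumes X: "X \<subseteq> carrier A" and star: "\<And>x. x \<in> X \<Longrightarrow> cstar A x \<in> X"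
  shows "star_subalgebra A {y \<in> carrier A. \<forall>x\<in>X. cmult A x y = cmult A y x}" (is "star_subalgebra A ?C")
proof -
  have Xc: "x \<in> carrier A" if "x \<in> X" for x using X that by blast
  have "closed_subspace A ?C"
  proof (rule closed_subspaceI)
    fix Y y assume Y: "conv Y y" "\<And>n. Y n \<in> ?C"
    have "cmult A x y = cmult A y x" if x: "x \<in> X" for x
    proof (rule conv_eq)
      show "conv (\<lambda>n. cmult A x (Y n)) (cmult A x y)" by (rule conv_mult[OF conv_const[OF Xc[OF x]] Y(1)])
      have "conv (\<lambda>n. cmult A (Y n) x) (cmult A y x)" by (rule conv_mult[OF Y(1) conv_const[OF Xc[OF x]]])
      then show "conv (\<lambda>n. cmult A x (Y n)) (cmult A y x)" using Y(2) x by simp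
    qed
    then show "y \<in> ?C" using conv_carrier(2)[OF Y(1)] by simp
  qed (auto simp: closed Xc mult_add_left mult_add_right mult_scale mult_zero)
  moreover have "cmult A y z \<in> ?C" if y: "y \<in> ?C" and z: "z \<in> ?C" for y z
  proof -
    have "cmult A x (cmult A y z) = cmult A (cmult A y z) x" if x: "x \<in> X" for x
    proof -
      have "cmult A x (cmult A y z) = cmult A (cmult A x y) z" using y z Xc[OF x] by (simp add: mult_assoc)
      also have "\<dots> = cmult A (cmult A y x) z" using y x by simp
      also have "\<dots> = cmult A y (cmult A x z)" using y z Xc[OF x] by (simp add: mult_assoc)
      also have "\<dots> = cmult A y (cmult A z x)" using z x by simp
      finally show ?thesis using y z Xc[OF x] by (simp add: mult_assoc)
    qed
    then show ?thesis using y z by (simp add: closed)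
  qed
  moreover have "cstar A y \<in> ?C" if y: "y \<in> ?C" for y
  proof -
    have "cmult A x (cstar A y) = cmult A (cstar A y) x" if x: "x \<in> X" for x
    proof -
      have "cmult A x (cstar A y) = cstar A (cmult A y (cstar A x))"
        using y Xc[OF x] by (simp add: star_mult star_star closed)
      also have "cmult A y (cstar A x) = cmult A (cstar A x) y" using y star[OF x] by simp
      finally show ?thesis using y Xc[OF x] by (simp add: star_mult star_star closed)
    qed
    then show ?thesis using y by (simp add: closed)
  qed
  ultimately show ?thesis by (simp add: star_subalgebra_def)
qed

text \<open>The commutant is used twice: that of \<open>G\<close> is everything, so \<open>G\<close>
  lies in the commutant of \<open>carrier A\<close>, which is then everything as well.\<close>

lemma generators_commute_imp_commutative:
  assumes G: "generates A G" and star: "\<And>x. x \<in> G \<Longrightarrow> cstar A x \<in> G"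
    and comm: "\<And>x y. x \<in> G \<Longrightarrow> y \<in> G \<Longrightarrow> cmult A x y = cmult A y x"
    and x: "x \<in> carrier A" and y: "y \<in> carrier A"
  shows "cmult A x y = cmult A y x"
proof -
  have Gc: "G \<subseteq> carrier A" using G by (simp add: generates_def)
  have 1: "carrier A \<subseteq> {y \<in> carrier A. \<forall>x\<in>G. cmult A x y = cmult A y x}"
    using G centralizer_subalgebra[OF Gc star] comm Gc unfolding generates_def by blast
  have "carrier A \<subseteq> {y \<in> carrier A. \<forall>x\<in>carrier A. cmult A x y = cmult A y x}"
  proof -
    have "G \<subseteq> {y \<in> carrier A. \<forall>x\<in>carrier A. cmult A x y = cmult A y x}" using 1 Gc by force
    then show ?thesis using G centralizer_subalgebra[of "carrier A"] star_closed unfolding generates_def by blast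
  qed
  then show ?thesis using x y by blast
qed

lemma corner_closed_subspace:
  assumes e: "e \<in> carrier A"
  shows "closed_subspace A {x \<in> carrier A. cmult A e x = x}"
proof (rule closed_subspaceI)
  fix X x assume X: "conv X x" "\<And>n. X n \<in> {x \<in> carrier A. cmult A e x = x}"
  have "conv X (cmult A e x)" using conv_mult[OF conv_const[OF e] X(1)] X(2) by simp
  then have "cmult A e x = x" using X(1) by (rule conv_eq)
  then show "x \<in> {x \<in> carrier A. cmult A e x = x}" using conv_carrier(2)[OF X(1)] by simp
qed (use e in \<open>auto simp: closed mult_add_right mult_scale mult_zero\<close>)

lemma corner_ideal:
  assumes comm: "\<And>x y. x \<in> carrier A \<Longrightarrow> y \<in> carrier A \<Longrightarrow> cmult A x y = cmult A y x"
    and e: "e \<in> carrier A" "cstar A e = e"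
  shows "closed_star_ideal A {x \<in> carrier A. cmult A e x = x}"
proof -
  have "cmult A e (cmult A a x) = cmult A a x \<and> cmult A e (cmult A x a) = cmult A x a"
    if a: "a \<in> carrier A" and x: "x \<in> carrier A" "cmult A e x = x" for a x
  proof -
    have "cmult A e (cmult A x a) = cmult A x a" using mult_assoc[OF e(1) x(1) a] x(2) by simp
    then show ?thesis using comm[OF a x(1)] by simp
  qed
  moreover have "cmult A e (cstar A x) = cstar A x" if x: "x \<in> carrier A" "cmult A e x = x" for x
    using star_mult[OF x(1) e(1)] comm[OF x(1) e(1)] x(2) e(2) by simp
  ultimately show ?thesis
    unfolding closed_star_ideal_def using corner_closed_subspace[OF e(1)] by (simp add: closed)
qed

text \<open>Makes multiplication by a projection comparable with other homomorphisms on generators;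
  unit laws and composites of conjugations are checked that way.\<close>

lemma star_hom_mult_central:
  assumes comm: "\<And>x y. x \<in> carrier A \<Longrightarrow> y \<in> carrier A \<Longrightarrow> cmult A x y = cmult A y x"
    and e: "e \<in> carrier A" "cstar A e = e" "cmult A e e = e"
  shows "cmult A e \<in> star_hom A A"
proof -
  have "cmult A e (cmult A x y) = cmult A (cmult A e x) (cmult A e y)" if "x \<in> carrier A" "y \<in> carrier A" for x y
  proof -
    have "cmult A (cmult A e x) (cmult A e y) = cmult A e (cmult A (cmult A x e) y)"
      using that e(1) by (simp add: mult_assoc closed)
    also have "cmult A x e = cmult A e x" by (rule comm[OF that(1) e(1)])
    also have "cmult A e (cmult A (cmult A e x) y) = cmult A (cmult A e e) (cmult A x y)"
      using that e(1) by (simp add: mult_assoc closed)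
    finally show ?thesis by (simp add: e(3))
  qed
  moreover have "cmult A e (cstar A x) = cstar A (cmult A e x)" if "x \<in> carrier A" for x
    using that e comm[of e "cstar A x"] by (simp add: star_mult closed)
  ultimately show ?thesis
    using e by (simp add: star_hom_def closed mult_add_right mult_scale)
qed

end

lemma star_hom_id: "(\<lambda>x. x) \<in> star_hom A A"
  by (simp add: star_hom_def)

subsection \<open>Nondegenerate representations\<close>

text \<open>For a projection this is its range, now available as a Hilbert space. By continuity of
  \<open>T\<close>, a convergent sequence of fixed vectors tends both to \<open>x\<close> and to
  \<open>T x\<close>.\<close>

lemma op_fixed_space:
  assumes H: "hilbert_space H" and T: "T \<in> bounded_ops H"
  shows "hilbert_space {x \<in> H. T x = x}"
  unfolding hilbert_space_def
proof (intro conjI allI ballI impI)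
  show "{x \<in> H. T x = x} \<subseteq> ell2" using hs_ell2[OF H] by auto
  show "(\<lambda>_. 0) \<in> {x \<in> H. T x = x}" using hs_zero[OF H] bop_zero[OF H T] by (simp add: zero_fun_def)
  show "(\<lambda>i. x i + y i) \<in> {x \<in> H. T x = x}" if "x \<in> {x \<in> H. T x = x}" "y \<in> {x \<in> H. T x = x}" for x y
    using that hs_add[OF H, of x y] bop_add[OF H T, of x y] by (simp add: plus_fun_def)
  show "(\<lambda>i. c * x i) \<in> {x \<in> H. T x = x}" if "x \<in> {x \<in> H. T x = x}" for c x
    using that hs_scale[OF H, of x c] bop_scale[OF H T, of x c] by (simp add: vscale_def)
  fix X x assume "(\<forall>n::nat. X n \<in> {x \<in> H. T x = x}) \<and> x \<in> ell2 \<and> (\<lambda>n. ell2_norm (\<lambda>i. X n i - x i)) \<longlonglongrightarrow> 0"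
  then have X: "\<And>n. X n \<in> H" "\<And>n. T (X n) = X n" "x \<in> ell2" "(\<lambda>n. ell2_norm (X n - x)) \<longlonglongrightarrow> 0"
    by (auto simp: fun_diff_def)
  have x: "x \<in> H" by (rule hs_closed[OF H X(1,3,4)])
  have "(\<lambda>n. ell2_norm (X n - T x)) \<longlonglongrightarrow> 0"
  proof (rule tendsto_0_le[OF X(4)])
    have "ell2_norm (X n - T x) \<le> op_norm H T * ell2_norm (X n - x)" for n
      using op_norm_bound[OF H T hs_diff[OF H X(1) x], of n] bop_diff[OF H T X(1) x, of n] X(2) by simp
    then show "\<forall>\<^sub>F n in sequentially. norm (ell2_norm (X n - T x)) \<le> norm (ell2_norm (X n - x)) * op_norm H T"
      by (simp add: mult.commute)
  qed
  then have "ell2_inner (T x) y = ell2_inner x y" if "y \<in> H" for y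
    using LIMSEQ_unique[OF hs_inner_tendsto[OF H X(1) bop_apply[OF H T x] _ that] hs_inner_tendsto[OF H X(1) x X(4) that]] by blast
  then have "T x = x"
    by (intro hs_inner_eqI[OF H bop_apply[OF H T x] x]) (metis ell2_inner_commute)
  then show "x \<in> {x \<in> H. T x = x}" using x by simp
qed

text \<open>\<open>\<pi> u\<close> fixes every \<open>\<pi> a x\<close>, and its fixed space is
  closed, so it contains their closed span. Conversely, \<open>x = \<pi> u x\<close> exhibits every
  vector in the required form.\<close>

lemma nondegenerate_iff_unit:
  assumes H: "hilbert_space H" and \<pi>: "\<pi> \<in> star_hom A (Bop H)"
    and u: "u \<in> carrier A" "\<And>a. a \<in> carrier A \<Longrightarrow> cmult A u a = a"
  shows "nondegenerate H A \<pi> \<longleftrightarrow> \<pi> u = id_op H"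
proof
  note \<pi>D = star_hom_BopD[OF \<pi>]
  let ?X = "{\<pi> a x | a x. a \<in> carrier A \<and> x \<in> H}"
  have XH: "?X \<subseteq> H" using bop_apply[OF H \<pi>D(1)] by blast
  show "\<pi> u = id_op H" if "nondegenerate H A \<pi>"
  proof (rule bop_eqI[OF H \<pi>D(1)[OF u(1)] id_op_closed[OF H]])
    let ?K = "{x \<in> H. \<pi> u x = x}"
    have "?X \<subseteq> ?K"
    proof
      fix y assume "y \<in> ?X"
      then obtain a x where y: "y = \<pi> a x" "a \<in> carrier A" "x \<in> H" by blast
      have "\<pi> u (\<pi> a x) = \<pi> (cmult A u a) x" by (simp only: \<pi>D(4)[OF u(1) y(2)] compose_apply[OF y(3)])
      then show "y \<in> ?K" using y u XH by auto
    qed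
    then have "hilbert_span ?X \<subseteq> ?K" using op_fixed_space[OF H \<pi>D(1)[OF u(1)]] unfolding hilbert_span_def by blast
    moreover have "hilbert_span ?X = H" using that by (simp add: nondegenerate_def)
    ultimately show "\<pi> u x = id_op H x" if "x \<in> H" for x using that by auto
  qed
  show "nondegenerate H A \<pi>" if id: "\<pi> u = id_op H"
  proof -
    have HX: "H \<subseteq> ?X"
    proof
      fix x assume x: "x \<in> H"
      then have "x = \<pi> u x" by (simp add: id)
      then show "x \<in> ?X" using x u(1) by blast
    qed
    have "hilbert_span ?X = H"
    proof
      show "hilbert_span ?X \<subseteq> H" using H XH unfolding hilbert_span_def by blast
      show "H \<subseteq> hilbert_span ?X" using HX unfolding hilbert_span_def by blast
    qed
    then show ?thesis by (simp add: nondegenerate_def)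
  qed
qed

text \<open>Multiplicativity holds because the inner factor \<open>T* T\<close> commutes with
  \<open>\<pi> a\<close> and is absorbed by \<open>T\<close>.\<close>

lemma star_hom_conj_partial_isometry:
  assumes H: "hilbert_space H" and \<pi>: "\<pi> \<in> star_hom A (Bop H)" and T: "T \<in> bounded_ops H"
    and reg: "compose H T (compose H (adjoint H T) T) = T"
    and comm: "\<And>a. a \<in> carrier A \<Longrightarrow>
      compose H (\<pi> a) (compose H (adjoint H T) T) = compose H (compose H (adjoint H T) T) (\<pi> a)"
  shows "(\<lambda>a. compose H T (compose H (\<pi> a) (adjoint H T))) \<in> star_hom A (Bop H)"
proof -
  note \<pi>D = star_hom_BopD[OF \<pi>]
  note Ts = adjoint_bop[OF H T]
  note ap = bop_apply[OF H T] bop_apply[OF H Ts] bop_apply[OF H \<pi>D(1)]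
  have TT: "T (\<pi> a (adjoint H T (T x))) = T (\<pi> a x)" if "a \<in> carrier A" "x \<in> H" for a x
    using fun_cong[OF comm[OF that(1)], of x] fun_cong[OF reg, of "\<pi> a x"] that by (simp add: ap)
  have cl: "compose H T (compose H (\<pi> a) (adjoint H T)) \<in> bounded_ops H" if "a \<in> carrier A" for a
    using that by (intro Bop_closed[OF H] T \<pi>D)
  have "compose H T (compose H (\<pi> (cadd A x y)) (adjoint H T)) =
      cadd (Bop H) (compose H T (compose H (\<pi> x) (adjoint H T))) (compose H T (compose H (\<pi> y) (adjoint H T)))"
    if "x \<in> carrier A" "y \<in> carrier A" for x y
    unfolding \<pi>D(2)[OF that] using that
    by (intro bop_eqI[OF H] Bop_closed[OF H] T \<pi>D(1)) (auto simp: ap bop_add[OF H T])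
  moreover have "compose H T (compose H (\<pi> (cscale A c x)) (adjoint H T)) =
      cscale (Bop H) c (compose H T (compose H (\<pi> x) (adjoint H T)))" if "x \<in> carrier A" for x c
    unfolding \<pi>D(3)[OF that] using that
    by (intro bop_eqI[OF H] Bop_closed[OF H] T \<pi>D(1)) (auto simp: ap bop_scale[OF H T])
  moreover have "compose H T (compose H (\<pi> (cmult A x y)) (adjoint H T)) =
      compose H (compose H T (compose H (\<pi> x) (adjoint H T))) (compose H T (compose H (\<pi> y) (adjoint H T)))"
    if "x \<in> carrier A" "y \<in> carrier A" for x y
    unfolding \<pi>D(4)[OF that] using that
    by (intro bop_eqI[OF H] Bop_closed[OF H] T \<pi>D(1)) (auto simp: ap TT)
  moreover have "compose H T (compose H (\<pi> (cstar A x)) (adjoint H T)) =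
      adjoint H (compose H T (compose H (\<pi> x) (adjoint H T)))" if "x \<in> carrier A" for x
    unfolding \<pi>D(5)[OF that] using that
    by (simp add: \<pi>D(1) adjoint_compose[OF H] Bop_closed[OF H] T adjoint_adjoint[OF H T] compose_assoc'[OF H Ts])
  ultimately show ?thesis using cl by (simp add: star_hom_def)
qed

lemma star_hom_conj_isometry:
  assumes H: "hilbert_space H" and \<pi>: "\<pi> \<in> star_hom A (Bop H)" and T: "T \<in> bounded_ops H"
    and iso: "compose H (adjoint H T) T = id_op H"
  shows "(\<lambda>a. compose H T (compose H (\<pi> a) (adjoint H T))) \<in> star_hom A (Bop H)"
  by (rule star_hom_conj_partial_isometry[OF H \<pi> T])
    (simp_all add: iso compose_id_right[OF H] compose_id_left[OF H] T star_hom_BopD(1)[OF \<pi>])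

subsection \<open>Restriction to the range of a projection\<close>

context
  fixes H :: "'i vec set" and q :: "'i operator"
  assumes H: "hilbert_space H" and q: "q \<in> bounded_ops H" "compose H q q = q" "adjoint H q = q"
begin

definition fixed_space :: "'i vec set" where
  "fixed_space = {x \<in> H. q x = x}"

lemma fixed_space_hs: "hilbert_space fixed_space"
  unfolding fixed_space_def by (rule op_fixed_space[OF H q(1)])

lemma q_fixed: "x \<in> H \<Longrightarrow> q x \<in> fixed_space"
  using fun_cong[OF q(2), of x] bop_apply[OF H q(1)] by (simp add: fixed_space_def)

lemma q_contractive: "x \<in> H \<Longrightarrow> ell2_norm (q x) \<le> ell2_norm x"
  by (rule partial_isometry_contractive[OF H q(1)]) (simp_all add: q)

lemma restrict_bop:
  assumes R: "R \<in> bounded_ops H" "compose H q R = R"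
  shows "restrict R fixed_space \<in> bounded_ops fixed_space"
proof (rule bopI[OF fixed_space_hs])
  have R_in: "R x \<in> fixed_space" if "x \<in> H" for x
    using fun_cong[OF R(2), of x] that bop_apply[OF H R(1) that] by (simp add: fixed_space_def)
  have sub: "x \<in> H" if "x \<in> fixed_space" for x using that by (simp add: fixed_space_def)
  show "restrict R fixed_space x \<in> fixed_space" if "x \<in> fixed_space" for x using R_in[OF sub[OF that]] that by simp
  show "restrict R fixed_space (x + y) = restrict R fixed_space x + restrict R fixed_space y"
    if "x \<in> fixed_space" "y \<in> fixed_space" for x y
    using that bop_add[OF H R(1) sub[OF that(1)] sub[OF that(2)]] hs_add[OF fixed_space_hs that] by simp
  show "restrict R fixed_space (c *\<^sub>v x) = c *\<^sub>v restrict R fixed_space x" if "x \<in> fixed_space" for c x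
    using that bop_scale[OF H R(1) sub[OF that]] hs_scale[OF fixed_space_hs that] by simp
  show "ell2_norm (restrict R fixed_space x) \<le> op_norm H R * ell2_norm x" if "x \<in> fixed_space" for x
    using op_norm_bound[OF H R(1) sub[OF that]] that by simp
qed simp

lemma restrict_adjoint:
  assumes R: "R \<in> bounded_ops H" "compose H q R = R" "compose H R q = R"
  shows "adjoint fixed_space (restrict R fixed_space) = restrict (adjoint H R) fixed_space"
proof (rule adjoint_eqI[OF fixed_space_hs])
  have "compose H q (adjoint H R) = adjoint H R"
    using adjoint_compose[OF H R(1) q(1)] R(3) q(3) by simp
  then show "restrict (adjoint H R) fixed_space \<in> bounded_ops fixed_space"
    by (intro restrict_bop adjoint_bop[OF H R(1)])
  show "restrict R fixed_space \<in> bounded_ops fixed_space" by (rule restrict_bop[OF R(1,2)])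
  show "ell2_inner (restrict R fixed_space x) y = ell2_inner x (restrict (adjoint H R) fixed_space y)"
    if "x \<in> fixed_space" "y \<in> fixed_space" for x y
    using that adjoint_inner[OF H R(1), of x y] by (simp add: fixed_space_def)
qed

lemma restrict_compose:
  assumes R: "R \<in> bounded_ops H" "compose H q R = R"
  shows "restrict (compose H R' R) fixed_space = compose fixed_space (restrict R' fixed_space) (restrict R fixed_space)"
proof
  fix x
  show "restrict (compose H R' R) fixed_space x = compose fixed_space (restrict R' fixed_space) (restrict R fixed_space) x"
    using bop_apply[OF fixed_space_hs restrict_bop[OF R]]
    by (cases "x \<in> fixed_space") (auto simp: compose_def fixed_space_def)
qed

text \<open>\<open>R x = R (q x)\<close> and \<open>q\<close> is a contraction, so compressing to
  the range of \<open>q\<close> loses no norm.\<close>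

lemma restrict_op_norm:
  assumes R: "R \<in> bounded_ops H" "compose H q R = R" "compose H R q = R"
  shows "op_norm H R \<le> op_norm fixed_space (restrict R fixed_space)"
proof (rule op_norm_le[OF H])
  note b = restrict_bop[OF R(1,2)]
  show "0 \<le> op_norm fixed_space (restrict R fixed_space)" by (rule op_norm_nonneg[OF fixed_space_hs b])
  fix x assume x: "x \<in> H"
  have "R x = restrict R fixed_space (q x)" using fun_cong[OF R(3), of x] x q_fixed[OF x] by simp
  then have "ell2_norm (R x) \<le> op_norm fixed_space (restrict R fixed_space) * ell2_norm (q x)"
    using op_norm_bound[OF fixed_space_hs b q_fixed[OF x]] by simp
  also have "\<dots> \<le> op_norm fixed_space (restrict R fixed_space) * ell2_norm x"
    by (intro mult_left_mono q_contractive x op_norm_nonneg[OF fixed_space_hs b])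
  finally show "ell2_norm (R x) \<le> op_norm fixed_space (restrict R fixed_space) * ell2_norm x" .
qed

lemma restrict_star_hom:
  assumes \<pi>: "\<pi> \<in> star_hom A (Bop H)"
    and ql: "\<And>a. a \<in> carrier A \<Longrightarrow> compose H q (\<pi> a) = \<pi> a" and qr: "\<And>a. a \<in> carrier A \<Longrightarrow> compose H (\<pi> a) q = \<pi> a"
  shows "(\<lambda>a. restrict (\<pi> a) fixed_space) \<in> star_hom A (Bop fixed_space)"
proof -
  note \<pi>D = star_hom_BopD[OF \<pi>]
  have lin: "restrict (cadd (Bop H) R R') fixed_space = cadd (Bop fixed_space) (restrict R fixed_space) (restrict R' fixed_space)"
    "restrict (cscale (Bop H) c R) fixed_space = cscale (Bop fixed_space) c (restrict R fixed_space)" for R R' c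
    by (auto simp: Bop_def fixed_space_def fun_eq_iff restrict_def)
  show ?thesis
    unfolding star_hom_def mem_Collect_eq Bop_sel
  proof (intro conjI ballI allI Pi_I)
    fix a c assume a: "a \<in> carrier A"
    note Ra = \<pi>D(1)[OF a] ql[OF a]
    show "restrict (\<pi> a) fixed_space \<in> bounded_ops fixed_space" by (rule restrict_bop[OF Ra])
    show "restrict (\<pi> (cscale A c a)) fixed_space = cscale (Bop fixed_space) c (restrict (\<pi> a) fixed_space)"
      by (simp only: \<pi>D(3)[OF a] lin)
    show "restrict (\<pi> (cstar A a)) fixed_space = adjoint fixed_space (restrict (\<pi> a) fixed_space)"
      by (simp only: \<pi>D(5)[OF a] restrict_adjoint[OF Ra qr[OF a]])
    fix b assume b: "b \<in> carrier A"
    show "restrict (\<pi> (cadd A a b)) fixed_space =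
        cadd (Bop fixed_space) (restrict (\<pi> a) fixed_space) (restrict (\<pi> b) fixed_space)"
      by (simp only: \<pi>D(2)[OF a b] lin)
    show "restrict (\<pi> (cmult A a b)) fixed_space =
        compose fixed_space (restrict (\<pi> a) fixed_space) (restrict (\<pi> b) fixed_space)"
      by (simp only: \<pi>D(4)[OF a b] restrict_compose[OF \<pi>D(1)[OF b] ql[OF b]])
  qed
qed

end

lemma isometry_norm:
  assumes H: "hilbert_space H" and U: "U \<in> bounded_ops H" "compose H (adjoint H U) U = id_op H"
  shows "op_norm H U \<le> 1"
proof (rule op_norm_le[OF H])
  show "ell2_norm (U x) \<le> 1 * ell2_norm x" if "x \<in> H" for x
    using partial_isometry_contractive[OF H U(1) _ that] U(2) compose_id_right[OF H U(1)] by simp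
qed simp

section \<open>First isomorphism: crossed product by the monoid \<open>S\<close>\<close>

section \<open>\<open>C\<^sup>*(S\<^sup>*)\<close> as a crossed product by \<open>S\<close>\<close>

context
  fixes S :: "'s::monoid_mult itself" and I :: "'i itself"
begin

abbreviation "SI \<equiv> universal_isg S"
abbreviation "EI \<equiv> idempotents (universal_isg S)"
abbreviation "ZI \<equiv> zero_elements (universal_isg S)"
abbreviation "AE \<equiv> cstar_isg_idempotents I S"
abbreviation gen :: "'s word set \<Rightarrow> (nat \<Rightarrow> 's word set \<Rightarrow> complex) set" where
  "gen \<equiv> isg_gen I EI ZI"
abbreviation v :: "'s \<Rightarrow> 's word set" where "v s \<equiv> cls [(s, False)]"
abbreviation conj_el :: "'s word set \<Rightarrow> 's word set \<Rightarrow> 's word set" where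
  "conj_el p e \<equiv> smul SI p (smul SI e (sstar SI p))"

interpretation E: regular_star_semigroup EI by (rule E_regular_star_semigroup)
interpretation PP: regular_star_semigroup SI by (rule P_regular_star_semigroup)
interpretation A: rep_cstar AE "sg_index EI ZI :: ('i vec set \<times> _) set" fst "isg_rep EI"
  unfolding cstar_isg_idempotents_def by (rule E.isg_rep_cstar)

lemma universal_isg_TYPE: "universal_isg TYPE('s) = SI"
  by (simp add: universal_isg_def)

lemma gen_closed: "e \<in> carrier EI \<Longrightarrow> gen e \<in> carrier AE"
  unfolding cstar_isg_idempotents_def by (rule E.isg_gen_closed)

lemma gen_mult: "e \<in> carrier EI \<Longrightarrow> f \<in> carrier EI \<Longrightarrow> cmult AE (gen e) (gen f) = gen (smul SI e f)"
  unfolding cstar_isg_idempotents_def by (simp add: E.isg_gen_mult) (simp add: E_sel)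

lemma gen_star: "e \<in> carrier EI \<Longrightarrow> cstar AE (gen e) = gen e"
  unfolding cstar_isg_idempotents_def by (simp add: E.isg_gen_star) (simp add: E_sel E_star)

lemma gen_generates: "generates AE (gen ` carrier EI)"
  unfolding cstar_isg_idempotents_def by (rule E.isg_gen_generates)

lemma AE_commute:
  assumes "x \<in> carrier AE" "y \<in> carrier AE" shows "cmult AE x y = cmult AE y x"
  by (rule A.generators_commute_imp_commutative[OF gen_generates _ _ assms])
    (auto simp: gen_star gen_mult E_commute)

text \<open>Multiplication by the image of the unit and the identity map are both homomorphisms, and
  they agree on generators.\<close>

lemma AE_unit:
  assumes x: "x \<in> carrier AE" shows "cmult AE (gen (cls [])) x = x"
proof -
  have "cmult AE (gen (cls [])) \<in> star_hom AE AE"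
    by (rule A.star_hom_mult_central[OF AE_commute]) (auto simp: gen_closed unit_in_E gen_star gen_mult P_mult)
  then show ?thesis
  proof (rule hom_unique[OF A.rep_cstar_axioms A.rep_cstar_axioms _ star_hom_id gen_generates _ x])
    fix y assume "y \<in> gen ` carrier EI"
    then obtain e where e: "e \<in> carrier EI" "y = gen e" by blast
    have "e \<in> carrier SI" using e(1) by (simp add: E_carrier)
    then show "cmult AE (gen (cls [])) y = y" by (simp add: e gen_mult unit_in_E P_unit)
  qed
qed

lemma conj_comp:
  assumes "p \<in> carrier SI" "q \<in> carrier SI" "e \<in> carrier EI"
  shows "conj_el p (conj_el q e) = conj_el (smul SI p q) e"
  using assms by (simp add: E_carrier P_star_mult P_assoc P_mult_closed P_star_closed)

lemma conj_unit: "e \<in> carrier EI \<Longrightarrow> conj_el (cls []) e = e"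
  using P_unit[of e S] by (simp add: P_star E_carrier)

lemma conj_zero: "z \<in> ZI \<Longrightarrow> p \<in> carrier SI \<Longrightarrow> conj_el p z = z"
  by (simp add: zero_elements_def P_star_closed)

lemma conj_cancel:
  assumes e: "e \<in> carrier EI" shows "conj_el (sstar SI (v s)) (conj_el (v s) e) = e"
proof -
  have "smul SI (sstar SI (v s)) (v s) = cls []" by (simp add: P_star word_star_Cons isometry_relation)
  then show ?thesis
    using conj_comp[of "sstar SI (v s)" "v s" e] conj_unit[OF e] e by (simp only: cls_closed P_star_closed simp_thms)
qed

lemma conj_range:
  assumes e: "e \<in> carrier EI"
  shows "conj_el (v s) (conj_el (sstar SI (v s)) e) = smul SI (smul SI (v s) (sstar SI (v s))) e"
proof -
  let ?f = "smul SI (v s) (sstar SI (v s))"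
  have f: "?f \<in> carrier EI" by (rule mult_star_in_E) simp
  have c: "?f \<in> carrier SI" "smul SI ?f ?f = ?f" "e \<in> carrier SI" using f e by (auto simp: E_carrier)
  have "conj_el (v s) (conj_el (sstar SI (v s)) e) = smul SI ?f (smul SI e (sstar SI ?f))"
    by (rule conj_comp) (simp_all add: e P_star_closed)
  also have "\<dots> = smul SI ?f (smul SI ?f e)" by (simp only: E_star[OF f] E_commute[OF e f])
  also have "\<dots> = smul SI (smul SI ?f ?f) e" using P_assoc[OF c(1,1,3)] by simp
  also have "\<dots> = smul SI ?f e" by (simp only: c(2))
  finally show ?thesis .
qed

text \<open>Chosen by its values on generators: existence is functoriality, and generation
  determines the choice on the carrier.\<close>

definition conj_map :: "'s word set \<Rightarrow> (nat \<Rightarrow> 's word set \<Rightarrow> complex) set \<Rightarrow> (nat \<Rightarrow> 's word set \<Rightarrow> complex) set" where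
  "conj_map p = (SOME f. f \<in> star_hom AE AE \<and> (\<forall>e\<in>carrier EI. f (gen e) = gen (conj_el p e)))"

lemma conj_map:
  assumes p: "p \<in> carrier SI"
  shows "conj_map p \<in> star_hom AE AE" "e \<in> carrier EI \<Longrightarrow> conj_map p (gen e) = gen (conj_el p e)"
proof -
  \<comment> \<open>Conjugation fixes the zero of \<open>S*\<close>, so the set of killed elements
    is respected and \<open>isg_map\<close> applies.\<close>
  have Z: "(\<lambda>e. conj_el p e) ` ZI \<subseteq> ZI" using conj_zero p by auto
  have "\<exists>f. f \<in> star_hom AE AE \<and> (\<forall>e\<in>carrier EI. f (gen e) = gen (conj_el p e))"
    using E.isg_map[OF E_regular_star_semigroup conj_hom[OF p] Z, of I] unfolding cstar_isg_idempotents_def by blast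
  from someI_ex[OF this] show "conj_map p \<in> star_hom AE AE" "e \<in> carrier EI \<Longrightarrow> conj_map p (gen e) = gen (conj_el p e)"
    unfolding conj_map_def by auto
qed

lemma conj_map_closed: "p \<in> carrier SI \<Longrightarrow> x \<in> carrier AE \<Longrightarrow> conj_map p x \<in> carrier AE"
  using conj_map(1)[of p] by (auto simp: star_hom_def)

definition mon_action :: "'s \<Rightarrow> (nat \<Rightarrow> 's word set \<Rightarrow> complex) set \<Rightarrow> (nat \<Rightarrow> 's word set \<Rightarrow> complex) set" where
  "mon_action s = conj_map (v s)"

lemma AE_hom_eqI:
  assumes "f \<in> star_hom AE AE" "g \<in> star_hom AE AE" "\<And>e. e \<in> carrier EI \<Longrightarrow> f (gen e) = g (gen e)" "x \<in> carrier AE"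
  shows "f x = g x"
  using hom_unique[OF A.rep_cstar_axioms A.rep_cstar_axioms assms(1,2) gen_generates _ assms(4)] assms(3) by auto

lemma mon_action_left_inverse:
  assumes x: "x \<in> carrier AE" shows "conj_map (sstar SI (v s)) (mon_action s x) = x"
  unfolding mon_action_def
  by (rule AE_hom_eqI[OF star_hom_comp[OF conj_map(1) conj_map(1)] star_hom_id _ x])
    (simp_all add: P_star_closed conj_map(2) conj_in_E conj_cancel)

lemma mon_action_range:
  assumes x: "x \<in> carrier AE"
  shows "mon_action s (conj_map (sstar SI (v s)) x) = cmult AE (gen (smul SI (v s) (sstar SI (v s)))) x"
proof -
  let ?f = "smul SI (v s) (sstar SI (v s))"
  have f: "?f \<in> carrier EI" by (rule mult_star_in_E) simp
  have m: "cmult AE (gen ?f) \<in> star_hom AE AE"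
    by (rule A.star_hom_mult_central[OF AE_commute]) (use f in \<open>auto simp: gen_closed gen_star gen_mult E_carrier\<close>)
  show ?thesis unfolding mon_action_def
    by (rule AE_hom_eqI[OF star_hom_comp[OF conj_map(1) conj_map(1)] m _ x])
      (simp_all add: P_star_closed conj_map(2) conj_in_E conj_range gen_mult f)
qed

text \<open>Conjugation by \<open>v_s*\<close> is a left inverse since \<open>v_s* v_s = 1\<close>,
  and the other composite is multiplication by \<open>v_s v_s*\<close>. Hence the range is the
  corner cut out by a projection of a commutative algebra, which is an ideal.\<close>

lemma mon_action_injective_action: "injective_action AE mon_action"
proof -
  have hom: "mon_action s \<in> star_hom AE AE" for s unfolding mon_action_def by (rule conj_map(1)) simp
  have inj: "inj_on (mon_action s) (carrier AE)" for s
    by (rule inj_on_inverseI[of _ "conj_map (sstar SI (v s))"]) (rule mon_action_left_inverse)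
  have ideal: "closed_star_ideal AE (mon_action s ` carrier AE)" for s
  proof -
    let ?f = "smul SI (v s) (sstar SI (v s))"
    have f: "?f \<in> carrier EI" by (rule mult_star_in_E) simp
    have fu: "conj_el (v s) (cls []) = ?f" using P_unit[of "sstar SI (v s)" S] by (simp add: P_star_closed)
    have "mon_action s ` carrier AE = {x \<in> carrier AE. cmult AE (gen ?f) x = x}"
    proof (intro subset_antisym subsetI)
      fix y assume "y \<in> mon_action s ` carrier AE"
      then obtain x where x: "x \<in> carrier AE" "y = mon_action s x" by blast
      have "cmult AE (gen ?f) (mon_action s x) = cmult AE (mon_action s (gen (cls []))) (mon_action s x)"
        using fu by (simp add: mon_action_def conj_map(2) unit_in_E)
      also have "\<dots> = mon_action s (cmult AE (gen (cls [])) x)"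
        using hom[of s] x gen_closed[OF unit_in_E] by (simp add: star_hom_def)
      also have "\<dots> = mon_action s x" by (simp add: AE_unit x)
      finally show "y \<in> {x \<in> carrier AE. cmult AE (gen ?f) x = x}"
        using x hom[of s] by (auto simp: star_hom_def)
    next
      fix y assume y: "y \<in> {x \<in> carrier AE. cmult AE (gen ?f) x = x}"
      then have "y = mon_action s (conj_map (sstar SI (v s)) y)" using mon_action_range[of y s] by simp
      then show "y \<in> mon_action s ` carrier AE"
        using y conj_map_closed[of "sstar SI (v s)" y] by (simp add: P_star_closed)
    qed
    then show ?thesis using A.corner_ideal[OF AE_commute gen_closed[OF f] gen_star[OF f]] by simp
  qed
  have comp: "mon_action (s * t) a = mon_action s (mon_action t a)" if a: "a \<in> carrier AE" for s t a
    unfolding mon_action_def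
    by (rule AE_hom_eqI[OF conj_map(1) star_hom_comp[OF conj_map(1) conj_map(1)] _ a])
      (simp_all add: conj_map(2) conj_in_E conj_comp product_relation)
  show ?thesis unfolding injective_action_def using hom inj ideal comp by blast
qed

subsection \<open>Covariant representations of \<open>(C\<^sup>*(E), S)\<close> and representations of \<open>S\<^sup>*\<close>\<close>

definition cov_rel :: "'i vec set \<Rightarrow> ((nat \<Rightarrow> 's word set \<Rightarrow> complex) set + 's \<Rightarrow> 'i operator) \<Rightarrow> bool" where
  "cov_rel H \<rho> \<longleftrightarrow> covariant_monoid AE mon_action H (\<lambda>a. \<rho> (Inl a)) (\<lambda>s. \<rho> (Inr s))"

text \<open>The representation of \<open>S*\<close> generated by the isometries of the pair. That it
  restricts on \<open>E\<close> to the other half of the pair is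
  \<open>cov_word_idem\<close>.\<close>

definition cov_word :: "'i vec set \<times> ((nat \<Rightarrow> 's word set \<Rightarrow> complex) set + 's \<Rightarrow> 'i operator) \<Rightarrow> 's word set \<Rightarrow> 'i operator" where
  "cov_word j = isometries_and_projections.word_rep (fst j) (\<lambda>s. snd j (Inr s))"

context
  fixes H :: "'i vec set" and \<rho>
  assumes H: "hilbert_space H" and cov: "cov_rel H \<rho>"
begin

abbreviation "\<pi> \<equiv> \<lambda>a. \<rho> (Inl a)"
abbreviation "T \<equiv> \<lambda>s. \<rho> (Inr s)"

lemma cov_hom: "\<pi> \<in> star_hom AE (Bop H)"
  and cov_T: "T s \<in> bounded_ops H" "compose H (adjoint H (T s)) (T s) = id_op H"
    "T (s * t) = compose H (T s) (T t)"
  using cov unfolding cov_rel_def covariant_monoid_def by auto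

lemma cov_unit: "\<pi> (gen (cls [])) = id_op H"
  using cov nondegenerate_iff_unit[OF H cov_hom gen_closed[OF unit_in_E] AE_unit]
  unfolding cov_rel_def covariant_monoid_def by auto

lemma cov_bop: "e \<in> carrier EI \<Longrightarrow> \<pi> (gen e) \<in> bounded_ops H"
  using star_hom_BopD(1)[OF cov_hom] gen_closed by blast

lemma cov_mult: "e \<in> carrier EI \<Longrightarrow> f \<in> carrier EI \<Longrightarrow> \<pi> (gen (smul SI e f)) = compose H (\<pi> (gen e)) (\<pi> (gen f))"
  using star_hom_BopD(4)[OF cov_hom gen_closed gen_closed] by (simp add: gen_mult)

lemma cov_conj:
  assumes e: "e \<in> carrier EI"
  shows "\<pi> (gen (conj_el (v s) e)) = compose H (T s) (compose H (\<pi> (gen e)) (adjoint H (T s)))"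
proof -
  have "\<pi> (mon_action s (gen e)) = compose H (T s) (compose H (\<pi> (gen e)) (adjoint H (T s)))"
    using cov gen_closed[OF e] unfolding cov_rel_def covariant_monoid_def by blast
  then show ?thesis using e by (simp add: mon_action_def conj_map(2))
qed

text \<open>Covariance prescribes only conjugation with \<open>T_s\<close> on the left. Let
  \<open>X\<close> and \<open>Y\<close> be the images of \<open>v_s* e v_s\<close> and of
  \<open>e\<close>. Applied to the first element, covariance gives
  \<open>T_s X T_s* = T_s T_s* Y\<close>, and multiplying by \<open>T_s*\<close> on the left and
  \<open>T_s\<close> on the right isolates \<open>X\<close>.\<close>

lemma cov_conj':
  assumes e: "e \<in> carrier EI"
  shows "\<pi> (gen (conj_el (sstar SI (v s)) e)) = compose H (adjoint H (T s)) (compose H (\<pi> (gen e)) (T s))"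
proof -
  let ?f = "smul SI (v s) (sstar SI (v s))" and ?e' = "conj_el (sstar SI (v s)) e"
  let ?Ts = "adjoint H (T s)"
  have f: "?f \<in> carrier EI" by (rule mult_star_in_E) simp
  have e': "?e' \<in> carrier EI" by (rule conj_in_E) (simp_all add: e P_star_closed)
  note Tb = cov_T(1)[of s] and Tsb = adjoint_bop[OF H cov_T(1)[of s]]
  have TT: "?Ts (T s x) = x" if "x \<in> H" for x using fun_cong[OF cov_T(2)[of s], of x] that by simp
  have "conj_el (v s) (cls []) = ?f" using P_unit[of "sstar SI (v s)" S] by (simp add: P_star_closed)
  then have \<pi>f: "\<pi> (gen ?f) = compose H (T s) ?Ts"
    using cov_conj[OF unit_in_E, of s] by (simp add: cov_unit compose_id_left[OF H Tsb])
  have eq: "compose H (T s) (compose H (\<pi> (gen ?e')) ?Ts) = compose H (compose H (T s) ?Ts) (\<pi> (gen e))"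
    using cov_conj[OF e', of s] conj_range[OF e, of s] cov_mult[OF f e] \<pi>f by simp
  show ?thesis
  proof (rule bop_eqI[OF H])
    show "\<pi> (gen ?e') \<in> bounded_ops H" by (rule cov_bop[OF e'])
    show "compose H ?Ts (compose H (\<pi> (gen e)) (T s)) \<in> bounded_ops H"
      by (intro Bop_closed[OF H] cov_T cov_bop e)
    fix x assume x: "x \<in> H"
    note ap = bop_apply[OF H Tb] bop_apply[OF H Tsb] bop_apply[OF H cov_bop[OF e]] bop_apply[OF H cov_bop[OF e']]
    have "T s (\<pi> (gen ?e') (?Ts (T s x))) = T s (?Ts (\<pi> (gen e) (T s x)))"
      using fun_cong[OF eq, of "T s x"] x by (simp add: ap)
    then have "?Ts (T s (\<pi> (gen ?e') x)) = ?Ts (T s (?Ts (\<pi> (gen e) (T s x))))" using x by (simp add: TT)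
    then show "\<pi> (gen ?e') x = compose H ?Ts (compose H (\<pi> (gen e)) (T s)) x"
      using x by (simp add: TT ap)
  qed
qed

lemma cov_isometries: "isometries_and_projections H T {\<pi> (gen e) | e. e \<in> carrier EI}"
proof
  show "compose H X X = X" if "X \<in> {\<pi> (gen e) | e. e \<in> carrier EI}" for X
    using that by (auto simp: E_carrier simp flip: cov_mult)
  show "compose H X Y = compose H Y X" if "X \<in> {\<pi> (gen e) | e. e \<in> carrier EI}" "Y \<in> {\<pi> (gen e) | e. e \<in> carrier EI}" for X Y
    using that by (auto simp: E_commute simp flip: cov_mult)
  show "id_op H \<in> {\<pi> (gen e) | e. e \<in> carrier EI}" using cov_unit unit_in_E by force
  show "compose H (T s) (compose H X (adjoint H (T s))) \<in> {\<pi> (gen e) | e. e \<in> carrier EI}"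
    if X: "X \<in> {\<pi> (gen e) | e. e \<in> carrier EI}" for s X
  proof -
    obtain e where e: "e \<in> carrier EI" "X = \<pi> (gen e)" using X by blast
    have "conj_el (v s) e \<in> carrier EI" by (rule conj_in_E[OF _ e(1)]) simp
    then show ?thesis unfolding e(2) cov_conj[OF e(1), symmetric] by blast
  qed
  show "compose H (adjoint H (T s)) (compose H X (T s)) \<in> {\<pi> (gen e) | e. e \<in> carrier EI}"
    if X: "X \<in> {\<pi> (gen e) | e. e \<in> carrier EI}" for s X
  proof -
    obtain e where e: "e \<in> carrier EI" "X = \<pi> (gen e)" using X by blast
    have "conj_el (sstar SI (v s)) e \<in> carrier EI" by (rule conj_in_E[OF _ e(1)]) (simp add: P_star_closed)
    then show ?thesis unfolding e(2) cov_conj'[OF e(1), symmetric] by blast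
  qed
qed (use H cov_T cov_bop in auto)

interpretation V: isometries_and_projections H T "{\<pi> (gen e) | e. e \<in> carrier EI}" by (rule cov_isometries)

lemma cov_word_eq: "cov_word (H, \<rho>) = V.word_rep"
  by (simp add: cov_word_def)

text \<open>The covariance formulas for the two kinds of letters, \<open>cov_conj\<close> and
  \<open>cov_conj'\<close>, composed along a word.\<close>

lemma word_op_gen:
  assumes e: "e \<in> carrier EI"
  shows "compose H (word_op H T w) (compose H (\<pi> (gen e)) (adjoint H (word_op H T w))) = \<pi> (gen (conj_el (cls w) e))"
proof (induction w)
  case Nil
  then show ?case using e by (simp add: conj_unit adjoint_id[OF H] compose_id_left[OF H cov_bop] compose_id_right[OF H cov_bop])
next
  case (Cons a w)
  obtain g b where a: "a = (g, b)" by fastforce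
  let ?l = "if b then adjoint H (T g) else T g" and ?W = "word_op H T w" and ?X = "\<pi> (gen e)"
  let ?f = "conj_el (cls w) e"
  have f: "?f \<in> carrier EI" by (rule conj_in_E[OF _ e]) simp
  note b = V.letter_bop V.word_op_bop cov_bop[OF e] adjoint_bop[OF H V.word_op_bop] adjoint_bop[OF H V.letter_bop]
  have "compose H (word_op H T (a # w)) (compose H ?X (adjoint H (word_op H T (a # w))))
      = compose H ?l (compose H (compose H ?W (compose H ?X (adjoint H ?W))) (adjoint H ?l))"
    by (simp only: a word_op.simps adjoint_compose[OF H V.letter_bop V.word_op_bop] compose_assoc'[OF H] b compose_closed[OF H])
  also have "\<dots> = compose H ?l (compose H (\<pi> (gen ?f)) (adjoint H ?l))" by (simp only: Cons.IH)
  also have "\<dots> = \<pi> (gen (conj_el (cls [(g, b)]) ?f))"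
  proof (cases b)
    case True
    have "cls [(g, True)] = sstar SI (v g)" by (simp add: P_star word_star_Cons)
    then show ?thesis using cov_conj'[OF f, of g] True by (simp add: adjoint_adjoint[OF H cov_T(1)])
  next
    case False
    then show ?thesis using cov_conj[OF f, of g] by simp
  qed
  also have "conj_el (cls [(g, b)]) ?f = conj_el (cls (a # w)) e"
    by (subst conj_comp) (simp_all add: e P_mult a)
  finally show ?case .
qed

lemma cov_word_cls: "cov_word (H, \<rho>) (cls w) = word_op H T w"
  by (simp add: cov_word_eq V.word_rep_cls)

lemma cov_word_range: "compose H (cov_word (H, \<rho>) (cls w)) (adjoint H (cov_word (H, \<rho>) (cls w))) = \<pi> (gen (smul SI (cls w) (sstar SI (cls w))))"
  using word_op_gen[OF unit_in_E, of w] P_unit[of "sstar SI (cls w)" S]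
  by (simp add: cov_word_eq V.word_rep_cls cov_unit compose_id_left[OF H] adjoint_bop[OF H V.word_op_bop] P_star_closed)

text \<open>An idempotent equals its own range projection, and covariance for words applied to the
  unit identifies the range projection of a word with the value of \<open>\<pi>\<close> at the
  corresponding generator.\<close>

lemma cov_word_idem:
  assumes e: "e \<in> carrier EI" shows "cov_word (H, \<rho>) e = \<pi> (gen e)"
proof -
  have ec: "e \<in> carrier SI" "smul SI e e = e" using e by (auto simp: E_carrier)
  obtain w where w: "e = cls w" using ec(1) by (rule P_E)
  have "cov_word (H, \<rho>) (smul SI e (sstar SI e)) = compose H (cov_word (H, \<rho>) e) (adjoint H (cov_word (H, \<rho>) e))"
    using ec(1) by (simp add: cov_word_eq sg_repsD[OF V.word_rep_sg_reps[unfolded universal_isg_TYPE]] P_star_closed)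
  then show ?thesis using cov_word_range[of w] by (simp add: E_star[OF e] ec flip: w)
qed

lemma cov_word_index: "(H, cov_word (H, \<rho>)) \<in> sg_index SI ZI"
proof -
  have "cov_word (H, \<rho>) z = zero_op H" if z: "z \<in> ZI" for z
  proof -
    have zE: "z \<in> carrier EI" using z zero_in_E by blast
    have "gen z = czero AE" unfolding cstar_isg_idempotents_def using z zE by (rule E.isg_gen_zero)
    then show ?thesis using A.star_hom_zero[OF H cov_hom] by (simp add: cov_word_idem[OF zE])
  qed
  then show ?thesis unfolding sg_index_def using H V.word_rep_sg_reps[unfolded universal_isg_TYPE] by (simp add: cov_word_eq)
qed

end

abbreviation "cov_gens \<equiv> Inl ` carrier AE \<union> range (Inr :: 's \<Rightarrow> (nat \<Rightarrow> 's word set \<Rightarrow> complex) set + 's)"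

definition pair_of_rep :: "'i vec set \<Rightarrow> ('s word set \<Rightarrow> 'i operator) \<Rightarrow> (nat \<Rightarrow> 's word set \<Rightarrow> complex) set + 's \<Rightarrow> 'i operator" where
  "pair_of_rep H p = (\<lambda>x. case x of Inl a \<Rightarrow> isg_rep EI (H, p) a | Inr s \<Rightarrow> p (v s))"

lemma sg_index_restrict: "(H, p) \<in> sg_index SI ZI \<Longrightarrow> (H, p) \<in> sg_index EI ZI"
  unfolding sg_index_def by (auto intro!: sg_repsI simp: E_sel sg_repsD E_carrier)

text \<open>Both sides of the covariance condition are *-homomorphisms in the coefficient, so it
  suffices to compare them on generators, where they agree by multiplicativity of
  \<open>p\<close>.\<close>

lemma pair_of_rep_cov:
  assumes p: "(H, p) \<in> sg_index SI ZI" and unit: "p (cls []) = id_op H"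
  shows "cov_rel H (pair_of_rep H p)"
proof -
  have H: "hilbert_space H" and pr: "p \<in> sg_reps SI H" using p by (auto simp: sg_index_def)
  note pD = sg_repsD[OF pr]
  note pE = sg_index_restrict[OF p]
  have hom: "isg_rep EI (H, p) \<in> star_hom AE (Bop H)" using A.hom[OF pE] by simp
  have gen': "isg_rep EI (H, p) (gen e) = p e" if "e \<in> carrier EI" for e using E.isg_rep_gen[OF pE that] by simp
  have iso: "compose H (adjoint H (p (v s))) (p (v s)) = id_op H" for s
    using pD(2)[of "sstar SI (v s)" "v s"] pD(3)[of "v s"] unit
    by (simp add: P_star word_star_Cons isometry_relation)
  \<comment> \<open>\<open>v 1\<close> is an idempotent isometry, so
    \<open>v_1 = v_1* v_1 v_1 = v_1* v_1 = 1\<close>.\<close>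
  have v1: "v 1 = cls []"
  proof -
    have "v 1 = smul SI (cls []) (v 1)" by (simp add: P_unit)
    also have "\<dots> = smul SI (smul SI (cls [(1, True)]) (v 1)) (v 1)" by (simp only: isometry_relation)
    also have "\<dots> = smul SI (cls [(1, True)]) (smul SI (v 1) (v 1))" by (simp add: P_assoc)
    also have "\<dots> = cls []" using product_relation[of S 1 1] by (simp add: isometry_relation)
    finally show ?thesis .
  qed
  have cov: "isg_rep EI (H, p) (mon_action s a) =
      compose H (p (v s)) (compose H (isg_rep EI (H, p) a) (adjoint H (p (v s))))" if a: "a \<in> carrier AE" for s a
  proof -
    have m: "mon_action s \<in> star_hom AE AE" unfolding mon_action_def by (rule conj_map(1)) simp
    have "isg_rep EI (H, p) (mon_action s (gen e)) =
        compose H (p (v s)) (compose H (isg_rep EI (H, p) (gen e)) (adjoint H (p (v s))))" if e: "e \<in> carrier EI" for e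
    proof -
      have "conj_el (v s) e \<in> carrier EI" by (rule conj_in_E[OF _ e]) simp
      moreover have "e \<in> carrier SI" using e by (simp add: E_carrier)
      ultimately show ?thesis using e
        by (simp add: mon_action_def conj_map(2) gen' pD P_mult_closed P_star_closed)
    qed
    then show ?thesis
      by (intro A.star_hom_unique[OF H star_hom_comp[OF m hom] star_hom_conj_isometry[OF H hom pD(1) iso] gen_generates _ a])
        auto
  qed
  have "nondegenerate H AE (isg_rep EI (H, p))"
    using nondegenerate_iff_unit[OF H hom gen_closed[OF unit_in_E] AE_unit] gen'[OF unit_in_E] unit by simp
  moreover have "p (v (s * t)) = compose H (p (v s)) (p (v t))" for s t
    using pD(2)[of "v s" "v t"] by (simp add: product_relation)
  ultimately show ?thesis
    unfolding cov_rel_def covariant_monoid_def pair_of_rep_def using hom iso cov unit v1 pD(1) by simp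
qed

text \<open>A covariant pair comes with no norm condition; the bound for a coefficient
  \<open>a\<close> is automatic continuity.\<close>

lemma cov_bounded_relations:
  "bounded_relations cov_gens cov_rel (\<lambda>x. case x of Inl a \<Rightarrow> cnorm AE a | Inr s \<Rightarrow> 1)"
proof
  fix H \<rho> g assume H: "hilbert_space H" and R: "cov_rel H \<rho>" and g: "g \<in> cov_gens"
  show "\<rho> g \<in> bounded_ops H"
    using g star_hom_BopD(1)[OF cov_hom[OF H R]] cov_T(1)[OF H R] by auto
  show "op_norm H (\<rho> g) \<le> (case g of Inl a \<Rightarrow> cnorm AE a | Inr s \<Rightarrow> 1)"
    using g A.star_hom_contractive[OF H cov_hom[OF H R]] isometry_norm[OF H cov_T(1)[OF H R] cov_T(2)[OF H R]] by auto
next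
  have "(id_op {0} :: 'i operator) \<in> bounded_ops {0}" by (rule id_op_closed[OF hilbert_space_zero])
  then have "zero_op {0} = (id_op {0} :: 'i operator)" by (simp add: bop_zero_space)
  then have "cov_rel {0} (pair_of_rep {0} (\<lambda>_. zero_op {0}))" by (intro pair_of_rep_cov zero_space_index)
  then show "\<exists>H \<rho>. hilbert_space H \<and> cov_rel H \<rho>" using hilbert_space_zero by blast
qed

interpretation B: bounded_relations cov_gens cov_rel "\<lambda>x. case x of Inl a \<Rightarrow> cnorm AE a | Inr s \<Rightarrow> 1"
  by (rule cov_bounded_relations)

abbreviation "PC \<equiv> isg_cstar I SI ZI"

definition cov_rep :: "'i vec set \<times> ((nat \<Rightarrow> 's word set \<Rightarrow> complex) set + 's \<Rightarrow> 'i operator) \<Rightarrow>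
    (nat \<Rightarrow> 's word set \<Rightarrow> complex) set \<Rightarrow> 'i operator" where
  "cov_rep j = isg_rep SI (fst j, cov_word j)"

interpretation PC: rep_cstar PC "sg_index SI ZI :: ('i vec set \<times> _) set" fst "isg_rep SI"
  by (rule PP.isg_rep_cstar)

text \<open>The elements fixed by left multiplication with the unit generator form a closed subspace
  containing the spanning generators. The law on the right is the adjoint of the law on the
  left.\<close>

lemma PC_unit:
  assumes x: "x \<in> carrier PC"
  shows "cmult PC (isg_gen I SI ZI (cls [])) x = x" "cmult PC x (isg_gen I SI ZI (cls [])) = x"
proof -
  let ?u = "isg_gen I SI ZI (cls [])"
  have u: "?u \<in> carrier PC" by (rule PP.isg_gen_closed) simp
  have left: "cmult PC ?u y = y" if y: "y \<in> carrier PC" for y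
  proof -
    have "isg_gen I SI ZI ` carrier SI \<subseteq> {x \<in> carrier PC. cmult PC ?u x = x}"
      by (auto simp: PP.isg_gen_closed PP.isg_gen_mult P_unit)
    then show ?thesis using PP.isg_gen_spans[of I ZI] PC.corner_closed_subspace[OF u] y unfolding spans_def by blast
  qed
  have us: "cstar PC ?u = ?u" by (simp add: PP.isg_gen_star P_star)
  show "cmult PC ?u x = x" by (rule left[OF x])
  have "cmult PC x ?u = cstar PC (cmult PC ?u (cstar PC x))"
    using x u us by (simp add: PC.star_mult PC.star_star PC.closed)
  also have "\<dots> = x" using x by (simp add: left PC.closed PC.star_star)
  finally show "cmult PC x ?u = x" .
qed

text \<open>A representation of \<open>S*\<close> need not send the unit to the identity. Its value
  \<open>q\<close> there is a projection absorbed on both sides by all other values, so restriction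
  to the range of \<open>q\<close> gives a unital representation without loss of norm, and this one
  comes from a covariant pair.\<close>

lemma unital_part:
  fixes H :: "'i vec set" and p :: "'s word set \<Rightarrow> 'i operator"
  assumes j: "(H, p) \<in> sg_index SI ZI"
  shows "\<exists>k\<in>rel_index cov_rel. \<forall>x\<in>carrier PC. op_norm H (isg_rep SI (H, p) x) \<le> op_norm (fst k) (cov_rep k x)"
proof -
  have H: "hilbert_space H" and pr: "p \<in> sg_reps SI H" and pz: "\<And>z. z \<in> ZI \<Longrightarrow> p z = zero_op H"
    using j by (auto simp: sg_index_def)
  note pD = sg_repsD[OF pr]
  define q where "q = p (cls [])"
  have q: "q \<in> bounded_ops H" "compose H q q = q" "adjoint H q = q"
    using pD(1)[of "cls []"] pD(2)[of "cls []" "cls []"] pD(3)[of "cls []"] by (simp_all add: q_def P_mult P_star)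
  let ?H = "fixed_space H q"
  note H' = fixed_space_hs[OF H q]
  have ql: "compose H q (p s) = p s" "compose H (p s) q = p s" if "s \<in> carrier SI" for s
    using pD(2)[of "cls []" s] pD(2)[of s "cls []"] that by (simp_all add: q_def P_unit)
  define p' where "p' s = restrict (p s) ?H" for s
  have p'reps: "p' \<in> sg_reps SI ?H"
    by (rule sg_repsI)
      (simp_all add: p'_def restrict_bop[OF H q] restrict_compose[OF H q] restrict_adjoint[OF H q] pD ql)
  have "p' z = zero_op ?H" if "z \<in> ZI" for z
    using pz[OF that] by (auto simp: p'_def fun_eq_iff restrict_def zero_op_def fixed_space_def[OF H q])
  then have p'i: "(?H, p') \<in> sg_index SI ZI" using p'reps H' by (simp add: sg_index_def)
  have p'u: "p' (cls []) = id_op ?H"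
    unfolding p'_def q_def[symmetric] by (auto simp: fun_eq_iff restrict_def id_op_def fixed_space_def[OF H q])
  define k where "k = (?H, pair_of_rep ?H p')"
  have cov: "cov_rel ?H (pair_of_rep ?H p')" by (rule pair_of_rep_cov[OF p'i p'u])
  have k: "k \<in> rel_index cov_rel" using cov H' by (simp add: k_def rel_index_def)
  have word: "cov_word k s = p' s" if s: "s \<in> carrier SI" for s
  proof -
    obtain w where w: "s = cls w" using s by (rule P_E)
    have "cov_word k (cls w) = word_op ?H (\<lambda>s. p' (v s)) w"
      using cov_word_cls[OF H' cov, of w] by (simp add: k_def pair_of_rep_def)
    also have "\<dots> = p' (cls w)"
    proof (rule sg_rep_word[symmetric])
      show "p' \<in> sg_reps (universal_isg TYPE('s)) ?H" by (simp add: universal_isg_TYPE p'reps)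
    qed (fact H' p'u)+
    finally show ?thesis by (simp add: w)
  qed
  have ki: "(?H, cov_word k) \<in> sg_index SI ZI"
    using cov_word_index[OF H' cov] by (simp add: k_def)
  have u: "isg_gen I SI ZI (cls []) \<in> carrier PC" by (rule PP.isg_gen_closed) simp
  have ru: "isg_rep SI (H, p) (isg_gen I SI ZI (cls [])) = q" using PP.isg_rep_gen[OF j, of "cls []" I] by (simp add: q_def)
  have qx: "compose H q (isg_rep SI (H, p) x) = isg_rep SI (H, p) x"
    "compose H (isg_rep SI (H, p) x) q = isg_rep SI (H, p) x" if x: "x \<in> carrier PC" for x
    using PC.rep_mult[OF j u x] PC.rep_mult[OF j x u] by (simp_all add: PC_unit[OF x] ru)
  have hom: "isg_rep SI (H, p) \<in> star_hom PC (Bop H)" using PC.hom[OF j] by simp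
  have "op_norm H (isg_rep SI (H, p) x) \<le> op_norm (fst k) (cov_rep k x)" if x: "x \<in> carrier PC" for x
  proof -
    have "restrict (isg_rep SI (H, p) x) ?H = isg_rep SI (?H, cov_word k) x"
    proof (rule PP.star_hom_eq_isg_rep[OF H' restrict_star_hom[OF H q hom qx] _ x _ ki])
      show "ZI \<subseteq> carrier SI" by (auto simp: zero_elements_def)
      show "restrict (isg_rep SI (H, p) (isg_gen I SI ZI s)) ?H = cov_word k s" if "s \<in> carrier SI" for s
        using that PP.isg_rep_gen[OF j that, of I] by (simp add: word p'_def)
    qed
    moreover have "op_norm H (isg_rep SI (H, p) x) \<le> op_norm ?H (restrict (isg_rep SI (H, p) x) ?H)"
      by (rule restrict_op_norm[OF H q star_hom_BopD(1)[OF hom x] qx[OF x]])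
    ultimately show ?thesis by (simp add: cov_rep_def k_def)
  qed
  then show ?thesis using k by blast
qed

lemma PC_cov: "rep_cstar PC (rel_index cov_rel) fst cov_rep"
proof (rule rep_cstar_reindex[OF PP.isg_rep_cstar, where m = "\<lambda>k. (fst k, cov_word k)"])
  show "rel_index cov_rel \<noteq> {}" using B.rel_nonempty by (auto simp: rel_index_def)
  show "(fst k, cov_word k) \<in> sg_index SI ZI" if "k \<in> rel_index cov_rel" for k
    using that cov_word_index[of "fst k" "snd k"] by (auto simp: rel_index_def)
  show "\<exists>k\<in>rel_index cov_rel. \<forall>x\<in>carrier PC. op_norm (fst j) (isg_rep SI j x) \<le> op_norm (fst k) (cov_rep k x)"
    if "j \<in> sg_index SI ZI" for j :: "'i vec set \<times> _"
    using unital_part[of "fst j" "snd j"] that by simp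
qed (simp_all add: cov_rep_def)

lemma word_op_map: "word_op H \<rho> (map (\<lambda>(s, b). (f s, b)) w) = word_op H (\<lambda>s. \<rho> (f s)) w"
  by (induction w) auto

theorem cstar_universal_isg_iso:
  "cstar_isomorphic (cstar_universal_isg I S) (crossed_product_monoid I AE mon_action)"
proof -
  have "crossed_product_monoid I AE mon_action = completion B.D"
    unfolding crossed_product_monoid_def cov_rel_def[abs_def] ..
  moreover have "cstar_isomorphic PC (completion B.D)"
  proof (rule matched_iso[OF PC_cov B.univ_rep_cstar PP.isg_gen_generates _ B.univ_generates])
    have word: "cov_word j (cls w) = word_op (fst j) (\<lambda>s. snd j (Inr s)) w"
      and index: "(fst j, cov_word j) \<in> sg_index SI ZI"
      and H: "hilbert_space (fst j)" and R: "cov_rel (fst j) (snd j)" if "j \<in> rel_index cov_rel" for j w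
      using that cov_word_cls[of "fst j" "snd j" w] cov_word_index[of "fst j" "snd j"] by (auto simp: rel_index_def)
    have rep_gen: "cov_rep j (isg_gen I SI ZI s) = cov_word j s" if "j \<in> rel_index cov_rel" "s \<in> carrier SI" for j s
      using PP.isg_rep_gen[OF index[OF that(1)] that(2), of I] by (simp add: cov_rep_def)
    fix g assume "g \<in> isg_gen I SI ZI ` carrier SI"
    then obtain w where g: "g = isg_gen I SI ZI (cls w)" by (auto simp: P_carrier)
    show "\<exists>y\<in>carrier (completion B.D). \<forall>j\<in>rel_index cov_rel. B.univ_rep j y = cov_rep j g"
    proof (intro bexI ballI)
      \<comment> \<open>An element of \<open>S*\<close> is matched by the corresponding word in the
        isometry generators alone.\<close>
      let ?w = "map (\<lambda>(s, b). (Inr s, b)) w"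
      have wG: "fst ` set ?w \<subseteq> cov_gens" by auto
      show "B.univ_word ?w \<in> carrier (completion B.D)" by (rule B.univ_word_closed[OF wG])
      show "B.univ_rep j (B.univ_word ?w) = cov_rep j g" if "j \<in> rel_index cov_rel" for j
        using that by (simp only: B.univ_rep_word[OF wG that] word_op_map g rep_gen[OF that cls_closed] word[OF that])
    qed
  next
    have word: "cov_word j (cls w) = word_op (fst j) (\<lambda>s. snd j (Inr s)) w"
      and index: "(fst j, cov_word j) \<in> sg_index SI ZI"
      and H: "hilbert_space (fst j)" and R: "cov_rel (fst j) (snd j)" if "j \<in> rel_index cov_rel" for j w
      using that cov_word_cls[of "fst j" "snd j" w] cov_word_index[of "fst j" "snd j"] by (auto simp: rel_index_def)
    have rep_gen: "cov_rep j (isg_gen I SI ZI s) = cov_word j s" if "j \<in> rel_index cov_rel" "s \<in> carrier SI" for j s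
      using PP.isg_rep_gen[OF index[OF that(1)] that(2), of I] by (simp add: cov_rep_def)
    fix g assume "g \<in> insert (B.univ_word []) ((\<lambda>g. B.univ_word [(g, False)]) ` cov_gens)"
    then consider "g = B.univ_word []" | s where "g = B.univ_word [(Inr s, False)]"
      | a where "a \<in> carrier AE" "g = B.univ_word [(Inl a, False)]" by blast
    then show "\<exists>x\<in>carrier PC. \<forall>j\<in>rel_index cov_rel. cov_rep j x = B.univ_rep j g"
    proof cases
      case 1
      have "cov_rep j (isg_gen I SI ZI (cls [])) = B.univ_rep j g" if j: "j \<in> rel_index cov_rel" for j
        using B.univ_rep_word[of "[]" j] j by (simp add: 1 rep_gen[OF j] word[OF j])
      then show ?thesis by (intro bexI[of _ "isg_gen I SI ZI (cls [])"] ballI PP.isg_gen_closed cls_closed)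
    next
      case (2 s)
      have "cov_rep j (isg_gen I SI ZI (v s)) = B.univ_rep j g" if j: "j \<in> rel_index cov_rel" for j
        using B.univ_rep_word[of "[(Inr s, False)]" j] j by (simp add: 2 rep_gen[OF j] word[OF j])
      then show ?thesis by (intro bexI[of _ "isg_gen I SI ZI (v s)"] ballI PP.isg_gen_closed cls_closed)
    next
      case (3 a)
      \<comment> \<open>A coefficient is matched by its image under the homomorphism induced by the
        inclusion of \<open>E\<close> in \<open>S*\<close>; agreement is checked on generators by
        \<open>cov_word_idem\<close>.\<close>
      have incl: "(\<lambda>e. e) \<in> star_semigroup_hom EI SI" by (auto simp: star_semigroup_hom_def E_sel E_carrier)
      obtain f where f: "f \<in> star_hom AE PC" "\<And>e. e \<in> carrier EI \<Longrightarrow> f (gen e) = isg_gen I SI ZI e"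
        using E.isg_map[OF P_regular_star_semigroup incl, of ZI ZI I] unfolding cstar_isg_idempotents_def by auto
      have fc: "f a \<in> carrier PC" using f(1) 3 by (auto simp: star_hom_def)
      have "cov_rep j (f a) = B.univ_rep j g" if j: "j \<in> rel_index cov_rel" for j
      proof -
        have "(\<lambda>x. cov_rep j (f x)) \<in> star_hom AE (Bop (fst j))"
          by (rule star_hom_comp[OF f(1) rep_cstar.axioms(1)[OF PC_cov, THEN normed_by_reps.hom, OF j]])
        moreover have "cov_rep j (f (gen e)) = snd j (Inl (gen e))" if e: "e \<in> carrier EI" for e
        proof -
          have "e \<in> carrier SI" using e by (simp add: E_carrier)
          then show ?thesis using cov_word_idem[OF H[OF j] R[OF j] e] by (simp add: f(2)[OF e] rep_gen[OF j])
        qed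
        ultimately have "cov_rep j (f a) = snd j (Inl a)"
          using A.star_hom_unique[OF H[OF j] _ cov_hom[OF H[OF j] R[OF j]] gen_generates _ 3(1)] by auto
        moreover have "B.univ_rep j g = snd j (Inl a)"
          using B.univ_rep_word[of "[(Inl a, False)]" j] j 3 star_hom_BopD(1)[OF cov_hom[OF H[OF j] R[OF j]] 3(1)]
          by (simp add: compose_id_right[OF H[OF j]])
        ultimately show ?thesis by simp
      qed
      then show ?thesis using fc by blast
    qed
  qed
  ultimately show ?thesis by (simp add: cstar_universal_isg_def)
qed

end

section \<open>Partial bijections cut out of everywhere defined maps\<close>

section \<open>Actions by partial bijections from actions by endomorphisms\<close>

text \<open>Used twice with the same formulas, for conjugation on the projections and for its
  extension to their C*-algebra, so that the two resulting actions are compatible.\<close>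

locale endomorphism_action =
  fixes S :: "'s::monoid_mult itself" and X :: "'x set" and C :: "'s word set \<Rightarrow> 'x \<Rightarrow> 'x"
  assumes C_closed: "p \<in> carrier (universal_isg S) \<Longrightarrow> x \<in> X \<Longrightarrow> C p x \<in> X"
    and C_mult: "p \<in> carrier (universal_isg S) \<Longrightarrow> q \<in> carrier (universal_isg S) \<Longrightarrow> x \<in> X \<Longrightarrow>
      C (smul (universal_isg S) p q) x = C p (C q x)"
    and C_unit: "x \<in> X \<Longrightarrow> C (cls []) x = x"
begin

abbreviation "Sg \<equiv> universal_isg S"

text \<open>For conjugation by \<open>p\<close> this is the corner of \<open>p* p\<close>, the
  domain of the partial map of \<open>p\<close>. Phrased through \<open>C\<close> alone, it also
  makes sense on a set \<open>X\<close> without multiplication.\<close>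

definition support :: "'s word set \<Rightarrow> 'x set" where
  "support p = {x \<in> X. C (sstar Sg p) (C p x) = x}"

definition corner_map :: "'s word set \<Rightarrow> 'x \<rightharpoonup> 'x" where
  "corner_map p = (\<lambda>x. if x \<in> support p then Some (C p x) else None)"

lemma dom_corner_map: "dom (corner_map p) = support p"
  by (auto simp: corner_map_def dom_def)

lemma corner_map_apply: "x \<in> support p \<Longrightarrow> corner_map p x = Some (C p x)"
  by (simp add: corner_map_def)

lemma support_subset: "support p \<subseteq> X"
  by (auto simp: support_def)

lemma C_regular:
  assumes p: "p \<in> carrier Sg" and x: "x \<in> X" shows "C p (C (sstar Sg p) (C p x)) = C p x"
  using C_mult[OF p _ x, of "smul Sg (sstar Sg p) p"] C_mult[OF P_star_closed[OF p] p x] p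
  by (simp add: P_regular P_mult_closed P_star_closed)

lemma C_support: "p \<in> carrier Sg \<Longrightarrow> x \<in> support p \<Longrightarrow> C p x \<in> support (sstar Sg p)"
  by (simp add: support_def C_closed P_star_star)

lemma C_in_support:
  assumes p: "p \<in> carrier Sg" and x: "x \<in> X" shows "C p x \<in> support (sstar Sg p)"
  using C_regular[OF p x] C_closed[OF p x] by (simp add: support_def P_star_star p)

lemma ran_corner_map:
  assumes p: "p \<in> carrier Sg" shows "ran (corner_map p) = support (sstar Sg p)"
proof (intro subset_antisym subsetI)
  fix y assume "y \<in> ran (corner_map p)"
  then obtain x where "x \<in> support p" "y = C p x" by (auto simp: ran_def corner_map_def split: if_splits)
  then show "y \<in> support (sstar Sg p)" using C_support[OF p] by blast
next
  fix y assume y: "y \<in> support (sstar Sg p)"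
  have "C (sstar Sg p) y \<in> support p" using C_support[OF P_star_closed[OF p] y] by (simp add: P_star_star p)
  then have "corner_map p (C (sstar Sg p) y) = Some (C p (C (sstar Sg p) y))" by (rule corner_map_apply)
  also have "C p (C (sstar Sg p) y) = y" using y by (simp add: support_def P_star_star p)
  finally show "y \<in> ran (corner_map p)" by (rule ranI)
qed

lemma inj_C: "inj_on (C p) (support p)"
  by (rule inj_on_inverseI[of _ "C (sstar Sg p)"]) (simp add: support_def)

lemma bij_C:
  assumes p: "p \<in> carrier Sg" shows "bij_betw (C p) (support p) (support (sstar Sg p))"
proof (rule bij_betw_byWitness[where f' = "C (sstar Sg p)"])
  show "C (sstar Sg p) ` support (sstar Sg p) \<subseteq> support p"
    using C_support[OF P_star_closed[OF p]] by (auto simp: P_star_star p)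
  show "C p ` support p \<subseteq> support (sstar Sg p)" using C_support[OF p] by blast
qed (auto simp: support_def P_star_star p)

lemma corner_map_star:
  assumes p: "p \<in> carrier Sg" shows "corner_map (sstar Sg p) = partial_inverse (corner_map p)"
proof
  fix y
  show "corner_map (sstar Sg p) y = partial_inverse (corner_map p) y"
  proof (cases "y \<in> support (sstar Sg p)")
    case True
    let ?x = "C (sstar Sg p) y"
    have x: "?x \<in> support p" using C_support[OF P_star_closed[OF p] True] by (simp add: P_star_star p)
    have Cx: "C p ?x = y" using True by (simp add: support_def P_star_star p)
    have "(THE x. corner_map p x = Some y) = ?x"
    proof (rule the_equality)
      show "corner_map p ?x = Some y" using corner_map_apply[OF x] Cx by simp
      fix z assume "corner_map p z = Some y"
      then have z: "z \<in> support p" "C p z = y" by (auto simp: corner_map_def split: if_splits)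
      then show "z = ?x" by (auto simp: support_def)
    qed
    then show ?thesis using True by (simp add: partial_inverse_def ran_corner_map[OF p] corner_map_apply)
  next
    case False
    then show ?thesis by (simp add: partial_inverse_def ran_corner_map[OF p]) (simp add: corner_map_def)
  qed
qed

text \<open>The inclusion from left to right rests on commuting idempotents: since
  \<open>q q*\<close> commutes with \<open>p* p\<close>, if \<open>q* p* p q\<close> fixes
  \<open>x\<close> then \<open>p* p\<close> fixes the image of \<open>x\<close> under
  \<open>q\<close>. This makes the domain of a product the domain of the composite.\<close>

lemma support_mult:
  assumes p: "p \<in> carrier Sg" and q: "q \<in> carrier Sg"
  shows "x \<in> support (smul Sg p q) \<longleftrightarrow> x \<in> support q \<and> C q x \<in> support p"
proof
  let ?p = "sstar Sg p" and ?q = "sstar Sg q"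
  have cl: "?p \<in> carrier Sg" "?q \<in> carrier Sg" using p q by (simp_all add: P_star_closed)
  {
    assume x: "x \<in> support (smul Sg p q)"
    have xX: "x \<in> X" using x support_subset by blast
    have fx: "C ?q (C ?p (C p (C q x))) = x"
      using x xX p q cl by (simp add: support_def P_star_mult C_mult C_closed)
    have x_q: "x \<in> support q"
      using C_in_support[OF cl(2), of "C ?p (C p (C q x))"] fx xX p q cl by (simp add: C_closed P_star_star)
    have com: "smul Sg (smul Sg q ?q) (smul Sg ?p p) = smul Sg (smul Sg ?p p) (smul Sg q ?q)"
      using P_commute[OF q cl(1)] by (simp add: P_star_star p)
    have "C q x = C (smul Sg (smul Sg q ?q) (smul Sg ?p p)) (C q x)"
      using fx xX p q cl by (simp add: C_mult C_closed P_mult_closed)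
    also have "\<dots> = C ?p (C p (C q x))"
      unfolding com using C_regular[OF q xX] xX p q cl by (simp add: C_mult C_closed P_mult_closed)
    finally have "C q x \<in> support p" using C_closed[OF q xX] by (simp add: support_def)
    then show "x \<in> support q \<and> C q x \<in> support p" using x_q by blast
  next
    assume "x \<in> support q \<and> C q x \<in> support p"
    then show "x \<in> support (smul Sg p q)" using p q cl by (simp add: support_def P_star_mult C_mult C_closed)
  }
qed

lemma corner_map_mult:
  assumes p: "p \<in> carrier Sg" and q: "q \<in> carrier Sg"
  shows "corner_map (smul Sg p q) = corner_map p \<circ>\<^sub>m corner_map q"
proof
  fix x
  have "x \<in> support q \<Longrightarrow> x \<in> X" using support_subset by blast
  then show "corner_map (smul Sg p q) x = (corner_map p \<circ>\<^sub>m corner_map q) x"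
    by (simp add: corner_map_def map_comp_def support_mult[OF p q] C_mult[OF p q])
qed

lemma ran_corner_map_unit: "ran (corner_map (cls [])) = X"
  by (subst ran_corner_map) (auto simp: P_star support_def C_unit)

lemma corner_map_set_action: "isg_set_action Sg X corner_map"
proof -
  have "corner_map p \<in> carrier (partial_bijections X)" if p: "p \<in> carrier Sg" for p
  proof -
    have "inj_on (corner_map p) (support p)"
      using inj_C[of p] by (auto simp: inj_on_def corner_map_apply)
    then show ?thesis by (simp add: partial_bijections_def dom_corner_map ran_corner_map[OF p] support_subset)
  qed
  then have "corner_map \<in> star_semigroup_hom Sg (partial_bijections X)"
    by (simp add: star_semigroup_hom_def) (simp add: partial_bijections_def corner_map_mult corner_map_star)
  moreover have "(\<Union>s\<in>carrier Sg. ran (corner_map s)) = X"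
  proof (intro subset_antisym UN_least)
    show "ran (corner_map s) \<subseteq> X" if "s \<in> carrier Sg" for s
      unfolding ran_corner_map[OF that] by (rule support_subset)
    show "X \<subseteq> (\<Union>s\<in>carrier Sg. ran (corner_map s))" using ran_corner_map_unit cls_closed by blast
  qed
  ultimately show ?thesis by (simp add: isg_set_action_def)
qed

end

section \<open>Constructible right ideals\<close>

section \<open>Constructible sets\<close>

text \<open>The lists in \<open>constructible\<close> alternate preimages and translates, so a lone
  translate is completed by the preimage under \<open>1\<close>;
  \<open>pretranslate_in_constructible\<close> pads on the other side.\<close>

lemma translate_in_constructible:
  assumes "X \<in> constructible" shows "translate a X \<in> constructible"
proof -
  have "pretranslate 1 (translate a X) = translate a X" by (auto simp: pretranslate_def)
  then have "foldr (\<lambda>(a, b) X. pretranslate a (translate b X)) ((1, a) # ps) UNIV = translate a X"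
    if "X = foldr (\<lambda>(a, b) X. pretranslate a (translate b X)) ps UNIV" for ps
    using that by simp
  moreover have "translate a {} = {}" by (simp add: translate_def)
  ultimately show ?thesis using assms unfolding constructible_def by blast
qed

lemma pretranslate_in_constructible:
  assumes "X \<in> constructible" shows "pretranslate a X \<in> constructible"
proof -
  have "translate 1 X = X" by (auto simp: translate_def)
  then have "foldr (\<lambda>(a, b) X. pretranslate a (translate b X)) ((a, 1) # ps) UNIV = pretranslate a X"
    if "X = foldr (\<lambda>(a, b) X. pretranslate a (translate b X)) ps UNIV" for ps
    using that by simp
  moreover have "pretranslate a {} = {}" by (simp add: pretranslate_def)
  ultimately show ?thesis using assms unfolding constructible_def by blast
qed

lemma UNIV_in_constructible: "UNIV \<in> constructible"
proof -
  have "foldr (\<lambda>(a, b) X. pretranslate a (translate b X)) [] UNIV = UNIV" by simp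
  then show ?thesis unfolding constructible_def by blast
qed

lemma empty_in_constructible: "{} \<in> constructible"
  by (simp add: constructible_def)

text \<open>Induction on the list of the first set, with \<open>Y\<close> arbitrary, by the identity
  \<open>a^{-1}(b Z) \<inter> Y = a^{-1}(b (Z \<inter> b^{-1}(a Y)))\<close>. Left cancellation is
  used for the inclusion from right to left, where \<open>a x = a y\<close> must give
  \<open>x = y\<close>.\<close>

lemma Int_in_constructible:
  fixes X Y :: "'s::monoid_mult set"
  assumes left_cancellative: "\<And>a b c :: 's. a * b = a * c \<Longrightarrow> b = c"
    and X: "X \<in> constructible" and Y: "Y \<in> constructible"
  shows "X \<inter> Y \<in> constructible"
proof -
  have "foldr (\<lambda>(a, b) X. pretranslate a (translate b X)) ps UNIV \<inter> Y \<in> constructible" if "Y \<in> constructible"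
    for ps and Y :: "'s set"
    using that
  proof (induction ps arbitrary: Y)
    case (Cons p ps)
    obtain a b where p: "p = (a, b)" by fastforce
    let ?Z = "foldr (\<lambda>(a, b) X. pretranslate a (translate b X)) ps UNIV"
    have "pretranslate a (translate b ?Z) \<inter> Y =
        pretranslate a (translate b (?Z \<inter> pretranslate b (translate a Y)))"
    proof (intro Set.set_eqI iffI)
      fix x assume "x \<in> pretranslate a (translate b ?Z) \<inter> Y"
      then obtain z where "a * x = b * z" "z \<in> ?Z" "x \<in> Y" by (auto simp: pretranslate_def translate_def)
      moreover from this have "z \<in> pretranslate b (translate a Y)"
        unfolding pretranslate_def translate_def mem_Collect_eq by metis
      ultimately show "x \<in> pretranslate a (translate b (?Z \<inter> pretranslate b (translate a Y)))"
        unfolding pretranslate_def[of a] translate_def[of b] mem_Collect_eq by blast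
    next
      fix x assume "x \<in> pretranslate a (translate b (?Z \<inter> pretranslate b (translate a Y)))"
      then obtain z y where z: "a * x = b * z" "z \<in> ?Z" "b * z = a * y" "y \<in> Y"
        by (auto simp: pretranslate_def translate_def)
      then have "x = y" using left_cancellative[of a x y] by simp
      then show "x \<in> pretranslate a (translate b ?Z) \<inter> Y"
        using z unfolding pretranslate_def translate_def by blast
    qed
    moreover have "?Z \<inter> pretranslate b (translate a Y) \<in> constructible"
      by (intro Cons.IH pretranslate_in_constructible translate_in_constructible Cons.prems)
    ultimately show ?case
      by (simp add: p) (intro pretranslate_in_constructible translate_in_constructible; assumption)
  qed simp
  then show ?thesis using X Y by (auto simp: constructible_def empty_in_constructible)
qed

lemma projection_norm:
  assumes H: "hilbert_space H" and q: "q \<in> bounded_ops H" "compose H q q = q" "adjoint H q = q"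
  shows "op_norm H q \<le> 1"
proof (rule op_norm_le[OF H])
  show "ell2_norm (q x) \<le> 1 * ell2_norm x" if "x \<in> H" for x
    using partial_isometry_contractive[OF H q(1) _ that] q by simp
qed simp

section \<open>C*(S): the elements of \<open>S*\<close> and the projections inside it\<close>

section \<open>The C*-algebra of a left cancellative monoid\<close>

lemma semigroup_relationsD:
  assumes "semigroup_relations H \<rho>"
  shows "\<rho> (Inl s) \<in> bounded_ops H" "compose H (adjoint H (\<rho> (Inl s))) (\<rho> (Inl s)) = id_op H"
    and "X \<in> constructible \<Longrightarrow> \<rho> (Inr X) \<in> bounded_ops H"
      "X \<in> constructible \<Longrightarrow> adjoint H (\<rho> (Inr X)) = \<rho> (Inr X)"
      "X \<in> constructible \<Longrightarrow> compose H (\<rho> (Inr X)) (\<rho> (Inr X)) = \<rho> (Inr X)"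
    and "\<rho> (Inl (s * t)) = compose H (\<rho> (Inl s)) (\<rho> (Inl t))"
    and "X \<in> constructible \<Longrightarrow>
      compose H (\<rho> (Inl s)) (compose H (\<rho> (Inr X)) (adjoint H (\<rho> (Inl s)))) = \<rho> (Inr (translate s X))"
    and "\<rho> (Inr UNIV) = id_op H" "\<rho> (Inr {}) = zero_op H"
    and "X \<in> constructible \<Longrightarrow> Y \<in> constructible \<Longrightarrow> \<rho> (Inr (X \<inter> Y)) = compose H (\<rho> (Inr X)) (\<rho> (Inr Y))"
  using assms unfolding semigroup_relations_def by blast+

abbreviation "sg_gens \<equiv> range (Inl :: 's::monoid_mult \<Rightarrow> 's + 's set) \<union> Inr ` constructible"

lemma semigroup_bounded_relations:
  "bounded_relations (sg_gens :: ('s::monoid_mult + 's set) set)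
    (semigroup_relations :: 'i vec set \<Rightarrow> _ \<Rightarrow> bool) (\<lambda>_. 1)"
proof
  fix H :: "'i vec set" and \<rho> :: "'s + 's set \<Rightarrow> 'i operator" and g :: "'s + 's set"
  assume H: "hilbert_space H" and R: "semigroup_relations H \<rho>" and g: "g \<in> sg_gens"
  note RD = semigroup_relationsD[OF R]
  show "\<rho> g \<in> bounded_ops H" using g RD(1,3) by blast
  show "op_norm H (\<rho> g) \<le> 1"
    using g isometry_norm[OF H RD(1,2)] projection_norm[OF H RD(3,5,4)] by blast
next
  have z: "R = zero_op {0}" if "R \<in> bounded_ops {0}" for R :: "'i operator"
    using that bop_zero_space by blast
  have "semigroup_relations {0} (\<lambda>_ :: 's + 's set. zero_op {0} :: 'i operator)"
    using z[OF adjoint_bop[OF hilbert_space_zero zero_op_closed[OF hilbert_space_zero]]]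
      z[OF compose_closed[OF hilbert_space_zero zero_op_closed[OF hilbert_space_zero] zero_op_closed[OF hilbert_space_zero]]]
      z[OF id_op_closed[OF hilbert_space_zero]] zero_op_closed[OF hilbert_space_zero, where 'i = 'i]
    by (simp add: semigroup_relations_def)
  then show "\<exists>(H :: 'i vec set) (\<rho> :: 's + 's set \<Rightarrow> 'i operator). hilbert_space H \<and> semigroup_relations H \<rho>"
    using hilbert_space_zero by blast
qed

locale left_cancellative_monoid =
  fixes S :: "'s::monoid_mult itself" and I :: "'i itself"
  assumes left_cancellative: "\<And>a b c :: 's. a * b = a * c \<Longrightarrow> b = c"
begin

abbreviation "Sp \<equiv> universal_isg S"
abbreviation "Cs \<equiv> semigroup_cstar I S"
abbreviation "JS \<equiv> rel_index (semigroup_relations :: 'i vec set \<Rightarrow> ('s + 's set \<Rightarrow> 'i operator) \<Rightarrow> bool)"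
abbreviation "ee \<equiv> semigroup_proj I :: 's set \<Rightarrow> _"
abbreviation "Qs \<equiv> proj_semigroup I S"

interpretation R: bounded_relations "sg_gens :: ('s + 's set) set"
    "semigroup_relations :: 'i vec set \<Rightarrow> ('s + 's set \<Rightarrow> 'i operator) \<Rightarrow> bool" "\<lambda>_. 1"
  by (rule semigroup_bounded_relations)

abbreviation cs_rep :: "('i vec set \<times> ('s + 's set \<Rightarrow> 'i operator)) \<Rightarrow> (nat \<Rightarrow> ('s + 's set) word \<Rightarrow> complex) set \<Rightarrow> 'i operator" where
  "cs_rep \<equiv> R.univ_rep"

lemma semigroup_cstar_eq: "Cs = completion R.D"
  by (simp add: semigroup_cstar_def semigroup_star_algebra_def)

interpretation C: rep_cstar Cs JS fst cs_rep
  unfolding semigroup_cstar_eq by (rule R.univ_rep_cstar)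

lemma translate_pretranslate: "translate s (pretranslate s X) = (X :: 's set) \<inter> translate s UNIV"
  by (auto simp: pretranslate_def translate_def)

lemma Int_constructible: "X \<in> constructible \<Longrightarrow> Y \<in> constructible \<Longrightarrow> X \<inter> Y \<in> constructible" for X Y :: "'s set"
  by (rule Int_in_constructible[OF left_cancellative])

context
  fixes H :: "'i vec set" and \<rho> :: "'s + 's set \<Rightarrow> 'i operator"
  assumes H: "hilbert_space H" and R: "semigroup_relations H \<rho>"
begin

lemmas RD = semigroup_relationsD[OF R]

lemma range_relation: "compose H (\<rho> (Inl s)) (adjoint H (\<rho> (Inl s))) = \<rho> (Inr (translate s UNIV))"
  using RD(7)[OF UNIV_in_constructible, of s] by (simp add: RD(8) compose_id_left[OF H] adjoint_bop[OF H RD(1)])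

text \<open>The relations prescribe only \<open>w_s e_X w_s*\<close>. Since
  \<open>s (s^{-1} X) = X \<inter> s S\<close>, they give \<open>w_s e w_s* = e_X w_s w_s*\<close>
  for the projection \<open>e\<close> of \<open>s^{-1} X\<close>, and multiplying by
  \<open>w_s*\<close> on the left and \<open>w_s\<close> on the right yields the formula.\<close>

lemma pretranslate_relation:
  assumes X: "X \<in> constructible"
  shows "compose H (adjoint H (\<rho> (Inl s))) (compose H (\<rho> (Inr X)) (\<rho> (Inl s))) = \<rho> (Inr (pretranslate s X))"
proof -
  let ?W = "\<rho> (Inl s)" and ?V = "adjoint H (\<rho> (Inl s))"
  let ?P = "\<rho> (Inr (pretranslate s X))"
  have cX: "pretranslate s X \<in> constructible" by (rule pretranslate_in_constructible[OF X])
  have tU: "translate s UNIV \<in> constructible" by (rule translate_in_constructible[OF UNIV_in_constructible])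
  note b = RD(1)[of s] adjoint_bop[OF H RD(1)[of s]] RD(3)[OF cX] RD(3)[OF X]
  have id: "compose H ?V ?W = id_op H" by (rule RD(2))
  have eq: "compose H ?W (compose H ?P ?V) = compose H (\<rho> (Inr X)) (compose H ?W ?V)"
    using RD(7)[OF cX, of s] RD(10)[OF X tU] by (simp add: translate_pretranslate range_relation)
  have "?P = compose H (compose H ?V ?W) (compose H ?P (compose H ?V ?W))"
    by (simp only: id compose_id_right[OF H b(3)] compose_id_left[OF H b(3)])
  also have "\<dots> = compose H ?V (compose H (compose H ?W (compose H ?P ?V)) ?W)"
    by (simp only: compose_assoc'[OF H] b compose_closed[OF H])
  also have "\<dots> = compose H ?V (compose H (\<rho> (Inr X)) (compose H ?W (compose H ?V ?W)))"
    by (simp only: eq compose_assoc'[OF H] b compose_closed[OF H])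
  also have "\<dots> = compose H ?V (compose H (\<rho> (Inr X)) ?W)"
    by (simp only: id compose_id_right[OF H b(1)])
  finally show ?thesis ..
qed

text \<open>Commutation is the symmetry of intersection, and stability under the two conjugations is
  that of constructible sets under translates and preimages.\<close>

lemma sg_isometries: "isometries_and_projections H (\<lambda>s. \<rho> (Inl s)) ((\<lambda>X. \<rho> (Inr X)) ` constructible)"
proof
  fix X Y assume "X \<in> (\<lambda>X. \<rho> (Inr X)) ` constructible"
  then obtain X' where X: "X' \<in> constructible" "X = \<rho> (Inr X')" by blast
  show "X \<in> bounded_ops H" "compose H X X = X" using RD(3,5) X by simp_all
  show "compose H (\<rho> (Inl s)) (compose H X (adjoint H (\<rho> (Inl s)))) \<in> (\<lambda>X. \<rho> (Inr X)) ` constructible" for s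
    unfolding X(2) RD(7)[OF X(1)] by (rule imageI) (rule translate_in_constructible[OF X(1)])
  show "compose H (adjoint H (\<rho> (Inl s))) (compose H X (\<rho> (Inl s))) \<in> (\<lambda>X. \<rho> (Inr X)) ` constructible" for s
    unfolding X(2) pretranslate_relation[OF X(1)] by (rule imageI) (rule pretranslate_in_constructible[OF X(1)])
  assume "Y \<in> (\<lambda>X. \<rho> (Inr X)) ` constructible"
  then obtain Y' where Y: "Y' \<in> constructible" "Y = \<rho> (Inr Y')" by blast
  show "compose H X Y = compose H Y X"
    unfolding X(2) Y(2) RD(10)[OF X(1) Y(1), symmetric] RD(10)[OF Y(1) X(1), symmetric] by (simp only: Int_commute)
next
  show "id_op H \<in> (\<lambda>X. \<rho> (Inr X)) ` constructible"
    using UNIV_in_constructible RD(8) by (metis imageI)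
qed (fact H RD(1,2,6))+

end

definition isom_rep :: "('i vec set \<times> ('s + 's set \<Rightarrow> 'i operator)) \<Rightarrow> 's word set \<Rightarrow> 'i operator" where
  "isom_rep j = isometries_and_projections.word_rep (fst j) (\<lambda>s. snd j (Inl s))"

lemma JS_E: "j \<in> JS \<Longrightarrow> hilbert_space (fst j)" "j \<in> JS \<Longrightarrow> semigroup_relations (fst j) (snd j)"
  by (auto simp: rel_index_def)

lemma isom_rep:
  assumes j: "j \<in> JS"
  shows "isom_rep j \<in> sg_reps Sp (fst j)" "isom_rep j (cls w) = word_op (fst j) (\<lambda>s. snd j (Inl s)) w"
proof -
  interpret V: isometries_and_projections "fst j" "\<lambda>s. snd j (Inl s)" "(\<lambda>X. snd j (Inr X)) ` constructible"
    by (rule sg_isometries[OF JS_E(1,2)]) (fact j)+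
  show "isom_rep j \<in> sg_reps Sp (fst j)"
    using V.word_rep_sg_reps unfolding universal_isg_TYPE[of S] isom_rep_def .
  show "isom_rep j (cls w) = word_op (fst j) (\<lambda>s. snd j (Inl s)) w"
    unfolding isom_rep_def by (rule V.word_rep_cls)
qed

lemma isom_rep_letter: "j \<in> JS \<Longrightarrow> isom_rep j (v s) = snd j (Inl s)"
  using isom_rep(2)[of j "[(s, False)]"] semigroup_relationsD(1)[OF JS_E(2)[of j], of s]
  by (simp add: compose_id_right[OF JS_E(1)])

lemma isom_rep_letter_star: "j \<in> JS \<Longrightarrow> isom_rep j (cls [(s, True)]) = adjoint (fst j) (snd j (Inl s))"
  using isom_rep(2)[of j "[(s, True)]"] semigroup_relationsD(1)[OF JS_E(2)[of j], of s]
  by (simp add: compose_id_right[OF JS_E(1)] adjoint_bop[OF JS_E(1)])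

text \<open>The image of \<open>p\<close> in C*(S), as a word in the \<open>w_s\<close>; by
  \<open>cs_rep_uu\<close> its values do not depend on the chosen representative.\<close>

definition uu :: "'s word set \<Rightarrow> (nat \<Rightarrow> ('s + 's set) word \<Rightarrow> complex) set" where
  "uu p = R.univ_word (map (\<lambda>(s, b). (Inl s, b)) (SOME w. w \<in> p))"

lemma uu_closed: "uu p \<in> carrier Cs"
  unfolding uu_def semigroup_cstar_eq by (rule R.univ_word_closed) auto

lemma cs_rep_uu:
  assumes j: "j \<in> JS" and p: "p \<in> carrier Sp" shows "cs_rep j (uu p) = isom_rep j p"
proof -
  obtain w where w: "p = cls w" using p by (rule P_E)
  have "cs_rep j (uu p) = word_op (fst j) (\<lambda>s. snd j (Inl s)) (SOME w. w \<in> p)"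
    unfolding uu_def by (subst R.univ_rep_word[OF _ j]) (auto simp: word_op_map)
  also have "\<dots> = isom_rep j (cls (SOME w. w \<in> p))" by (rule isom_rep(2)[OF j, symmetric])
  also have "\<dots> = isom_rep j p" unfolding w cls_someI ..
  finally show ?thesis .
qed

lemma ee_eq: "ee X = R.univ_word [(Inr X, False)]"
  by (simp add: semigroup_proj_def R.univ_word_def semigroup_star_algebra_def)

lemma ee_closed: "X \<in> constructible \<Longrightarrow> ee X \<in> carrier Cs"
  unfolding ee_eq semigroup_cstar_eq by (rule R.univ_word_closed) auto

lemma cs_rep_ee:
  assumes j: "j \<in> JS" and X: "X \<in> constructible" shows "cs_rep j (ee X) = snd j (Inr X)"
  unfolding ee_eq using X semigroup_relationsD(3)[OF JS_E(2)[OF j] X]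
  by (subst R.univ_rep_word[OF _ j]) (auto simp: compose_id_right[OF JS_E(1)[OF j]])

lemma uu_mult: "p \<in> carrier Sp \<Longrightarrow> q \<in> carrier Sp \<Longrightarrow> uu (smul Sp p q) = cmult Cs (uu p) (uu q)"
  by (rule C.separated) (simp_all add: uu_closed C.closed C.rep_simps cs_rep_uu P_mult_closed sg_repsD(2)[OF isom_rep(1)])

lemma uu_star: "p \<in> carrier Sp \<Longrightarrow> uu (sstar Sp p) = cstar Cs (uu p)"
  by (rule C.separated) (simp_all add: uu_closed C.closed C.rep_simps cs_rep_uu P_star_closed sg_repsD(3)[OF isom_rep(1)])

lemma uu_unit: "uu (cls []) = ee UNIV"
  by (rule C.separated)
    (simp_all add: uu_closed ee_closed UNIV_in_constructible cs_rep_uu cs_rep_ee isom_rep(2) semigroup_relationsD(8)[OF JS_E(2)])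

lemma ee_unit: "x \<in> carrier Cs \<Longrightarrow> cmult Cs (ee UNIV) x = x" "x \<in> carrier Cs \<Longrightarrow> cmult Cs x (ee UNIV) = x"
  by (rule C.separated;
      simp add: C.closed ee_closed UNIV_in_constructible C.rep_simps cs_rep_ee semigroup_relationsD(8)[OF JS_E(2)]
        compose_id_left[OF JS_E(1)] compose_id_right[OF JS_E(1)] C.rep_bop)+

lemma ee_Int: "X \<in> constructible \<Longrightarrow> Y \<in> constructible \<Longrightarrow> cmult Cs (ee X) (ee Y) = ee (X \<inter> Y)"
  by (rule C.separated)
    (simp_all add: ee_closed C.closed C.rep_simps cs_rep_ee Int_constructible semigroup_relationsD(10)[OF JS_E(2)])

lemma ee_star: "X \<in> constructible \<Longrightarrow> cstar Cs (ee X) = ee X"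
  by (rule C.separated) (simp_all add: ee_closed C.closed C.rep_simps cs_rep_ee semigroup_relationsD(4)[OF JS_E(2)])

lemma ee_empty: "ee {} = czero Cs"
  by (rule C.separated)
    (simp_all add: ee_closed C.closed C.rep_simps cs_rep_ee empty_in_constructible semigroup_relationsD(9)[OF JS_E(2)])

subsection \<open>The semigroup of projections\<close>

lemma Q_sel: "carrier Qs = ee ` constructible" "smul Qs = cmult Cs" "sstar Qs = cstar Cs"
  by (simp_all add: proj_semigroup_def)

lemma Q_closed: "x \<in> carrier Qs \<Longrightarrow> x \<in> carrier Cs"
  by (auto simp: Q_sel ee_closed)

lemma Q_mult_closed: "x \<in> carrier Qs \<Longrightarrow> y \<in> carrier Qs \<Longrightarrow> cmult Cs x y \<in> carrier Qs"
  unfolding Q_sel by (elim imageE) (simp add: ee_Int Int_constructible)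

lemma Q_commute: "x \<in> carrier Qs \<Longrightarrow> y \<in> carrier Qs \<Longrightarrow> cmult Cs x y = cmult Cs y x"
  unfolding Q_sel by (elim imageE) (simp add: ee_Int Int_commute)

lemma Q_idem: "x \<in> carrier Qs \<Longrightarrow> cmult Cs x x = x"
  unfolding Q_sel by (elim imageE) (simp add: ee_Int)

lemma Q_star: "x \<in> carrier Qs \<Longrightarrow> cstar Cs x = x"
  unfolding Q_sel by (elim imageE) (simp add: ee_star)

lemma Q_regular_star_semigroup: "regular_star_semigroup Qs"
  by standard (simp_all add: Q_sel(2,3) Q_mult_closed Q_star Q_idem)

definition cc :: "'s word set \<Rightarrow> (nat \<Rightarrow> ('s + 's set) word \<Rightarrow> complex) set \<Rightarrow> (nat \<Rightarrow> ('s + 's set) word \<Rightarrow> complex) set" where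
  "cc p x = cmult Cs (uu p) (cmult Cs x (cstar Cs (uu p)))"

lemma cc_mult:
  "p \<in> carrier Sp \<Longrightarrow> q \<in> carrier Sp \<Longrightarrow> x \<in> carrier Cs \<Longrightarrow> cc (smul Sp p q) x = cc p (cc q x)"
  unfolding cc_def by (simp add: uu_mult C.star_mult C.mult_assoc uu_closed C.closed)

lemma cc_unit: "x \<in> carrier Cs \<Longrightarrow> cc (cls []) x = x"
  unfolding cc_def by (simp add: uu_unit ee_star UNIV_in_constructible ee_unit)

lemma cc_letter:
  assumes X: "X \<in> constructible"
  shows "cc (v s) (ee X) = ee (translate s X)" "cc (cls [(s, True)]) (ee X) = ee (pretranslate s X)"
  unfolding cc_def
  by (rule C.separated; simp add: X uu_closed ee_closed C.closed C.rep_simps cs_rep_uu cs_rep_ee isom_rep_letter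
      isom_rep_letter_star translate_in_constructible pretranslate_in_constructible semigroup_relationsD(7)[OF JS_E(2)]
      adjoint_adjoint[OF JS_E(1) semigroup_relationsD(1)[OF JS_E(2)]] pretranslate_relation[OF JS_E(1,2)])+

text \<open>Conjugation by a word is a composite of conjugations by letters, and letters act on the
  \<open>e_X\<close> through translates and preimages, which stay constructible.\<close>

lemma cc_Q:
  assumes p: "p \<in> carrier Sp" and x: "x \<in> carrier Qs" shows "cc p x \<in> carrier Qs"
proof -
  have "cc (cls w) x \<in> carrier Qs" for w
  proof (induction w)
    case Nil
    then show ?case using x by (simp add: cc_unit Q_closed)
  next
    case (Cons a w)
    obtain s b where a: "a = (s, b)" by fastforce
    have "cls (a # w) = smul Sp (cls [a]) (cls w)" by (simp add: P_mult)
    then have eq: "cc (cls (a # w)) x = cc (cls [a]) (cc (cls w) x)"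
      using x by (simp only: cc_mult[OF cls_closed cls_closed Q_closed])
    obtain X where X: "X \<in> constructible" "cc (cls w) x = ee X" using Cons by (auto simp: Q_sel(1))
    show ?case unfolding eq X(2) using cc_letter[OF X(1), of s] X(1)
      by (cases b) (auto simp: a Q_sel(1) translate_in_constructible pretranslate_in_constructible)
  qed
  then show ?thesis using p by (auto elim: P_E)
qed

text \<open>\<open>p* p\<close> is the conjugate by \<open>p*\<close> of the unit
  \<open>e_S\<close>, so it is one of the projections \<open>e_X\<close>. It is the projection that
  cuts out the domain of the action.\<close>

lemma uu_source_Q:
  assumes p: "p \<in> carrier Sp" shows "uu (smul Sp (sstar Sp p) p) \<in> carrier Qs"
proof -
  have "ee UNIV \<in> carrier Qs" unfolding Q_sel(1) by (rule imageI[OF UNIV_in_constructible])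
  then have "cc (sstar Sp p) (ee UNIV) \<in> carrier Qs" by (rule cc_Q[OF P_star_closed[OF p]])
  moreover have "cc (sstar Sp p) (ee UNIV) = uu (smul Sp (sstar Sp p) p)"
    by (simp add: cc_def ee_unit C.closed uu_closed uu_star p C.star_star uu_mult P_star_closed)
  ultimately show ?thesis by simp
qed

lemma uu_source_mult:
  assumes p: "p \<in> carrier Sp" shows "cmult Cs (uu p) (uu (smul Sp (sstar Sp p) p)) = uu p"
  using p by (simp add: P_regular P_mult_closed P_star_closed flip: uu_mult)

lemma cc_source:
  assumes p: "p \<in> carrier Sp" and x: "x \<in> carrier Qs"
  shows "cc (smul Sp (sstar Sp p) p) x = cmult Cs (uu (smul Sp (sstar Sp p) p)) x"
proof -
  let ?e = "uu (smul Sp (sstar Sp p) p)"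
  note e = uu_source_Q[OF p]
  have "cc (smul Sp (sstar Sp p) p) x = cmult Cs (cmult Cs ?e ?e) x"
    unfolding cc_def Q_star[OF e] Q_commute[OF x e] using e x by (simp add: C.mult_assoc Q_closed)
  then show ?thesis by (simp add: Q_idem[OF e])
qed

lemma cc_hom:
  assumes p: "p \<in> carrier Sp" shows "cc p \<in> star_semigroup_hom Qs Qs"
proof -
  let ?e = "uu (smul Sp (sstar Sp p) p)" and ?u = "uu p"
  note e = uu_source_Q[OF p]
  have es: "cmult Cs (cstar Cs ?u) ?u = ?e" using p by (simp add: uu_mult uu_star P_star_closed)
  have "cc p (cmult Cs x y) = cmult Cs (cc p x) (cc p y)" if x: "x \<in> carrier Qs" and y: "y \<in> carrier Qs" for x y
  proof -
    note cl = Q_closed[OF x] Q_closed[OF y] Q_closed[OF e] uu_closed C.closed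
    have "cmult Cs (cc p x) (cc p y) = cmult Cs ?u (cmult Cs (cmult Cs x (cmult Cs (cstar Cs ?u) ?u)) (cmult Cs y (cstar Cs ?u)))"
      unfolding cc_def by (simp add: C.mult_assoc cl)
    also have "\<dots> = cmult Cs (cmult Cs ?u ?e) (cmult Cs (cmult Cs x y) (cstar Cs ?u))"
      unfolding es Q_commute[OF x e] by (simp add: C.mult_assoc cl)
    finally show ?thesis by (simp add: uu_source_mult[OF p] cc_def)
  qed
  moreover have "cc p (cstar Cs x) = cstar Cs (cc p x)" if "x \<in> carrier Qs" for x
    using that by (simp add: Q_star cc_Q[OF p])
  ultimately show ?thesis by (simp add: star_semigroup_hom_def Q_sel(2,3) cc_Q[OF p])
qed

lemma cc_zero: "p \<in> carrier Sp \<Longrightarrow> cc p (ee {}) = ee {}"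
  by (simp add: cc_def ee_empty C.mult_zero uu_closed C.closed)

end

section \<open>The crossed product for an action on corners of a commutative algebra\<close>

section \<open>The crossed product by an action on corners\<close>

text \<open>Covariance for an inverse semigroup speaks of ranges of projections rather than of the
  projections. Equal ranges give \<open>r q = q\<close> and \<open>q r = r\<close>, and the adjoint
  of the first equation identifies the two.\<close>

lemma projection_eqI:
  fixes H :: "'i vec set"
  assumes H: "hilbert_space H"
    and q: "q \<in> bounded_ops H" "compose H q q = q" "adjoint H q = q"
    and r: "r \<in> bounded_ops H" "compose H r r = r" "adjoint H r = r"
    and range: "q ` H = r ` H"
  shows "q = r"
proof -
  have fix_range: "s (t x) = t x" if "t ` H = s ` H" "compose H s s = s" "x \<in> H" for s t :: "'i operator" and x
  proof -
    note hyp = that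
    obtain y where "y \<in> H" "t x = s y" using hyp(1,3) by blast
    then show ?thesis using fun_cong[OF hyp(2), of y] by simp
  qed
  have "compose H r q = q" "compose H q r = r"
    using fix_range[OF range r(2)] fix_range[OF range[symmetric] q(2)]
    by (auto intro!: bop_eqI[OF H] compose_closed[OF H] q r)
  then show ?thesis using adjoint_compose[OF H r(1) q(1)] q(3) r(3) by simp
qed

text \<open>\<open>f p\<close> plays the role of \<open>p* p\<close> inside \<open>A\<close>: by
  \<open>C_source\<close>, applying the map of \<open>p\<close> and then the map of
  \<open>p*\<close> is multiplication by it, so \<open>support p\<close> is a corner.\<close>

locale corner_action = rep_cstar A J Hs \<rho> + endomorphism_action S "carrier A" C
  for A :: "'a star_algebra" and J :: "'j set" and Hs :: "'j \<Rightarrow> 'i vec set" and \<rho> :: "'j \<Rightarrow> 'a \<Rightarrow> 'i operator"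
    and S :: "'s::monoid_mult itself" and C :: "'s word set \<Rightarrow> 'a \<Rightarrow> 'a" +
  fixes f :: "'s word set \<Rightarrow> 'a" and u :: 'a and I :: "'i itself"
  assumes commutative: "x \<in> carrier A \<Longrightarrow> y \<in> carrier A \<Longrightarrow> cmult A x y = cmult A y x"
    and C_hom: "p \<in> carrier (universal_isg S) \<Longrightarrow> C p \<in> star_hom A A"
    and f_closed: "p \<in> carrier (universal_isg S) \<Longrightarrow> f p \<in> carrier A"
    and f_star: "p \<in> carrier (universal_isg S) \<Longrightarrow> cstar A (f p) = f p"
    and C_source: "p \<in> carrier (universal_isg S) \<Longrightarrow> x \<in> carrier A \<Longrightarrow>
      C (sstar (universal_isg S) p) (C p x) = cmult A (f p) x"
    and u_closed: "u \<in> carrier A" and u_unit: "x \<in> carrier A \<Longrightarrow> cmult A u x = x"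
begin

lemma C_linear:
  assumes "p \<in> carrier Sg"
  shows "x \<in> carrier A \<Longrightarrow> y \<in> carrier A \<Longrightarrow> C p (cadd A x y) = cadd A (C p x) (C p y)"
    "x \<in> carrier A \<Longrightarrow> C p (cscale A c x) = cscale A c (C p x)"
    "x \<in> carrier A \<Longrightarrow> y \<in> carrier A \<Longrightarrow> C p (cmult A x y) = cmult A (C p x) (C p y)"
    "x \<in> carrier A \<Longrightarrow> C p (cstar A x) = cstar A (C p x)"
  using C_hom[OF assms] by (auto simp: star_hom_def)

lemma support_corner: "p \<in> carrier Sg \<Longrightarrow> support p = {x \<in> carrier A. cmult A (f p) x = x}"
  by (auto simp: support_def C_source)

text \<open>\<open>f p\<close> is the value at the unit of the map of \<open>p\<close> followed by
  the map of \<open>p*\<close>, and by \<open>C_regular\<close> applying this composite twice is the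
  same as applying it once.\<close>

lemma f_idem:
  assumes p: "p \<in> carrier Sg" shows "cmult A (f p) (f p) = f p"
proof -
  have fu: "cmult A (f p) u = f p" using commutative[OF f_closed[OF p] u_closed] u_unit[OF f_closed[OF p]] by simp
  have "cmult A (f p) (cmult A (f p) u) = cmult A (f p) u"
    using C_regular[OF p u_closed] C_source[OF p u_closed] C_source[OF p mult_closed[OF f_closed[OF p] u_closed]]
    by simp
  then show ?thesis by (simp add: fu)
qed

lemma f_support: "p \<in> carrier Sg \<Longrightarrow> f p \<in> support p"
  by (simp add: support_corner f_closed f_idem)

lemma support_ideal: "p \<in> carrier Sg \<Longrightarrow> closed_star_ideal A (support p)"
  unfolding support_corner by (rule corner_ideal[OF commutative f_closed f_star])

lemma support_subspace: "p \<in> carrier Sg \<Longrightarrow> closed_subspace A (support p)"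
  using support_ideal by (simp add: closed_star_ideal_def)

lemma support_closed:
  assumes p: "p \<in> carrier Sg"
  shows "czero A \<in> support p" "x \<in> support p \<Longrightarrow> y \<in> support p \<Longrightarrow> cadd A x y \<in> support p"
    "x \<in> support p \<Longrightarrow> cscale A c x \<in> support p" "x \<in> support p \<Longrightarrow> a \<in> carrier A \<Longrightarrow> cmult A x a \<in> support p"
    "x \<in> support p \<Longrightarrow> a \<in> carrier A \<Longrightarrow> cmult A a x \<in> support p" "x \<in> support p \<Longrightarrow> cstar A x \<in> support p"
  using support_ideal[OF p] closed_subspaceD[OF support_subspace[OF p]] unfolding closed_star_ideal_def by blast+

lemma corner_map_algebra_action: "isg_algebra_action Sg A corner_map"
proof -
  have "corner_map p \<in> carrier (partial_automorphisms A)" if p: "p \<in> carrier Sg" for p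
  proof -
    note sub = subsetD[OF support_subset, of _ p]
    have "(\<lambda>x. the (corner_map p x)) \<in> star_hom (A\<lparr>carrier := support p\<rparr>) (A\<lparr>carrier := support (sstar Sg p)\<rparr>)"
      using C_support[OF p]
      by (auto simp: star_hom_def corner_map_apply support_closed[OF p] C_linear[OF p] sub)
    moreover have "bij_betw (\<lambda>x. the (corner_map p x)) (support p) (support (sstar Sg p))"
      using bij_C[OF p] by (rule bij_betw_cong[THEN iffD1, rotated]) (simp add: corner_map_apply)
    ultimately show ?thesis
      by (simp add: partial_automorphisms_def dom_corner_map ran_corner_map[OF p] star_iso_def
          support_ideal[OF p] support_ideal[OF P_star_closed[OF p]])
  qed
  then have "corner_map \<in> star_semigroup_hom Sg (partial_automorphisms A)"
    by (simp add: star_semigroup_hom_def) (simp add: partial_automorphisms_def corner_map_mult corner_map_star)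
  moreover have "(\<Union>s\<in>carrier Sg. ran (corner_map s)) = carrier A"
    using corner_map_set_action by (simp add: isg_set_action_def)
  ultimately show ?thesis by (simp add: isg_algebra_action_def)
qed

abbreviation "CA \<equiv> covariance_algebra I Sg A corner_map"

lemma CA_carrier: "F \<in> carrier CA \<longleftrightarrow> (\<forall>s\<in>carrier Sg. F s \<in> support (sstar Sg s)) \<and>
    (\<forall>s. s \<notin> carrier Sg \<longrightarrow> F s = czero A) \<and> finite {s. F s \<noteq> czero A}"
  by (auto simp: covariance_algebra_def ran_corner_map)

lemma CA_apply: "F \<in> carrier CA \<Longrightarrow> F s \<in> carrier A"
  using support_subset[of "sstar Sg s"] by (cases "s \<in> carrier Sg") (auto simp: CA_carrier zero_closed)

abbreviation conv_term :: "('s word set \<Rightarrow> 'a) \<Rightarrow> ('s word set \<Rightarrow> 'a) \<Rightarrow> 's word set \<times> 's word set \<Rightarrow> 'a" where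
  "conv_term F G \<equiv> \<lambda>(s, t). the (corner_map s (cmult A (the (corner_map (sstar Sg s) (F s))) (G t)))"

lemma CA_sel:
  "cadd CA F G = (\<lambda>s. cadd A (F s) (G s))" "czero CA = (\<lambda>_. czero A)" "cscale CA c F = (\<lambda>s. cscale A c (F s))"
  "cmult CA F G = (\<lambda>r. csum A (conv_term F G)
    {(s, t). s \<in> carrier Sg \<and> t \<in> carrier Sg \<and> F s \<noteq> czero A \<and> G t \<noteq> czero A \<and> smul Sg s t = r})"
  "cstar CA F = (\<lambda>r. if r \<in> carrier Sg then the (corner_map r (cstar A (F (sstar Sg r)))) else czero A)"
  by (simp_all add: covariance_algebra_def)

text \<open>The product of the covariance algebra takes a detour through the domain of the partial
  map. With the everywhere defined \<open>C\<close> the term becomes \<open>F s\<close> times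
  \<open>C s (G t)\<close>, the form needed to compare it with a composition of operators.\<close>

lemma conv_term:
  assumes F: "F \<in> carrier CA" and G: "G \<in> carrier CA" and s: "s \<in> carrier Sg" and t: "t \<in> carrier Sg"
  shows "conv_term F G (s, t) = cmult A (F s) (C s (G t))"
    and "conv_term F G (s, t) \<in> support (sstar Sg (smul Sg s t))"
proof -
  have Fs: "F s \<in> support (sstar Sg s)" and Gt: "G t \<in> support (sstar Sg t)" using F G s t by (auto simp: CA_carrier)
  have cl: "F s \<in> carrier A" "G t \<in> carrier A" using CA_apply F G by auto
  have s': "sstar Sg s \<in> carrier Sg" and t': "sstar Sg t \<in> carrier Sg" using s t by (simp_all add: P_star_closed)
  have "C (sstar Sg s) (F s) \<in> support s" using C_support[OF s' Fs] by (simp add: P_star_star s)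
  then have "cmult A (C (sstar Sg s) (F s)) (G t) \<in> support s" by (rule support_closed(4)[OF s]) (rule cl)
  then have "conv_term F G (s, t) = C s (cmult A (C (sstar Sg s) (F s)) (G t))"
    by (simp add: corner_map_apply Fs)
  also have "\<dots> = cmult A (C s (C (sstar Sg s) (F s))) (C s (G t))" by (rule C_linear(3)[OF s C_closed[OF s' cl(1)] cl(2)])
  also have "C s (C (sstar Sg s) (F s)) = F s" using Fs by (simp add: support_def P_star_star s)
  finally show eq: "conv_term F G (s, t) = cmult A (F s) (C s (G t))" .
  have "C s (G t) \<in> support (sstar Sg (smul Sg s t))"
  proof -
    have "G t = C t (C (sstar Sg t) (G t))" using Gt by (simp add: support_def P_star_star t)
    then have "C s (G t) = C (smul Sg s t) (C (sstar Sg t) (G t))"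
      using C_mult[OF s t C_closed[OF t' cl(2)]] by simp
    then show ?thesis using C_in_support[OF P_mult_closed[OF s t] C_closed[OF t' cl(2)]] by simp
  qed
  then show "conv_term F G (s, t) \<in> support (sstar Sg (smul Sg s t))"
    unfolding eq by (rule support_closed(5)[OF P_star_closed[OF P_mult_closed[OF s t]]]) (rule cl)
qed

lemma conv_index:
  assumes F: "F \<in> carrier CA" and G: "G \<in> carrier CA"
  shows "{(s, t). s \<in> carrier Sg \<and> t \<in> carrier Sg \<and> F s \<noteq> czero A \<and> G t \<noteq> czero A \<and> smul Sg s t = r}
    = {i \<in> {s. F s \<noteq> czero A} \<times> {s. G s \<noteq> czero A}. (\<lambda>(s, t). smul Sg s t) i = r}"
  using F G by (auto simp: CA_carrier)

lemma CA_mult_eq: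
  assumes F: "F \<in> carrier CA" and G: "G \<in> carrier CA"
  shows "cmult CA F G = (\<lambda>r. csum A (conv_term F G)
    {i \<in> {s. F s \<noteq> czero A} \<times> {s. G s \<noteq> czero A}. (\<lambda>(s, t). smul Sg s t) i = r})"
  unfolding CA_sel conv_index[OF assms] ..

lemma CA_in_Sg: "F \<in> carrier CA \<Longrightarrow> F s \<noteq> czero A \<Longrightarrow> s \<in> carrier Sg"
  by (auto simp: CA_carrier)

lemma CA_mult_closed:
  assumes F: "F \<in> carrier CA" and G: "G \<in> carrier CA"
  shows "cmult CA F G \<in> carrier CA"
    and "{r. cmult CA F G r \<noteq> czero A} \<subseteq> (\<lambda>(s, t). smul Sg s t) ` ({s. F s \<noteq> czero A} \<times> {s. G s \<noteq> czero A})"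
proof -
  let ?h = "\<lambda>(s, t). smul Sg s t" and ?U = "{s. F s \<noteq> czero A} \<times> {s. G s \<noteq> czero A}"
  have fin: "finite ?U" using F G by (auto simp: CA_carrier)
  have U: "fst i \<in> carrier Sg" "snd i \<in> carrier Sg" if "i \<in> ?U" for i using that CA_in_Sg F G by auto
  show sub: "{r. cmult CA F G r \<noteq> czero A} \<subseteq> ?h ` ?U"
  proof
    fix r assume r: "r \<in> {r. cmult CA F G r \<noteq> czero A}"
    then have "{i \<in> ?U. ?h i = r} \<noteq> {}" unfolding CA_mult_eq[OF F G] mem_Collect_eq using csum_empty by metis
    then show "r \<in> ?h ` ?U" by blast
  qed
  have "cmult CA F G r \<in> support (sstar Sg r)" if r: "r \<in> carrier Sg" for r
    unfolding CA_mult_eq[OF F G]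
  proof (rule csum_in_subspace[OF support_subspace[OF P_star_closed[OF r]]])
    show "finite {i \<in> ?U. ?h i = r}" using fin by (rule finite_subset[rotated]) blast
    fix i assume i: "i \<in> {i \<in> ?U. ?h i = r}"
    then have "i \<in> ?U" "?h i = r" by blast+
    then show "conv_term F G i \<in> support (sstar Sg r)"
      using conv_term(2)[OF F G U, of i i] by (cases i) simp
  qed
  moreover have "cmult CA F G r = czero A" if r: "r \<notin> carrier Sg" for r
  proof (rule ccontr)
    assume "cmult CA F G r \<noteq> czero A"
    then have "r \<in> ?h ` ?U" using sub by blast
    then obtain i where "i \<in> ?U" "r = ?h i" by blast
    then show False using r U[of i] P_mult_closed[of "fst i" S "snd i"] by (cases i) simp
  qed
  moreover have "finite {r. cmult CA F G r \<noteq> czero A}" by (rule finite_subset[OF sub finite_imageI[OF fin]])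
  ultimately show "cmult CA F G \<in> carrier CA" unfolding CA_carrier by blast
qed

lemma CA_star_apply:
  assumes F: "F \<in> carrier CA" and r: "r \<in> carrier Sg"
  shows "cstar CA F r = C r (cstar A (F (sstar Sg r)))" "cstar CA F r \<in> support (sstar Sg r)"
proof -
  have "F (sstar Sg r) \<in> support r" using F r by (metis CA_carrier P_star_closed P_star_star)
  then have "cstar A (F (sstar Sg r)) \<in> support r" by (rule support_closed(6)[OF r])
  then show "cstar CA F r = C r (cstar A (F (sstar Sg r)))" "cstar CA F r \<in> support (sstar Sg r)"
    using r C_support[OF r] by (simp_all add: CA_sel corner_map_apply)
qed

lemma scale_0: "x \<in> carrier A \<Longrightarrow> cscale A 0 x = czero A"
  using norm_scale[of x 0] norm_nonneg[of "cscale A 0 x"] by (intro norm_eq_0) (simp_all add: scale_closed)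

lemma C_zero: "p \<in> carrier Sg \<Longrightarrow> C p (czero A) = czero A"
  using C_linear(2)[of p "czero A" 0] by (simp add: scale_0 zero_closed C_closed)

lemma star_zero: "cstar A (czero A) = czero A"
  using norm_star[OF zero_closed] by (simp add: norm_eq_0 norm_zero closed norm_nonneg order_antisym)

lemma CA_star_closed:
  assumes F: "F \<in> carrier CA"
  shows "cstar CA F \<in> carrier CA" "{r. cstar CA F r \<noteq> czero A} \<subseteq> sstar Sg ` {s. F s \<noteq> czero A}"
proof -
  show sub: "{r. cstar CA F r \<noteq> czero A} \<subseteq> sstar Sg ` {s. F s \<noteq> czero A}"
  proof
    fix r assume "r \<in> {r. cstar CA F r \<noteq> czero A}"
    then have ne: "cstar CA F r \<noteq> czero A" by blast
    then have r: "r \<in> carrier Sg" by (simp add: CA_sel(5) split: if_splits)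
    have "F (sstar Sg r) \<noteq> czero A" using ne CA_star_apply(1)[OF F r] C_zero[OF r] star_zero by metis
    then have "sstar Sg (sstar Sg r) \<in> sstar Sg ` {s. F s \<noteq> czero A}" by blast
    then show "r \<in> sstar Sg ` {s. F s \<noteq> czero A}" by (simp add: P_star_star r)
  qed
  have "finite {s. F s \<noteq> czero A}" using F by (simp add: CA_carrier)
  then have "finite {r. cstar CA F r \<noteq> czero A}" by (rule finite_subset[OF sub finite_imageI])
  then show "cstar CA F \<in> carrier CA" unfolding CA_carrier using CA_star_apply(2)[OF F] by (simp add: CA_sel(5))
qed

subsection \<open>Covariant representations\<close>

definition cv_index :: "('i vec set \<times> ('a \<Rightarrow> 'i operator) \<times> ('s word set \<Rightarrow> 'i operator)) set" where
  "cv_index = {(H, \<phi>, W). hilbert_space H \<and> covariant_isg Sg A corner_map H \<phi> W}"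

definition cv_rep :: "('i vec set \<times> ('a \<Rightarrow> 'i operator) \<times> ('s word set \<Rightarrow> 'i operator)) \<Rightarrow> ('s word set \<Rightarrow> 'a) \<Rightarrow> 'i operator" where
  "cv_rep j F = (\<lambda>x\<in>fst j. \<Sum>s | s \<in> carrier Sg \<and> F s \<noteq> czero A. fst (snd j) (F s) (snd (snd j) s x))"

text \<open>\<open>f p\<close> belongs to the ideal \<open>support p\<close> and is a unit for it,
  so the vectors \<open>\<phi> a x\<close> already fill the range of a projection.\<close>

lemma source_range:
  assumes H: "hilbert_space H" and hom: "\<phi> \<in> star_hom A (Bop H)" and p: "p \<in> carrier Sg"
  shows "{\<phi> a x | a x. a \<in> support p \<and> x \<in> H} = \<phi> (f p) ` H"
proof (intro subset_antisym subsetI)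
  fix y assume "y \<in> {\<phi> a x | a x. a \<in> support p \<and> x \<in> H}"
  then obtain a x where a: "a \<in> support p" "x \<in> H" "y = \<phi> a x" by blast
  then have ac: "a \<in> carrier A" "cmult A (f p) a = a" by (auto simp: support_corner[OF p])
  have "\<phi> (f p) (\<phi> a x) = compose H (\<phi> (f p)) (\<phi> a) x" using a(2) by simp
  also have "\<dots> = y" using star_hom_BopD(4)[OF hom f_closed[OF p] ac(1)] by (simp add: ac(2) a(3))
  finally have "y = \<phi> (f p) (\<phi> a x)" ..
  then show "y \<in> \<phi> (f p) ` H" using bop_apply[OF H star_hom_BopD(1)[OF hom ac(1)] a(2)] by blast
next
  fix y assume "y \<in> \<phi> (f p) ` H"
  then show "y \<in> {\<phi> a x | a x. a \<in> support p \<and> x \<in> H}" using f_support[OF p] by blast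
qed

context
  fixes H :: "'i vec set" and \<phi> :: "'a \<Rightarrow> 'i operator" and W :: "'s word set \<Rightarrow> 'i operator"
  assumes H: "hilbert_space H" and cov: "covariant_isg Sg A corner_map H \<phi> W"
begin

lemmas cv_parts = cov[unfolded covariant_isg_def]
lemmas cv_hom = cv_parts[THEN conjunct1]
lemmas cv_nondegenerate = cv_parts[THEN conjunct2, THEN conjunct1]
lemmas cv_sg = cv_parts[THEN conjunct2, THEN conjunct2, THEN conjunct1]
lemmas cv_units = cv_parts[THEN conjunct2, THEN conjunct2, THEN conjunct2, THEN conjunct1]
lemmas cv_all = cv_parts[THEN conjunct2, THEN conjunct2, THEN conjunct2, THEN conjunct2]

lemma cv_W_unit: "W (cls []) = id_op H"
  by (rule cv_units[rule_format]) (simp add: P_unit_element)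

lemmas cvD = star_hom_BopD[OF cv_hom]
lemmas cvW = sg_repsD[OF cv_sg]

lemma cv_unit: "\<phi> u = id_op H"
  using cv_nondegenerate nondegenerate_iff_unit[OF H cv_hom u_closed u_unit] by simp

lemma W_regular: "p \<in> carrier Sg \<Longrightarrow> compose H (W p) (compose H (adjoint H (W p)) (W p)) = W p"
  using cvW(2)[of p "smul Sg (sstar Sg p) p"] by (simp add: cvW P_mult_closed P_star_closed P_regular)

text \<open>Both sides are projections, and covariance together with \<open>source_range\<close>
  gives them the same range.\<close>

lemma cv_source:
  assumes p: "p \<in> carrier Sg" shows "compose H (adjoint H (W p)) (W p) = \<phi> (f p)"
proof (rule projection_eqI[OF H])
  let ?q = "compose H (adjoint H (W p)) (W p)"
  note b = cvW(1)[OF p] adjoint_bop[OF H cvW(1)[OF p]]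
  show "?q \<in> bounded_ops H" by (rule compose_closed[OF H b(2,1)])
  show "compose H ?q ?q = ?q" by (simp add: compose_assoc'[OF H] b compose_closed[OF H] W_regular p)
  show "adjoint H ?q = ?q" by (simp add: adjoint_compose[OF H] b adjoint_adjoint[OF H])
  show "\<phi> (f p) \<in> bounded_ops H" by (rule cvD(1)[OF f_closed[OF p]])
  show "compose H (\<phi> (f p)) (\<phi> (f p)) = \<phi> (f p)" using cvD(4)[OF f_closed[OF p] f_closed[OF p]] by (simp add: f_idem p)
  show "adjoint H (\<phi> (f p)) = \<phi> (f p)" using cvD(5)[OF f_closed[OF p]] by (simp add: f_star p)
  have "?q ` H = {\<phi> a x | a x. a \<in> support p \<and> x \<in> H}"
    using bspec[OF cv_all p] unfolding dom_corner_map by (rule conjunct1)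
  then show "?q ` H = \<phi> (f p) ` H" unfolding source_range[OF H cv_hom p] .
qed

lemma cv_range:
  assumes p: "p \<in> carrier Sg" shows "compose H (W p) (adjoint H (W p)) = \<phi> (f (sstar Sg p))"
  using cv_source[OF P_star_closed[OF p]] by (simp add: cvW p adjoint_adjoint[OF H])

lemma cv_source_absorb:
  assumes p: "p \<in> carrier Sg" shows "compose H (W p) (\<phi> (f p)) = W p"
  using W_regular[OF p] by (simp add: cv_source p)

lemma cv_conj_support:
  "p \<in> carrier Sg \<Longrightarrow> a \<in> support p \<Longrightarrow> \<phi> (C p a) = compose H (W p) (compose H (\<phi> a) (adjoint H (W p)))"
  using bspec[OF bspec[OF cv_all, THEN conjunct2, THEN conjunct2], of p a] by (simp add: dom_corner_map corner_map_apply)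

text \<open>Covariance is assumed only on the domain. A general \<open>a\<close> is replaced by its
  compression \<open>f p a\<close>, which has the same image under \<open>C p\<close>; on the other
  side \<open>f p\<close> is absorbed by \<open>W p\<close>.\<close>

lemma cv_move:
  assumes p: "p \<in> carrier Sg" and a: "a \<in> carrier A"
  shows "compose H (\<phi> (C p a)) (W p) = compose H (W p) (\<phi> a)"
proof -
  let ?b = "cmult A (f p) a"
  note b = cvW(1)[OF p] adjoint_bop[OF H cvW(1)[OF p]] cvD(1)[OF f_closed[OF p]] cvD(1)[OF a]
  have bs: "?b \<in> support p" by (rule support_closed(4)[OF p f_support[OF p] a])
  have bc: "?b \<in> carrier A" using support_subset bs by blast
  have bf: "cmult A ?b (f p) = ?b"
    using commutative[OF bc f_closed[OF p]] bs by (simp add: support_corner[OF p])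
  have "C p a = C p (C (sstar Sg p) (C p a))" by (rule C_regular[OF p a, symmetric])
  then have "C p a = C p ?b" by (simp add: C_source p a)
  then have "compose H (\<phi> (C p a)) (W p) = compose H (W p) (compose H (\<phi> ?b) (compose H (adjoint H (W p)) (W p)))"
    by (simp add: cv_conj_support[OF p bs] compose_assoc'[OF H] b compose_closed[OF H])
  also have "\<dots> = compose H (W p) (\<phi> ?b)"
    unfolding cv_source[OF p] using cvD(4)[OF bc f_closed[OF p]] by (simp add: bf)
  also have "\<dots> = compose H (compose H (W p) (\<phi> (f p))) (\<phi> a)"
    by (simp add: cvD(4)[OF f_closed[OF p] a] compose_assoc'[OF H] b)
  finally show ?thesis by (simp add: cv_source_absorb p)
qed

abbreviation elem_op :: "'s word set \<Rightarrow> 'a \<Rightarrow> 'i operator" where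
  "elem_op s a \<equiv> compose H (\<phi> a) (W s)"

lemma elem_op_bop: "s \<in> carrier Sg \<Longrightarrow> a \<in> carrier A \<Longrightarrow> elem_op s a \<in> bounded_ops H"
  by (rule compose_closed[OF H cvD(1) cvW(1)])

lemma elem_op_norm:
  assumes s: "s \<in> carrier Sg" and a: "a \<in> carrier A" shows "op_norm H (elem_op s a) \<le> cnorm A a"
proof (rule op_norm_le[OF H norm_nonneg[OF a]])
  fix x assume x: "x \<in> H"
  have Wx: "W s x \<in> H" by (rule bop_apply[OF H cvW(1)[OF s] x])
  have "ell2_norm (\<phi> a (W s x)) \<le> op_norm H (\<phi> a) * ell2_norm (W s x)" by (rule op_norm_bound[OF H cvD(1)[OF a] Wx])
  also have "\<dots> \<le> cnorm A a * ell2_norm x"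
    using star_hom_contractive[OF H cv_hom a] partial_isometry_contractive[OF H cvW(1)[OF s] W_regular[OF s] x]
    by (rule mult_mono) (simp_all add: norm_nonneg a)
  finally show "ell2_norm (elem_op s a x) \<le> cnorm A a * ell2_norm x" using x by simp
qed

lemma elem_op_mult:
  assumes s: "s \<in> carrier Sg" and t: "t \<in> carrier Sg" and a: "a \<in> carrier A" and b: "b \<in> carrier A"
  shows "elem_op (smul Sg s t) (cmult A a (C s b)) = compose H (elem_op s a) (elem_op t b)"
proof -
  note bb = cvW(1)[OF s] cvW(1)[OF t] cvD(1)[OF a] cvD(1)[OF b] cvD(1)[OF C_closed[OF s b]]
  have "elem_op (smul Sg s t) (cmult A a (C s b)) = compose H (\<phi> a) (compose H (compose H (\<phi> (C s b)) (W s)) (W t))"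
    by (simp add: cvD(4)[OF a C_closed[OF s b]] cvW(2)[OF s t] compose_assoc'[OF H] bb compose_closed[OF H])
  also have "\<dots> = compose H (elem_op s a) (elem_op t b)"
    unfolding cv_move[OF s b] by (simp add: compose_assoc'[OF H] bb compose_closed[OF H])
  finally show ?thesis .
qed

lemma elem_op_star:
  assumes s: "s \<in> carrier Sg" and a: "a \<in> carrier A" "a \<in> support (sstar Sg s)"
  shows "elem_op (sstar Sg s) (C (sstar Sg s) (cstar A a)) = adjoint H (elem_op s a)"
proof -
  have s': "sstar Sg s \<in> carrier Sg" by (rule P_star_closed[OF s])
  have "elem_op (sstar Sg s) (C (sstar Sg s) (cstar A a)) = compose H (W (sstar Sg s)) (\<phi> (cstar A a))"
    by (rule cv_move[OF s']) (simp add: closed a)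
  then show ?thesis by (simp add: adjoint_compose[OF H] cvD a cvW s)
qed

lemma cv_rep_superset:
  assumes "finite K" "{s. F s \<noteq> czero A} \<subseteq> K" "K \<subseteq> carrier Sg" "x \<in> H" "F \<in> carrier CA"
  shows "cv_rep (H, \<phi>, W) F x = (\<Sum>s\<in>K. elem_op s (F s) x)"
proof -
  have z: "\<phi> (czero A) (W s x) = 0" if "s \<in> K" for s
    using star_hom_zero[OF H cv_hom] bop_apply[OF H cvW(1)[of s] assms(4)] that assms(3) by auto
  show ?thesis using assms(4) unfolding cv_rep_def fst_conv snd_conv restrict_apply'[OF assms(4)]
    by (simp, intro sum.mono_neutral_left) (use assms z in auto)
qed

lemma cv_rep_eq:
  assumes F: "F \<in> carrier CA"
  shows "cv_rep (H, \<phi>, W) F = (\<lambda>x\<in>H. \<Sum>s | F s \<noteq> czero A. elem_op s (F s) x)"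
proof -
  have "cv_rep (H, \<phi>, W) F x = (\<Sum>s | F s \<noteq> czero A. elem_op s (F s) x)" if "x \<in> H" for x
    by (rule cv_rep_superset) (use F that in \<open>auto simp: CA_carrier\<close>)
  moreover have "cv_rep (H, \<phi>, W) F x = undefined" if "x \<notin> H" for x using that by (simp add: cv_rep_def)
  ultimately show ?thesis by (intro ext) (simp add: restrict_def)
qed

lemma cv_rep_bop:
  assumes F: "F \<in> carrier CA"
  shows "cv_rep (H, \<phi>, W) F \<in> bounded_ops H" "op_norm H (cv_rep (H, \<phi>, W) F) \<le> (\<Sum>s | F s \<noteq> czero A. cnorm A (F s))"
  unfolding cv_rep_eq[OF F]
  by (rule op_norm_sum[OF H]; use F in \<open>simp add: CA_carrier\<close> | (rule elem_op_bop elem_op_norm; use F CA_in_Sg CA_apply in blast))+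

lemma cv_rep_mult:
  assumes F: "F \<in> carrier CA" and G: "G \<in> carrier CA" and x: "x \<in> H"
  shows "cv_rep (H, \<phi>, W) (cmult CA F G) x = cv_rep (H, \<phi>, W) F (cv_rep (H, \<phi>, W) G x)"
proof -
  let ?h = "\<lambda>(s, t). smul Sg s t" and ?U = "{s. F s \<noteq> czero A}" and ?V = "{s. G s \<noteq> czero A}"
  let ?K = "\<lambda>r. {i \<in> ?U \<times> ?V. ?h i = r}"
  have fin: "finite ?U" "finite ?V" using F G by (auto simp: CA_carrier)
  have U: "s \<in> carrier Sg" if "s \<in> ?U" for s using that CA_in_Sg[OF F] by blast
  have V: "s \<in> carrier Sg" if "s \<in> ?V" for s using that CA_in_Sg[OF G] by blast
  have tc: "conv_term F G i \<in> carrier A" if "i \<in> ?U \<times> ?V" for i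
  proof -
    note iUV = that
    obtain s t where i: "i = (s, t)" "s \<in> ?U" "t \<in> ?V" using iUV by blast
    show ?thesis using conv_term(2)[OF F G U[OF i(2)] V[OF i(3)]] support_subset by (auto simp: i(1))
  qed
  have hc: "?h i \<in> carrier Sg" if "i \<in> ?U \<times> ?V" for i
    using that P_mult_closed[OF U[of "fst i"] V[of "snd i"]] by (simp add: case_prod_unfold mem_Times_iff)
  have "cv_rep (H, \<phi>, W) (cmult CA F G) x = (\<Sum>r\<in>?h ` (?U \<times> ?V). elem_op r (cmult CA F G r) x)"
    by (rule cv_rep_superset[OF _ CA_mult_closed(2)[OF F G] _ x CA_mult_closed(1)[OF F G]]) (use fin hc in auto)
  also have "\<dots> = (\<Sum>r\<in>?h ` (?U \<times> ?V). \<Sum>i\<in>?K r. elem_op (?h i) (conv_term F G i) x)"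
  proof (intro sum.cong refl)
    fix r assume "r \<in> ?h ` (?U \<times> ?V)"
    then have r: "r \<in> carrier Sg" using hc by blast
    have Wx: "W r x \<in> H" by (rule bop_apply[OF H cvW(1)[OF r] x])
    have "\<phi> (csum A (conv_term F G) (?K r)) (W r x) = (\<Sum>i\<in>?K r. \<phi> (conv_term F G i) (W r x))"
    proof (rule linear_csum_apply[OF H cv_hom Wx])
      show "finite (?K r)" by (rule finite_subset[of _ "?U \<times> ?V"]) (use fin in auto)
      show "conv_term F G i \<in> carrier A" if "i \<in> ?K r" for i using that tc by blast
    qed
    also have "\<dots> = (\<Sum>i\<in>?K r. elem_op (?h i) (conv_term F G i) x)"
    proof (rule sum.cong[OF refl])
      fix i assume "i \<in> ?K r"
      then have "?h i = r" by blast
      then show "\<phi> (conv_term F G i) (W r x) = elem_op (?h i) (conv_term F G i) x" using x by simp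
    qed
    finally show "elem_op r (cmult CA F G r) x = (\<Sum>i\<in>?K r. elem_op (?h i) (conv_term F G i) x)"
      using x by (simp only: CA_mult_eq[OF F G] compose_apply)
  qed
  \<comment> \<open>The coefficient at \<open>r\<close> collects the pairs with product
    \<open>r\<close>, so summing over \<open>r\<close> runs through every pair from the two supports
    once.\<close>
  also have "\<dots> = (\<Sum>i\<in>?U \<times> ?V. elem_op (?h i) (conv_term F G i) x)"
    by (rule sum.group) (use fin in auto)
  also have "\<dots> = (\<Sum>(s, t)\<in>?U \<times> ?V. elem_op s (F s) (elem_op t (G t) x))"
  proof (rule sum.cong[OF refl])
    fix i assume "i \<in> ?U \<times> ?V"
    then obtain s t where i: "i = (s, t)" "s \<in> ?U" "t \<in> ?V" by blast
    note s = U[OF i(2)] and t = V[OF i(3)]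
    have "elem_op (smul Sg s t) (conv_term F G (s, t)) = compose H (elem_op s (F s)) (elem_op t (G t))"
      unfolding conv_term(1)[OF F G s t] by (rule elem_op_mult[OF s t CA_apply[OF F] CA_apply[OF G]])
    from fun_cong[OF this, of x] show "elem_op (?h i) (conv_term F G i) x
        = (case i of (s, t) \<Rightarrow> elem_op s (F s) (elem_op t (G t) x))"
      unfolding i(1) prod.case compose_apply[OF x] .
  qed
  also have "\<dots> = (\<Sum>s\<in>?U. \<Sum>t\<in>?V. elem_op s (F s) (elem_op t (G t) x))"
    by (rule sum.cartesian_product[symmetric])
  also have "\<dots> = (\<Sum>s\<in>?U. elem_op s (F s) (cv_rep (H, \<phi>, W) G x))"
  proof (rule sum.cong[OF refl])
    fix s assume s: "s \<in> ?U"
    have "elem_op t (G t) x \<in> H" if "t \<in> ?V" for t by (rule bop_apply[OF H elem_op_bop[OF V[OF that] CA_apply[OF G]] x])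
    from bop_sum[OF H elem_op_bop[OF U[OF s] CA_apply[OF F]] this]
    show "(\<Sum>t\<in>?V. elem_op s (F s) (elem_op t (G t) x)) = elem_op s (F s) (cv_rep (H, \<phi>, W) G x)"
      unfolding cv_rep_eq[OF G] restrict_apply'[OF x] by (rule sym)
  qed
  also have "\<dots> = cv_rep (H, \<phi>, W) F (cv_rep (H, \<phi>, W) G x)"
    unfolding cv_rep_eq[OF F] restrict_apply'[OF bop_apply[OF H cv_rep_bop(1)[OF G] x]] ..
  finally show ?thesis .
qed

lemma cv_rep_star:
  assumes F: "F \<in> carrier CA"
  shows "cv_rep (H, \<phi>, W) (cstar CA F) = adjoint H (cv_rep (H, \<phi>, W) F)"
proof (rule adjoint_eqI[OF H cv_rep_bop(1)[OF F] cv_rep_bop(1)[OF CA_star_closed(1)[OF F]], symmetric])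
  fix x y assume x: "x \<in> H" and y: "y \<in> H"
  let ?U = "{s. F s \<noteq> czero A}"
  have U: "s \<in> carrier Sg" if "s \<in> ?U" for s using that CA_in_Sg[OF F] by blast
  have b: "elem_op s (F s) \<in> bounded_ops H" if "s \<in> ?U" for s by (rule elem_op_bop[OF U[OF that] CA_apply[OF F]])
  have star: "elem_op (sstar Sg s) (cstar CA F (sstar Sg s)) = adjoint H (elem_op s (F s))" if "s \<in> ?U" for s
  proof -
    have "F s \<in> support (sstar Sg s)" using F U[OF that] by (simp add: CA_carrier)
    then show ?thesis
      using elem_op_star[OF U[OF that] CA_apply[OF F]] CA_star_apply(1)[OF F P_star_closed[OF U[OF that]]]
      by (simp add: P_star_star[OF U[OF that]])
  qed
  have inj: "inj_on (sstar Sg) ?U" by (rule inj_on_inverseI[of _ "sstar Sg"]) (rule P_star_star[OF U])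
  have "ell2_inner (cv_rep (H, \<phi>, W) F x) y = (\<Sum>s\<in>?U. ell2_inner (elem_op s (F s) x) y)"
    unfolding cv_rep_eq[OF F] restrict_apply'[OF x]
    by (rule ell2_inner_sum_left) (rule hs_ell2[OF H] y bop_apply[OF H b x] | assumption)+
  also have "\<dots> = (\<Sum>s\<in>?U. ell2_inner x (elem_op (sstar Sg s) (cstar CA F (sstar Sg s)) y))"
    by (rule sum.cong[OF refl]) (simp only: star adjoint_inner[OF H b x y])
  also have "\<dots> = ell2_inner x (\<Sum>s\<in>?U. elem_op (sstar Sg s) (cstar CA F (sstar Sg s)) y)"
  proof (rule ell2_inner_sum_right[symmetric])
    show "x \<in> ell2" by (rule hs_ell2[OF H x])
    show "elem_op (sstar Sg s) (cstar CA F (sstar Sg s)) y \<in> ell2" if "s \<in> ?U" for s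
      unfolding star[OF that] by (rule hs_ell2[OF H bop_apply[OF H adjoint_bop[OF H b[OF that]] y]])
  qed
  also have "(\<Sum>s\<in>?U. elem_op (sstar Sg s) (cstar CA F (sstar Sg s)) y) = (\<Sum>r\<in>sstar Sg ` ?U. elem_op r (cstar CA F r) y)"
    by (simp only: sum.reindex[OF inj] o_def)
  also have "\<dots> = cv_rep (H, \<phi>, W) (cstar CA F) y"
    by (rule cv_rep_superset[OF _ CA_star_closed(2)[OF F] _ y CA_star_closed(1)[OF F], symmetric])
      (use F U P_star_closed in \<open>auto simp: CA_carrier\<close>)
  finally show "ell2_inner (cv_rep (H, \<phi>, W) F x) y = ell2_inner x (cv_rep (H, \<phi>, W) (cstar CA F) y)" .
qed

end

end

text \<open>Lets an inclusion for a corner be checked on a set that spans all of \<open>A\<close>,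
  by multiplying with the projection; see \<open>alg_action_induced\<close>.\<close>

lemma (in rep_cstar) mult_preimage_subspace:
  assumes e: "e \<in> carrier A" and K: "closed_subspace A K"
  shows "closed_subspace A {x \<in> carrier A. cmult A e x \<in> K}"
proof (rule closed_subspaceI)
  fix X x assume X: "conv X x" "\<And>n. X n \<in> {x \<in> carrier A. cmult A e x \<in> K}"
  have "cmult A e x \<in> K"
    by (rule conv_in_closed_subspace[OF K conv_mult[OF conv_const[OF e] X(1)]]) (use X(2) in blast)
  then show "x \<in> {x \<in> carrier A. cmult A e x \<in> K}" using conv_carrier(2)[OF X(1)] by blast
qed (use closed_subspaceD[OF K] in \<open>auto simp: closed e mult_zero mult_add_right mult_scale\<close>)

context corner_action
begin

lemma scale_zero: "cscale A c (czero A) = czero A"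
  using norm_scale[OF zero_closed, of c] norm_nonneg[OF scale_closed[OF zero_closed], of c]
  by (intro norm_eq_0) (simp_all add: closed norm_zero)

lemma CA_add_closed:
  assumes F: "F \<in> carrier CA" and G: "G \<in> carrier CA" shows "cadd CA F G \<in> carrier CA"
proof -
  have "{s. cadd A (F s) (G s) \<noteq> czero A} \<subseteq> {s. F s \<noteq> czero A} \<union> {s. G s \<noteq> czero A}"
    using add_zero[OF zero_closed] by auto
  then have "finite {s. cadd A (F s) (G s) \<noteq> czero A}"
    by (rule finite_subset) (use F G in \<open>simp add: CA_carrier\<close>)
  then show ?thesis unfolding CA_carrier CA_sel(1)
    using F G add_zero[OF zero_closed] by (auto simp: CA_carrier intro!: support_closed P_star_closed)
qed

lemma CA_scale_closed:
  assumes F: "F \<in> carrier CA" shows "cscale CA c F \<in> carrier CA"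
proof -
  have "{s. cscale A c (F s) \<noteq> czero A} \<subseteq> {s. F s \<noteq> czero A}" using scale_zero by auto
  then have "finite {s. cscale A c (F s) \<noteq> czero A}"
    by (rule finite_subset) (use F in \<open>simp add: CA_carrier\<close>)
  then show ?thesis unfolding CA_carrier CA_sel(3)
    using F scale_zero by (auto simp: CA_carrier intro!: support_closed P_star_closed)
qed

lemma CA_zero_closed: "czero CA \<in> carrier CA"
  by (simp add: CA_carrier CA_sel(2) support_closed P_star_closed)

text \<open>Extends covariance from the domain to all of \<open>A\<close>: \<open>C p a\<close> lies
  in the corner of \<open>p p*\<close>, so the range projection may be inserted, and then
  \<open>a\<close> is moved across \<open>W p\<close>.\<close>

lemma cv_conj:
  fixes H :: "'i vec set"
  assumes H: "hilbert_space H" and cov: "covariant_isg Sg A corner_map H \<phi> W" and p: "p \<in> carrier Sg" and a: "a \<in> carrier A"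
  shows "\<phi> (C p a) = compose H (W p) (compose H (\<phi> a) (adjoint H (W p)))"
proof -
  note W = cvW(1)[OF H cov p] and Cpa = C_closed[OF p a] and p' = P_star_closed[OF p]
  note b = W adjoint_bop[OF H W] cvD(1)[OF H cov Cpa] cvD(1)[OF H cov a]
  have "cmult A (f (sstar Sg p)) (C p a) = C p a"
    using C_in_support[OF p a] by (simp add: support_corner[OF p'])
  then have "\<phi> (C p a) = compose H (\<phi> (C p a)) (\<phi> (f (sstar Sg p)))"
    using cvD(4)[OF H cov Cpa f_closed[OF p']] commutative[OF Cpa f_closed[OF p']] by simp
  also have "\<dots> = compose H (compose H (\<phi> (C p a)) (W p)) (adjoint H (W p))"
    by (simp only: cv_range[OF H cov p, symmetric] compose_assoc'[OF H] b)
  also have "\<dots> = compose H (W p) (compose H (\<phi> a) (adjoint H (W p)))"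
    by (simp only: cv_move[OF H cov p a] compose_assoc'[OF H] b)
  finally show ?thesis .
qed

lemma cv_rep_star_hom:
  assumes H: "hilbert_space H" and cov: "covariant_isg Sg A corner_map H \<phi> W"
  shows "cv_rep (H, \<phi>, W) \<in> star_hom CA (Bop H)"
proof -
  let ?r = "cv_rep (H, \<phi>, W)"
  note D = cvD[OF H cov] and Wb = cvW(1)[OF H cov]
  have add: "?r (cadd CA F G) = cadd (Bop H) (?r F) (?r G)" if F: "F \<in> carrier CA" and G: "G \<in> carrier CA" for F G
  proof (rule bop_eqI[OF H])
    show "?r (cadd CA F G) \<in> bounded_ops H" by (rule cv_rep_bop(1)[OF H cov CA_add_closed[OF F G]])
    show "cadd (Bop H) (?r F) (?r G) \<in> bounded_ops H" by (intro Bop_closed[OF H] cv_rep_bop(1)[OF H cov] F G)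
    fix x assume x: "x \<in> H"
    let ?K = "{s. F s \<noteq> czero A} \<union> {s. G s \<noteq> czero A}"
    have K: "finite ?K" using F G by (simp add: CA_carrier)
    have K': "?K \<subseteq> carrier Sg" using CA_in_Sg[OF F] CA_in_Sg[OF G] by blast
    note sup = cv_rep_superset[OF H cov K _ K' x]
    have "?r (cadd CA F G) x = (\<Sum>s\<in>?K. compose H (\<phi> (cadd CA F G s)) (W s) x)"
      by (rule sup[OF _ CA_add_closed[OF F G]]) (use add_zero[OF zero_closed] in \<open>auto simp: CA_sel\<close>)
    also have "\<dots> = (\<Sum>s\<in>?K. compose H (\<phi> (F s)) (W s) x + compose H (\<phi> (G s)) (W s) x)"
    proof (rule sum.cong[OF refl])
      fix s assume "s \<in> ?K"
      then have "W s x \<in> H" using bop_apply[OF H Wb[OF subsetD[OF K']] x] by blast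
      then show "compose H (\<phi> (cadd CA F G s)) (W s) x = compose H (\<phi> (F s)) (W s) x + compose H (\<phi> (G s)) (W s) x"
        using x by (simp add: CA_sel(1) D(2)[OF CA_apply[OF F] CA_apply[OF G]])
    qed
    also have "\<dots> = ?r F x + ?r G x"
      unfolding sum.distrib using sup[OF Un_upper1 F] sup[OF Un_upper2 G] by simp
    finally show "?r (cadd CA F G) x = cadd (Bop H) (?r F) (?r G) x" using x by simp
  qed
  have scale: "?r (cscale CA c F) = cscale (Bop H) c (?r F)" if F: "F \<in> carrier CA" for c F
  proof (rule bop_eqI[OF H])
    show "?r (cscale CA c F) \<in> bounded_ops H" by (rule cv_rep_bop(1)[OF H cov CA_scale_closed[OF F]])
    show "cscale (Bop H) c (?r F) \<in> bounded_ops H" by (intro Bop_closed[OF H] cv_rep_bop(1)[OF H cov] F)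
    fix x assume x: "x \<in> H"
    let ?K = "{s. F s \<noteq> czero A}"
    have K: "finite ?K" using F by (simp add: CA_carrier)
    have K': "?K \<subseteq> carrier Sg" using CA_in_Sg[OF F] by blast
    note sup = cv_rep_superset[OF H cov K _ K' x]
    have "?r (cscale CA c F) x = (\<Sum>s\<in>?K. compose H (\<phi> (cscale CA c F s)) (W s) x)"
      by (rule sup[OF _ CA_scale_closed[OF F]]) (use scale_zero in \<open>auto simp: CA_sel\<close>)
    also have "\<dots> = (\<Sum>s\<in>?K. c *\<^sub>v compose H (\<phi> (F s)) (W s) x)"
    proof (rule sum.cong[OF refl])
      fix s assume "s \<in> ?K"
      then have "W s x \<in> H" using bop_apply[OF H Wb[OF subsetD[OF K']] x] by blast
      then show "compose H (\<phi> (cscale CA c F s)) (W s) x = c *\<^sub>v compose H (\<phi> (F s)) (W s) x"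
        using x by (simp add: CA_sel(3) D(3)[OF CA_apply[OF F]])
    qed
    also have "\<dots> = c *\<^sub>v ?r F x"
      using sup[OF order_refl F] by (simp add: vscale_sum_right)
    finally show "?r (cscale CA c F) x = cscale (Bop H) c (?r F) x" using x by simp
  qed
  have mult: "?r (cmult CA F G) = compose H (?r F) (?r G)" if "F \<in> carrier CA" "G \<in> carrier CA" for F G
    using cv_rep_mult[OF H cov that] that
    by (intro bop_eqI[OF H] cv_rep_bop(1)[OF H cov] CA_mult_closed(1) compose_closed[OF H]) simp_all
  show ?thesis
    unfolding star_hom_def using cv_rep_bop(1)[OF H cov] add scale mult cv_rep_star[OF H cov] by simp
qed

lemma CA_normed_by_reps:
  assumes ne: "cv_index \<noteq> {}"
  shows "normed_by_reps CA cv_index fst cv_rep"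
proof
  show "czero CA \<in> carrier CA" by (rule CA_zero_closed)
  fix F G c assume F: "F \<in> carrier CA" and G: "G \<in> carrier CA"
  show "cadd CA F G \<in> carrier CA" "cscale CA c F \<in> carrier CA" "cmult CA F G \<in> carrier CA" "cstar CA F \<in> carrier CA"
    by (rule CA_add_closed[OF F G] CA_scale_closed[OF F] CA_mult_closed(1)[OF F G] CA_star_closed(1)[OF F])+
  show "bdd_above ((\<lambda>j. op_norm (fst j) (cv_rep j F)) ` cv_index)"
  proof (rule bdd_aboveI)
    fix r assume "r \<in> (\<lambda>j. op_norm (fst j) (cv_rep j F)) ` cv_index"
    then obtain H \<phi> W where "r = op_norm H (cv_rep (H, \<phi>, W) F)" "hilbert_space H" "covariant_isg Sg A corner_map H \<phi> W"
      by (auto simp: cv_index_def)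
    then show "r \<le> (\<Sum>s | F s \<noteq> czero A. cnorm A (F s))" using cv_rep_bop(2)[OF _ _ F] by blast
  qed
  have rep_eq: "(\<lambda>x\<in>H. \<lambda>i. \<Sum>s | s \<in> carrier Sg \<and> F s \<noteq> czero A. \<phi> (F s) (W s x) i) = cv_rep (H, \<phi>, W) F"
    for H :: "'i vec set" and \<phi> :: "'a \<Rightarrow> 'i operator" and W :: "'s word set \<Rightarrow> 'i operator"
    by (auto simp: cv_rep_def fun_eq_iff vec_apply)
  have "{op_norm H (cv_rep (H, \<phi>, W) F) | H \<phi> W. hilbert_space H \<and> covariant_isg Sg A corner_map H \<phi> W}
      = (\<lambda>j. op_norm (fst j) (cv_rep j F)) ` cv_index"
  proof (intro subset_antisym subsetI)
    fix r assume "r \<in> {op_norm H (cv_rep (H, \<phi>, W) F) | H \<phi> W. hilbert_space H \<and> covariant_isg Sg A corner_map H \<phi> W}"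
    then obtain H \<phi> W where r: "r = op_norm H (cv_rep (H, \<phi>, W) F)" "hilbert_space H \<and> covariant_isg Sg A corner_map H \<phi> W"
      by blast
    then have "(H, \<phi>, W) \<in> cv_index" by (simp add: cv_index_def)
    then show "r \<in> (\<lambda>j. op_norm (fst j) (cv_rep j F)) ` cv_index" by (rule rev_image_eqI) (simp add: r(1))
  next
    fix r assume "r \<in> (\<lambda>j. op_norm (fst j) (cv_rep j F)) ` cv_index"
    then obtain j where j: "j \<in> cv_index" "r = op_norm (fst j) (cv_rep j F)" by blast
    obtain H \<phi> W where "j = (H, \<phi>, W)" by (cases j)
    then show "r \<in> {op_norm H (cv_rep (H, \<phi>, W) F) | H \<phi> W. hilbert_space H \<and> covariant_isg Sg A corner_map H \<phi> W}"
      using j unfolding cv_index_def by (simp, blast)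
  qed
  then show "cnorm CA F = Sup ((\<lambda>j. op_norm (fst j) (cv_rep j F)) ` cv_index)"
    by (simp add: covariance_algebra_def rep_eq)
next
  fix j :: "'i vec set \<times> ('a \<Rightarrow> 'i operator) \<times> ('s word set \<Rightarrow> 'i operator)" assume "j \<in> cv_index"
  then obtain H \<phi> W where j: "j = (H, \<phi>, W)" "hilbert_space H" "covariant_isg Sg A corner_map H \<phi> W"
    by (auto simp: cv_index_def)
  show "hilbert_space (fst j)" "cv_rep j \<in> star_hom CA (Bop (fst j))" using j cv_rep_star_hom by simp_all
  show "cv_rep j (czero CA) = zero_op (fst j)"
    by (simp add: cv_rep_def CA_sel(2) zero_op_def zero_fun_def)
qed (rule ne)

text \<open>The element \<open>a \<delta>_p\<close> of the covariance algebra.\<close>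

definition single :: "'s word set \<Rightarrow> 'a \<Rightarrow> 's word set \<Rightarrow> 'a" where
  "single p a = (\<lambda>s. if s = p then a else czero A)"

lemma single_closed:
  assumes p: "p \<in> carrier Sg" and a: "a \<in> support (sstar Sg p)" shows "single p a \<in> carrier CA"
proof -
  have "finite {s. single p a s \<noteq> czero A}" by (rule finite_subset[of _ "{p}"]) (auto simp: single_def)
  then show ?thesis using assms by (auto simp: CA_carrier single_def support_closed P_star_closed)
qed

lemma cv_rep_single:
  assumes H: "hilbert_space H" and cov: "covariant_isg Sg A corner_map H \<phi> W"
    and p: "p \<in> carrier Sg" and a: "a \<in> support (sstar Sg p)"
  shows "cv_rep (H, \<phi>, W) (single p a) = compose H (\<phi> a) (W p)"
proof (rule bop_eqI[OF H])
  have ac: "a \<in> carrier A" using a support_subset by blast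
  show "cv_rep (H, \<phi>, W) (single p a) \<in> bounded_ops H" by (rule cv_rep_bop(1)[OF H cov single_closed[OF p a]])
  show "compose H (\<phi> a) (W p) \<in> bounded_ops H" by (rule elem_op_bop[OF H cov p ac])
  fix x assume "x \<in> H"
  then have "cv_rep (H, \<phi>, W) (single p a) x = (\<Sum>s\<in>{p}. compose H (\<phi> (single p a s)) (W s) x)"
    by (intro cv_rep_superset[OF H cov] single_closed p a) (auto simp: single_def p)
  then show "cv_rep (H, \<phi>, W) (single p a) x = compose H (\<phi> a) (W p) x" by (simp add: single_def)
qed

lemma CA_generates:
  assumes ne: "cv_index \<noteq> {}"
  shows "generates (completion CA) {to_completion CA (single p a) | p a. p \<in> carrier Sg \<and> a \<in> support (sstar Sg p)}"
proof (rule spans_generates)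
  interpret N: normed_by_reps CA cv_index fst cv_rep by (rule CA_normed_by_reps[OF ne])
  let ?G = "{to_completion CA (single p a) | p a. p \<in> carrier Sg \<and> a \<in> support (sstar Sg p)}"
  show "spans (completion CA) ?G"
    unfolding spans_def
  proof (intro conjI allI impI)
    show "?G \<subseteq> carrier (completion CA)" using N.to_completion_closed[OF single_closed] by blast
    fix K assume K: "closed_subspace (completion CA) K" and G: "?G \<subseteq> K"
    have "to_completion CA F \<in> K" if "finite Y" "F \<in> carrier CA" "{s. F s \<noteq> czero A} \<subseteq> Y" for Y F
      using that
    proof (induction Y arbitrary: F rule: finite_induct)
      case empty
      then have "F = czero CA" by (auto simp: CA_sel(2))
      then show ?case using closed_subspaceD(2)[OF K] by (simp add: N.compl_zero to_completion_def)
    next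
      case (insert p Y)
      show ?case
      proof (cases "p \<in> carrier Sg")
        case False
        then have "{s. F s \<noteq> czero A} \<subseteq> Y" using insert.prems CA_in_Sg by blast
        then show ?thesis using insert.IH insert.prems(1) by blast
      next
        case p: True
        have Fp: "F p \<in> support (sstar Sg p)" using insert.prems(1) p by (simp add: CA_carrier)
        let ?F = "F(p := czero A)"
        have "finite {s. ?F s \<noteq> czero A}"
          by (rule finite_subset[of _ "{s. F s \<noteq> czero A}"]) (use insert.prems(1) in \<open>auto simp: CA_carrier\<close>)
        then have F': "?F \<in> carrier CA" using insert.prems(1) by (auto simp: CA_carrier support_closed P_star_closed)
        have "{s. ?F s \<noteq> czero A} \<subseteq> Y" using insert.prems(2) by auto
        then have "to_completion CA ?F \<in> K" by (rule insert.IH[OF F'])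
        moreover have "to_completion CA (single p (F p)) \<in> K" using G p Fp by blast
        ultimately have "to_completion CA (cadd CA (single p (F p)) ?F) \<in> K"
          unfolding N.to_completion_add[OF single_closed[OF p Fp] F'] by (intro closed_subspaceD(3)[OF K])
        moreover have "cadd CA (single p (F p)) ?F = F"
          using add_zero CA_apply[OF insert.prems(1)] add_commute[OF zero_closed]
          by (auto simp: CA_sel(1) single_def fun_eq_iff zero_closed)
        ultimately show ?thesis by simp
      qed
    qed
    then have mem: "to_completion CA F \<in> K" if "F \<in> carrier CA" for F using that by (auto simp: CA_carrier)
    show "carrier (completion CA) \<subseteq> K"
      by (rule N.completion_subspace_dense[OF K]) (use mem N.norm_diff_self in force)
  qed
qed

end

section \<open>Second isomorphism: crossed product by the inverse semigroup\<close>

section \<open>\<open>C\<^sup>*(S)\<close> as a crossed product by \<open>S\<^sup>*\<close>\<close>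

context left_cancellative_monoid
begin

abbreviation "As \<equiv> cstar_proj_semigroup I S"
abbreviation "pg \<equiv> proj_gen I S"

interpretation R: bounded_relations "sg_gens :: ('s + 's set) set"
    "semigroup_relations :: 'i vec set \<Rightarrow> ('s + 's set \<Rightarrow> 'i operator) \<Rightarrow> bool" "\<lambda>_. 1"
  by (rule semigroup_bounded_relations)

interpretation C: rep_cstar Cs JS fst cs_rep
  unfolding semigroup_cstar_eq by (rule R.univ_rep_cstar)

interpretation Q: regular_star_semigroup Qs by (rule Q_regular_star_semigroup)

interpretation A: rep_cstar As "sg_index Qs {ee {}} :: ('i vec set \<times> _) set" fst "isg_rep Qs"
  unfolding cstar_proj_semigroup_def by (rule Q.isg_rep_cstar)

lemma pg_closed: "x \<in> carrier Qs \<Longrightarrow> pg x \<in> carrier As"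
  unfolding cstar_proj_semigroup_def proj_gen_def by (rule Q.isg_gen_closed)

lemma pg_mult: "x \<in> carrier Qs \<Longrightarrow> y \<in> carrier Qs \<Longrightarrow> cmult As (pg x) (pg y) = pg (cmult Cs x y)"
  unfolding cstar_proj_semigroup_def proj_gen_def by (simp add: Q.isg_gen_mult) (simp add: Q_sel)

lemma pg_star: "x \<in> carrier Qs \<Longrightarrow> cstar As (pg x) = pg x"
  unfolding cstar_proj_semigroup_def proj_gen_def by (simp add: Q.isg_gen_star) (simp add: Q_sel(3) Q_star)

lemma pg_spans: "spans As (pg ` carrier Qs)"
  unfolding cstar_proj_semigroup_def proj_gen_def by (rule Q.isg_gen_spans)

lemmas pg_generates = spans_generates[OF pg_spans]

lemma ee_in_Q: "Y \<in> constructible \<Longrightarrow> ee Y \<in> carrier Qs"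
  unfolding Q_sel(1) by (rule imageI)

lemma pg_zero: "pg (ee {}) = czero As"
  unfolding cstar_proj_semigroup_def proj_gen_def
  by (rule Q.isg_gen_zero) (simp_all add: ee_in_Q empty_in_constructible)

lemma As_commute: "x \<in> carrier As \<Longrightarrow> y \<in> carrier As \<Longrightarrow> cmult As x y = cmult As y x"
  by (rule A.generators_commute_imp_commutative[OF pg_generates]) (auto simp: pg_star pg_mult Q_commute)

lemma As_hom_eqI:
  assumes "g \<in> star_hom As As" "h \<in> star_hom As As" "\<And>x. x \<in> carrier Qs \<Longrightarrow> g (pg x) = h (pg x)" "a \<in> carrier As"
  shows "g a = h a"
proof (rule hom_unique[OF A.rep_cstar_axioms A.rep_cstar_axioms assms(1,2) pg_generates _ assms(4)])
  fix y assume "y \<in> pg ` carrier Qs"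
  then show "g y = h y" using assms(3) by blast
qed

lemma mult_pg_hom: "e \<in> carrier Qs \<Longrightarrow> cmult As (pg e) \<in> star_hom As As"
  by (rule A.star_hom_mult_central[OF As_commute]) (simp_all add: pg_closed pg_star pg_mult Q_idem)

lemma UNIV_in_Q: "ee UNIV \<in> carrier Qs"
  by (rule ee_in_Q[OF UNIV_in_constructible])

lemma As_unit: "a \<in> carrier As \<Longrightarrow> cmult As (pg (ee UNIV)) a = a"
  by (rule As_hom_eqI[OF mult_pg_hom[OF UNIV_in_Q] star_hom_id])
    (simp_all add: pg_mult UNIV_in_Q ee_unit Q_closed)

definition CC :: "'s word set \<Rightarrow> _" where
  "CC p = (SOME g. g \<in> star_hom As As \<and> (\<forall>x\<in>carrier Qs. g (pg x) = pg (cc p x)))"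

lemma CC:
  assumes p: "p \<in> carrier Sp"
  shows "CC p \<in> star_hom As As" "x \<in> carrier Qs \<Longrightarrow> CC p (pg x) = pg (cc p x)"
proof -
  \<comment> \<open>\<open>ee {}\<close> is the zero of C*(S) and is fixed by conjugation, so the
    killed element is respected and \<open>isg_map\<close> applies.\<close>
  have Z: "cc p ` {ee {}} \<subseteq> {ee {}}" using cc_zero[OF p] by simp
  have "\<exists>g. g \<in> star_hom As As \<and> (\<forall>x\<in>carrier Qs. g (pg x) = pg (cc p x))"
    using Q.isg_map[OF Q_regular_star_semigroup cc_hom[OF p] Z, of I] unfolding cstar_proj_semigroup_def proj_gen_def by blast
  from someI_ex[OF this] show "CC p \<in> star_hom As As" "x \<in> carrier Qs \<Longrightarrow> CC p (pg x) = pg (cc p x)"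
    unfolding CC_def by auto
qed

text \<open>The projection \<open>p* p\<close> seen in the C*-algebra of the projections, which is
  meaningful by \<open>uu_source_Q\<close>.\<close>

definition src :: "'s word set \<Rightarrow> _" where
  "src p = pg (uu (smul Sp (sstar Sp p) p))"

lemma CC_comp:
  assumes p: "p \<in> carrier Sp" and q: "q \<in> carrier Sp" and a: "a \<in> carrier As"
  shows "CC (smul Sp p q) a = CC p (CC q a)"
  by (rule As_hom_eqI[OF CC(1) star_hom_comp[OF CC(1) CC(1)] _ a])
    (simp_all add: p q P_mult_closed CC(2) cc_Q cc_mult Q_closed)

sublocale set_act: endomorphism_action S "carrier Qs" cc
  by standard (simp_all add: cc_Q cc_mult cc_unit Q_closed)

lemma CC_corner_action: "corner_action As (sg_index Qs {ee {}} :: ('i vec set \<times> _) set) fst (isg_rep Qs) S CC src (pg (ee UNIV))"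
proof (intro corner_action.intro A.rep_cstar_axioms)
  show "endomorphism_action S (carrier As) CC"
  proof
    show "CC p x \<in> carrier As" if "p \<in> carrier Sp" "x \<in> carrier As" for p x
      using CC(1)[OF that(1)] that(2) by (auto simp: star_hom_def)
    show "CC (smul Sp p q) x = CC p (CC q x)" if "p \<in> carrier Sp" "q \<in> carrier Sp" "x \<in> carrier As" for p q x
      by (rule CC_comp[OF that])
    show "CC (cls []) x = x" if "x \<in> carrier As" for x
      by (rule As_hom_eqI[OF CC(1) star_hom_id _ that]) (simp_all add: CC(2) cc_unit Q_closed)
  qed
  show "corner_action_axioms As S CC src (pg (ee UNIV))"
  proof
    fix p assume p: "p \<in> carrier Sp"
    note e = uu_source_Q[OF p] and p' = P_star_closed[OF p]
    show "CC p \<in> star_hom As As" by (rule CC(1)[OF p])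
    show "src p \<in> carrier As" "cstar As (src p) = src p" by (simp_all add: src_def pg_closed pg_star e)
    show "CC (sstar Sp p) (CC p x) = cmult As (src p) x" if x: "x \<in> carrier As" for x
    proof -
      have "CC (smul Sp (sstar Sp p) p) x = cmult As (src p) x"
        unfolding src_def
        by (rule As_hom_eqI[OF CC(1)[OF P_mult_closed[OF p' p]] mult_pg_hom[OF e] _ x])
          (simp add: CC(2) P_mult_closed p p' cc_source pg_mult e)
      then show ?thesis by (simp add: CC_comp p p' x)
    qed
  qed ((rule As_commute As_unit; assumption) | rule pg_closed[OF UNIV_in_Q])+
qed

sublocale alg_act: corner_action As "sg_index Qs {ee {}} :: ('i vec set \<times> _) set" fst "isg_rep Qs" S CC src "pg (ee UNIV)" I
  by (rule CC_corner_action)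

abbreviation "set_action \<equiv> set_act.corner_map"
abbreviation "alg_action \<equiv> alg_act.corner_map"

lemma pg_support:
  assumes p: "p \<in> carrier Sp" and x: "x \<in> set_act.support p" shows "pg x \<in> alg_act.support p"
proof -
  have xQ: "x \<in> carrier Qs" "cc (sstar Sp p) (cc p x) = x" using x by (auto simp: set_act.support_def)
  then show ?thesis by (simp add: alg_act.support_def pg_closed CC(2) p P_star_closed cc_Q)
qed

text \<open>One inclusion holds because the corner is closed. For the other, multiplication by
  \<open>src p\<close> maps each \<open>pg x\<close> to \<open>pg\<close> of an element of the
  domain in the set of projections. As the \<open>pg x\<close> span linearly, it maps everything
  into the closed span in question, and it fixes the corner.\<close>

lemma alg_action_induced: "induces_action Sp set_action pg As alg_action"
  unfolding induces_action_def
proof (intro ballI conjI)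
  fix p assume p: "p \<in> carrier Sp"
  let ?G = "pg ` set_act.support p"
  note e = uu_source_Q[OF p] and f = alg_act.f_closed[OF p]
  have "closed_span As ?G \<subseteq> alg_act.support p"
    unfolding closed_span_def using alg_act.support_subspace[OF p] pg_support[OF p] by blast
  moreover have "alg_act.support p \<subseteq> K" if K: "closed_subspace As K" "?G \<subseteq> K" for K
  proof
    fix a assume "a \<in> alg_act.support p"
    then have a: "a \<in> carrier As" "cmult As (src p) a = a" by (auto simp: alg_act.support_corner[OF p])
    have "pg ` carrier Qs \<subseteq> {b \<in> carrier As. cmult As (src p) b \<in> K}"
    proof
      fix b assume "b \<in> pg ` carrier Qs"
      then obtain x where x: "x \<in> carrier Qs" "b = pg x" by blast
      have "cc (sstar Sp p) (cc p x) \<in> set_act.support p"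
        using set_act.C_in_support[OF P_star_closed[OF p] cc_Q[OF p x(1)]] by (simp add: P_star_star p)
      moreover have "cmult As (src p) b = pg (cc (sstar Sp p) (cc p x))"
        using alg_act.C_source[OF p pg_closed[OF x(1)]] by (simp add: x CC(2) p P_star_closed cc_Q)
      ultimately show "b \<in> {b \<in> carrier As. cmult As (src p) b \<in> K}" using K(2) pg_closed[OF x(1)] x(2) by auto
    qed
    then have "carrier As \<subseteq> {b \<in> carrier As. cmult As (src p) b \<in> K}"
      using pg_spans A.mult_preimage_subspace[OF f K(1)] unfolding spans_def by blast
    then have "cmult As (src p) a \<in> K" using a(1) by blast
    then show "a \<in> K" using a(2) by simp
  qed
  then have "alg_act.support p \<subseteq> closed_span As ?G" unfolding closed_span_def by blast
  ultimately show "dom (alg_action p) = closed_span As (pg ` dom (set_action p))"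
    unfolding alg_act.dom_corner_map set_act.dom_corner_map by (intro subset_antisym)
  fix x assume "x \<in> dom (set_action p)"
  then have x: "x \<in> set_act.support p" by (simp add: set_act.dom_corner_map)
  have xQ: "x \<in> carrier Qs" using x by (simp add: set_act.support_def)
  show "alg_action p (pg x) = Some (pg (the (set_action p x)))"
    using alg_act.corner_map_apply[OF pg_support[OF p x]] set_act.corner_map_apply[OF x] CC(2)[OF p xQ] by simp
qed

abbreviation "JC \<equiv> alg_act.cv_index"

subsection \<open>Covariant representations and representations of the relations\<close>

definition rel_of :: "('i vec set \<times> (_ \<Rightarrow> 'i operator) \<times> ('s word set \<Rightarrow> 'i operator)) \<Rightarrow> 's + 's set \<Rightarrow> 'i operator" where
  "rel_of j = (\<lambda>x. case x of Inl s \<Rightarrow> snd (snd j) (v s) | Inr Y \<Rightarrow> fst (snd j) (pg (ee Y)))"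

text \<open>The isometry relation comes from unitality of \<open>W\<close>. The relation
  \<open>w_s e_X w_s* = e_{sX}\<close> is the extended covariance \<open>cv_conj\<close>, since
  \<open>cc\<close> of a letter \<open>v_s\<close> acts on the projections by translation.\<close>

lemma rel_of:
  assumes H: "hilbert_space H" and cov: "covariant_isg Sp As alg_action H \<phi> W"
  shows "semigroup_relations H (rel_of (H, \<phi>, W))"
proof -
  note D = alg_act.cvD[OF H cov] and Ws = alg_act.cvW[OF H cov]
  have iso: "compose H (adjoint H (W (v s))) (W (v s)) = id_op H" for s
    using Ws(2)[of "sstar Sp (v s)" "v s"] Ws(3)[of "v s"] alg_act.cv_W_unit[OF H cov]
    by (simp add: P_star word_star_Cons isometry_relation)
  have ee: "\<phi> (pg (ee Y)) \<in> bounded_ops H" "adjoint H (\<phi> (pg (ee Y))) = \<phi> (pg (ee Y))" if "Y \<in> constructible" for Y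
    using D(1)[OF pg_closed[OF ee_in_Q[OF that]]] D(5)[OF pg_closed[OF ee_in_Q[OF that]]] pg_star[OF ee_in_Q[OF that]] by simp_all
  have mult: "\<phi> (pg (ee (Y \<inter> Z))) = compose H (\<phi> (pg (ee Y))) (\<phi> (pg (ee Z)))" if "Y \<in> constructible" "Z \<in> constructible" for Y Z
    using D(4)[OF pg_closed[OF ee_in_Q[OF that(1)]] pg_closed[OF ee_in_Q[OF that(2)]]] pg_mult[OF ee_in_Q[OF that(1)] ee_in_Q[OF that(2)]]
    by (simp add: ee_Int that)
  have conj: "compose H (W (v s)) (compose H (\<phi> (pg (ee Y))) (adjoint H (W (v s)))) = \<phi> (pg (ee (translate s Y)))"
    if "Y \<in> constructible" for s Y
    using alg_act.cv_conj[OF H cov cls_closed pg_closed[OF ee_in_Q[OF that]], of "[(s, False)]"]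
      CC(2)[OF cls_closed ee_in_Q[OF that], of "[(s, False)]"] cc_letter(1)[OF that, of s] by simp
  have WW: "W (v (s * t)) = compose H (W (v s)) (W (v t))" for s t
    using Ws(2)[of "v s" "v t"] by (simp add: product_relation)
  have idem: "compose H (\<phi> (pg (ee Y))) (\<phi> (pg (ee Y))) = \<phi> (pg (ee Y))" if "Y \<in> constructible" for Y
    using mult[OF that that] by simp
  have zero: "\<phi> (pg (ee {})) = zero_op H"
    using A.star_hom_zero[OF H alg_act.cv_hom[OF H cov]] by (simp add: pg_zero)
  show ?thesis
    unfolding semigroup_relations_def rel_of_def
    using iso ee mult conj WW idem zero alg_act.cv_unit[OF H cov] Ws(1) by simp
qed

definition match :: "('i vec set \<times> (_ \<Rightarrow> 'i operator) \<times> ('s word set \<Rightarrow> 'i operator)) \<Rightarrow> 'i vec set \<times> ('s + 's set \<Rightarrow> 'i operator)" where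
  "match j = (fst j, rel_of j)"

lemma JC_D:
  assumes "j \<in> JC"
  shows "hilbert_space (fst j)" "covariant_isg Sp As alg_action (fst j) (fst (snd j)) (snd (snd j))"
  using assms by (auto simp: alg_act.cv_index_def)

lemma match_index: "j \<in> JC \<Longrightarrow> match j \<in> JS"
  using rel_of[OF JC_D] by (simp add: match_def rel_index_def JC_D(1))

definition pair_of :: "'i vec set \<times> ('s + 's set \<Rightarrow> 'i operator) \<Rightarrow>
    'i vec set \<times> ((nat \<Rightarrow> (nat \<Rightarrow> ('s + 's set) word \<Rightarrow> complex) set \<Rightarrow> complex) set \<Rightarrow> 'i operator) \<times> ('s word set \<Rightarrow> 'i operator)" where
  "pair_of j = (fst j, isg_rep Qs (fst j, cs_rep j), isom_rep j)"

lemma cs_rep_index: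
  assumes j: "j \<in> JS" shows "(fst j, cs_rep j) \<in> sg_index Qs {ee {}}"
proof -
  have "cs_rep j \<in> sg_reps Qs (fst j)"
    by (rule sg_repsI) (simp_all add: C.rep_bop[OF j] C.rep_simps[OF j] Q_sel(2,3) Q_closed)
  then show ?thesis using C.rep_zero[OF j] JS_E(1)[OF j] by (simp add: sg_index_def ee_empty)
qed

lemma pair_rep_pg: "j \<in> JS \<Longrightarrow> x \<in> carrier Qs \<Longrightarrow> isg_rep Qs (fst j, cs_rep j) (pg x) = cs_rep j x"
  unfolding proj_gen_def using Q.isg_rep_gen[OF cs_rep_index, of j x I] by simp

text \<open>Everything follows from \<open>W_p* W_p\<close> being the image of \<open>src p\<close>.
  It gives the ranges, and it commutes with the coefficients, so conjugation by \<open>W_p\<close>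
  is a homomorphism that may be compared with \<open>CC p\<close> on generators.\<close>

lemma pair_of:
  assumes j: "j \<in> JS" shows "pair_of j \<in> JC"
proof -
  let ?H = "fst j" and ?\<phi> = "isg_rep Qs (fst j, cs_rep j)" and ?W = "isom_rep j"
  note H = JS_E(1)[OF j] and Ws = sg_repsD[OF isom_rep(1)[OF j]]
  have hom: "?\<phi> \<in> star_hom As (Bop ?H)" using A.hom[OF cs_rep_index[OF j]] by simp
  note D = star_hom_BopD[OF hom]
  have src: "compose ?H (adjoint ?H (?W p)) (?W p) = ?\<phi> (src p)" if p: "p \<in> carrier Sp" for p
    using Ws(2)[OF P_star_closed[OF p] p] Ws(3)[OF p] cs_rep_uu[OF j P_mult_closed[OF P_star_closed[OF p] p]]
    by (simp add: src_def pair_rep_pg[OF j uu_source_Q[OF p]])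
  have rng: "compose ?H (adjoint ?H (?W p)) (?W p) ` ?H = {?\<phi> a x | a x. a \<in> alg_act.support p \<and> x \<in> ?H}"
    if p: "p \<in> carrier Sp" for p
    unfolding src[OF p] by (rule alg_act.source_range[OF H hom p, symmetric])
  have rng': "compose ?H (?W p) (adjoint ?H (?W p)) ` ?H = {?\<phi> a x | a x. a \<in> alg_act.support (sstar Sp p) \<and> x \<in> ?H}"
    if p: "p \<in> carrier Sp" for p
    using rng[OF P_star_closed[OF p]] by (simp add: Ws(3)[OF p] adjoint_adjoint[OF H Ws(1)[OF p]])
  have conj: "?\<phi> (CC p a) = compose ?H (?W p) (compose ?H (?\<phi> a) (adjoint ?H (?W p)))"
    if p: "p \<in> carrier Sp" and a: "a \<in> carrier As" for p a
  proof (rule A.star_hom_unique[OF H star_hom_comp[OF CC(1)[OF p] hom] star_hom_conj_partial_isometry[OF H hom Ws(1)[OF p]] pg_generates _ a])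
    show "compose ?H (?W p) (compose ?H (adjoint ?H (?W p)) (?W p)) = ?W p"
      using Ws(2)[OF p P_mult_closed[OF P_star_closed[OF p] p]] Ws(2)[OF P_star_closed[OF p] p] Ws(3)[OF p] by (simp add: P_regular p)
    show "compose ?H (?\<phi> b) (compose ?H (adjoint ?H (?W p)) (?W p)) = compose ?H (compose ?H (adjoint ?H (?W p)) (?W p)) (?\<phi> b)"
      if b: "b \<in> carrier As" for b
      unfolding src[OF p] using D(4)[OF b alg_act.f_closed[OF p]] D(4)[OF alg_act.f_closed[OF p] b] As_commute[OF b alg_act.f_closed[OF p]] by simp
    fix b assume "b \<in> pg ` carrier Qs"
    then obtain x where x: "x \<in> carrier Qs" "b = pg x" by blast
    have "?\<phi> (CC p b) = cs_rep j (cc p x)" by (simp add: x CC(2) p pair_rep_pg[OF j] cc_Q)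
    also have "\<dots> = compose ?H (?W p) (compose ?H (cs_rep j x) (adjoint ?H (?W p)))"
      by (simp add: cc_def C.rep_simps[OF j] C.closed uu_closed Q_closed x cs_rep_uu[OF j p])
    finally show "?\<phi> (CC p b) = compose ?H (?W p) (compose ?H (?\<phi> b) (adjoint ?H (?W p)))"
      by (simp add: x pair_rep_pg[OF j])
  qed
  have "?\<phi> (pg (ee UNIV)) = id_op ?H"
    using semigroup_relationsD(8)[OF JS_E(2)[OF j]] by (simp add: pair_rep_pg[OF j UNIV_in_Q] cs_rep_ee[OF j UNIV_in_constructible])
  then have nd: "nondegenerate ?H As ?\<phi>"
    using nondegenerate_iff_unit[OF H hom pg_closed[OF UNIV_in_Q] As_unit] by simp
  have unit: "?W w = id_op ?H" if "is_unit_element Sp w" for w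
    using that isom_rep(2)[OF j, of "[]"] by (simp add: P_unit_element)
  have "covariant_isg Sp As alg_action ?H ?\<phi> ?W"
    unfolding covariant_isg_def alg_act.dom_corner_map
  proof (intro conjI ballI allI impI hom nd isom_rep(1)[OF j] unit)
    fix p assume p: "p \<in> carrier Sp"
    show "compose ?H (adjoint ?H (?W p)) (?W p) ` ?H = {?\<phi> a x | a x. a \<in> alg_act.support p \<and> x \<in> ?H}" by (rule rng[OF p])
    show "compose ?H (?W p) (adjoint ?H (?W p)) ` ?H = {?\<phi> a x | a x. a \<in> ran (alg_action p) \<and> x \<in> ?H}"
      unfolding alg_act.ran_corner_map[OF p] by (rule rng'[OF p])
    fix a assume a: "a \<in> alg_act.support p"
    show "?\<phi> (the (alg_action p a)) = compose ?H (?W p) (compose ?H (?\<phi> a) (adjoint ?H (?W p)))"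
      using conj[OF p subsetD[OF alg_act.support_subset a]] by (simp add: alg_act.corner_map_apply[OF a])
  qed
  then show ?thesis using H by (simp add: pair_of_def alg_act.cv_index_def)
qed

lemma JC_nonempty: "JC \<noteq> {}"
  using R.rel_nonempty pair_of by (auto simp: rel_index_def)

lemma Cs_generates: "generates Cs (insert (R.univ_word []) ((\<lambda>g. R.univ_word [(g, False)]) ` sg_gens))"
  unfolding semigroup_cstar_eq by (rule R.univ_generates)

text \<open>This round trip shows that covariant pairs already attain the norm of C*(S). Values on
  the algebra are compared rather than the families themselves, as \<open>snd j\<close> is
  unconstrained outside \<open>sg_gens\<close>.\<close>

lemma match_pair_of:
  assumes j: "j \<in> JS" and x: "x \<in> carrier Cs" shows "cs_rep (match (pair_of j)) x = cs_rep j x"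
proof -
  have m: "match (pair_of j) \<in> JS" by (rule match_index[OF pair_of[OF j]])
  have fst: "fst (match (pair_of j)) = fst j" by (simp add: match_def pair_of_def)
  have gens: "snd (match (pair_of j)) g = snd j g" if "g \<in> sg_gens" for g
  proof -
    from that consider s where "g = Inl s" | Y where "Y \<in> constructible" "g = Inr Y" by blast
    then show ?thesis
    proof cases
      case (2 Y)
      then show ?thesis
        by (simp add: match_def rel_of_def pair_of_def pair_rep_pg[OF j ee_in_Q] cs_rep_ee[OF j])
    qed (simp add: match_def rel_of_def pair_of_def isom_rep_letter[OF j])
  qed
  show ?thesis
  proof (rule C.star_hom_unique[OF JS_E(1)[OF j] _ C.hom[OF j] Cs_generates _ x])
    show "cs_rep (match (pair_of j)) \<in> star_hom Cs (Bop (fst j))" using C.hom[OF m] unfolding fst .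
    fix y assume "y \<in> insert (R.univ_word []) ((\<lambda>g. R.univ_word [(g, False)]) ` sg_gens)"
    then consider "y = R.univ_word []" | g where "g \<in> sg_gens" "y = R.univ_word [(g, False)]" by blast
    then show "cs_rep (match (pair_of j)) y = cs_rep j y"
    proof cases
      case 1
      then show ?thesis using R.univ_rep_word[of "[]", OF _ m] R.univ_rep_word[of "[]", OF _ j] fst by simp
    next
      case (2 g)
      have w: "fst ` set [(g, False)] \<subseteq> sg_gens" using 2(1) by simp
      show ?thesis unfolding 2(2) R.univ_rep_word[OF w m] R.univ_rep_word[OF w j] fst by (simp add: gens[OF 2(1)])
    qed
  qed
qed

lemma Cs_cov: "rep_cstar Cs JC fst (\<lambda>j. cs_rep (match j))"
proof (rule rep_cstar_reindex[OF C.rep_cstar_axioms JC_nonempty, where m = match])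
  show "\<exists>k\<in>JC. \<forall>x\<in>carrier Cs. op_norm (fst j) (cs_rep j x) \<le> op_norm (fst k) (cs_rep (match k) x)" if j: "j \<in> JS" for j
  proof (rule bexI[OF _ pair_of[OF j]])
    have "fst (pair_of j) = fst j" by (simp add: pair_of_def)
    then show "\<forall>x\<in>carrier Cs. op_norm (fst j) (cs_rep j x) \<le> op_norm (fst (pair_of j)) (cs_rep (match (pair_of j)) x)"
      by (simp add: match_pair_of[OF j])
  qed
qed (erule match_index | simp add: match_def)+

text \<open>The representation of \<open>S*\<close> in a covariant pair is unital, hence it is the
  one rebuilt from its own isometries.\<close>

lemma isom_rep_match:
  assumes j: "j \<in> JC" and p: "p \<in> carrier Sp" shows "isom_rep (match j) p = snd (snd j) p"
proof -
  obtain w where w: "p = cls w" using p by (rule P_E)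
  note H = JC_D(1)[OF j] and cov = JC_D(2)[OF j]
  have "snd (snd j) \<in> sg_reps (universal_isg TYPE('s)) (fst j)"
    unfolding universal_isg_TYPE[of S] by (rule alg_act.cv_sg[OF H cov])
  from sg_rep_word[OF H this alg_act.cv_W_unit[OF H cov], of w]
  show ?thesis using isom_rep(2)[OF match_index[OF j], of w] by (simp add: w match_def rel_of_def)
qed

lemma cs_rep_match_ee: "j \<in> JC \<Longrightarrow> Y \<in> constructible \<Longrightarrow> cs_rep (match j) (ee Y) = fst (snd j) (pg (ee Y))"
  by (simp add: cs_rep_ee match_index) (simp add: match_def rel_of_def)

text \<open>The natural map from the C*-algebra of the projections to C*(S). In the isomorphism
  below, \<open>a \<delta>_p\<close> is matched by the product of \<open>\<kappa> a\<close> and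
  \<open>uu p\<close>.\<close>

lemma proj_hom:
  "\<exists>\<kappa>\<in>star_hom As Cs. \<forall>j\<in>JC. \<forall>a\<in>carrier As. cs_rep (match j) (\<kappa> a) = fst (snd j) a"
proof -
  let ?m = "\<lambda>j. (fst j, \<lambda>x. fst (snd j) (pg x))"
  have hom: "fst (snd j) \<in> star_hom (isg_cstar I Qs {ee {}}) (Bop (fst j))" if "j \<in> JC" for j
    using alg_act.cv_hom[OF JC_D(1,2)[OF that]] unfolding cstar_proj_semigroup_def .
  have Z: "{ee {}} \<subseteq> carrier Qs" using ee_in_Q[OF empty_in_constructible] by simp
  have idx: "?m j \<in> sg_index Qs {ee {}}" if "j \<in> JC" for j
    using Q.star_hom_restrict[OF JC_D(1)[OF that] hom[OF that] Z] by (simp add: proj_gen_def)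
  have "\<exists>\<kappa>\<in>star_hom As Cs. \<forall>a\<in>carrier As. \<forall>j\<in>JC. cs_rep (match j) (\<kappa> a) = isg_rep Qs (?m j) a"
  proof (rule matched_hom[OF A.rep_cstar_axioms Cs_cov idx _ pg_generates])
    fix y assume "y \<in> pg ` carrier Qs"
    then obtain x where x: "x \<in> carrier Qs" "y = pg x" by blast
    obtain Y where Y: "Y \<in> constructible" "x = ee Y" using x(1) unfolding Q_sel(1) by blast
    show "\<exists>z\<in>carrier Cs. \<forall>j\<in>JC. cs_rep (match j) z = isg_rep Qs (?m j) y"
    proof (intro bexI[of _ x] ballI)
      show "x \<in> carrier Cs" by (rule Q_closed[OF x(1)])
      show "cs_rep (match j) x = isg_rep Qs (?m j) y" if j: "j \<in> JC" for j
        using Q.isg_rep_gen[OF idx[OF j] x(1), of I] cs_rep_match_ee[OF j Y(1)] by (simp add: x(2) Y(2) proj_gen_def)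
    qed
  qed simp_all
  then obtain \<kappa> where \<kappa>: "\<kappa> \<in> star_hom As Cs"
    "\<And>a j. a \<in> carrier As \<Longrightarrow> j \<in> JC \<Longrightarrow> cs_rep (match j) (\<kappa> a) = isg_rep Qs (?m j) a" by blast
  have "isg_rep Qs (?m j) a = fst (snd j) a" if j: "j \<in> JC" and a: "a \<in> carrier As" for j a
    by (rule Q.star_hom_eq_isg_rep[OF JC_D(1)[OF j] hom[OF j] Z _ _ idx[OF j], symmetric])
      (use a in \<open>simp_all add: cstar_proj_semigroup_def proj_gen_def\<close>)
  then show ?thesis using \<kappa> by (intro bexI[of _ \<kappa>]) simp_all
qed

theorem semigroup_cstar_iso: "cstar_isomorphic Cs (crossed_product_isg I Sp As alg_action)"
proof -
  interpret N: normed_by_reps alg_act.CA JC fst alg_act.cv_rep by (rule alg_act.CA_normed_by_reps[OF JC_nonempty])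
  obtain \<kappa> where \<kappa>: "\<kappa> \<in> star_hom As Cs"
    "\<And>j a. j \<in> JC \<Longrightarrow> a \<in> carrier As \<Longrightarrow> cs_rep (match j) (\<kappa> a) = fst (snd j) a" using proj_hom by blast
  let ?t = "\<lambda>p a. to_completion alg_act.CA (alg_act.single p a)"
  have t: "N.compl_rep j (?t p a) = compose (fst j) (fst (snd j) a) (snd (snd j) p)"
    if j: "j \<in> JC" and p: "p \<in> carrier Sp" and a: "a \<in> alg_act.support (sstar Sp p)" for j p a
    using N.compl_rep_to_completion[OF j alg_act.single_closed[OF p a]] alg_act.cv_rep_single[OF JC_D(1,2)[OF j] p a] by simp
  have tc: "?t p a \<in> carrier (completion alg_act.CA)" if "p \<in> carrier Sp" "a \<in> alg_act.support (sstar Sp p)" for p a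
    by (rule N.to_completion_closed[OF alg_act.single_closed[OF that]])
  have all: "a \<in> alg_act.support (sstar Sp (cls []))" if "a \<in> carrier As" for a
    using that by (simp add: P_star alg_act.support_def alg_act.C_unit)
  have id: "compose (fst j) R (snd (snd j) (cls [])) = R" if "j \<in> JC" "R \<in> bounded_ops (fst j)" for j R
    using alg_act.cv_W_unit[OF JC_D(1,2)[OF that(1)]] compose_id_right[OF JC_D(1)[OF that(1)] that(2)] by simp
  have bop: "fst (snd j) a \<in> bounded_ops (fst j)" if "j \<in> JC" "a \<in> carrier As" for j a
    by (rule alg_act.cvD(1)[OF JC_D(1,2)[OF that(1)] that(2)])
  have tE: "N.compl_rep j (?t (cls []) (pg (ee Y))) = fst (snd j) (pg (ee Y))" if "j \<in> JC" "Y \<in> constructible" for j Y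
    using t[OF that(1) cls_closed all[OF pg_closed[OF ee_in_Q[OF that(2)]]]] id[OF that(1) bop[OF that(1) pg_closed[OF ee_in_Q[OF that(2)]]]]
    by simp
  have "cstar_isomorphic Cs (completion alg_act.CA)"
  proof (rule matched_iso[OF Cs_cov N.completion_rep_cstar Cs_generates _ alg_act.CA_generates[OF JC_nonempty]])
    fix g assume "g \<in> insert (R.univ_word []) ((\<lambda>g. R.univ_word [(g, False)]) ` sg_gens)"
    then consider "g = R.univ_word []" | s where "g = R.univ_word [(Inl s, False)]"
      | Y where "Y \<in> constructible" "g = R.univ_word [(Inr Y, False)]" by blast
    then show "\<exists>y\<in>carrier (completion alg_act.CA). \<forall>j\<in>JC. N.compl_rep j y = cs_rep (match j) g"
    proof cases
      case 1
      show ?thesis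
      proof (intro bexI[of _ "?t (cls []) (pg (ee UNIV))"] ballI tc cls_closed all pg_closed UNIV_in_Q)
        fix j assume j: "j \<in> JC"
        show "N.compl_rep j (?t (cls []) (pg (ee UNIV))) = cs_rep (match j) g"
          using tE[OF j UNIV_in_constructible] alg_act.cv_unit[OF JC_D(1,2)[OF j]] R.univ_rep_word[of "[]", OF _ match_index[OF j]]
          by (simp add: 1 match_def)
      qed
    next
      case (2 s)
      have p: "v s \<in> carrier Sp" by simp
      note p' = P_star_closed[OF p]
      show ?thesis
      \<comment> \<open>The coefficient at \<open>v s\<close> must lie in the corner of
        \<open>v_s v_s*\<close>; the unit of that corner works because
        \<open>w_s w_s* w_s = w_s\<close>.\<close>
      proof (intro bexI[of _ "?t (v s) (src (sstar Sp (v s)))"] ballI tc p alg_act.f_support[OF p'])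
        fix j assume j: "j \<in> JC"
        note H = JC_D(1)[OF j] and cov = JC_D(2)[OF j]
        have w: "fst ` set [(Inl s :: 's + 's set, False)] \<subseteq> sg_gens" by simp
        have "N.compl_rep j (?t (v s) (src (sstar Sp (v s)))) =
            compose (fst j) (compose (fst j) (snd (snd j) (v s)) (adjoint (fst j) (snd (snd j) (v s)))) (snd (snd j) (v s))"
          using t[OF j p alg_act.f_support[OF p']] alg_act.cv_range[OF H cov p] by simp
        also have "\<dots> = snd (snd j) (v s)"
          by (simp only: compose_assoc'[OF H alg_act.cvW(1)[OF H cov p]] alg_act.W_regular[OF H cov p])
        also have "\<dots> = cs_rep (match j) g"
          unfolding 2 R.univ_rep_word[OF w match_index[OF j]]
          by (simp add: match_def rel_of_def compose_id_right[OF H alg_act.cvW(1)[OF H cov p]])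
        finally show "N.compl_rep j (?t (v s) (src (sstar Sp (v s)))) = cs_rep (match j) g" .
      qed
    next
      case (3 Y)
      show ?thesis
      proof (intro bexI[of _ "?t (cls []) (pg (ee Y))"] ballI tc cls_closed all pg_closed ee_in_Q 3(1))
        fix j assume j: "j \<in> JC"
        show "N.compl_rep j (?t (cls []) (pg (ee Y))) = cs_rep (match j) g"
          using tE[OF j 3(1)] cs_rep_match_ee[OF j 3(1)] by (simp add: 3(2) ee_eq)
      qed
    qed
  next
    fix g assume "g \<in> {?t p a | p a. p \<in> carrier Sp \<and> a \<in> alg_act.support (sstar Sp p)}"
    then obtain p a where g: "p \<in> carrier Sp" "a \<in> alg_act.support (sstar Sp p)" "g = ?t p a" by blast
    have a: "a \<in> carrier As" using g(2) alg_act.support_subset by blast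
    have \<kappa>a: "\<kappa> a \<in> carrier Cs" using \<kappa>(1) a by (auto simp: star_hom_def)
    show "\<exists>x\<in>carrier Cs. \<forall>j\<in>JC. cs_rep (match j) x = N.compl_rep j g"
    proof (intro bexI[of _ "cmult Cs (\<kappa> a) (uu p)"] ballI C.mult_closed[OF \<kappa>a uu_closed])
      fix j assume j: "j \<in> JC"
      have "cs_rep (match j) (cmult Cs (\<kappa> a) (uu p)) = compose (fst j) (fst (snd j) a) (snd (snd j) p)"
        using C.rep_mult[OF match_index[OF j] \<kappa>a uu_closed[of p]] cs_rep_uu[OF match_index[OF j] g(1)] isom_rep_match[OF j g(1)] \<kappa>(2)[OF j a]
        by (simp add: match_def)
      then show "cs_rep (match j) (cmult Cs (\<kappa> a) (uu p)) = N.compl_rep j g" by (simp add: g(3) t[OF j g(1,2)])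
    qed
  qed
  then show ?thesis by (simp add: crossed_product_isg_def)
qed

end

theorem corollary7p16:
  fixes S :: "'s::monoid_mult itself" and I :: "'i itself"
  assumes left_cancellative: "\<And>a b c :: 's. a * b = a * c \<Longrightarrow> b = c"
    and large_universe: "\<exists>f :: 's list \<Rightarrow> 'i. inj f"
  shows "\<exists>\<beta> \<alpha> \<gamma>.
     injective_action (cstar_isg_idempotents I S) (\<beta> :: 's \<Rightarrow> _) \<and>
     isg_set_action (universal_isg S) (carrier (proj_semigroup I S)) \<alpha> \<and>
     isg_algebra_action (universal_isg S) (cstar_proj_semigroup I S) \<gamma> \<and>
     induces_action (universal_isg S) \<alpha> (proj_gen I S) (cstar_proj_semigroup I S) \<gamma> \<and>
     cstar_isomorphic (cstar_universal_isg I S)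
       (crossed_product_monoid I (cstar_isg_idempotents I S) \<beta>) \<and>
     cstar_isomorphic (semigroup_cstar I S)
       (crossed_product_isg I (universal_isg S) (cstar_proj_semigroup I S) \<gamma>)"
proof -
  interpret L: left_cancellative_monoid S I by standard (rule left_cancellative)
  show ?thesis
    using mon_action_injective_action[of I S] cstar_universal_isg_iso[of I S] L.set_act.corner_map_set_action
      L.alg_act.corner_map_algebra_action L.alg_action_induced L.semigroup_cstar_iso by blast
qed

end
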